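(* Let $(R,\mathfrak m,\mathsf k)$ be a noetherian local ring of codepth $3$ and of class $\mathbf T$, and let $A$ be its Koszul homology, considered as a graded-commutative ring. For all $k\ge1$, set $\partial_k^{\mathbb F}=[\varphi^{(k)}]$, where $\varphi^{(k)}\colon C^{(k)}\to C^{(k-1)}$ are the chain maps defined in the context. Then a graded minimal resolution of the residue field $\mathsf k$ over $A$ has the form $$\mathbb F\colon\ \cdots\to\bigoplus_{s=k}^{3k}A^{u_{k,s}}(-s)\xrightarrow{\partial_k^{\mathbb F}}\bigoplus_{s=k-1}^{3(k-1)}A^{u_{k-1,s}}(-s)\xrightarrow{\partial_{k-1}^{\mathbb F}}\cdots\to\bigoplus_{s=1}^{3}A^{u_{1,s}}(-s)\xrightarrow{\partial_1^{\mathbb F}}A,$$ where $u_{0,0}=1$ and, for $k\ge1$ and all $s$, $$u_{k,s}=\sum_{\substack{j\ge 1,\ k_1,\dots,k_j\ge1\\ k_1+\dots+k_j=k,\ s_1+\dots+s_j=s\\ s_i\ne k_i\ \text{for all } i\ge2}}\ell_{k_1,s_1}\ell_{k_2,s_2}\cdots\ell_{k_j,s_j}.$$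
   Context: Setting. $R$ has codepth $3$ (embedding dimension minus depth), $K$ is the Koszul complex of $R$ on a minimal set of generators of $\mathfrak m$, $A=H(K)=A_0\oplus A_1\oplus A_2\oplus A_3$, graded by homological degree, and $a_i=\operatorname{rank}_{\mathsf k}A_i$. Class $\mathbf T$ means that there are cycles $z^j_u\in K_j$ such that: $A_0$ has basis $[1]$; $A_1$ has basis $[z^1_1],\dots,[z^1_{a_1}]$; $A_2$ has basis $[z^1_1][z^1_2],[z^1_2][z^1_3],[z^1_1][z^1_3],[z^2_1],\dots,[z^2_{a_2-3}]$; $A_3$ has basis $[z^3_1],\dots,[z^3_{a_3}]$; and, apart from these products of $[z^1_1],[z^1_2],[z^1_3]$ (and graded-commutativity and the unit), all products of basis elements are zero. Fix such cycles. Products of elements of $K$ are written $\wedge$. Matrices over $K$ or $A$ act by left multiplication on column vectors. Matrices $\beta,\beta'$. Set $b_k=\binom{k+2}{2}$ for $k\ge0$ and $b_k=0$ for $k<0$. A set with $b_k$ elements is indexed by words $u_1\dots u_k$ with $1\le u_1\le\dots\le u_k\le3$, ordered lexicographically; $[w]$ is the word $w$ reordered non-decreasingly. $\beta_k$ is the $b_{k-1}\times b_k$ matrix whose entry at $(v_1\dots v_{k-1},u_1\dots u_k)$ is $z^1_u$ if $u_1\dots u_k=[v_1\dots v_{k-1}u]$ for some $u\in\{1,2,3\}$ and $0$ otherwise. $\beta'_k$ is the $b_{k-1}\times b_{k-2}$ matrix whose entry at $(u_1\dots u_{k-1},v_1\dots v_{k-2})$ is $z^1_{u'}\wedge z^1_{u''}$,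 where $\{u',u''\}=\{1,2,3\}\setminus\{u\}$ and $u'<u''$, if $u_1\dots u_{k-1}=[v_1\dots v_{k-2}u]$, and $0$ otherwise. Put $\gamma_1=(z^1_4\ \cdots\ z^1_{a_1})$, $\gamma_2=(z^2_1\ \cdots\ z^2_{a_2-3})$, $\gamma_3=(z^3_1\ \cdots\ z^3_{a_3})$. For a matrix or map $\theta$, $\theta^m$ is the block diagonal sum of $m$ copies of $\theta$. Integers. $d_0=1$, $d_k=(a_1-3)\ell_{k-1}$ for $k\ge1$, $\ell_k=\sum_{i=0}^kb_{k-i}d_i$ for $k\ge 0$, $\ell_k=0$ for $k<0$; $\ell'_0=0$, $\ell'_k=\ell_{k-2}+(a_2-3)\ell_{k-1}$ for $k\ge1$; $\ell''_0=0$, $\ell''_k=a_3\ell_{k-1}$ for $k\ge 1$. For $k,r\ge0$: $\ell_{k,r}=\ell_k,\ell'_k,\ell''_k$ if $r=k,k+1,k+2$ respectively, and $0$ otherwise. Matrices $\alpha$. For $k\ge1$: $\alpha_k=\big(\bigoplus_{i=0}^{k-1}\beta_{k-i}^{d_i}\,\big|\,\gamma_1^{\ell_{k-1}}\big)$, of size $\ell_{k-1}\times\ell_k$; $\alpha'_k=\big(N_k\,\big|\,\gamma_2^{\ell_{k-1}}\big)$, of size $\ell_{k-1}\times\ell'_k$, where $N_k$ has top block the zero matrix of size $d_{k-1}\times\ell_{k-2}$ and bottom block $\bigoplus_{i=0}^{k-2}(\beta'_{k-i})^{d_i}$; $\alpha''_k=\gamma_3^{\ell_{k-1}}$, of size $\ell_{k-1}\times\ell''_k$.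 Write $\alpha_{k,k}=\alpha_k$, $\alpha_{k,k+1}=\alpha'_k$, $\alpha_{k,k+2}=\alpha''_k$ and $\Delta_k=(\alpha_{k,k}\ \ \alpha_{k,k+1}\ \ \alpha_{k,k+2})$. Monomials. Consider the noncommutative monomials in indeterminates $X_{i,i},X_{i,i+1},X_{i,i+2}$ ($i\ge1$) that are nonzero in $\mathbb Z\langle X_{i,i},X_{i,i+1},X_{i,i+2}\rangle/(X_{i,i}X_{j,j},X_{i,i+1}X_{j,j},X_{i,i+2}X_{j,j}\colon i,j\ge1)$, i.e. $\mathbf m=X_{k_1,s_1}\cdots X_{k_j,s_j}$ ($j\ge0$), with $k_i\ge1$, $k_1\le s_1\le k_1+2$ and $k_i<s_i\le k_i+2$ for $i\ge2$. Put $\deg_1\mathbf m=\sum k_i$, $\deg_2\mathbf m=\sum s_i$, $\deg_3\mathbf m=\prod\ell_{k_i,s_i}$ (equal to $1$ for $\mathbf m=1$), and $X_{0,0}=1$. Let $\mathbf n$ denote monomials containing no $X_{i,i}$ with $i\ge1$ (possibly $\mathbf n=1$). Complexes and maps. $C^{(k)}=\bigoplus_{\deg_1\mathbf m=k}\Sigma^{\deg_2\mathbf m}K^{\deg_3\mathbf m}$, where $(\Sigma^sK)_i=K_{i-s}$ with differential $(-1)^s\partial$; in particular $C^{(0)}=K$, and $C^{(k)}\cong\bigoplus_s\Sigma^sK^{u_{k,s}}$. The maps $\varphi^{(k)}\colon C^{(k)}\to C^{(k-1)}$ are built from blocks: to the three arrows $X_{i,r}\mathbf n\to X_{i-1,i-1}\mathbf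 n$, $r\in\{i,i+1,i+2\}$, $i\ge1$, one associates the map $(\Delta_i)^{\deg_3\mathbf n}$. They are defined recursively as block diagonal maps by $$\varphi^{(1)}=\Delta_1,\qquad \varphi^{(2)}=\operatorname{diag}\big(\Delta_2,\ \Delta_1^{\ell_{1,2}},\ \Delta_1^{\ell_{1,3}}\big),$$ $$\varphi^{(k+1)}=\operatorname{diag}\big(\Delta_{k+1},\ \Delta_1^{\ell_{k,k+1}},\ \Delta_1^{\ell_{k,k+2}},\ (\varphi^{(k)})^{\ell_{1,2}},\ (\varphi^{(k)})^{\ell_{1,3}}\big)\quad\text{for } k\ge2.$$ $[\varphi^{(k)}]$ is the induced map $H(C^{(k)})\to H(C^{(k-1)})$, where $H(C^{(k)})\cong\bigoplus_sA^{u_{k,s}}(-s)$, with $A(-s)_j=A_{j-s}$.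
   Formalization: The zero block of N_k is placed at the bottom, not the top (with it on top exactness fails at the first step), and φ^(k) is defined by the blocks attached to the arrows X_{i,r}n → X_{i-1,i-1}n, since the displayed recursion omits blocks from φ^(4) on. *)

theory Defs
  imports
    "HOL-Algebra.Ring_Divisibility"
    "HOL-Algebra.Embedded_Algebras"
    "HOL-Algebra.Product_Groups"
    "HOL-Algebra.QuotRing"
    "Jordan_Normal_Form.Matrix"
begin

section \<open>Local rings, depth and codepth\<close>

locale noetherian_local_ring = cring R + noetherian_ring R + maximalideal \<mm> R
  for R (structure) and \<mm> +
  assumes maximal_unique: "maximalideal M R \<Longrightarrow> M = \<mm>"

definition embdim :: "('a, 'b) ring_scheme \<Rightarrow> 'a set \<Rightarrow> nat" where
  "embdim R \<mm> = (LEAST n. \<exists>ys. length ys = n \<and> set ys \<subseteq> carrier R \<and> genideal R (set ys) = \<mm>)"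

definition regular_sequence :: "('a, 'b) ring_scheme \<Rightarrow> 'a list \<Rightarrow> bool" where
  "regular_sequence R ys \<longleftrightarrow>
     set ys \<subseteq> carrier R \<and> genideal R (set ys) \<noteq> carrier R \<and>
     (\<forall>i<length ys. \<forall>r\<in>carrier R.
        ys ! i \<otimes>\<^bsub>R\<^esub> r \<in> genideal R (set (take i ys)) \<longrightarrow> r \<in> genideal R (set (take i ys)))"

definition depth :: "('a, 'b) ring_scheme \<Rightarrow> 'a set \<Rightarrow> nat" where
  "depth R \<mm> = (GREATEST n. \<exists>ys. length ys = n \<and> set ys \<subseteq> \<mm> \<and> regular_sequence R ys)"

definition codepth :: "('a, 'b) ring_scheme \<Rightarrow> 'a set \<Rightarrow> nat" where
  "codepth R \<mm> = embdim R \<mm> - depth R \<mm>"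

definition minimal_generators :: "('a, 'b) ring_scheme \<Rightarrow> 'a set \<Rightarrow> 'a list \<Rightarrow> bool" where
  "minimal_generators R \<mm> xs \<longleftrightarrow>
     distinct xs \<and> set xs \<subseteq> carrier R \<and> genideal R (set xs) = \<mm> \<and>
     (\<forall>Y. Y \<subset> set xs \<longrightarrow> genideal R Y \<noteq> \<mm>)"

section \<open>The Koszul complex and its homology\<close>

text \<open>The Koszul complex on \<open>xs = [x\<^sub>0, \<dots>, x\<^sub>n\<^sub>-\<^sub>1]\<close> is the exterior algebra of the free module with
  basis \<open>e\<^sub>0, \<dots>, e\<^sub>n\<^sub>-\<^sub>1\<close>. An element is given by its coordinates in the basis
  \<open>e\<^sub>S = e\<^sub>i \<and> e\<^sub>j \<and> \<dots>\<close> with \<open>S = {i < j < \<dots>} \<subseteq> {..<n}\<close>. The product of the ring below is the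
  wedge product; for disjoint \<open>T\<close> and \<open>U\<close>, \<open>e\<^sub>T \<and> e\<^sub>U\<close> is \<open>e\<^bsub>T \<union> U\<^esub>\<close> up to the sign of the shuffle.\<close>

definition shuffle_sign :: "('a, 'b) ring_scheme \<Rightarrow> nat set \<Rightarrow> nat set \<Rightarrow> 'a" where
  "shuffle_sign R T U = (\<ominus>\<^bsub>R\<^esub> \<one>\<^bsub>R\<^esub>) [^]\<^bsub>R\<^esub> card {(i, j). i \<in> T \<and> j \<in> U \<and> j < i}"

definition koszul_ring :: "('a, 'b) ring_scheme \<Rightarrow> 'a list \<Rightarrow> (nat set \<Rightarrow> 'a) ring" where
  "koszul_ring R xs =
     \<lparr>carrier = Pow {..<length xs} \<rightarrow>\<^sub>E carrier R,
      monoid.mult = (\<lambda>f g. \<lambda>S\<in>Pow {..<length xs}.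
        \<Oplus>\<^bsub>R\<^esub>T\<in>Pow S. shuffle_sign R T (S - T) \<otimes>\<^bsub>R\<^esub> (f T \<otimes>\<^bsub>R\<^esub> g (S - T))),
      one = (\<lambda>S\<in>Pow {..<length xs}. if S = {} then \<one>\<^bsub>R\<^esub> else \<zero>\<^bsub>R\<^esub>),
      zero = (\<lambda>S\<in>Pow {..<length xs}. \<zero>\<^bsub>R\<^esub>),
      add = (\<lambda>f g. \<lambda>S\<in>Pow {..<length xs}. f S \<oplus>\<^bsub>R\<^esub> g S)\<rparr>"

definition koszul_deg :: "('a, 'b) ring_scheme \<Rightarrow> 'a list \<Rightarrow> nat \<Rightarrow> (nat set \<Rightarrow> 'a) set" where
  "koszul_deg R xs i =
     {f \<in> carrier (koszul_ring R xs). \<forall>S\<in>Pow {..<length xs}. card S \<noteq> i \<longrightarrow> f S = \<zero>\<^bsub>R\<^esub>}"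

text \<open>\<open>e\<^sub>U \<mapsto> \<Sum>\<^bsub>i \<in> U\<^esub> (-1)\<^bsup>card {j \<in> U. j < i}\<^esup> x\<^sub>i e\<^bsub>U - {i}\<^esub>\<close>, read off at the coordinate \<open>S = U - {i}\<close>.\<close>

definition koszul_diff ::
  "('a, 'b) ring_scheme \<Rightarrow> 'a list \<Rightarrow> (nat set \<Rightarrow> 'a) \<Rightarrow> nat set \<Rightarrow> 'a" where
  "koszul_diff R xs f = (\<lambda>S\<in>Pow {..<length xs}.
     \<Oplus>\<^bsub>R\<^esub>i\<in>{..<length xs} - S. shuffle_sign R {i} S \<otimes>\<^bsub>R\<^esub> (xs ! i \<otimes>\<^bsub>R\<^esub> f (insert i S)))"

definition koszul_cycles :: "('a, 'b) ring_scheme \<Rightarrow> 'a list \<Rightarrow> (nat set \<Rightarrow> 'a) set" where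
  "koszul_cycles R xs =
     {f \<in> carrier (koszul_ring R xs). koszul_diff R xs f = \<zero>\<^bsub>koszul_ring R xs\<^esub>}"

definition koszul_boundaries :: "('a, 'b) ring_scheme \<Rightarrow> 'a list \<Rightarrow> (nat set \<Rightarrow> 'a) set" where
  "koszul_boundaries R xs = koszul_diff R xs ` carrier (koszul_ring R xs)"

definition koszul_homology :: "('a, 'b) ring_scheme \<Rightarrow> 'a list \<Rightarrow> (nat set \<Rightarrow> 'a) set ring" where
  "koszul_homology R xs =
     (koszul_ring R xs)\<lparr>carrier := koszul_cycles R xs\<rparr> Quot koszul_boundaries R xs"

definition hclass :: "('a, 'b) ring_scheme \<Rightarrow> 'a list \<Rightarrow> (nat set \<Rightarrow> 'a) \<Rightarrow> (nat set \<Rightarrow> 'a) set" where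
  "hclass R xs f = koszul_boundaries R xs +>\<^bsub>koszul_ring R xs\<^esub> f"

definition homology_deg ::
  "('a, 'b) ring_scheme \<Rightarrow> 'a list \<Rightarrow> nat \<Rightarrow> (nat set \<Rightarrow> 'a) set set" where
  "homology_deg R xs i = hclass R xs ` (koszul_cycles R xs \<inter> koszul_deg R xs i)"

text \<open>If \<open>xs\<close> generates the maximal ideal, the degree 0 part of the homology is a subfield, canonically
  identified with the residue field; ranks and bases over the residue field are taken over it.\<close>

definition homology_rank :: "('a, 'b) ring_scheme \<Rightarrow> 'a list \<Rightarrow> nat \<Rightarrow> nat" where
  "homology_rank R xs i =
     ring.dim (koszul_homology R xs) (homology_deg R xs 0) (homology_deg R xs i)"

definition is_homology_basis ::
  "('a, 'b) ring_scheme \<Rightarrow> 'a list \<Rightarrow> nat \<Rightarrow> (nat set \<Rightarrow> 'a) set list \<Rightarrow> bool" where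
  "is_homology_basis R xs i us \<longleftrightarrow>
     ring.independent (koszul_homology R xs) (homology_deg R xs 0) us \<and>
     ring.Span (koszul_homology R xs) (homology_deg R xs 0) us = homology_deg R xs i"

section \<open>Class T\<close>

text \<open>The basis of the part of degree \<open>i \<in> {0,1,2,3}\<close> formed from the cycles \<open>z j u\<close> (\<open>z\<^sup>j\<^sub>u\<close>).\<close>

definition class_T_basis ::
  "('a, 'b) ring_scheme \<Rightarrow> 'a list \<Rightarrow> (nat \<Rightarrow> nat \<Rightarrow> nat set \<Rightarrow> 'a) \<Rightarrow> nat \<Rightarrow> (nat set \<Rightarrow> 'a) set list"
where
  "class_T_basis R xs z i =
     (let a = homology_rank R xs; A = koszul_homology R xs; h = (\<lambda>j u. hclass R xs (z j u)) in
      if i = 0 then [\<one>\<^bsub>A\<^esub>]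
      else if i = 1 then map (h 1) [1..<Suc (a 1)]
      else if i = 2 then
        [h 1 1 \<otimes>\<^bsub>A\<^esub> h 1 2, h 1 2 \<otimes>\<^bsub>A\<^esub> h 1 3, h 1 1 \<otimes>\<^bsub>A\<^esub> h 1 3] @ map (h 2) [1..<Suc (a 2 - 3)]
      else map (h 3) [1..<Suc (a 3)])"

definition class_T_cycles ::
  "('a, 'b) ring_scheme \<Rightarrow> 'a list \<Rightarrow> (nat \<Rightarrow> nat \<Rightarrow> nat set \<Rightarrow> 'a) \<Rightarrow> bool" where
  "class_T_cycles R xs z \<longleftrightarrow>
     (let a = homology_rank R xs; A = koszul_homology R xs; h = (\<lambda>j u. hclass R xs (z j u)) in
      3 \<le> a 1 \<and> 3 \<le> a 2 \<and>
      (\<forall>u\<in>{1..a 1}. z 1 u \<in> koszul_cycles R xs \<inter> koszul_deg R xs 1) \<and>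
      (\<forall>u\<in>{1..a 2 - 3}. z 2 u \<in> koszul_cycles R xs \<inter> koszul_deg R xs 2) \<and>
      (\<forall>u\<in>{1..a 3}. z 3 u \<in> koszul_cycles R xs \<inter> koszul_deg R xs 3) \<and>
      (\<forall>i\<in>{0..3}. is_homology_basis R xs i (class_T_basis R xs z i)) \<and>
      (\<forall>i>3. homology_deg R xs i = {\<zero>\<^bsub>A\<^esub>}) \<and>
      (\<forall>u\<in>{1..a 1}. \<forall>v\<in>{1..a 1}. \<not> (u \<le> 3 \<and> v \<le> 3 \<and> u \<noteq> v) \<longrightarrow> h 1 u \<otimes>\<^bsub>A\<^esub> h 1 v = \<zero>\<^bsub>A\<^esub>) \<and>
      (\<forall>i\<in>{1..3}. \<forall>j\<in>{1..3}. (i, j) \<noteq> (1, 1) \<longrightarrow>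
         (\<forall>x\<in>set (class_T_basis R xs z i). \<forall>y\<in>set (class_T_basis R xs z j). x \<otimes>\<^bsub>A\<^esub> y = \<zero>\<^bsub>A\<^esub>)))"

section \<open>The integers\<close>

definition bnum :: "nat \<Rightarrow> nat" where
  "bnum k = (k + 2) choose 2"

text \<open>The numbers \<open>d\<^sub>i\<close> are inlined in the recursion for \<open>\<ell>\<^sub>k\<close>.\<close>

fun ell :: "(nat \<Rightarrow> nat) \<Rightarrow> nat \<Rightarrow> nat" where
  "ell a k = (\<Sum>i\<leftarrow>[0..<Suc k]. bnum (k - i) * (case i of 0 \<Rightarrow> 1 | Suc j \<Rightarrow> (a 1 - 3) * ell a j))"

declare ell.simps [simp del]

definition dnum :: "(nat \<Rightarrow> nat) \<Rightarrow> nat \<Rightarrow> nat" where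
  "dnum a k = (if k = 0 then 1 else (a 1 - 3) * ell a (k - 1))"

lemma ell_eq: "ell a k = (\<Sum>i\<le>k. bnum (k - i) * dnum a i)"
proof -
  have "ell a k = (\<Sum>i\<leftarrow>[0..<Suc k]. bnum (k - i) * dnum a i)"
    unfolding ell.simps[of a k] dnum_def
    by (intro arg_cong[where f = sum_list] map_cong) (auto split: nat.split)
  also have "\<dots> = (\<Sum>i\<in>{0..<Suc k}. bnum (k - i) * dnum a i)"
    by (subst interv_sum_list_conv_sum_set_nat) simp
  finally show ?thesis
    by (simp add: atLeast0LessThan lessThan_Suc_atMost)
qed

text \<open>\<open>\<ell>\<^sub>k\<^sub>-\<^sub>2\<close>, which is \<open>0\<close> if \<open>k < 2\<close>.\<close>

definition ell_m2 :: "(nat \<Rightarrow> nat) \<Rightarrow> nat \<Rightarrow> nat" where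
  "ell_m2 a k = (if k < 2 then 0 else ell a (k - 2))"

definition ell' :: "(nat \<Rightarrow> nat) \<Rightarrow> nat \<Rightarrow> nat" where
  "ell' a k = (if k = 0 then 0 else ell_m2 a k + (a 2 - 3) * ell a (k - 1))"

definition ell'' :: "(nat \<Rightarrow> nat) \<Rightarrow> nat \<Rightarrow> nat" where
  "ell'' a k = (if k = 0 then 0 else a 3 * ell a (k - 1))"

definition ell2 :: "(nat \<Rightarrow> nat) \<Rightarrow> nat \<Rightarrow> nat \<Rightarrow> nat" where
  "ell2 a k r =
     (if r = k then ell a k else if r = k + 1 then ell' a k else if r = k + 2 then ell'' a k else 0)"

definition unum :: "(nat \<Rightarrow> nat) \<Rightarrow> nat \<Rightarrow> nat \<Rightarrow> nat" where
  "unum a k s =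
     (if k = 0 then (if s = 0 then 1 else 0)
      else \<Sum>m\<in>{m :: (nat \<times> nat) list. m \<noteq> [] \<and> (\<forall>i<length m. 1 \<le> fst (m ! i)) \<and>
                 sum_list (map fst m) = k \<and> sum_list (map snd m) = s \<and>
                 (\<forall>i<length m. 1 \<le> i \<longrightarrow> snd (m ! i) \<noteq> fst (m ! i))}.
             prod_list (map (\<lambda>(i, r). ell2 a i r) m))"

section \<open>The matrices over the Koszul complex\<close>

text \<open>Non-decreasing words of length \<open>k\<close> in the letters 1, 2, 3, in lexicographic order.\<close>

definition words :: "nat \<Rightarrow> nat list list" where
  "words k = filter sorted (product_lists (replicate k [1, 2, 3]))"

definition block_diag :: "'a \<Rightarrow> 'a mat list \<Rightarrow> 'a mat" where
  "block_diag o' Ms = foldr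
     (\<lambda>M N. four_block_mat M (mat (dim_row M) (dim_col N) (\<lambda>_. o'))
                           (mat (dim_row N) (dim_col M) (\<lambda>_. o')) N) Ms (mat 0 0 (\<lambda>_. o'))"

definition hcat :: "'a mat \<Rightarrow> 'a mat \<Rightarrow> 'a mat" where
  "hcat M N = mat (dim_row M) (dim_col M + dim_col N)
     (\<lambda>(i, j). if j < dim_col M then M $$ (i, j) else N $$ (i, j - dim_col M))"

definition vcat :: "'a mat \<Rightarrow> 'a mat \<Rightarrow> 'a mat" where
  "vcat M N = mat (dim_row M + dim_row N) (dim_col M)
     (\<lambda>(i, j). if i < dim_row M then M $$ (i, j) else N $$ (i - dim_row M, j))"

context
  fixes R :: "('a, 'b) ring_scheme" and xs :: "'a list" and z :: "nat \<Rightarrow> nat \<Rightarrow> nat set \<Rightarrow> 'a"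
begin

definition mat_beta :: "nat \<Rightarrow> (nat set \<Rightarrow> 'a) mat" where
  "mat_beta k = mat (bnum (k - 1)) (bnum k) (\<lambda>(i, j).
     let P = (\<lambda>u. u \<in> {1, 2, 3} \<and> words k ! j = sort (words (k - 1) ! i @ [u]))
     in if \<exists>u. P u then z 1 (THE u. P u) else \<zero>\<^bsub>koszul_ring R xs\<^esub>)"

text \<open>Only used for \<open>k \<ge> 2\<close>.\<close>

definition mat_beta' :: "nat \<Rightarrow> (nat set \<Rightarrow> 'a) mat" where
  "mat_beta' k = mat (bnum (k - 1)) (bnum (k - 2)) (\<lambda>(i, j).
     let P = (\<lambda>u. u \<in> {1, 2, 3} \<and> words (k - 1) ! i = sort (words (k - 2) ! j @ [u]));
         V = {1, 2, 3} - {THE u. P u}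
     in if \<exists>u. P u then z 1 (Min V) \<otimes>\<^bsub>koszul_ring R xs\<^esub> z 1 (Max V) else \<zero>\<^bsub>koszul_ring R xs\<^esub>)"

definition mat_gamma1 :: "(nat set \<Rightarrow> 'a) mat" where
  "mat_gamma1 = mat 1 (homology_rank R xs 1 - 3) (\<lambda>(_, j). z 1 (j + 4))"

definition mat_gamma2 :: "(nat set \<Rightarrow> 'a) mat" where
  "mat_gamma2 = mat 1 (homology_rank R xs 2 - 3) (\<lambda>(_, j). z 2 (j + 1))"

definition mat_gamma3 :: "(nat set \<Rightarrow> 'a) mat" where
  "mat_gamma3 = mat 1 (homology_rank R xs 3) (\<lambda>(_, j). z 3 (j + 1))"

definition mat_alpha :: "nat \<Rightarrow> (nat set \<Rightarrow> 'a) mat" where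
  "mat_alpha k = hcat
     (block_diag \<zero>\<^bsub>koszul_ring R xs\<^esub>
        (concat (map (\<lambda>i. replicate (dnum (homology_rank R xs) i) (mat_beta (k - i))) [0..<k])))
     (block_diag \<zero>\<^bsub>koszul_ring R xs\<^esub> (replicate (ell (homology_rank R xs) (k - 1)) mat_gamma1))"

text \<open>The rows of \<open>\<alpha>\<^sub>k\<close> and of \<open>\<alpha>'\<^sub>k\<close> correspond to the columns of \<open>\<alpha>\<^sub>k\<^sub>-\<^sub>1\<close>. In \<open>\<alpha>\<^sub>k\<close>, the
  \<open>b\<^sub>k\<^sub>-\<^sub>1\<^sub>-\<^sub>i d\<^sub>i\<close> rows of the block \<open>i < k - 1\<close> correspond to the columns of the same block of
  \<open>\<alpha>\<^sub>k\<^sub>-\<^sub>1\<close>, and the last \<open>d\<^sub>k\<^sub>-\<^sub>1\<close> rows (\<open>i = k - 1\<close>) to the columns of the \<open>\<gamma>\<^sub>1\<close>-blocks of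
  \<open>\<alpha>\<^sub>k\<^sub>-\<^sub>1\<close>. Accordingly the \<open>d\<^sub>k\<^sub>-\<^sub>1\<close> zero rows of \<open>N\<^sub>k\<close> come last: with the zero rows displayed
  first, the column of \<open>\<beta>'\<^sub>2\<close> would sit partly on the \<open>\<gamma>\<^sub>1\<close>-rows and exactness would already
  fail at the first step.\<close>

definition mat_N :: "nat \<Rightarrow> (nat set \<Rightarrow> 'a) mat" where
  "mat_N k = vcat
     (block_diag \<zero>\<^bsub>koszul_ring R xs\<^esub>
        (concat (map (\<lambda>i. replicate (dnum (homology_rank R xs) i) (mat_beta' (k - i))) [0..<k - 1])))
     (mat (dnum (homology_rank R xs) (k - 1)) (ell_m2 (homology_rank R xs) k) (\<lambda>_. \<zero>\<^bsub>koszul_ring R xs\<^esub>))"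

definition mat_alpha' :: "nat \<Rightarrow> (nat set \<Rightarrow> 'a) mat" where
  "mat_alpha' k = hcat (mat_N k)
     (block_diag \<zero>\<^bsub>koszul_ring R xs\<^esub> (replicate (ell (homology_rank R xs) (k - 1)) mat_gamma2))"

definition mat_alpha'' :: "nat \<Rightarrow> (nat set \<Rightarrow> 'a) mat" where
  "mat_alpha'' k =
     block_diag \<zero>\<^bsub>koszul_ring R xs\<^esub> (replicate (ell (homology_rank R xs) (k - 1)) mat_gamma3)"

text \<open>\<open>\<alpha>\<^bsub>k,r\<^esub>\<close>, of size \<open>\<ell>\<^bsub>k-1\<^esub> \<times> \<ell>\<^bsub>k,r\<^esub>\<close>, for \<open>r \<in> {k, k+1, k+2}\<close>.\<close>

definition mat_alpha2 :: "nat \<Rightarrow> nat \<Rightarrow> (nat set \<Rightarrow> 'a) mat" where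
  "mat_alpha2 k r =
     (if r = k then mat_alpha k else if r = k + 1 then mat_alpha' k else mat_alpha'' k)"

section \<open>The complexes and the maps between them\<close>

text \<open>A monomial \<open>X\<^bsub>i,r\<^esub> X\<^bsub>i',r'\<^esub> \<dots>\<close> is the list \<open>[(i, r), (i', r'), \<dots>]\<close>. The summand
  \<open>\<Sigma>\<^bsup>deg\<^sub>2 m\<^esup> K\<^bsup>deg\<^sub>3 m\<^esup>\<close> has the basis elements \<open>(m, c)\<close>, where \<open>c\<close> lists one position
  \<open>< \<ell>\<^bsub>i,r\<^esub>\<close> for each factor \<open>X\<^bsub>i,r\<^esub>\<close> of \<open>m\<close>.\<close>

definition monomials :: "nat \<Rightarrow> (nat \<times> nat) list set" where
  "monomials k =
     {m. (\<forall>(i, r)\<in>set m. 1 \<le> i \<and> i \<le> r \<and> r \<le> i + 2) \<and> (\<forall>(i, r)\<in>set (tl m). i < r) \<and>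
         sum_list (map fst m) = k}"

definition cx_index :: "nat \<Rightarrow> ((nat \<times> nat) list \<times> nat list) set" where
  "cx_index k =
     {(m, c). m \<in> monomials k \<and> list_all2 (\<lambda>(i, r) p. p < ell2 (homology_rank R xs) i r) m c}"

definition cx_shift :: "(nat \<times> nat) list \<times> nat list \<Rightarrow> nat" where
  "cx_shift b = sum_list (map snd (fst b))"

text \<open>Degree \<open>j\<close> part of \<open>\<Oplus>\<^bsub>b \<in> I\<^esub> \<Sigma>\<^bsup>dg b\<^esup> M\<close> (also written \<open>\<Oplus>\<^bsub>b \<in> I\<^esub> M(-dg b)\<close>) if \<open>G\<close> is the grading
  of \<open>M\<close> and \<open>o'\<close> its zero.\<close>

definition shifted_sum_deg ::
  "'c \<Rightarrow> (nat \<Rightarrow> 'c set) \<Rightarrow> 'd set \<Rightarrow> ('d \<Rightarrow> nat) \<Rightarrow> nat \<Rightarrow> ('d \<Rightarrow> 'c) set" where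
  "shifted_sum_deg o' G I dg j = (\<Pi>\<^sub>E b\<in>I. if dg b \<le> j then G (j - dg b) else {o'})"

definition cx ::
  "nat \<Rightarrow> ((nat \<times> nat) list \<times> nat list \<Rightarrow> nat set \<Rightarrow> 'a) monoid" where
  "cx k = product_group (cx_index k) (\<lambda>_. add_monoid (koszul_ring R xs))"

definition cx_deg ::
  "nat \<Rightarrow> nat \<Rightarrow> ((nat \<times> nat) list \<times> nat list \<Rightarrow> nat set \<Rightarrow> 'a) set" where
  "cx_deg k = shifted_sum_deg \<zero>\<^bsub>koszul_ring R xs\<^esub> (koszul_deg R xs) (cx_index k) cx_shift"

definition cx_diff ::
  "nat \<Rightarrow> ((nat \<times> nat) list \<times> nat list \<Rightarrow> nat set \<Rightarrow> 'a) \<Rightarrow>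
   (nat \<times> nat) list \<times> nat list \<Rightarrow> nat set \<Rightarrow> 'a" where
  "cx_diff k x = (\<lambda>b\<in>cx_index k.
     if even (cx_shift b) then koszul_diff R xs (x b) else \<ominus>\<^bsub>koszul_ring R xs\<^esub> koszul_diff R xs (x b))"

text \<open>The entry of \<open>\<phi>\<^sup>(\<^sup>k\<^sup>)\<close> in row \<open>b'\<close> and in the column of a basis element of the summand
  \<open>X\<^bsub>i,r\<^esub> n\<close>: the copy of \<open>\<Delta>\<^sub>i\<close> attached to a basis element \<open>(n, c)\<close> of the summand \<open>n\<close> maps to
  \<open>X\<^bsub>i-1,i-1\<^esub> n\<close>, where \<open>X\<^bsub>0,0\<^esub> = 1\<close> (and \<open>\<Delta>\<^sub>1\<close> has a single row).
  With the summands ordered accordingly, \<open>\<phi>\<^sup>(\<^sup>k\<^sup>)\<close> is block diagonal, with \<open>\<Delta>\<^sub>k\<close> and, for each \<open>1 \<le> j < k\<close>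
  and \<open>r \<in> {k-j+1, k-j+2}\<close>, \<open>\<ell>\<^bsub>k-j,r\<^esub>\<close> copies of \<open>\<phi>\<^sup>(\<^sup>j\<^sup>)\<close> (the monomials with last factor \<open>X\<^bsub>k-j,r\<^esub>\<close>).\<close>

fun phi_entry ::
  "(nat \<times> nat) list \<times> nat list \<Rightarrow> (nat \<times> nat) list \<times> nat list \<Rightarrow> nat set \<Rightarrow> 'a" where
  "phi_entry b' ((i, r) # n, p # c) =
     (if i = 1 then (if b' = (n, c) then mat_alpha2 1 r $$ (0, p) else \<zero>\<^bsub>koszul_ring R xs\<^esub>)
      else (case b' of
              (y # n', q # c') \<Rightarrow>
                (if y = (i - 1, i - 1) \<and> n' = n \<and> c' = c then mat_alpha2 i r $$ (q, p) else \<zero>\<^bsub>koszul_ring R xs\<^esub>)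
            | _ \<Rightarrow> \<zero>\<^bsub>koszul_ring R xs\<^esub>))"
| "phi_entry b' _ = \<zero>\<^bsub>koszul_ring R xs\<^esub>"

definition phi ::
  "nat \<Rightarrow> ((nat \<times> nat) list \<times> nat list \<Rightarrow> nat set \<Rightarrow> 'a) \<Rightarrow>
   (nat \<times> nat) list \<times> nat list \<Rightarrow> nat set \<Rightarrow> 'a" where
  "phi k x = (\<lambda>b'\<in>cx_index (k - 1). \<Oplus>\<^bsub>koszul_ring R xs\<^esub>b\<in>cx_index k. phi_entry b' b \<otimes>\<^bsub>koszul_ring R xs\<^esub> x b)"

definition is_chain_map ::
  "nat \<Rightarrow> nat \<Rightarrow> (((nat \<times> nat) list \<times> nat list \<Rightarrow> nat set \<Rightarrow> 'a) \<Rightarrow>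
   (nat \<times> nat) list \<times> nat list \<Rightarrow> nat set \<Rightarrow> 'a) \<Rightarrow> bool" where
  "is_chain_map k l f \<longleftrightarrow>
     f \<in> hom (cx k) (cx l) \<and> (\<forall>j. f ` cx_deg k j \<subseteq> cx_deg l j) \<and>
     (\<forall>x\<in>carrier (cx k). f (cx_diff k x) = cx_diff l (f x))"

definition cx_boundaries ::
  "nat \<Rightarrow> ((nat \<times> nat) list \<times> nat list \<Rightarrow> nat set \<Rightarrow> 'a) set" where
  "cx_boundaries k = cx_diff k ` carrier (cx k)"

definition cx_cycles ::
  "nat \<Rightarrow> ((nat \<times> nat) list \<times> nat list \<Rightarrow> nat set \<Rightarrow> 'a) set" where
  "cx_cycles k = {x \<in> carrier (cx k). cx_diff k x = \<one>\<^bsub>cx k\<^esub>}"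

definition cx_homology ::
  "nat \<Rightarrow> ((nat \<times> nat) list \<times> nat list \<Rightarrow> nat set \<Rightarrow> 'a) set monoid" where
  "cx_homology k = (cx k)\<lparr>carrier := cx_cycles k\<rparr> Mod cx_boundaries k"

text \<open>The class of a cycle \<open>x\<close> is mapped to the class of \<open>\<phi>\<^sup>(\<^sup>k\<^sup>) x\<close>.\<close>

definition phi_induced ::
  "nat \<Rightarrow> ((nat \<times> nat) list \<times> nat list \<Rightarrow> nat set \<Rightarrow> 'a) set \<Rightarrow>
   ((nat \<times> nat) list \<times> nat list \<Rightarrow> nat set \<Rightarrow> 'a) set" where
  "phi_induced k X = cx_boundaries (k - 1) <#>\<^bsub>cx (k - 1)\<^esub> (phi k ` X)"

text \<open>The canonical map \<open>H(C\<^sup>(\<^sup>k\<^sup>)) \<rightarrow> \<Oplus>\<^bsub>b\<^esub> A(-dg b)\<close>, sending the class of \<open>(x\<^sub>b)\<^sub>b\<close> to the family of the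
  classes of the \<open>x\<^sub>b\<close>, and the induced map of \<open>\<phi>\<^sup>(\<^sup>k\<^sup>)\<close> under this identification.\<close>

definition homology_coords ::
  "nat \<Rightarrow> ((nat \<times> nat) list \<times> nat list \<Rightarrow> nat set \<Rightarrow> 'a) set \<Rightarrow>
   (nat \<times> nat) list \<times> nat list \<Rightarrow> (nat set \<Rightarrow> 'a) set" where
  "homology_coords k X = (\<lambda>b\<in>cx_index k. (\<lambda>x. x b) ` X)"

definition res_diff ::
  "nat \<Rightarrow> ((nat \<times> nat) list \<times> nat list \<Rightarrow> (nat set \<Rightarrow> 'a) set) \<Rightarrow>
   (nat \<times> nat) list \<times> nat list \<Rightarrow> (nat set \<Rightarrow> 'a) set" where
  "res_diff k v =
     homology_coords (k - 1)
       (phi_induced k (inv_into (carrier (cx_homology k)) (homology_coords k) v))"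

end

section \<open>Graded minimal resolutions\<close>

text \<open>The following refers to a graded ring \<open>A\<close> with grading \<open>G\<close>, which need not be commutative.
  \<open>I \<rightarrow>\<^sub>E carrier A\<close> is the free right \<open>A\<close>-module with finite basis \<open>I\<close>; left multiplication by
  matrices over \<open>A\<close> is right \<open>A\<close>-linear. A right module \<open>M\<close> is an additive group (the multiplication
  in its record is irrelevant) with an action \<open>act\<close>.\<close>

definition right_linear ::
  "('m, 'b) ring_scheme \<Rightarrow> 'v set \<Rightarrow> ('v \<Rightarrow> 'v \<Rightarrow> 'v) \<Rightarrow> ('v \<Rightarrow> 'm \<Rightarrow> 'v) \<Rightarrow>
   'w set \<Rightarrow> ('w \<Rightarrow> 'w \<Rightarrow> 'w) \<Rightarrow> ('w \<Rightarrow> 'm \<Rightarrow> 'w) \<Rightarrow> ('v \<Rightarrow> 'w) \<Rightarrow> bool" where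
  "right_linear A V addV actV W addW actW f \<longleftrightarrow>
     f \<in> V \<rightarrow> W \<and>
     (\<forall>v\<in>V. \<forall>v'\<in>V. f (addV v v') = addW (f v) (f v')) \<and>
     (\<forall>v\<in>V. \<forall>r\<in>carrier A. f (actV v r) = actW (f v) r)"

definition free_add :: "('m, 'b) ring_scheme \<Rightarrow> 'c set \<Rightarrow> ('c \<Rightarrow> 'm) \<Rightarrow> ('c \<Rightarrow> 'm) \<Rightarrow> 'c \<Rightarrow> 'm" where
  "free_add A I v w = (\<lambda>b\<in>I. v b \<oplus>\<^bsub>A\<^esub> w b)"

definition free_act :: "('m, 'b) ring_scheme \<Rightarrow> 'c set \<Rightarrow> ('c \<Rightarrow> 'm) \<Rightarrow> 'm \<Rightarrow> 'c \<Rightarrow> 'm" where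
  "free_act A I v r = (\<lambda>b\<in>I. v b \<otimes>\<^bsub>A\<^esub> r)"

text \<open>The graded free modules \<open>F\<^sub>k = \<Oplus>\<^bsub>b \<in> I k\<^esub> A(-dg b)\<close>, the differentials \<open>del k : F\<^sub>k \<rightarrow> F\<^sub>k\<^sub>-\<^sub>1\<close>
  (\<open>k \<ge> 1\<close>) and the augmentation \<open>aug : F\<^sub>0 \<rightarrow> M\<close> form a graded minimal free resolution of the right
  module \<open>M\<close>, which is concentrated in degree 0. Minimality is \<open>del k F\<^sub>k \<subseteq> F\<^sub>k\<^sub>-\<^sub>1 A\<^sub>+\<close>.\<close>

definition graded_minimal_resolution ::
  "('m, 'b) ring_scheme \<Rightarrow> (nat \<Rightarrow> 'm set) \<Rightarrow> (nat \<Rightarrow> 'c set) \<Rightarrow> ('c \<Rightarrow> nat) \<Rightarrow>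
   (nat \<Rightarrow> ('c \<Rightarrow> 'm) \<Rightarrow> 'c \<Rightarrow> 'm) \<Rightarrow> ('n, 'e) ring_scheme \<Rightarrow> ('n \<Rightarrow> 'm \<Rightarrow> 'n) \<Rightarrow>
   (('c \<Rightarrow> 'm) \<Rightarrow> 'n) \<Rightarrow> bool" where
  "graded_minimal_resolution A G I dg del M act aug \<longleftrightarrow>
     (let F = (\<lambda>k. I k \<rightarrow>\<^sub>E carrier A); Fdeg = (\<lambda>k. shifted_sum_deg \<zero>\<^bsub>A\<^esub> G (I k) dg) in
      (\<forall>k. finite (I k)) \<and>
      (\<forall>k\<ge>1. right_linear A (F k) (free_add A (I k)) (free_act A (I k))
                (F (k - 1)) (free_add A (I (k - 1))) (free_act A (I (k - 1))) (del k)) \<and>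
      (\<forall>k\<ge>1. \<forall>j. del k ` Fdeg k j \<subseteq> Fdeg (k - 1) j) \<and>
      right_linear A (F 0) (free_add A (I 0)) (free_act A (I 0)) (carrier M) (add M) act aug \<and>
      (\<forall>j\<ge>1. aug ` Fdeg 0 j \<subseteq> {\<zero>\<^bsub>M\<^esub>}) \<and>
      aug ` F 0 = carrier M \<and>
      del 1 ` F 1 = {v \<in> F 0. aug v = \<zero>\<^bsub>M\<^esub>} \<and>
      (\<forall>k\<ge>1. del (Suc k) ` F (Suc k) = {v \<in> F k. del k v = (\<lambda>b\<in>I (k - 1). \<zero>\<^bsub>A\<^esub>)}) \<and>
      (\<forall>k\<ge>1. \<forall>v\<in>F k. \<forall>b\<in>I (k - 1). del k v b \<in> genideal A (\<Union>i\<in>{1..}. G i)))"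

text \<open>The ring homomorphism from the Koszul homology onto the residue field: the class of a cycle is
  sent to the residue class of its component of degree 0.\<close>

definition koszul_aug :: "('a, 'b) ring_scheme \<Rightarrow> 'a set \<Rightarrow> (nat set \<Rightarrow> 'a) set \<Rightarrow> 'a set" where
  "koszul_aug R \<mm> X = (\<Union>f\<in>X. \<mm> +>\<^bsub>R\<^esub> f {})"

definition residue_act ::
  "('a, 'b) ring_scheme \<Rightarrow> 'a set \<Rightarrow> 'a set \<Rightarrow> (nat set \<Rightarrow> 'a) set \<Rightarrow> 'a set" where
  "residue_act R \<mm> y X = y \<otimes>\<^bsub>R Quot \<mm>\<^esub> koszul_aug R \<mm> X"

end

theory Submission
  imports Defs
begin

text \<open>Let \<open>A\<close> be the Koszul homology, \<open>A\<^sub>+\<close> its part of positive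
  degree and \<open>e\<^sub>1, e\<^sub>2, e\<^sub>3\<close> the classes of the cycles
  \<open>z\<^sup>1\<^sub>1, z\<^sup>1\<^sub>2, z\<^sup>1\<^sub>3\<close>. In class T the only nonzero
  products of elements of \<open>A\<^sub>+\<close> come from the products \<open>e\<^sub>u e\<^sub>t\<close>
  with \<open>u \<noteq> t\<close>, which are linearly independent for \<open>u < t\<close> and lie in
  degree 2. So \<open>A\<close> is an exterior algebra in three variables, truncated above degree 2,
  extended by a vector space that \<open>A\<^sub>+\<close> annihilates.

  Suppose that \<open>\<Delta>\<^sub>k\<close> kills a vector with coordinates \<open>X\<close>,
  \<open>Y\<close>, \<open>T\<close> at the columns of \<open>\<alpha>\<^sub>k\<close>,
  \<open>\<alpha>'\<^sub>k\<close>, \<open>\<alpha>''\<^sub>k\<close>, and look at the result degree by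
  degree, with coordinates split into homogeneous parts.
  \<^item> In degree 1 only the parts of \<open>X\<close> of degree 0 occur. The columns of
    \<open>\<alpha>\<^sub>k\<close> are linearly independent over \<open>A\<^sub>0\<close>, so these parts
    vanish (\<open>Bw_indep\<close>).
  \<^item> In degree 3 only the parts of \<open>T\<close> of degree 0 occur, at the basis elements
    \<open>\<gamma>\<^sub>3\<close>. So they vanish.
  \<^item> In degree 2 the parts of \<open>X\<close> of degree 1 meet the parts of \<open>Y\<close> of
    degree 0. The matrices \<open>\<beta>\<close> form the resolution of the residue field over the exterior
    algebra, by divided powers; its exactness says that the parts of \<open>X\<close> in question are images
    of constants under the next matrix. The columns of \<open>\<beta>'\<close> are independent of the image
    of \<open>\<beta>\<close>, because in the untruncated exterior algebra the following map of that
    resolution kills this image and sends the columns of \<open>\<beta>'\<close> to multiples of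
    \<open>e\<^sub>1 e\<^sub>2 e\<^sub>3\<close> (\<open>Bw_kernel\<close>).
  \<^item> The parts of \<open>X\<close> of degree 2 and 3 and the parts of \<open>Y\<close> and
    \<open>T\<close> in \<open>A\<^sub>+\<close> are unrestricted. The former are in the image of
    \<open>\<Delta>\<^sub>k\<^sub>+\<^sub>1\<close>: the images of \<open>\<beta>\<close> and
    \<open>\<beta>'\<close> together with \<open>\<gamma>\<^sub>2\<close> and
    \<open>\<gamma>\<^sub>3\<close> exhaust these degrees (\<open>Bw_Cw_surj\<close>,
    \<open>Row_image\<close>).

  Thus the kernel of \<open>\<Delta>\<^sub>k\<close> consists of the image of
  \<open>\<Delta>\<^sub>k\<^sub>+\<^sub>1\<close> at the columns of \<open>\<alpha>\<^sub>k\<close> and of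
  arbitrary elements of \<open>A\<^sub>+\<close> at the other columns (\<open>Row_kernel\<close>). Since
  \<open>A\<^sub>+\<close> is the image of \<open>\<Delta>\<^sub>1\<close>, a new copy of the whole
  construction has to start at each of the other columns. That is the recursion that defines
  \<open>\<phi>\<^sup>(\<^sup>k\<^sup>)\<close>, and exactness of the resolution follows block by block
  (\<open>kernel_image\<close>).

  The rows of \<open>\<alpha>\<^sub>k\<^sub>+\<^sub>1\<close> fall into blocks, one for each matrix
  \<open>\<beta>\<close> in it, and the rows of such a block are indexed by words. A row number therefore
  corresponds to a block number together with a word (\<open>idx\<close>), in terms of which
  \<open>\<beta>\<close> and \<open>\<beta>'\<close> become the operators \<open>Bw\<close> and
  \<open>Cw\<close> on functions of words (\<open>row_formula\<close>). A basis element of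
  \<open>C\<^sup>(\<^sup>k\<^sup>)\<close> with \<open>k > 0\<close> is a column of some
  \<open>\<Delta>\<^sub>i\<close> attached to a monomial \<open>n\<close>, and a row of
  \<open>\<Delta>\<^sub>i\<close> attached to \<open>n\<close> is a basis element
  \<open>X\<^bsub>i-1,i-1\<^esub> n\<close> (\<open>DD_row\<close>).

  The entries of \<open>\<phi>\<^sup>(\<^sup>k\<^sup>)\<close> are homogeneous cycles whose degree is the
  difference of the shifts, so the Leibniz rule of the Koszul complex turns
  \<open>\<phi>\<^sup>(\<^sup>k\<^sup>)\<close> into a chain map (\<open>sdiff_mult\<close>). A homology
  class of a finite sum of shifted copies of the Koszul complex is a product set of homology classes
  (\<open>carrier_cx_homology\<close>), which identifies the homology with a free module and the induced map
  with the matrix of the classes of the entries (\<open>res_diff_eq\<close>).\<close>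

section \<open>Finite sums\<close>

context abelian_monoid
begin

lemma finsum_sum_swap:
  assumes "finite A" "finite B" "\<And>a b. a \<in> A \<Longrightarrow> b \<in> B \<Longrightarrow> f a b \<in> carrier G"
  shows "(\<Oplus>a\<in>A. \<Oplus>b\<in>B. f a b) = (\<Oplus>b\<in>B. \<Oplus>a\<in>A. f a b)"
  using assms(1,3)
proof (induction A)
  case empty
  then show ?case by (simp add: finsum_zero)
next
  case (insert a A)
  have "(\<Oplus>a\<in>insert a A. \<Oplus>b\<in>B. f a b) = (\<Oplus>b\<in>B. f a b) \<oplus> (\<Oplus>a\<in>A. \<Oplus>b\<in>B. f a b)"
    using insert by (intro finsum_insert) (auto intro!: finsum_closed)
  also have "\<dots> = (\<Oplus>b\<in>B. f a b) \<oplus> (\<Oplus>b\<in>B. \<Oplus>a\<in>A. f a b)"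
    using insert by simp
  also have "\<dots> = (\<Oplus>b\<in>B. f a b \<oplus> (\<Oplus>a\<in>A. f a b))"
    using insert by (intro finsum_addf[symmetric]) (auto intro!: finsum_closed)
  also have "\<dots> = (\<Oplus>b\<in>B. \<Oplus>a\<in>insert a A. f a b)"
    using insert by (intro finsum_cong' refl) (auto intro!: finsum_closed finsum_insert[symmetric])
  finally show ?case .
qed

lemma finsum_Sigma:
  assumes "finite A" "\<And>a. a \<in> A \<Longrightarrow> finite (B a)"
    "\<And>a b. a \<in> A \<Longrightarrow> b \<in> B a \<Longrightarrow> f a b \<in> carrier G"
  shows "(\<Oplus>a\<in>A. \<Oplus>b\<in>B a. f a b) = (\<Oplus>p\<in>Sigma A B. f (fst p) (snd p))"
  using assms
proof (induction A)
  case empty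
  then show ?case by simp
next
  case (insert a A)
  have "(\<Oplus>a\<in>insert a A. \<Oplus>b\<in>B a. f a b) = (\<Oplus>b\<in>B a. f a b) \<oplus> (\<Oplus>a\<in>A. \<Oplus>b\<in>B a. f a b)"
    using insert by (intro finsum_insert) (auto intro!: finsum_closed)
  also have "\<dots> = (\<Oplus>p\<in>Pair a ` B a. f (fst p) (snd p)) \<oplus> (\<Oplus>p\<in>Sigma A B. f (fst p) (snd p))"
    using insert by (subst finsum_reindex) (auto simp: inj_on_def)
  also have "\<dots> = (\<Oplus>p\<in>Pair a ` B a \<union> Sigma A B. f (fst p) (snd p))"
    using insert by (intro finsum_Un_disjoint[symmetric]) auto
  also have "Pair a ` B a \<union> Sigma A B = Sigma (insert a A) B" by auto
  finally show ?case .
qed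

text \<open>Reindexing by pairs of disjoint subsets, \<open>T = U \<union> V\<close>, for the associativity of the wedge product.\<close>

lemma finsum_Pow_Pow:
  assumes "finite S" "\<And>T U. T \<subseteq> S \<Longrightarrow> U \<subseteq> T \<Longrightarrow> f T U \<in> carrier G"
  shows "(\<Oplus>T\<in>Pow S. \<Oplus>U\<in>Pow T. f T U) = (\<Oplus>U\<in>Pow S. \<Oplus>V\<in>Pow (S - U). f (U \<union> V) U)"
proof -
  have fin: "finite T" if "T \<subseteq> S" for T
    using that assms(1) finite_subset by blast
  define h where "h = (\<lambda>(U, V). (U \<union> V, U) :: 'c set \<times> 'c set)"
  have im: "h ` (SIGMA U:Pow S. Pow (S - U)) = Sigma (Pow S) Pow"
  proof (intro equalityI subsetI)
    fix p assume "p \<in> Sigma (Pow S) Pow"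
    then obtain T U where p: "p = (T, U)" "T \<subseteq> S" "U \<subseteq> T" by auto
    have "p = h (U, T - U)" using p by (auto simp: h_def)
    then show "p \<in> h ` (SIGMA U:Pow S. Pow (S - U))" using p by (intro image_eqI) auto
  qed (auto simp: h_def)
  have inj: "inj_on h (SIGMA U:Pow S. Pow (S - U))"
    by (auto simp: h_def inj_on_def)
  have "(\<Oplus>T\<in>Pow S. \<Oplus>U\<in>Pow T. f T U) = (\<Oplus>p\<in>Sigma (Pow S) Pow. f (fst p) (snd p))"
    using assms fin by (intro finsum_Sigma) auto
  also have "\<dots> = (\<Oplus>p\<in>(SIGMA U:Pow S. Pow (S - U)). f (fst (h p)) (snd (h p)))"
    unfolding im[symmetric]
  proof (intro finsum_reindex inj Pi_I)
    fix p assume "p \<in> h ` (SIGMA U:Pow S. Pow (S - U))"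
    then show "f (fst p) (snd p) \<in> carrier G" unfolding im by (auto intro: assms(2))
  qed
  also have "\<dots> = (\<Oplus>p\<in>(SIGMA U:Pow S. Pow (S - U)). f (fst p \<union> snd p) (fst p))"
    by (intro finsum_cong' refl) (auto simp: h_def intro!: assms(2))
  also have "\<dots> = (\<Oplus>U\<in>Pow S. \<Oplus>V\<in>Pow (S - U). f (U \<union> V) U)"
    by (intro finsum_Sigma[symmetric, of _ _ "\<lambda>U V. f (U \<union> V) U"])
      (use assms(1) in \<open>auto intro!: assms(2)\<close>)
  finally show ?thesis .
qed

lemma finsum_Pow_insert:
  assumes "finite S" "i \<notin> S" "\<And>T. T \<subseteq> insert i S \<Longrightarrow> f T \<in> carrier G"
  shows "(\<Oplus>T\<in>Pow (insert i S). f T) = (\<Oplus>T\<in>Pow S. f T \<oplus> f (insert i T))"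
proof -
  have "(\<Oplus>T\<in>Pow (insert i S). f T) = (\<Oplus>T\<in>Pow S. f T) \<oplus> (\<Oplus>T\<in>insert i ` Pow S. f T)"
    unfolding Pow_insert using assms(1,2)
    by (intro finsum_Un_disjoint Pi_I) (auto intro!: assms(3))
  also have "(\<Oplus>T\<in>insert i ` Pow S. f T) = (\<Oplus>T\<in>Pow S. f (insert i T))"
    using assms(1,2) by (intro finsum_reindex Pi_I inj_onI) (auto intro!: assms(3))
  also have "(\<Oplus>T\<in>Pow S. f T) \<oplus> \<dots> = (\<Oplus>T\<in>Pow S. f T \<oplus> f (insert i T))"
    by (intro finsum_addf[symmetric] Pi_I) (auto intro!: assms(3))
  finally show ?thesis .
qed

lemma finsum_single:
  assumes "finite A" "a \<in> A" "f a \<in> carrier G" "\<And>x. x \<in> A \<Longrightarrow> x \<noteq> a \<Longrightarrow> f x = \<zero>"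
  shows "(\<Oplus>x\<in>A. f x) = f a"
proof -
  have "(\<Oplus>x\<in>A. f x) = (\<Oplus>x\<in>{a}. f x)"
  proof (intro add.finprod_mono_neutral_cong_right Pi_I)
    fix x assume "x \<in> A"
    then show "f x \<in> carrier G" using assms(3,4) by (cases "x = a") auto
  qed (use assms in auto)
  then show ?thesis using assms by simp
qed

end

text \<open>The reason for \<open>\<partial>\<partial> = 0\<close>: the terms indexed by \<open>(i,
  j)\<close> and \<open>(j, i)\<close> cancel. A separate condition on the diagonal avoids dividing by
  2.\<close>

lemma (in abelian_group) finsum_antisym:
  assumes "finite A" and cl: "\<And>i j. i \<in> A \<Longrightarrow> j \<in> A \<Longrightarrow> f i j \<in> carrier G"
    and anti: "\<And>i j. i \<in> A \<Longrightarrow> j \<in> A \<Longrightarrow> i \<noteq> j \<Longrightarrow> f i j \<oplus> f j i = \<zero>"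
    and diag: "\<And>i. i \<in> A \<Longrightarrow> f i i = \<zero>"
  shows "(\<Oplus>i\<in>A. \<Oplus>j\<in>A. f i j) = \<zero>"
  using assms
proof (induction A)
  case empty
  then show ?case by simp
next
  case (insert a A)
  note fin = \<open>finite A\<close> and a = \<open>a \<notin> A\<close> and cl = insert.prems(1)
  have cl': "(\<Oplus>i\<in>A. f i a) \<in> carrier G" "(\<Oplus>j\<in>A. f a j) \<in> carrier G"
    by (auto intro!: finsum_closed cl)
  have "(\<Oplus>i\<in>insert a A. \<Oplus>j\<in>insert a A. f i j) =
      (\<Oplus>j\<in>insert a A. f a j) \<oplus> (\<Oplus>i\<in>A. \<Oplus>j\<in>insert a A. f i j)"
    using fin a by (intro finsum_insert) (auto intro!: finsum_closed cl)
  also have "(\<Oplus>j\<in>insert a A. f a j) = (\<Oplus>j\<in>A. f a j)"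
    using fin a cl' insert.prems(3)[of a] by (subst finsum_insert) (auto intro!: cl)
  also have "(\<Oplus>i\<in>A. \<Oplus>j\<in>insert a A. f i j) = (\<Oplus>i\<in>A. f i a \<oplus> (\<Oplus>j\<in>A. f i j))"
    using fin a by (intro finsum_cong' refl) (auto intro!: finsum_insert finsum_closed cl)
  also have "\<dots> = (\<Oplus>i\<in>A. f i a) \<oplus> (\<Oplus>i\<in>A. \<Oplus>j\<in>A. f i j)"
    by (intro finsum_addf) (auto intro!: finsum_closed cl)
  also have "(\<Oplus>i\<in>A. \<Oplus>j\<in>A. f i j) = \<zero>"
    by (rule insert.IH) (auto intro!: cl insert.prems)
  also have "(\<Oplus>j\<in>A. f a j) \<oplus> ((\<Oplus>i\<in>A. f i a) \<oplus> \<zero>) = (\<Oplus>j\<in>A. f a j \<oplus> f j a)"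
    using cl' by (subst finsum_addf) (auto intro!: cl)
  also have "\<dots> = (\<Oplus>j\<in>A. \<zero>)"
    using insert.prems(2)[of a] a by (intro finsum_cong' refl) auto
  finally show ?case by (simp add: finsum_zero)
qed

section \<open>The Koszul complex as a differential graded algebra\<close>

locale koszul_complex = cring R for R (structure) +
  fixes xs :: "'a list"
  assumes xs_closed: "set xs \<subseteq> carrier R"
begin

abbreviation N :: "nat set" where "N \<equiv> {..<length xs}"
abbreviation KK where "KK \<equiv> koszul_ring R xs"
abbreviation sg where "sg \<equiv> shuffle_sign R"

definition parity :: "nat \<Rightarrow> 'a" where "parity n = (\<ominus> \<one>) [^] n"

lemma parity_closed [simp]: "parity n \<in> carrier R"
  by (simp add: parity_def)

lemma parity_0 [simp]: "parity 0 = \<one>"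
  by (simp add: parity_def)

lemma parity_add: "parity (m + n) = parity m \<otimes> parity n"
  by (simp add: parity_def nat_pow_mult)

lemma parity_Suc: "parity (Suc n) = \<ominus> parity n"
  by (simp add: parity_def r_minus)

lemma parity_sq [simp]: "parity n \<otimes> parity n = \<one>"
  by (induction n) (simp_all add: parity_Suc l_minus r_minus)

lemma parity_sq' [simp]: "a \<in> carrier R \<Longrightarrow> parity n \<otimes> (parity n \<otimes> a) = a"
  by (simp add: m_assoc[symmetric])

lemma parity_cases: "parity n = (if even n then \<one> else \<ominus> \<one>)"
  by (induction n) (auto simp: parity_Suc)

lemma sg_parity: "sg T U = parity (card {(i, j). i \<in> T \<and> j \<in> U \<and> j < i})"
  by (simp add: shuffle_sign_def parity_def)

lemma sg_closed [simp]: "sg T U \<in> carrier R"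
  by (simp add: sg_parity)

lemma sg_sq [simp]: "sg T U \<otimes> sg T U = \<one>"
  by (simp add: sg_parity)

lemma sg_sq' [simp]: "a \<in> carrier R \<Longrightarrow> sg T U \<otimes> (sg T U \<otimes> a) = a"
  by (simp add: sg_parity)

lemma sg_empty [simp]: "sg {} U = \<one>" "sg T {} = \<one>"
  by (simp_all add: sg_parity)

lemma finite_inversions: "finite T \<Longrightarrow> finite U \<Longrightarrow> finite {(i, j). i \<in> T \<and> j \<in> U \<and> j < (i::nat)}"
  by (rule finite_subset[of _ "T \<times> U"]) auto

lemma sg_Un_left:
  assumes "finite T" "finite U" "finite V" "T \<inter> U = {}"
  shows "sg (T \<union> U) V = sg T V \<otimes> sg U V"
proof -
  have "{(i, j). i \<in> T \<union> U \<and> j \<in> V \<and> j < i} =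
      {(i, j). i \<in> T \<and> j \<in> V \<and> j < i} \<union> {(i, j). i \<in> U \<and> j \<in> V \<and> j < i}"
    by auto
  moreover have "card \<dots> = card {(i, j). i \<in> T \<and> j \<in> V \<and> j < i} + card {(i, j). i \<in> U \<and> j \<in> V \<and> j < i}"
    using assms by (intro card_Un_disjoint finite_inversions) auto
  ultimately show ?thesis
    unfolding sg_parity by (simp add: parity_add)
qed

lemma sg_Un_right:
  assumes "finite T" "finite U" "finite V" "U \<inter> V = {}"
  shows "sg T (U \<union> V) = sg T U \<otimes> sg T V"
proof -
  have "{(i, j). i \<in> T \<and> j \<in> U \<union> V \<and> j < i} =
      {(i, j). i \<in> T \<and> j \<in> U \<and> j < i} \<union> {(i, j). i \<in> T \<and> j \<in> V \<and> j < i}"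
    by auto
  moreover have "card \<dots> = card {(i, j). i \<in> T \<and> j \<in> U \<and> j < i} + card {(i, j). i \<in> T \<and> j \<in> V \<and> j < i}"
    using assms by (intro card_Un_disjoint finite_inversions) auto
  ultimately show ?thesis
    unfolding sg_parity by (simp add: parity_add)
qed

lemma sg_insert_left:
  "finite U \<Longrightarrow> finite V \<Longrightarrow> i \<notin> U \<Longrightarrow> sg (insert i U) V = sg {i} V \<otimes> sg U V"
  using sg_Un_left[of "{i}" U V] by simp

lemma sg_insert_right:
  "finite T \<Longrightarrow> finite V \<Longrightarrow> i \<notin> V \<Longrightarrow> sg T (insert i V) = sg T {i} \<otimes> sg T V"
  using sg_Un_right[of T "{i}" V] by simp

lemma sg_singleton_commute:
  assumes "finite T" "i \<notin> T"
  shows "sg {i} T \<otimes> sg T {i} = parity (card T)"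
proof -
  have "{(k, j). k \<in> {i} \<and> j \<in> T \<and> j < k} = Pair i ` {j\<in>T. j < i}" by auto
  then have 1: "card {(k, j). k \<in> {i} \<and> j \<in> T \<and> j < k} = card {j\<in>T. j < i}"
    by (simp add: card_image inj_on_def)
  have "{(k, j). k \<in> T \<and> j \<in> {i} \<and> j < k} = (\<lambda>j. (j, i)) ` {j\<in>T. i < j}" by auto
  then have 2: "card {(k, j). k \<in> T \<and> j \<in> {i} \<and> j < k} = card {j\<in>T. i < j}"
    by (simp add: card_image inj_on_def)
  have "{j\<in>T. j < i} \<union> {j\<in>T. i < j} = T"
    using assms(2) by (auto; metis linorder_neqE_nat)
  moreover have "card ({j\<in>T. j < i} \<union> {j\<in>T. i < j}) = card {j\<in>T. j < i} + card {j\<in>T. i < j}"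
    using assms(1) by (intro card_Un_disjoint) auto
  ultimately have "card T = card {j\<in>T. j < i} + card {j\<in>T. i < j}" by simp
  then show ?thesis unfolding sg_parity 1 2 by (simp add: parity_add)
qed

lemma sg_singletons: "sg {i} {j} = (if j < i then \<ominus> \<one> else \<one>)"
proof -
  have "{(k, l). k \<in> {i} \<and> l \<in> {j} \<and> l < k} = (if j < i then {(i, j)} else {})" by auto
  then show ?thesis unfolding sg_parity by (simp add: parity_Suc)
qed

lemma finite_sub: "S \<subseteq> N \<Longrightarrow> finite S"
  using finite_subset by blast

lemma koszul_carrier: "carrier KK = Pow N \<rightarrow>\<^sub>E carrier R"
  by (simp add: koszul_ring_def)

lemma koszul_closed: "f \<in> carrier KK \<Longrightarrow> S \<subseteq> N \<Longrightarrow> f S \<in> carrier R"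
  by (auto simp: koszul_carrier PiE_iff)

lemma koszul_ext:
  "f \<in> carrier KK \<Longrightarrow> g \<in> carrier KK \<Longrightarrow> (\<And>S. S \<subseteq> N \<Longrightarrow> f S = g S) \<Longrightarrow> f = g"
  unfolding koszul_carrier by (rule PiE_ext) auto

lemma koszul_add: "S \<subseteq> N \<Longrightarrow> (f \<oplus>\<^bsub>KK\<^esub> g) S = f S \<oplus> g S"
  by (simp add: koszul_ring_def)

lemma koszul_zero: "S \<subseteq> N \<Longrightarrow> \<zero>\<^bsub>KK\<^esub> S = \<zero>"
  by (simp add: koszul_ring_def)

lemma koszul_one: "S \<subseteq> N \<Longrightarrow> \<one>\<^bsub>KK\<^esub> S = (if S = {} then \<one> else \<zero>)"
  by (simp add: koszul_ring_def)

lemma koszul_mult: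
  "S \<subseteq> N \<Longrightarrow> (f \<otimes>\<^bsub>KK\<^esub> g) S = (\<Oplus>T\<in>Pow S. sg T (S - T) \<otimes> (f T \<otimes> g (S - T)))"
  by (simp add: koszul_ring_def)

lemma koszul_mult_closed:
  assumes "f \<in> carrier KK" "g \<in> carrier KK" shows "f \<otimes>\<^bsub>KK\<^esub> g \<in> carrier KK"
proof -
  have "(\<Oplus>T\<in>Pow S. sg T (S - T) \<otimes> (f T \<otimes> g (S - T))) \<in> carrier R" if "S \<subseteq> N" for S
    using that by (intro finsum_closed Pi_I m_closed koszul_closed[OF assms(1)] koszul_closed[OF assms(2)] sg_closed) auto
  then show ?thesis by (simp add: koszul_ring_def)
qed

lemma koszul_mult_assoc:
  assumes f: "f \<in> carrier KK" and g: "g \<in> carrier KK" and h: "h \<in> carrier KK"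
  shows "(f \<otimes>\<^bsub>KK\<^esub> g) \<otimes>\<^bsub>KK\<^esub> h = f \<otimes>\<^bsub>KK\<^esub> (g \<otimes>\<^bsub>KK\<^esub> h)"
proof (rule koszul_ext)
  fix S assume S: "S \<subseteq> N"
  note fS = finite_sub[OF S]
  have cl: "f T \<in> carrier R" "g T \<in> carrier R" "h T \<in> carrier R" if "T \<subseteq> S" for T
    using f g h that S koszul_closed subset_trans by metis+
  have sub: "finite T" "T \<subseteq> N" if "T \<subseteq> S" for T
    using that S fS finite_subset by auto
  let ?F = "\<lambda>T U. sg T (S - T) \<otimes> ((sg U (T - U) \<otimes> (f U \<otimes> g (T - U))) \<otimes> h (S - T))"
  have F: "?F T U \<in> carrier R" if "T \<subseteq> S" "U \<subseteq> T" for T U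
    using that cl[of "S - T"] cl[of U] cl[of "T - U"] by (intro m_closed sg_closed) auto
  have "((f \<otimes>\<^bsub>KK\<^esub> g) \<otimes>\<^bsub>KK\<^esub> h) S = (\<Oplus>T\<in>Pow S. \<Oplus>U\<in>Pow T. ?F T U)"
    unfolding koszul_mult[OF S]
  proof (intro finsum_cong' refl)
    fix T assume "T \<in> Pow S"
    then have T: "T \<subseteq> S" by simp
    have c: "(\<lambda>U. sg U (T - U) \<otimes> (f U \<otimes> g (T - U))) \<in> Pow T \<rightarrow> carrier R"
      using T by (intro Pi_I m_closed sg_closed cl) auto
    show "sg T (S - T) \<otimes> ((f \<otimes>\<^bsub>KK\<^esub> g) T \<otimes> h (S - T)) = (\<Oplus>U\<in>Pow T. ?F T U)"
      unfolding koszul_mult[OF sub(2)[OF T]]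
      by (subst finsum_ldistr[OF _ _ c], (simp add: sub(1)[OF T] cl)+)
        (rule finsum_rdistr, use T in \<open>auto simp: sub(1) intro!: m_closed cl\<close>)
  qed (use F in \<open>auto intro!: finsum_closed\<close>)
  also have "\<dots> = (\<Oplus>U\<in>Pow S. \<Oplus>V\<in>Pow (S - U). ?F (U \<union> V) U)"
    using F by (intro finsum_Pow_Pow fS) auto
  also have "\<dots> = (f \<otimes>\<^bsub>KK\<^esub> (g \<otimes>\<^bsub>KK\<^esub> h)) S"
    unfolding koszul_mult[OF S]
  proof (intro finsum_cong' refl)
    fix U assume "U \<in> Pow S"
    then have U: "U \<subseteq> S" by simp
    let ?G = "\<lambda>V. sg V (S - U - V) \<otimes> (g V \<otimes> h (S - U - V))"
    have c: "?G \<in> Pow (S - U) \<rightarrow> carrier R"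
      using U by (intro Pi_I m_closed sg_closed cl) auto
    have c'a: "(\<Oplus>V\<in>Pow (S - U). ?G V) = (g \<otimes>\<^bsub>KK\<^esub> h) (S - U)"
      using U S by (intro koszul_mult[symmetric]) auto
    have c': "(\<lambda>V. f U \<otimes> ?G V) \<in> Pow (S - U) \<rightarrow> carrier R"
      using c cl(1)[OF U] by auto
    have "sg U (S - U) \<otimes> (f U \<otimes> (g \<otimes>\<^bsub>KK\<^esub> h) (S - U)) =
        (\<Oplus>V\<in>Pow (S - U). sg U (S - U) \<otimes> (f U \<otimes> ?G V))"
      unfolding c'a[symmetric] using fS
      by (subst finsum_rdistr[OF _ cl(1)[OF U] c], simp, subst finsum_rdistr[OF _ _ c']) auto
    also have "\<dots> = (\<Oplus>V\<in>Pow (S - U). ?F (U \<union> V) U)"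
    proof (intro finsum_cong' refl)
      fix V assume "V \<in> Pow (S - U)"
      then have V: "V \<subseteq> S - U" by simp
      define W where "W = S - U - V"
      have eqs: "S - (U \<union> V) = W" "U \<union> V - U = V" "S - U = V \<union> W" "S - U - V = W"
        using V unfolding W_def by auto
      have fin: "finite U" "finite V" "finite W"
        using sub U V by (auto simp: W_def)
      have s1: "sg (U \<union> V) W = sg U W \<otimes> sg V W"
        using fin V by (intro sg_Un_left) auto
      have s2: "sg U (S - U) = sg U V \<otimes> sg U W"
        unfolding eqs(3) using fin by (intro sg_Un_right) (auto simp: W_def)
      have c: "f U \<in> carrier R" "g V \<in> carrier R" "h W \<in> carrier R"
        using cl[of U] cl[of V] cl[of W] U V by (auto simp: W_def)
      show "sg U (S - U) \<otimes> (f U \<otimes> ?G V) = ?F (U \<union> V) U"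
        unfolding s2 eqs(1,2,4) s1 using c by (simp add: m_ac)
    qed (intro Pi_I F, use U in auto)
    finally show "(\<Oplus>V\<in>Pow (S - U). ?F (U \<union> V) U) = sg U (S - U) \<otimes> (f U \<otimes> (g \<otimes>\<^bsub>KK\<^esub> h) (S - U))"
      by simp
  qed (use S koszul_mult_closed[OF g h] in \<open>auto intro!: Pi_I m_closed sg_closed koszul_closed[OF f] koszul_closed[of "g \<otimes>\<^bsub>KK\<^esub> h"]\<close>)
  finally show "((f \<otimes>\<^bsub>KK\<^esub> g) \<otimes>\<^bsub>KK\<^esub> h) S = (f \<otimes>\<^bsub>KK\<^esub> (g \<otimes>\<^bsub>KK\<^esub> h)) S" .
qed (use assms in \<open>auto intro!: koszul_mult_closed\<close>)

lemma koszul_add_closed: "f \<in> carrier KK \<Longrightarrow> g \<in> carrier KK \<Longrightarrow> f \<oplus>\<^bsub>KK\<^esub> g \<in> carrier KK"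
  by (auto simp: koszul_ring_def)

lemma koszul_zero_closed: "\<zero>\<^bsub>KK\<^esub> \<in> carrier KK"
  by (auto simp: koszul_ring_def)

lemma koszul_one_closed: "\<one>\<^bsub>KK\<^esub> \<in> carrier KK"
  by (auto simp: koszul_ring_def)

lemma koszul_ring_is_ring: "ring KK"
proof (rule ringI)
  show "abelian_group KK"
  proof (rule abelian_groupI)
    fix f assume f: "f \<in> carrier KK"
    let ?g = "\<lambda>S\<in>Pow N. \<ominus> f S"
    have g: "?g \<in> carrier KK" using f by (auto simp: koszul_carrier)
    have "?g \<oplus>\<^bsub>KK\<^esub> f = \<zero>\<^bsub>KK\<^esub>"
      by (rule koszul_ext) (use f g in \<open>auto simp: koszul_add koszul_zero l_neg koszul_closed[OF f]
          intro!: koszul_add_closed koszul_zero_closed\<close>)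
    then show "\<exists>g\<in>carrier KK. g \<oplus>\<^bsub>KK\<^esub> f = \<zero>\<^bsub>KK\<^esub>" using g by blast
  qed (auto intro!: koszul_add_closed koszul_zero_closed koszul_ext
      simp: koszul_add koszul_zero a_ac koszul_closed)
  show "Group.monoid KK"
  proof (rule monoidI)
    fix f assume f: "f \<in> carrier KK"
    show "\<one>\<^bsub>KK\<^esub> \<otimes>\<^bsub>KK\<^esub> f = f"
    proof (rule koszul_ext)
      fix S assume S: "S \<subseteq> N"
      show "(\<one>\<^bsub>KK\<^esub> \<otimes>\<^bsub>KK\<^esub> f) S = f S"
        unfolding koszul_mult[OF S]
      proof (subst finsum_single[where a = "{}"])
        fix T assume T: "T \<in> Pow S" "T \<noteq> {}"
        then have "T \<subseteq> N" "f (S - T) \<in> carrier R" using S by (auto intro!: koszul_closed[OF f])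
        then show "sg T (S - T) \<otimes> (\<one>\<^bsub>KK\<^esub> T \<otimes> f (S - T)) = \<zero>" using T by (simp add: koszul_one)
      qed (use koszul_closed[OF f S] finite_sub[OF S] in \<open>auto simp: koszul_one\<close>)
    qed (use f in \<open>auto intro!: koszul_mult_closed koszul_one_closed\<close>)
    show "f \<otimes>\<^bsub>KK\<^esub> \<one>\<^bsub>KK\<^esub> = f"
    proof (rule koszul_ext)
      fix S assume S: "S \<subseteq> N"
      have 1: "\<one>\<^bsub>KK\<^esub> (S - T) = (if S = T then \<one> else \<zero>)" if "T \<subseteq> S" for T
        using that S by (subst koszul_one) auto
      show "(f \<otimes>\<^bsub>KK\<^esub> \<one>\<^bsub>KK\<^esub>) S = f S"
        unfolding koszul_mult[OF S]
      proof (subst finsum_single[where a = S])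
        fix T assume T: "T \<in> Pow S" "T \<noteq> S"
        then have "f T \<in> carrier R" using S by (auto intro!: koszul_closed[OF f])
        then show "sg T (S - T) \<otimes> (f T \<otimes> \<one>\<^bsub>KK\<^esub> (S - T)) = \<zero>" using T by (simp add: 1)
      qed (use koszul_closed[OF f S] finite_sub[OF S] in \<open>auto simp: koszul_one\<close>)
    qed (use f in \<open>auto intro!: koszul_mult_closed koszul_one_closed\<close>)
  qed (use koszul_mult_assoc in \<open>auto intro!: koszul_mult_closed koszul_one_closed\<close>)
  fix f g h assume fgh: "f \<in> carrier KK" "g \<in> carrier KK" "h \<in> carrier KK"
  show "(f \<oplus>\<^bsub>KK\<^esub> g) \<otimes>\<^bsub>KK\<^esub> h = f \<otimes>\<^bsub>KK\<^esub> h \<oplus>\<^bsub>KK\<^esub> g \<otimes>\<^bsub>KK\<^esub> h"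
  proof (rule koszul_ext)
    fix S assume S: "S \<subseteq> N"
    have cl: "f T \<in> carrier R" "g T \<in> carrier R" "h T \<in> carrier R" if "T \<subseteq> S" for T
      using fgh that S koszul_closed subset_trans by metis+
    have ad: "(f \<oplus>\<^bsub>KK\<^esub> g) T = f T \<oplus> g T" if "T \<in> Pow S" for T
      using that S by (intro koszul_add) auto
    show "((f \<oplus>\<^bsub>KK\<^esub> g) \<otimes>\<^bsub>KK\<^esub> h) S = (f \<otimes>\<^bsub>KK\<^esub> h \<oplus>\<^bsub>KK\<^esub> g \<otimes>\<^bsub>KK\<^esub> h) S"
      unfolding koszul_add[OF S] koszul_mult[OF S]
    proof (subst finsum_addf[symmetric], goal_cases)
      case 3
      show ?case
      proof (intro finsum_cong' refl)
        fix T assume T: "T \<in> Pow S"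
        then have "T \<subseteq> S" "S - T \<subseteq> S" by auto
        then show "sg T (S - T) \<otimes> ((f \<oplus>\<^bsub>KK\<^esub> g) T \<otimes> h (S - T)) =
            sg T (S - T) \<otimes> (f T \<otimes> h (S - T)) \<oplus> sg T (S - T) \<otimes> (g T \<otimes> h (S - T))"
          using cl by (simp add: ad[OF T] l_distr r_distr)
      qed (auto intro!: cl m_closed a_closed)
    qed (auto intro!: cl m_closed a_closed)
  qed (use fgh in \<open>auto intro!: koszul_mult_closed koszul_add_closed\<close>)
  show "h \<otimes>\<^bsub>KK\<^esub> (f \<oplus>\<^bsub>KK\<^esub> g) = h \<otimes>\<^bsub>KK\<^esub> f \<oplus>\<^bsub>KK\<^esub> h \<otimes>\<^bsub>KK\<^esub> g"
  proof (rule koszul_ext)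
    fix S assume S: "S \<subseteq> N"
    have cl: "f T \<in> carrier R" "g T \<in> carrier R" "h T \<in> carrier R" if "T \<subseteq> S" for T
      using fgh that S koszul_closed subset_trans by metis+
    have ad: "(f \<oplus>\<^bsub>KK\<^esub> g) (S - T) = f (S - T) \<oplus> g (S - T)" for T
      using S by (intro koszul_add) auto
    show "(h \<otimes>\<^bsub>KK\<^esub> (f \<oplus>\<^bsub>KK\<^esub> g)) S = (h \<otimes>\<^bsub>KK\<^esub> f \<oplus>\<^bsub>KK\<^esub> h \<otimes>\<^bsub>KK\<^esub> g) S"
      unfolding koszul_add[OF S] koszul_mult[OF S]
    proof (subst finsum_addf[symmetric], goal_cases)
      case 3
      show ?case
      proof (intro finsum_cong' refl)
        fix T assume T: "T \<in> Pow S"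
        then have "T \<subseteq> S" "S - T \<subseteq> S" by auto
        then show "sg T (S - T) \<otimes> (h T \<otimes> (f \<oplus>\<^bsub>KK\<^esub> g) (S - T)) =
            sg T (S - T) \<otimes> (h T \<otimes> f (S - T)) \<oplus> sg T (S - T) \<otimes> (h T \<otimes> g (S - T))"
          using cl by (simp add: ad r_distr)
      qed (auto intro!: cl m_closed a_closed)
    qed (auto intro!: cl m_closed a_closed)
  qed (use fgh in \<open>auto intro!: koszul_mult_closed koszul_add_closed\<close>)
qed

sublocale K: ring KK by (rule koszul_ring_is_ring)

lemma koszul_a_inv: "f \<in> carrier KK \<Longrightarrow> S \<subseteq> N \<Longrightarrow> (\<ominus>\<^bsub>KK\<^esub> f) S = \<ominus> f S"
proof -
  assume f: "f \<in> carrier KK" and S: "S \<subseteq> N"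
  have "f S \<oplus> (\<ominus>\<^bsub>KK\<^esub> f) S = (f \<oplus>\<^bsub>KK\<^esub> \<ominus>\<^bsub>KK\<^esub> f) S" using S by (simp add: koszul_add)
  also have "\<dots> = \<zero>" using f S by (simp add: K.r_neg koszul_zero)
  finally show ?thesis
    using f S K.a_inv_closed[OF f] by (metis koszul_closed minus_equality a_comm)
qed

lemma koszul_finsum:
  assumes "finite A" "f \<in> A \<rightarrow> carrier KK" "S \<subseteq> N"
  shows "(\<Oplus>\<^bsub>KK\<^esub>a\<in>A. f a) S = (\<Oplus>a\<in>A. f a S)"
  using assms
proof (induction A)
  case (insert a A)
  have "(\<lambda>a. f a S) \<in> A \<rightarrow> carrier R" using insert by (auto intro!: koszul_closed)
  then show ?case using insert by (simp add: koszul_add koszul_closed Pi_iff)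
qed (simp add: koszul_zero)

end

context koszul_complex
begin

abbreviation dd where "dd \<equiv> koszul_diff R xs"

text \<open>The contraction with the dual basis vector of \<open>e\<^sub>i\<close>; the Koszul differential
  is their combination with coefficients \<open>x\<^sub>i\<close>. Its values are zero at the subsets that
  contain \<open>i\<close>, so that all sums can run over the same index set.\<close>

definition contract :: "nat \<Rightarrow> (nat set \<Rightarrow> 'a) \<Rightarrow> nat set \<Rightarrow> 'a" where
  "contract i f S = (if i \<in> S then \<zero> else sg {i} S \<otimes> f (insert i S))"

text \<open>The grading involution, multiplication by \<open>(-1)\<^sup>j\<close> in degree
  \<open>j\<close>.\<close>

definition twist :: "(nat set \<Rightarrow> 'a) \<Rightarrow> nat set \<Rightarrow> 'a" where
  "twist f = (\<lambda>S\<in>Pow N. parity (card S) \<otimes> f S)"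

lemma nth_closed: "i \<in> N \<Longrightarrow> xs ! i \<in> carrier R"
  using xs_closed nth_mem by auto

lemma contract_closed: "f \<in> carrier KK \<Longrightarrow> i \<in> N \<Longrightarrow> S \<subseteq> N \<Longrightarrow> contract i f S \<in> carrier R"
  using koszul_closed[of f "insert i S"] by (auto simp: contract_def)

lemma twist_closed: "f \<in> carrier KK \<Longrightarrow> twist f \<in> carrier KK"
  by (auto simp: twist_def koszul_carrier intro!: m_closed)

lemma twist_apply: "S \<subseteq> N \<Longrightarrow> twist f S = parity (card S) \<otimes> f S"
  by (simp add: twist_def)

lemma twist_twist: "f \<in> carrier KK \<Longrightarrow> twist (twist f) = f"
  by (rule koszul_ext) (auto intro!: twist_closed simp: twist_apply koszul_closed)

lemma diff_apply:
  assumes f: "f \<in> carrier KK" and S: "S \<subseteq> N"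
  shows "dd f S = (\<Oplus>i\<in>N. xs ! i \<otimes> contract i f S)"
proof -
  have "(\<Oplus>i\<in>N. xs ! i \<otimes> contract i f S) = (\<Oplus>i\<in>N - S. sg {i} S \<otimes> (xs ! i \<otimes> f (insert i S)))"
  proof (intro add.finprod_mono_neutral_cong_right Pi_I)
    fix i assume i: "i \<in> N - S"
    have "f (insert i S) \<in> carrier R" using i S by (auto intro!: koszul_closed[OF f])
    with i show "xs ! i \<otimes> contract i f S = sg {i} S \<otimes> (xs ! i \<otimes> f (insert i S))"
      using nth_closed[of i] by (simp add: contract_def m_ac)
  next
    fix i assume "i \<in> N - (N - S)"
    then show "xs ! i \<otimes> contract i f S = \<zero>" using nth_closed[of i] by (simp add: contract_def)
  next
    fix i assume "i \<in> N"
    then show "xs ! i \<otimes> contract i f S \<in> carrier R"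
      using contract_closed[OF f _ S] nth_closed by auto
  qed auto
  then show ?thesis using S by (simp add: koszul_diff_def)
qed

lemma diff_closed: "f \<in> carrier KK \<Longrightarrow> dd f \<in> carrier KK"
proof -
  assume f: "f \<in> carrier KK"
  have "dd f S \<in> carrier R" if "S \<subseteq> N" for S
    unfolding diff_apply[OF f that]
    by (intro finsum_closed Pi_I m_closed contract_closed f that nth_closed)
  moreover have "dd f \<in> extensional (Pow N)" by (simp add: koszul_diff_def)
  ultimately show ?thesis by (auto simp: koszul_carrier PiE_iff)
qed

lemma contract_add:
  assumes "f \<in> carrier KK" "g \<in> carrier KK" "i \<in> N" "S \<subseteq> N"
  shows "contract i (f \<oplus>\<^bsub>KK\<^esub> g) S = contract i f S \<oplus> contract i g S"
  using assms by (simp add: contract_def koszul_add koszul_closed r_distr)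

lemma diff_add:
  assumes f: "f \<in> carrier KK" and g: "g \<in> carrier KK"
  shows "dd (f \<oplus>\<^bsub>KK\<^esub> g) = dd f \<oplus>\<^bsub>KK\<^esub> dd g"
proof (rule koszul_ext)
  fix S assume S: "S \<subseteq> N"
  have "dd (f \<oplus>\<^bsub>KK\<^esub> g) S = (\<Oplus>i\<in>N. xs ! i \<otimes> contract i f S \<oplus> xs ! i \<otimes> contract i g S)"
    unfolding diff_apply[OF koszul_add_closed[OF f g] S]
    by (intro finsum_cong' refl)
      (auto simp: contract_add[OF f g _ S] r_distr nth_closed contract_closed f g S
        intro!: nth_closed contract_closed m_closed a_closed)
  also have "\<dots> = dd f S \<oplus> dd g S"
    unfolding diff_apply[OF f S] diff_apply[OF g S]
    by (intro finsum_addf Pi_I m_closed contract_closed f g S nth_closed)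
  finally show "dd (f \<oplus>\<^bsub>KK\<^esub> g) S = (dd f \<oplus>\<^bsub>KK\<^esub> dd g) S"
    using S by (simp add: koszul_add)
qed (auto intro!: diff_closed f g koszul_add_closed)

lemma diff_zero: "dd \<zero>\<^bsub>KK\<^esub> = \<zero>\<^bsub>KK\<^esub>"
proof -
  have c: "dd \<zero>\<^bsub>KK\<^esub> \<in> carrier KK" by (rule diff_closed) simp
  have "dd \<zero>\<^bsub>KK\<^esub> = dd \<zero>\<^bsub>KK\<^esub> \<oplus>\<^bsub>KK\<^esub> dd \<zero>\<^bsub>KK\<^esub>"
    using diff_add[of "\<zero>\<^bsub>KK\<^esub>" "\<zero>\<^bsub>KK\<^esub>"] by simp
  then show ?thesis using c by (metis K.r_zero K.add.l_cancel K.zero_closed)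
qed

lemma diff_minus: "f \<in> carrier KK \<Longrightarrow> dd (\<ominus>\<^bsub>KK\<^esub> f) = \<ominus>\<^bsub>KK\<^esub> dd f"
proof -
  assume f: "f \<in> carrier KK"
  have "dd (\<ominus>\<^bsub>KK\<^esub> f) \<oplus>\<^bsub>KK\<^esub> dd f = dd (\<ominus>\<^bsub>KK\<^esub> f \<oplus>\<^bsub>KK\<^esub> f)"
    using f by (simp add: diff_add)
  also have "\<dots> = \<zero>\<^bsub>KK\<^esub>" using f by (simp add: K.l_neg diff_zero)
  finally show ?thesis using f by (simp add: K.minus_equality diff_closed)
qed

lemma diff_diff:
  assumes f: "f \<in> carrier KK"
  shows "dd (dd f) = \<zero>\<^bsub>KK\<^esub>"
proof (rule koszul_ext)
  fix S assume S: "S \<subseteq> N"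
  note fS = finite_sub[OF S]
  define F where "F = (\<lambda>i j. if i \<in> S \<or> j \<in> S \<or> i = j then \<zero>
    else sg {j} {i} \<otimes> (sg {i} S \<otimes> (sg {j} S \<otimes> (xs ! i \<otimes> (xs ! j \<otimes> f (insert i (insert j S)))))))"
  have cl: "f (insert i (insert j S)) \<in> carrier R" if "i \<in> N" "j \<in> N" for i j
    using that S by (auto intro!: koszul_closed[OF f])
  have Fcl: "F i j \<in> carrier R" if "i \<in> N" "j \<in> N" for i j
    using that by (auto simp: F_def intro!: m_closed nth_closed cl)
  have "dd (dd f) S = (\<Oplus>i\<in>N. \<Oplus>j\<in>N. F i j)"
    unfolding diff_apply[OF diff_closed[OF f] S]
  proof (intro finsum_cong' refl)
    fix i assume i: "i \<in> N"
    show "xs ! i \<otimes> contract i (dd f) S = (\<Oplus>j\<in>N. F i j)"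
    proof (cases "i \<in> S")
      case True
      then have "(\<Oplus>j\<in>N. F i j) = \<zero>" by (simp add: F_def)
      with True show ?thesis using nth_closed[OF i] by (simp add: contract_def)
    next
      case False
      have iS: "insert i S \<subseteq> N" using i S by auto
      have cl2: "xs ! j \<otimes> contract j f (insert i S) \<in> carrier R" if "j \<in> N" for j
        using that by (intro m_closed contract_closed nth_closed f iS)
      have F: "F i j = xs ! i \<otimes> sg {i} S \<otimes> (xs ! j \<otimes> contract j f (insert i S))" if j: "j \<in> N" for j
      proof (cases "j \<in> insert i S")
        case True
        then show ?thesis using False nth_closed[OF i] nth_closed[OF j]
          by (auto simp: F_def contract_def)
      next
        case jS: False
        have s: "sg {j} (insert i S) = sg {j} {i} \<otimes> sg {j} S"
          using False fS by (intro sg_insert_right) auto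
        show ?thesis
          using jS False nth_closed[OF i] nth_closed[OF j] cl[OF i j]
          by (auto simp: F_def contract_def s insert_commute m_ac)
      qed
      have "xs ! i \<otimes> contract i (dd f) S =
          xs ! i \<otimes> sg {i} S \<otimes> (\<Oplus>j\<in>N. xs ! j \<otimes> contract j f (insert i S))"
        using False nth_closed[OF i] koszul_closed[OF diff_closed[OF f] iS]
        unfolding diff_apply[OF f iS, symmetric] by (simp add: contract_def m_assoc)
      also have "\<dots> = (\<Oplus>j\<in>N. xs ! i \<otimes> sg {i} S \<otimes> (xs ! j \<otimes> contract j f (insert i S)))"
        using cl2 nth_closed[OF i] by (intro finsum_rdistr) auto
      also have "\<dots> = (\<Oplus>j\<in>N. F i j)"
        by (intro finsum_cong' refl) (auto simp: F intro!: Fcl i)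
      finally show ?thesis .
    qed
  qed (auto intro!: finsum_closed Fcl)
  also have "\<dots> = \<zero>"
  proof (intro finsum_antisym Fcl)
    fix i j assume i: "i \<in> N" and j: "j \<in> N" and ij: "i \<noteq> j"
    have "sg {j} {i} = \<ominus> sg {i} {j}"
      using ij by (auto simp: sg_singletons)
    then show "F i j \<oplus> F j i = \<zero>"
      using nth_closed[OF i] nth_closed[OF j] cl[OF i j] ij
      by (auto simp: F_def insert_commute m_ac l_minus r_minus l_neg)
  qed (auto simp: F_def)
  finally show "dd (dd f) S = \<zero>\<^bsub>KK\<^esub> S" using S by (simp add: koszul_zero)
qed (auto intro!: diff_closed f)

text \<open>Each contraction \<open>e\<^sub>i\<^sup>* \<lrcorner>\<close> is an odd derivation of the
  exterior algebra. The subsets of \<open>insert i S\<close> are sorted by whether they contain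
  \<open>i\<close>; if \<open>i\<close> itself lies in the coordinate that is read off, the two summands on
  the right cancel in pairs.\<close>

lemma contract_mult:
  assumes f: "f \<in> carrier KK" and g: "g \<in> carrier KK" and i: "i \<in> N" and S: "S \<subseteq> N"
  shows "contract i (f \<otimes>\<^bsub>KK\<^esub> g) S =
    (\<Oplus>T\<in>Pow S. sg T (S - T) \<otimes> (contract i f T \<otimes> g (S - T))) \<oplus>
    (\<Oplus>T\<in>Pow S. sg T (S - T) \<otimes> (twist f T \<otimes> contract i g (S - T)))"
proof -
  note fS = finite_sub[OF S]
  have clN: "f T \<in> carrier R" "g T \<in> carrier R" "twist f T \<in> carrier R"
      "contract i f T \<in> carrier R" "contract i g T \<in> carrier R" if "T \<subseteq> N" for T
    using that koszul_closed f g twist_closed contract_closed i by metis+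
  have subN: "T \<subseteq> N" if "T \<subseteq> S" for T using that S by auto
  let ?A = "\<lambda>T. sg T (S - T) \<otimes> (contract i f T \<otimes> g (S - T))"
  let ?B = "\<lambda>T. sg T (S - T) \<otimes> (twist f T \<otimes> contract i g (S - T))"
  have AB: "?A T \<in> carrier R" "?B T \<in> carrier R" if "T \<subseteq> S" for T
    using that by (auto intro!: m_closed clN subN)
  have rhs: "(\<Oplus>T\<in>Pow S. ?A T) \<oplus> (\<Oplus>T\<in>Pow S. ?B T) = (\<Oplus>T\<in>Pow S. ?A T \<oplus> ?B T)"
    by (intro finsum_addf[symmetric] Pi_I AB) auto
  show ?thesis
  proof (cases "i \<in> S")
    case False
    have iS: "insert i S \<subseteq> N" using i S by auto
    let ?C = "\<lambda>T. sg T (insert i S - T) \<otimes> (f T \<otimes> g (insert i S - T))"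
    have C: "?C T \<in> carrier R" if "T \<subseteq> insert i S" for T
      using that iS by (auto intro!: m_closed clN)
    have "contract i (f \<otimes>\<^bsub>KK\<^esub> g) S = sg {i} S \<otimes> (\<Oplus>T\<in>Pow (insert i S). ?C T)"
      using False by (simp add: contract_def koszul_mult[OF iS])
    also have "(\<Oplus>T\<in>Pow (insert i S). ?C T) = (\<Oplus>T\<in>Pow S. ?C T \<oplus> ?C (insert i T))"
      by (intro finsum_Pow_insert fS False C)
    also have "sg {i} S \<otimes> \<dots> = (\<Oplus>T\<in>Pow S. sg {i} S \<otimes> (?C T \<oplus> ?C (insert i T)))"
    proof (rule finsum_rdistr)
      show "(\<lambda>T. ?C T \<oplus> ?C (insert i T)) \<in> Pow S \<rightarrow> carrier R"
        by (intro Pi_I a_closed C) auto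
    qed (use fS in auto)
    also have "\<dots> = (\<Oplus>T\<in>Pow S. ?A T \<oplus> ?B T)"
    proof (intro finsum_cong' refl Pi_I a_closed AB)
      fix T assume "T \<in> Pow S"
      then have T: "T \<subseteq> S" "i \<notin> T" using False by auto
      define U where "U = S - T"
      have U: "U \<subseteq> S" "i \<notin> U" "T \<inter> U = {}" "S = T \<union> U" using T False by (auto simp: U_def)
      have eqs: "insert i S - T = insert i U" "insert i S - insert i T = U" "S - T = U"
        using T False by (auto simp: U_def)
      have fin: "finite T" "finite U" using T U fS finite_subset by auto
      have s1: "sg {i} S = sg {i} T \<otimes> sg {i} U"
        unfolding U(4) using fin U by (intro sg_Un_right) auto
      have s2: "sg T (insert i U) = sg T {i} \<otimes> sg T U"
        using fin U by (intro sg_insert_right) auto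
      have s3: "sg (insert i T) U = sg {i} U \<otimes> sg T U"
        using fin T by (intro sg_insert_left) auto
      have s4: "sg {i} T \<otimes> sg T {i} = parity (card T)"
        using fin T by (intro sg_singleton_commute) auto
      have s4': "sg {i} T \<otimes> (sg T {i} \<otimes> c) = parity (card T) \<otimes> c" if "c \<in> carrier R" for c
        using that by (simp add: s4[symmetric] m_assoc)
      have s4'': "sg T {i} \<otimes> (sg {i} T \<otimes> c) = parity (card T) \<otimes> c" if "c \<in> carrier R" for c
        using that s4'[OF that] by (simp add: m_lcomm)
      have c: "f T \<in> carrier R" "g (insert i U) \<in> carrier R" "f (insert i T) \<in> carrier R" "g U \<in> carrier R"
        using T U subN iS by (auto intro!: clN)
      have "sg {i} S \<otimes> ?C T = ?B T"
        unfolding eqs s1 s2 using c T U subN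
        by (simp add: twist_apply contract_def m_ac s4'')
      moreover have "sg {i} S \<otimes> ?C (insert i T) = ?A T"
        unfolding eqs s1 s3 using c T U subN
        by (simp add: contract_def m_ac)
      ultimately show "sg {i} S \<otimes> (?C T \<oplus> ?C (insert i T)) = ?A T \<oplus> ?B T"
        using C[of T] C[of "insert i T"] T AB[of T] by (subst r_distr) (auto intro!: a_comm simp del: insert_subset)
    qed auto
    finally show ?thesis unfolding rhs .
  next
    case True
    define S' where "S' = S - {i}"
    have S': "S = insert i S'" "i \<notin> S'" "finite S'" using True fS by (auto simp: S'_def)
    have "(\<Oplus>T\<in>Pow S. ?A T \<oplus> ?B T) = (\<Oplus>T\<in>Pow S'. (?A T \<oplus> ?B T) \<oplus> (?A (insert i T) \<oplus> ?B (insert i T)))"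
      unfolding S'(1)
      by (rule finsum_Pow_insert[OF S'(3,2)]) (auto simp: S'(1)[symmetric] intro!: a_closed AB)
    also have "\<dots> = (\<Oplus>T\<in>Pow S'. \<zero>)"
    proof (intro finsum_cong' refl Pi_I zero_closed)
      fix T assume "T \<in> Pow S'"
      then have T: "T \<subseteq> S'" "i \<notin> T" using S' by auto
      define U where "U = S' - T"
      have U: "U \<subseteq> S'" "i \<notin> U" using T S' by (auto simp: U_def)
      have eqs: "S - T = insert i U" "S - insert i T = U"
        using T S' by (auto simp: U_def)
      have fin: "finite T" "finite U" using T U S' finite_subset by auto
      have s2: "sg T (insert i U) = sg T {i} \<otimes> sg T U"
        using fin U by (intro sg_insert_right) auto
      have s3: "sg (insert i T) U = sg {i} U \<otimes> sg T U"
        using fin T by (intro sg_insert_left) auto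
      have s4: "sg {i} T \<otimes> sg T {i} = parity (card T)"
        using fin T by (intro sg_singleton_commute) auto
      have s4': "sg {i} T \<otimes> (sg T {i} \<otimes> c) = parity (card T) \<otimes> c" if "c \<in> carrier R" for c
        using that by (simp add: s4[symmetric] m_assoc)
      have s5: "sg T {i} \<otimes> sg {i} T = parity (card T)"
        using s4 by (simp add: m_comm)
      have TU: "insert i T \<subseteq> N" "insert i U \<subseteq> N" "T \<subseteq> N" "U \<subseteq> N"
        using T U S' S by auto
      have c: "f (insert i T) \<in> carrier R" "g (insert i U) \<in> carrier R"
        "twist f T \<in> carrier R" "g U \<in> carrier R"
        using TU by (auto intro!: clN)
      have "?B T = \<zero>" unfolding eqs using c by (simp add: contract_def)
      moreover have "?A (insert i T) = \<zero>" unfolding eqs using c by (simp add: contract_def)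
      moreover have "?A T = sg T U \<otimes> (parity (card T) \<otimes> (f (insert i T) \<otimes> g (insert i U)))"
        unfolding eqs s2 using c T by (simp add: contract_def m_ac s4 s4' s5)
      moreover have "?B (insert i T) = sg T U \<otimes> (parity (Suc (card T)) \<otimes> (f (insert i T) \<otimes> g (insert i U)))"
        unfolding eqs s3 using c T U TU fin by (simp add: twist_apply contract_def m_ac)
      ultimately show "(?A T \<oplus> ?B T) \<oplus> (?A (insert i T) \<oplus> ?B (insert i T)) = \<zero>"
        using c by (simp add: parity_Suc l_minus r_minus r_neg)
    qed
    also have "\<dots> = \<zero>" by simp
    finally show ?thesis unfolding rhs using True by (simp add: contract_def)
  qed
qed

text \<open>Summing the derivation property of the contractions with the coefficients
  \<open>x\<^sub>i\<close>.\<close>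

lemma leibniz:
  assumes f: "f \<in> carrier KK" and g: "g \<in> carrier KK"
  shows "dd (f \<otimes>\<^bsub>KK\<^esub> g) = dd f \<otimes>\<^bsub>KK\<^esub> g \<oplus>\<^bsub>KK\<^esub> twist f \<otimes>\<^bsub>KK\<^esub> dd g"
proof (rule koszul_ext)
  fix S assume S: "S \<subseteq> N"
  note fS = finite_sub[OF S]
  have clN: "f T \<in> carrier R" "g T \<in> carrier R" "twist f T \<in> carrier R" if "T \<subseteq> N" for T
    using that koszul_closed f g twist_closed by metis+
  have clC: "contract i f T \<in> carrier R" "contract i g T \<in> carrier R" if "T \<subseteq> N" "i \<in> N" for T i
    using that f g contract_closed by metis+
  have subN: "T \<subseteq> N" if "T \<subseteq> S" for T using that S by auto
  let ?A = "\<lambda>i T. sg T (S - T) \<otimes> (contract i f T \<otimes> g (S - T))"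
  let ?B = "\<lambda>i T. sg T (S - T) \<otimes> (twist f T \<otimes> contract i g (S - T))"
  have AB: "?A i T \<in> carrier R" "?B i T \<in> carrier R" if "T \<subseteq> S" "i \<in> N" for T i
    using that by (auto intro!: m_closed clN clC subN)
  have 1: "(\<Oplus>i\<in>N. xs ! i \<otimes> (\<Oplus>T\<in>Pow S. ?A i T)) = (dd f \<otimes>\<^bsub>KK\<^esub> g) S"
  proof -
    have "(\<Oplus>i\<in>N. xs ! i \<otimes> (\<Oplus>T\<in>Pow S. ?A i T)) = (\<Oplus>i\<in>N. \<Oplus>T\<in>Pow S. xs ! i \<otimes> ?A i T)"
      using fS by (intro finsum_cong' refl finsum_rdistr)
        (auto intro!: finsum_closed Pi_I m_closed nth_closed AB clN clC subN)
    also have "\<dots> = (\<Oplus>T\<in>Pow S. \<Oplus>i\<in>N. xs ! i \<otimes> ?A i T)"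
      using fS by (intro finsum_sum_swap) (auto intro!: m_closed nth_closed AB clN clC subN)
    also have "\<dots> = (\<Oplus>T\<in>Pow S. sg T (S - T) \<otimes> (dd f T \<otimes> g (S - T)))"
    proof (intro finsum_cong' refl)
      fix T assume "T \<in> Pow S"
      then have T: "T \<subseteq> N" "S - T \<subseteq> N" using S by auto
      let ?c = "sg T (S - T) \<otimes> g (S - T)"
      have "(\<Oplus>i\<in>N. xs ! i \<otimes> ?A i T) = (\<Oplus>i\<in>N. (xs ! i \<otimes> contract i f T) \<otimes> ?c)"
        using T by (intro finsum_cong' refl) (auto simp: m_ac nth_closed clN clC intro!: m_closed nth_closed clN clC)
      also have "\<dots> = dd f T \<otimes> ?c"
        unfolding diff_apply[OF f T(1)] using T
        by (intro finsum_ldistr[symmetric]) (auto intro!: m_closed nth_closed clN clC)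
      also have "\<dots> = sg T (S - T) \<otimes> (dd f T \<otimes> g (S - T))"
        using T clN[of "S - T"] koszul_closed[OF diff_closed[OF f], of T] by (simp add: m_ac)
      finally show "(\<Oplus>i\<in>N. xs ! i \<otimes> ?A i T) = sg T (S - T) \<otimes> (dd f T \<otimes> g (S - T))" .
    qed (use koszul_closed[OF diff_closed[OF f]] in \<open>auto intro!: m_closed clN subN\<close>)
    finally show ?thesis by (simp add: koszul_mult[OF S])
  qed
  have 2: "(\<Oplus>i\<in>N. xs ! i \<otimes> (\<Oplus>T\<in>Pow S. ?B i T)) = (twist f \<otimes>\<^bsub>KK\<^esub> dd g) S"
  proof -
    have "(\<Oplus>i\<in>N. xs ! i \<otimes> (\<Oplus>T\<in>Pow S. ?B i T)) = (\<Oplus>i\<in>N. \<Oplus>T\<in>Pow S. xs ! i \<otimes> ?B i T)"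
      using fS by (intro finsum_cong' refl finsum_rdistr)
        (auto intro!: finsum_closed Pi_I m_closed nth_closed AB clN clC subN)
    also have "\<dots> = (\<Oplus>T\<in>Pow S. \<Oplus>i\<in>N. xs ! i \<otimes> ?B i T)"
      using fS by (intro finsum_sum_swap) (auto intro!: m_closed nth_closed AB clN clC subN)
    also have "\<dots> = (\<Oplus>T\<in>Pow S. sg T (S - T) \<otimes> (twist f T \<otimes> dd g (S - T)))"
    proof (intro finsum_cong' refl)
      fix T assume "T \<in> Pow S"
      then have T: "T \<subseteq> N" "S - T \<subseteq> N" using S by auto
      let ?c = "sg T (S - T) \<otimes> twist f T"
      have "(\<Oplus>i\<in>N. xs ! i \<otimes> ?B i T) = (\<Oplus>i\<in>N. ?c \<otimes> (xs ! i \<otimes> contract i g (S - T)))"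
        using T by (intro finsum_cong' refl) (auto simp: m_ac nth_closed clN clC intro!: m_closed nth_closed clN clC)
      also have "\<dots> = ?c \<otimes> dd g (S - T)"
        unfolding diff_apply[OF g T(2)] using T
        by (intro finsum_rdistr[symmetric]) (auto intro!: m_closed nth_closed clN clC)
      also have "\<dots> = sg T (S - T) \<otimes> (twist f T \<otimes> dd g (S - T))"
        using T clN[of T] koszul_closed[OF diff_closed[OF g], of "S - T"] by (simp add: m_ac)
      finally show "(\<Oplus>i\<in>N. xs ! i \<otimes> ?B i T) = sg T (S - T) \<otimes> (twist f T \<otimes> dd g (S - T))" .
    qed (use koszul_closed[OF diff_closed[OF g]] S in \<open>auto intro!: m_closed clN subN\<close>)
    finally show ?thesis by (simp add: koszul_mult[OF S])
  qed
  have "dd (f \<otimes>\<^bsub>KK\<^esub> g) S =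
      (\<Oplus>i\<in>N. xs ! i \<otimes> (\<Oplus>T\<in>Pow S. ?A i T) \<oplus> xs ! i \<otimes> (\<Oplus>T\<in>Pow S. ?B i T))"
    unfolding diff_apply[OF koszul_mult_closed[OF f g] S]
  proof (intro finsum_cong' refl Pi_I a_closed m_closed nth_closed finsum_closed)
    fix i assume i: "i \<in> N"
    have "(\<Oplus>T\<in>Pow S. ?A i T) \<in> carrier R" "(\<Oplus>T\<in>Pow S. ?B i T) \<in> carrier R"
      by (intro finsum_closed Pi_I AB i; simp)+
    then show "xs ! i \<otimes> contract i (f \<otimes>\<^bsub>KK\<^esub> g) S =
        xs ! i \<otimes> (\<Oplus>T\<in>Pow S. ?A i T) \<oplus> xs ! i \<otimes> (\<Oplus>T\<in>Pow S. ?B i T)"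
      unfolding contract_mult[OF f g i S] using nth_closed[OF i] by (simp add: r_distr)
  qed (use S in \<open>auto intro!: clN clC subN\<close>)
  also have "\<dots> = (\<Oplus>i\<in>N. xs ! i \<otimes> (\<Oplus>T\<in>Pow S. ?A i T)) \<oplus> (\<Oplus>i\<in>N. xs ! i \<otimes> (\<Oplus>T\<in>Pow S. ?B i T))"
    by (intro finsum_addf Pi_I m_closed nth_closed finsum_closed) (use S in \<open>auto intro!: clN clC subN\<close>)
  finally show "dd (f \<otimes>\<^bsub>KK\<^esub> g) S = (dd f \<otimes>\<^bsub>KK\<^esub> g \<oplus>\<^bsub>KK\<^esub> twist f \<otimes>\<^bsub>KK\<^esub> dd g) S"
    unfolding 1 2 using S by (simp add: koszul_add)
qed (auto intro!: f g diff_closed koszul_mult_closed koszul_add_closed twist_closed)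

end

section \<open>Grading and homology of the Koszul complex\<close>

context koszul_complex
begin

abbreviation deg where "deg \<equiv> koszul_deg R xs"
abbreviation ZZ where "ZZ \<equiv> koszul_cycles R xs"
abbreviation BB where "BB \<equiv> koszul_boundaries R xs"

text \<open>The homogeneous component of degree \<open>j\<close>.\<close>

definition comp :: "nat \<Rightarrow> (nat set \<Rightarrow> 'a) \<Rightarrow> nat set \<Rightarrow> 'a" where
  "comp j f = (\<lambda>S\<in>Pow N. if card S = j then f S else \<zero>)"

lemma degI: "f \<in> carrier KK \<Longrightarrow> (\<And>S. S \<subseteq> N \<Longrightarrow> card S \<noteq> j \<Longrightarrow> f S = \<zero>) \<Longrightarrow> f \<in> deg j"
  by (simp add: koszul_deg_def)

lemma deg_closed: "f \<in> deg j \<Longrightarrow> f \<in> carrier KK"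
  by (simp add: koszul_deg_def)

lemma deg_zero: "f \<in> deg j \<Longrightarrow> S \<subseteq> N \<Longrightarrow> card S \<noteq> j \<Longrightarrow> f S = \<zero>"
  by (simp add: koszul_deg_def)

lemma zero_deg: "\<zero>\<^bsub>KK\<^esub> \<in> deg j"
  by (rule degI) (auto simp: koszul_zero)

lemma add_deg: "f \<in> deg j \<Longrightarrow> g \<in> deg j \<Longrightarrow> f \<oplus>\<^bsub>KK\<^esub> g \<in> deg j"
  by (rule degI) (auto simp: koszul_add deg_closed deg_zero)

lemma minus_deg: "f \<in> deg j \<Longrightarrow> \<ominus>\<^bsub>KK\<^esub> f \<in> deg j"
  by (rule degI) (auto simp: koszul_a_inv deg_closed deg_zero)

lemma mult_deg:
  assumes f: "f \<in> deg i" and g: "g \<in> deg j"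
  shows "f \<otimes>\<^bsub>KK\<^esub> g \<in> deg (i + j)"
proof (rule degI)
  fix S assume S: "S \<subseteq> N" "card S \<noteq> i + j"
  show "(f \<otimes>\<^bsub>KK\<^esub> g) S = \<zero>"
    unfolding koszul_mult[OF S(1)]
  proof (rule add.finprod_one_eqI)
    fix T assume "T \<in> Pow S"
    then have T: "T \<subseteq> N" "S - T \<subseteq> N" "card T + card (S - T) = card S"
      using S finite_sub[OF S(1)] card_mono[OF finite_sub[OF S(1)], of T]
      by (auto simp: card_Diff_subset finite_subset)
    have cl: "f T \<in> carrier R" "g (S - T) \<in> carrier R"
      using T koszul_closed deg_closed f g by blast+
    consider "card T \<noteq> i" | "card (S - T) \<noteq> j" using T S by force
    then show "sg T (S - T) \<otimes> (f T \<otimes> g (S - T)) = \<zero>"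
      by cases (use cl deg_zero[OF f T(1)] deg_zero[OF g T(2)] in simp_all)
  qed
qed (use f g deg_closed koszul_mult_closed in blast)

lemma comp_apply: "S \<subseteq> N \<Longrightarrow> comp j f S = (if card S = j then f S else \<zero>)"
  by (simp add: comp_def)

lemma comp_closed: "f \<in> carrier KK \<Longrightarrow> comp j f \<in> carrier KK"
  by (auto simp: comp_def koszul_carrier)

lemma comp_deg: "f \<in> carrier KK \<Longrightarrow> comp j f \<in> deg j"
  by (rule degI) (auto simp: comp_apply comp_closed)

lemma comp_deg_same: "f \<in> deg j \<Longrightarrow> comp j f = f"
  by (rule koszul_ext) (auto simp: comp_apply deg_closed comp_closed deg_zero)

lemma comp_deg_other: "f \<in> deg i \<Longrightarrow> i \<noteq> j \<Longrightarrow> comp j f = \<zero>\<^bsub>KK\<^esub>"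
  by (rule koszul_ext) (auto simp: comp_apply deg_closed comp_closed deg_zero koszul_zero)

lemma comp_add:
  "f \<in> carrier KK \<Longrightarrow> g \<in> carrier KK \<Longrightarrow> comp j (f \<oplus>\<^bsub>KK\<^esub> g) = comp j f \<oplus>\<^bsub>KK\<^esub> comp j g"
  by (rule koszul_ext) (auto simp: comp_apply comp_closed koszul_add)

lemma sum_comp:
  assumes f: "f \<in> carrier KK"
  shows "(\<Oplus>\<^bsub>KK\<^esub>j\<in>{..length xs}. comp j f) = f"
proof (rule koszul_ext)
  fix S assume S: "S \<subseteq> N"
  have "card S \<le> length xs" using card_mono[OF _ S] by simp
  then show "(\<Oplus>\<^bsub>KK\<^esub>j\<in>{..length xs}. comp j f) S = f S"
    using S f by (subst koszul_finsum, simp, auto intro: comp_closed,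
      subst finsum_single[where a = "card S"]) (auto simp: comp_apply koszul_closed)
qed (auto intro!: K.finsum_closed comp_closed f)

lemma contract_comp:
  assumes "S \<subseteq> N" "i \<in> N"
  shows "contract i (comp (Suc j) f) S = (if card S = j then contract i f S else \<zero>)"
  using assms finite_sub[OF assms(1)] by (auto simp: contract_def comp_apply)

lemma diff_comp:
  assumes f: "f \<in> carrier KK"
  shows "dd (comp (Suc j) f) = comp j (dd f)"
proof (rule koszul_ext)
  fix S assume S: "S \<subseteq> N"
  show "dd (comp (Suc j) f) S = comp j (dd f) S"
  proof (cases "card S = j")
    case True
    then show ?thesis
      using S f by (simp add: diff_apply comp_closed comp_apply contract_comp cong: add.finprod_cong)
        (intro finsum_cong' refl, auto simp: contract_comp intro!: m_closed contract_closed nth_closed)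
  next
    case False
    have "dd (comp (Suc j) f) S = (\<Oplus>i\<in>N. \<zero>)"
      unfolding diff_apply[OF comp_closed[OF f] S]
      by (intro finsum_cong' refl) (use False S nth_closed in \<open>auto simp: contract_comp\<close>)
    then show ?thesis using False S by (simp add: comp_apply)
  qed
qed (auto intro!: diff_closed comp_closed f)

lemma diff_deg_0: "f \<in> deg 0 \<Longrightarrow> dd f = \<zero>\<^bsub>KK\<^esub>"
proof (rule koszul_ext)
  fix S assume f: "f \<in> deg 0" and S: "S \<subseteq> N"
  have "contract i f S = \<zero>" if "i \<in> N" for i
    using deg_zero[OF f, of "insert i S"] that S finite_sub[OF S] by (auto simp: contract_def card_insert_if)
  then have "dd f S = (\<Oplus>i\<in>N. \<zero>)"
    unfolding diff_apply[OF deg_closed[OF f] S] by (intro finsum_cong' refl) (auto simp: nth_closed)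
  then show "dd f S = \<zero>\<^bsub>KK\<^esub> S" using S by (simp add: koszul_zero)
qed (auto intro: diff_closed deg_closed)

lemma twist_deg: "f \<in> deg j \<Longrightarrow> twist f = (if even j then f else \<ominus>\<^bsub>KK\<^esub> f)"
proof (rule koszul_ext)
  fix S assume f: "f \<in> deg j" and S: "S \<subseteq> N"
  have c: "f S \<in> carrier R" "f \<in> carrier KK" using f S deg_closed koszul_closed by auto
  show "twist f S = (if even j then f else \<ominus>\<^bsub>KK\<^esub> f) S"
    using c S deg_zero[OF f S] by (cases "card S = j") (auto simp: twist_apply parity_cases koszul_a_inv l_minus)
qed (auto intro: twist_closed deg_closed)

lemma one_deg: "\<one>\<^bsub>KK\<^esub> \<in> deg 0"
  by (rule degI) (auto simp: koszul_one)

lemma cycles_closed: "f \<in> ZZ \<Longrightarrow> f \<in> carrier KK"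
  by (simp add: koszul_cycles_def)

lemma cycles_diff: "f \<in> ZZ \<Longrightarrow> dd f = \<zero>\<^bsub>KK\<^esub>"
  by (simp add: koszul_cycles_def)

lemma cyclesI: "f \<in> carrier KK \<Longrightarrow> dd f = \<zero>\<^bsub>KK\<^esub> \<Longrightarrow> f \<in> ZZ"
  by (simp add: koszul_cycles_def)

lemma deg_0_cycles: "f \<in> deg 0 \<Longrightarrow> f \<in> ZZ"
  by (intro cyclesI deg_closed diff_deg_0)

lemma diff_twist:
  assumes f: "f \<in> carrier KK" shows "dd (twist f) = \<ominus>\<^bsub>KK\<^esub> twist (dd f)"
proof (rule koszul_ext)
  fix S assume S: "S \<subseteq> N"
  have "contract i (twist f) S = \<ominus> parity (card S) \<otimes> contract i f S" if "i \<in> N" for i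
  proof -
    have "f (insert i S) \<in> carrier R" "insert i S \<subseteq> N" using that S by (auto intro!: koszul_closed[OF f])
    then show ?thesis using finite_sub[OF S]
      by (auto simp: contract_def twist_apply parity_Suc l_minus r_minus m_ac)
  qed
  then have "dd (twist f) S = (\<Oplus>i\<in>N. (\<ominus> parity (card S)) \<otimes> (xs ! i \<otimes> contract i f S))"
    unfolding diff_apply[OF twist_closed[OF f] S]
    by (intro finsum_cong' refl)
      (auto simp: m_ac l_minus r_minus nth_closed contract_closed[OF f _ S] intro!: m_closed nth_closed contract_closed[OF f _ S])
  also have "\<dots> = (\<ominus> parity (card S)) \<otimes> dd f S"
    unfolding diff_apply[OF f S]
    by (intro finsum_rdistr[symmetric]) (auto intro!: m_closed nth_closed contract_closed[OF f _ S])
  finally show "dd (twist f) S = (\<ominus>\<^bsub>KK\<^esub> twist (dd f)) S"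
    using S koszul_closed[OF diff_closed[OF f] S] twist_closed[OF diff_closed[OF f]]
    by (simp add: koszul_a_inv twist_apply l_minus)
qed (use f in \<open>auto intro!: diff_closed twist_closed\<close>)

lemma twist_zero: "twist \<zero>\<^bsub>KK\<^esub> = \<zero>\<^bsub>KK\<^esub>"
  using twist_deg[OF zero_deg[of 0]] by simp

lemma cycles_mult: "f \<in> ZZ \<Longrightarrow> g \<in> ZZ \<Longrightarrow> f \<otimes>\<^bsub>KK\<^esub> g \<in> ZZ"
  by (intro cyclesI) (auto simp: leibniz cycles_closed cycles_diff twist_closed)

lemma cycles_subring: "subring ZZ KK"
proof (rule K.subringI)
  fix f g assume "f \<in> ZZ" "g \<in> ZZ"
  then show "f \<oplus>\<^bsub>KK\<^esub> g \<in> ZZ"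
    by (intro cyclesI) (auto simp: diff_add cycles_closed cycles_diff)
next
  fix f assume "f \<in> ZZ"
  then show "\<ominus>\<^bsub>KK\<^esub> f \<in> ZZ"
    by (intro cyclesI) (auto simp: diff_minus cycles_closed cycles_diff)
qed (auto intro: cycles_mult deg_0_cycles one_deg cycles_closed)

text \<open>The ring of cycles, of which the homology is the quotient by the ideal of boundaries.\<close>

definition ZR :: "(nat set \<Rightarrow> 'a) ring" where "ZR = KK\<lparr>carrier := ZZ\<rparr>"

lemma ZR_ring: "ring ZR"
  unfolding ZR_def by (rule K.subring_is_ring[OF cycles_subring])

sublocale ZR: ring ZR by (rule ZR_ring)

lemma ZR_simps [simp]: "carrier ZR = ZZ" "a \<otimes>\<^bsub>ZR\<^esub> b = a \<otimes>\<^bsub>KK\<^esub> b" "a \<oplus>\<^bsub>ZR\<^esub> b = a \<oplus>\<^bsub>KK\<^esub> b"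
  "\<one>\<^bsub>ZR\<^esub> = \<one>\<^bsub>KK\<^esub>" "\<zero>\<^bsub>ZR\<^esub> = \<zero>\<^bsub>KK\<^esub>"
  by (simp_all add: ZR_def)

lemma boundariesI: "f \<in> carrier KK \<Longrightarrow> dd f \<in> BB"
  by (simp add: koszul_boundaries_def)

lemma boundaries_cycles: "f \<in> BB \<Longrightarrow> f \<in> ZZ"
  by (auto simp: koszul_boundaries_def diff_diff diff_closed intro!: cyclesI)

lemma ZR_minus: "f \<in> ZZ \<Longrightarrow> \<ominus>\<^bsub>ZR\<^esub> f = \<ominus>\<^bsub>KK\<^esub> f"
  by (rule ZR.minus_equality) (use cycles_subring in \<open>auto simp: cycles_closed K.l_neg dest: subringE(5)\<close>)

text \<open>By the Leibniz rule, \<open>z\<close> times \<open>\<partial>f\<close> is the boundary of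
  \<open>z\<close> times \<open>f\<close> up to the sign involution if \<open>z\<close> is a cycle.\<close>

lemma boundaries_ideal: "ideal BB ZR"
proof (rule idealI[OF ZR_ring])
  show "subgroup BB (add_monoid ZR)"
  proof (rule group.subgroupI)
    show "group (add_monoid ZR)" by (rule ZR.a_group)
    show "BB \<noteq> {}" using boundariesI[of "\<zero>\<^bsub>KK\<^esub>"] by auto
    fix f assume f: "f \<in> BB"
    then obtain h where h: "h \<in> carrier KK" "f = dd h" by (auto simp: koszul_boundaries_def)
    have "inv\<^bsub>add_monoid ZR\<^esub> f = \<ominus>\<^bsub>KK\<^esub> f"
      using ZR_minus[OF boundaries_cycles[OF f]] by (simp add: a_inv_def)
    also have "\<dots> = dd (\<ominus>\<^bsub>KK\<^esub> h)" using h by (simp add: diff_minus)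
    finally show "inv\<^bsub>add_monoid ZR\<^esub> f \<in> BB" using h by (auto intro!: boundariesI)
    fix g assume "g \<in> BB"
    then obtain k where k: "k \<in> carrier KK" "g = dd k" by (auto simp: koszul_boundaries_def)
    show "f \<otimes>\<^bsub>add_monoid ZR\<^esub> g \<in> BB"
      using h k boundariesI[of "h \<oplus>\<^bsub>KK\<^esub> k"] by (simp add: diff_add)
  qed (auto intro: boundaries_cycles)
  fix f g assume f: "f \<in> BB" and g: "g \<in> carrier ZR"
  obtain h where h: "h \<in> carrier KK" "f = dd h" using f by (auto simp: koszul_boundaries_def)
  have g': "g \<in> carrier KK" "dd g = \<zero>\<^bsub>KK\<^esub>" using g by (auto simp: cycles_closed cycles_diff)
  have "f \<otimes>\<^bsub>ZR\<^esub> g = dd (h \<otimes>\<^bsub>KK\<^esub> g)"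
    using h g' by (simp add: leibniz twist_closed diff_closed)
  then show "f \<otimes>\<^bsub>ZR\<^esub> g \<in> BB" using h g' by (auto intro!: boundariesI koszul_mult_closed)
  have "dd (twist g) = \<zero>\<^bsub>KK\<^esub>" using g' by (simp add: diff_twist twist_zero)
  then have "g \<otimes>\<^bsub>ZR\<^esub> f = dd (twist g \<otimes>\<^bsub>KK\<^esub> h)"
    using h g' by (simp add: leibniz twist_closed diff_closed twist_twist)
  then show "g \<otimes>\<^bsub>ZR\<^esub> f \<in> BB" using h g' by (auto intro!: boundariesI koszul_mult_closed twist_closed)
qed

abbreviation AA where "AA \<equiv> koszul_homology R xs"
abbreviation hc where "hc \<equiv> hclass R xs"

lemma homology_eq: "AA = ZR Quot BB"
  by (simp add: koszul_homology_def ZR_def)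

lemma hclass_eq: "hc = (+>\<^bsub>ZR\<^esub>) BB"
  by (auto simp: hclass_def ZR_def a_r_coset_def r_coset_def fun_eq_iff)

lemma homology_ring: "ring AA"
  unfolding homology_eq by (rule ideal.quotient_is_ring[OF boundaries_ideal])

sublocale A: ring AA by (rule homology_ring)

lemma hclass_ring_hom: "hc \<in> Ring.ring_hom ZR AA"
  unfolding homology_eq hclass_eq by (rule ideal.rcos_ring_hom[OF boundaries_ideal])

lemma hclass_closed [simp]: "f \<in> ZZ \<Longrightarrow> hc f \<in> carrier AA"
  using ring_hom_closed[OF hclass_ring_hom] by simp

lemma hclass_add: "f \<in> ZZ \<Longrightarrow> g \<in> ZZ \<Longrightarrow> hc (f \<oplus>\<^bsub>KK\<^esub> g) = hc f \<oplus>\<^bsub>AA\<^esub> hc g"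
  using ring_hom_add[OF hclass_ring_hom] by simp

lemma hclass_mult: "f \<in> ZZ \<Longrightarrow> g \<in> ZZ \<Longrightarrow> hc (f \<otimes>\<^bsub>KK\<^esub> g) = hc f \<otimes>\<^bsub>AA\<^esub> hc g"
  using ring_hom_mult[OF hclass_ring_hom] by simp

lemma hclass_one: "hc \<one>\<^bsub>KK\<^esub> = \<one>\<^bsub>AA\<^esub>"
  using ring_hom_one[OF hclass_ring_hom] by simp

lemma zero_cycle: "\<zero>\<^bsub>KK\<^esub> \<in> ZZ"
  by (intro cyclesI) (auto simp: diff_zero)

lemma add_cycle: "f \<in> ZZ \<Longrightarrow> g \<in> ZZ \<Longrightarrow> f \<oplus>\<^bsub>KK\<^esub> g \<in> ZZ"
  using subringE(7)[OF cycles_subring] by blast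

lemma minus_cycle: "f \<in> ZZ \<Longrightarrow> \<ominus>\<^bsub>KK\<^esub> f \<in> ZZ"
  using subringE(5)[OF cycles_subring] by blast

lemma homology_carrier: "carrier AA = hc ` ZZ"
  unfolding homology_eq hclass_eq by (auto simp: FactRing_def A_RCOSETS_def' a_r_coset_def r_coset_def)

lemma homology_zero: "\<zero>\<^bsub>AA\<^esub> = BB"
  by (simp add: homology_eq FactRing_def)

lemma hclass_zero: "hc \<zero>\<^bsub>KK\<^esub> = \<zero>\<^bsub>AA\<^esub>"
proof -
  have "hc \<zero>\<^bsub>KK\<^esub> \<oplus>\<^bsub>AA\<^esub> hc \<zero>\<^bsub>KK\<^esub> = hc \<zero>\<^bsub>KK\<^esub>"
    using hclass_add[OF zero_cycle zero_cycle] by simp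
  then show ?thesis using hclass_closed[OF zero_cycle] by (metis A.add.r_cancel_one A.r_zero)
qed

lemma hclass_minus: "f \<in> ZZ \<Longrightarrow> hc (\<ominus>\<^bsub>KK\<^esub> f) = \<ominus>\<^bsub>AA\<^esub> hc f"
proof -
  assume f: "f \<in> ZZ"
  have "hc (\<ominus>\<^bsub>KK\<^esub> f) \<oplus>\<^bsub>AA\<^esub> hc f = \<zero>\<^bsub>AA\<^esub>"
    using hclass_add[OF minus_cycle[OF f] f, symmetric] cycles_closed[OF f] by (simp add: K.l_neg hclass_zero)
  then show ?thesis using f minus_cycle[OF f] by (simp add: A.minus_equality)
qed

lemma zero_boundary: "\<zero>\<^bsub>KK\<^esub> \<in> BB"
  using boundariesI[OF K.zero_closed] by (simp add: diff_zero)

lemma hclass_memI: "b \<in> BB \<Longrightarrow> b \<oplus>\<^bsub>KK\<^esub> f \<in> hc f"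
  by (auto simp: hclass_def a_r_coset_def r_coset_def)

lemma hclass_self: "f \<in> ZZ \<Longrightarrow> f \<in> hc f"
  using hclass_memI[OF zero_boundary, of f] cycles_closed[of f] by simp

lemma hclass_eq_zero: "f \<in> ZZ \<Longrightarrow> hc f = \<zero>\<^bsub>AA\<^esub> \<longleftrightarrow> f \<in> BB"
proof
  assume "f \<in> ZZ" "hc f = \<zero>\<^bsub>AA\<^esub>"
  then show "f \<in> BB" using hclass_self[of f] by (simp only: homology_zero)
next
  assume "f \<in> BB"
  have "abelian_subgroup BB ZR"
    by (rule abelian_subgroupI3[OF ideal.axioms(1)[OF boundaries_ideal] ZR.abelian_group_axioms])
  from abelian_subgroup.a_rcos_const[OF this \<open>f \<in> BB\<close>] show "hc f = \<zero>\<^bsub>AA\<^esub>"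
    by (simp only: homology_zero hclass_eq)
qed

lemma hclass_mem: "f \<in> ZZ \<Longrightarrow> g \<in> hc f \<Longrightarrow> g \<in> ZZ \<and> hc g = hc f"
proof -
  assume f: "f \<in> ZZ" and "g \<in> hc f"
  then obtain b where b: "b \<in> BB" "g = b \<oplus>\<^bsub>KK\<^esub> f"
    by (auto simp: hclass_def a_r_coset_def r_coset_def)
  note bz = boundaries_cycles[OF b(1)]
  have "hc g = hc f" using b f bz by (simp add: hclass_add hclass_eq_zero[THEN iffD2, OF bz])
  then show ?thesis using b bz f add_cycle by auto
qed

lemma hclass_finsum:
  assumes "finite I" "f \<in> I \<rightarrow> ZZ"
  shows "(\<Oplus>\<^bsub>KK\<^esub>i\<in>I. f i) \<in> ZZ \<and> hc (\<Oplus>\<^bsub>KK\<^esub>i\<in>I. f i) = (\<Oplus>\<^bsub>AA\<^esub>i\<in>I. hc (f i))"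
  using assms
proof (induction I)
  case (insert i I)
  have f: "f \<in> I \<rightarrow> carrier KK" "f i \<in> carrier KK" "(\<lambda>i. hc (f i)) \<in> I \<rightarrow> carrier AA" "f i \<in> ZZ"
    using insert.prems by (auto intro!: cycles_closed hclass_closed)
  have IH: "(\<Oplus>\<^bsub>KK\<^esub>i\<in>I. f i) \<in> ZZ" "hc (\<Oplus>\<^bsub>KK\<^esub>i\<in>I. f i) = (\<Oplus>\<^bsub>AA\<^esub>i\<in>I. hc (f i))"
    using insert.IH insert.prems by auto
  show ?case
    unfolding K.finsum_insert[OF insert.hyps f(1,2)]
      A.finsum_insert[OF insert.hyps f(3) hclass_closed[OF f(4)]]
    using IH f(4) by (simp add: add_cycle hclass_add)
qed (simp add: zero_cycle hclass_zero)

end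

section \<open>Words in three letters\<close>

text \<open>The product of a monomial, written as a word, with a variable.\<close>

definition act :: "nat \<Rightarrow> nat list \<Rightarrow> nat list" where
  "act u w = sort (w @ [u])"

definition W :: "nat \<Rightarrow> nat list set" where
  "W k = {w. length w = k \<and> sorted w \<and> set w \<subseteq> {1, 2, 3}}"

lemma mset_act [simp]: "mset (act u w) = add_mset u (mset w)"
  by (simp add: act_def)

lemma sorted_act [simp]: "sorted (act u w)"
  by (simp add: act_def)

lemma set_act [simp]: "set (act u w) = insert u (set w)"
  by (simp add: act_def)

lemma act_neq_Nil [simp]: "act u w \<noteq> []"
  using set_act[of u w] by (metis empty_set insert_not_empty)

lemma act_W: "w \<in> W k \<Longrightarrow> u \<in> {1, 2, 3} \<Longrightarrow> act u w \<in> W (Suc k)"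
  by (auto simp: W_def act_def)

lemma sorted_mset_eq: "sorted v \<Longrightarrow> sorted w \<Longrightarrow> mset v = mset w \<longleftrightarrow> v = w"
  by (metis properties_for_sort)

lemma act_commute: "act u (act t w) = act t (act u w)"
  by (subst sorted_mset_eq[symmetric]) auto

lemma act_inj_left:
  assumes "act u w = act t w" shows "u = t"
proof -
  have "add_mset u (mset w) = add_mset t (mset w)"
    using arg_cong[OF assms, of mset] unfolding mset_act .
  from arg_cong[OF this, of "\<lambda>M. count M u"] show ?thesis by (simp split: if_splits)
qed

lemma act_inj_right: "v \<in> W k \<Longrightarrow> w \<in> W k \<Longrightarrow> act u v = act u w \<Longrightarrow> v = w"
  by (metis (mono_tags, lifting) mset_act add_mset_add_mset_same_iff W_def mem_Collect_eq sorted_mset_eq)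

lemma remove_W:
  assumes "w \<in> W k" "u \<in> set w"
  obtains k' where "k = Suc k'" "remove1 u w \<in> W k'" "act u (remove1 u w) = w"
proof -
  have "sorted (remove1 u w)" "mset (remove1 u w) = mset w - {#u#}"
    using assms by (auto simp: W_def sorted_remove1)
  moreover from this have "act u (remove1 u w) = w"
    using assms by (subst sorted_mset_eq[symmetric]) (auto simp: W_def)
  moreover have "length w > 0" using assms by auto
  ultimately show ?thesis
    using assms set_remove1_subset[of u w]
    by (intro that[of "k - 1"]) (auto simp: W_def length_remove1)
qed

lemma remove_act: "w \<in> W k \<Longrightarrow> remove1 u (act u w) = w"
  by (subst sorted_mset_eq[symmetric]) (auto simp: W_def sorted_remove1)

lemma remove_act_other:
  "w \<in> W k \<Longrightarrow> t \<in> set w \<Longrightarrow> u \<noteq> t \<Longrightarrow> remove1 t (act u w) = act u (remove1 t w)"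
  by (subst sorted_mset_eq[symmetric]) (auto simp: W_def sorted_remove1)

lemma W_Suc_cases:
  assumes "s \<in> W (Suc k)"
  obtains u w where "u \<in> {1, 2, 3}" "w \<in> W k" "s = act u w"
proof -
  obtain u where "u \<in> set s" using assms by (cases s) (auto simp: W_def)
  then show ?thesis using remove_W[OF assms] assms that by (auto simp: W_def; metis diff_Suc_1 subsetD insertE emptyE)
qed

text \<open>The case of unique factorisation of monomials that makes a potential in \<open>Bw_kernel\<close> well defined.\<close>

lemma act_eq_act:
  assumes "act u w = act t w'" "u \<noteq> t" "w \<in> W k" "w' \<in> W k"
  obtains k' v where "k = Suc k'" "v \<in> W k'" "w = act t v" "w' = act u v"
proof -
  have m: "add_mset u (mset w) = add_mset t (mset w')"
    using arg_cong[OF assms(1), of mset] by simp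
  then have "t \<in> set w" using assms(2) by (metis insert_noteq_member set_mset_mset)
  then obtain k' where k': "k = Suc k'" "remove1 t w \<in> W k'" "act t (remove1 t w) = w"
    using remove_W[OF assms(3)] by metis
  have "mset w' = mset (act u (remove1 t w))"
    using m assms(2) by (metis k'(3) mset_act add_mset_commute add_mset_add_mset_same_iff)
  then have "w' = act u (remove1 t w)" using assms(4) by (subst (asm) sorted_mset_eq) (auto simp: W_def)
  then show ?thesis using k' that by metis
qed

lemma W_0: "W 0 = {[]}"
  by (auto simp: W_def)

section \<open>Algebras of class T\<close>

text \<open>The multiplicative structure of class T, as used for exactness. \<open>G\<close> is the grading;
  \<open>e 1, e 2, e 3\<close> with \<open>g1\<close> form a basis in degree 1, the products of two of the
  \<open>e u\<close> with \<open>g2\<close> form one in degree 2, and \<open>g3\<close> is one in degree 3.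
  Coefficients from \<open>G 0\<close> stand on the right, where the unknowns of the linear systems stand.
  Families of coefficients are total functions, so that no index conditions are needed when they are
  recombined.\<close>

locale class_T_algebra = ring A for A (structure) +
  fixes G :: "nat \<Rightarrow> 'a set" and e g1 g2 g3 :: "nat \<Rightarrow> 'a" and n1 n2 n3 :: nat
  assumes G_sub: "G i \<subseteq> carrier A"
    and G_zero: "\<zero> \<in> G i"
    and G_add: "x \<in> G i \<Longrightarrow> y \<in> G i \<Longrightarrow> x \<oplus> y \<in> G i"
    and G_minus: "x \<in> G i \<Longrightarrow> \<ominus> x \<in> G i"
    and G_decomp: "x \<in> carrier A \<Longrightarrow>
      \<exists>x0\<in>G 0. \<exists>x1\<in>G 1. \<exists>x2\<in>G 2. \<exists>x3\<in>G 3. x = x0 \<oplus> (x1 \<oplus> (x2 \<oplus> x3))"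
    and G_indep: "x0 \<in> G 0 \<Longrightarrow> x1 \<in> G 1 \<Longrightarrow> x2 \<in> G 2 \<Longrightarrow> x3 \<in> G 3 \<Longrightarrow>
      x0 \<oplus> (x1 \<oplus> (x2 \<oplus> x3)) = \<zero> \<Longrightarrow> x0 = \<zero> \<and> x1 = \<zero> \<and> x2 = \<zero> \<and> x3 = \<zero>"
    and G_mult0: "x \<in> G i \<Longrightarrow> c \<in> G 0 \<Longrightarrow> x \<otimes> c \<in> G i"
    and G_mult11: "x \<in> G 1 \<Longrightarrow> y \<in> G 1 \<Longrightarrow> x \<otimes> y \<in> G 2"
    and G_null: "x \<in> G i \<Longrightarrow> y \<in> G j \<Longrightarrow> i \<in> {1, 2, 3} \<Longrightarrow> j \<in> {1, 2, 3} \<Longrightarrow> (i, j) \<noteq> (1, 1) \<Longrightarrow>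
      x \<otimes> y = \<zero>"
    and e_deg: "u \<in> {1, 2, 3} \<Longrightarrow> e u \<in> G 1"
    and g1_deg: "u < n1 \<Longrightarrow> g1 u \<in> G 1"
    and g2_deg: "u < n2 \<Longrightarrow> g2 u \<in> G 2"
    and g3_deg: "u < n3 \<Longrightarrow> g3 u \<in> G 3"
    and e_sq: "u \<in> {1, 2, 3} \<Longrightarrow> e u \<otimes> e u = \<zero>"
    and e_anti: "u \<in> {1, 2, 3} \<Longrightarrow> t \<in> {1, 2, 3} \<Longrightarrow> e t \<otimes> e u = \<ominus> (e u \<otimes> e t)"
    and g1_null: "u < n1 \<Longrightarrow> x \<in> G 1 \<Longrightarrow> g1 u \<otimes> x = \<zero>"
    and g1_null': "u < n1 \<Longrightarrow> x \<in> G 1 \<Longrightarrow> x \<otimes> g1 u = \<zero>"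
    and span1: "x \<in> G 1 \<Longrightarrow> \<exists>c1\<in>G 0. \<exists>c2\<in>G 0. \<exists>c3\<in>G 0. \<exists>w. (\<forall>u. w u \<in> G 0) \<and>
      x = (e 1 \<otimes> c1 \<oplus> (e 2 \<otimes> c2 \<oplus> e 3 \<otimes> c3)) \<oplus> (\<Oplus>u\<in>{..<n1}. g1 u \<otimes> w u)"
    and span2: "x \<in> G 2 \<Longrightarrow> \<exists>c1\<in>G 0. \<exists>c2\<in>G 0. \<exists>c3\<in>G 0. \<exists>w. (\<forall>u. w u \<in> G 0) \<and>
      x = (e 1 \<otimes> e 2 \<otimes> c1 \<oplus> (e 1 \<otimes> e 3 \<otimes> c2 \<oplus> e 2 \<otimes> e 3 \<otimes> c3)) \<oplus> (\<Oplus>u\<in>{..<n2}. g2 u \<otimes> w u)"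
    and span3: "x \<in> G 3 \<Longrightarrow> \<exists>w. (\<forall>u. w u \<in> G 0) \<and> x = (\<Oplus>u\<in>{..<n3}. g3 u \<otimes> w u)"
    and indep1: "c1 \<in> G 0 \<Longrightarrow> c2 \<in> G 0 \<Longrightarrow> c3 \<in> G 0 \<Longrightarrow> (\<And>u. u < n1 \<Longrightarrow> w u \<in> G 0) \<Longrightarrow>
      (e 1 \<otimes> c1 \<oplus> (e 2 \<otimes> c2 \<oplus> e 3 \<otimes> c3)) \<oplus> (\<Oplus>u\<in>{..<n1}. g1 u \<otimes> w u) = \<zero> \<Longrightarrow>
      c1 = \<zero> \<and> c2 = \<zero> \<and> c3 = \<zero> \<and> (\<forall>u<n1. w u = \<zero>)"
    and indep2: "c1 \<in> G 0 \<Longrightarrow> c2 \<in> G 0 \<Longrightarrow> c3 \<in> G 0 \<Longrightarrow> (\<And>u. u < n2 \<Longrightarrow> w u \<in> G 0) \<Longrightarrow>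
      (e 1 \<otimes> e 2 \<otimes> c1 \<oplus> (e 1 \<otimes> e 3 \<otimes> c2 \<oplus> e 2 \<otimes> e 3 \<otimes> c3)) \<oplus> (\<Oplus>u\<in>{..<n2}. g2 u \<otimes> w u) = \<zero> \<Longrightarrow>
      c1 = \<zero> \<and> c2 = \<zero> \<and> c3 = \<zero> \<and> (\<forall>u<n2. w u = \<zero>)"
    and indep3: "(\<And>u. u < n3 \<Longrightarrow> w u \<in> G 0) \<Longrightarrow> (\<Oplus>u\<in>{..<n3}. g3 u \<otimes> w u) = \<zero> \<Longrightarrow>
      (\<forall>u<n3. w u = \<zero>)"
begin

lemma Gc: "x \<in> G i \<Longrightarrow> x \<in> carrier A" using G_sub by blast

lemma G_diff: "x \<in> G i \<Longrightarrow> y \<in> G i \<Longrightarrow> x \<ominus> y \<in> G i"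
  by (simp add: a_minus_def G_add G_minus)

lemma e_closed [simp]: "e (Suc 0) \<in> carrier A" "e 2 \<in> carrier A" "e 3 \<in> carrier A"
  using e_deg Gc by (force, force, force)

lemma gen_closed: "u < n1 \<Longrightarrow> g1 u \<in> carrier A" "u < n2 \<Longrightarrow> g2 u \<in> carrier A" "u < n3 \<Longrightarrow> g3 u \<in> carrier A"
  using g1_deg g2_deg g3_deg Gc by blast+

text \<open>The value of a row of basis elements \<open>\<gamma>\<^sub>1\<close>,
  \<open>\<gamma>\<^sub>2\<close> or \<open>\<gamma>\<^sub>3\<close> at a vector.\<close>

definition lin :: "(nat \<Rightarrow> 'a) \<Rightarrow> nat \<Rightarrow> (nat \<Rightarrow> 'a) \<Rightarrow> 'a" where
  "lin g n w = (\<Oplus>u\<in>{..<n}. g u \<otimes> w u)"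

text \<open>The matrices \<open>\<beta>\<close> as one operator: the entry in row \<open>w\<close> of the
  product of \<open>\<beta>\<^bsub>k+1\<^esub>\<close> with a vector indexed by words of length \<open>k +
  1\<close>.\<close>

definition Bw :: "(nat list \<Rightarrow> 'a) \<Rightarrow> nat list \<Rightarrow> 'a" where
  "Bw x w = e 1 \<otimes> x (act 1 w) \<oplus> (e 2 \<otimes> x (act 2 w) \<oplus> e 3 \<otimes> x (act 3 w))"

text \<open>Division of the index by the letter \<open>u\<close>, with value zero where this is
  impossible.\<close>

definition drp :: "nat \<Rightarrow> (nat list \<Rightarrow> 'a) \<Rightarrow> nat list \<Rightarrow> 'a" where
  "drp u y w = (if u \<in> set w then y (remove1 u w) else \<zero>)"

text \<open>The matrices \<open>\<beta>'\<close> as one operator: the product of two of the \<open>e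
  u\<close> goes with the division by the third letter.\<close>

definition Cw :: "(nat list \<Rightarrow> 'a) \<Rightarrow> nat list \<Rightarrow> 'a" where
  "Cw y w = e 1 \<otimes> e 2 \<otimes> drp 3 y w \<oplus> (e 1 \<otimes> e 3 \<otimes> drp 2 y w \<oplus> e 2 \<otimes> e 3 \<otimes> drp 1 y w)"

lemma lin_closed: "(\<And>u. u < n \<Longrightarrow> g u \<in> carrier A) \<Longrightarrow> (\<And>u. u < n \<Longrightarrow> w u \<in> carrier A) \<Longrightarrow> lin g n w \<in> carrier A"
  by (auto simp: lin_def intro!: finsum_closed)

lemma lin_deg:
  assumes "\<And>u. u < n \<Longrightarrow> g u \<in> G i" "\<And>u. u < n \<Longrightarrow> w u \<in> G 0" shows "lin g n w \<in> G i"
  using assms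
proof (induction n)
  case (Suc n)
  have "lin g (Suc n) w = g n \<otimes> w n \<oplus> lin g n w"
    using Suc.prems unfolding lin_def lessThan_Suc
    by (subst finsum_insert) (auto intro!: m_closed Gc[of "g _" i] Gc[of "w _" 0])
  then show ?case using Suc by (auto intro!: G_add G_mult0)
qed (simp add: lin_def G_zero)

lemma lin_zero: "(\<And>u. u < n \<Longrightarrow> g u \<otimes> w u = \<zero>) \<Longrightarrow> lin g n w = \<zero>"
  unfolding lin_def by (rule add.finprod_one_eqI) auto

lemma lin_add:
  assumes "\<And>u. u < n \<Longrightarrow> g u \<in> carrier A" "\<And>u. u < n \<Longrightarrow> v u \<in> carrier A" "\<And>u. u < n \<Longrightarrow> w u \<in> carrier A"
  shows "lin g n (\<lambda>u. v u \<oplus> w u) = lin g n v \<oplus> lin g n w"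
proof -
  have "lin g n (\<lambda>u. v u \<oplus> w u) = (\<Oplus>u\<in>{..<n}. g u \<otimes> v u \<oplus> g u \<otimes> w u)"
    unfolding lin_def using assms by (intro finsum_cong' refl) (auto simp: r_distr)
  also have "\<dots> = lin g n v \<oplus> lin g n w"
    unfolding lin_def using assms by (intro finsum_addf) auto
  finally show ?thesis .
qed

lemma lin_cong:
  assumes "\<And>u. u < n \<Longrightarrow> g u \<in> carrier A" "\<And>u. u < n \<Longrightarrow> w u \<in> carrier A" "\<And>u. u < n \<Longrightarrow> v u = w u"
  shows "lin g n v = lin g n w"
  unfolding lin_def using assms by (intro finsum_cong' refl) auto

lemma mult_lin:
  assumes "\<And>u. u < n \<Longrightarrow> g u \<in> carrier A" "\<And>u. u < n \<Longrightarrow> w u \<in> carrier A" "x \<in> carrier A"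
    "\<And>u. u < n \<Longrightarrow> x \<otimes> g u = \<zero>"
  shows "x \<otimes> lin g n w = \<zero>"
proof -
  have "x \<otimes> lin g n w = (\<Oplus>u\<in>{..<n}. x \<otimes> (g u \<otimes> w u))"
    unfolding lin_def using assms by (intro finsum_rdistr) auto
  also have "\<dots> = \<zero>"
    by (rule add.finprod_one_eqI) (use assms in \<open>auto simp: m_assoc[symmetric]\<close>)
  finally show ?thesis .
qed

lemma three_distr:
  assumes "p \<in> carrier A" "q \<in> carrier A" "r \<in> carrier A"
    "a \<in> carrier A" "b \<in> carrier A" "c \<in> carrier A" "a' \<in> carrier A" "b' \<in> carrier A" "c' \<in> carrier A"
  shows "(p \<otimes> a \<oplus> (q \<otimes> b \<oplus> r \<otimes> c)) \<oplus> (p \<otimes> a' \<oplus> (q \<otimes> b' \<oplus> r \<otimes> c')) =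
    p \<otimes> (a \<oplus> a') \<oplus> (q \<otimes> (b \<oplus> b') \<oplus> r \<otimes> (c \<oplus> c'))"
  using assms by (simp add: r_distr a_ac)

lemma W_act_closed:
  assumes "w \<in> W k" "\<And>s. s \<in> W (Suc k) \<Longrightarrow> x s \<in> H"
  shows "x (act (Suc 0) w) \<in> H" "x (act 2 w) \<in> H" "x (act 3 w) \<in> H"
  using assms act_W[OF assms(1), of 1] act_W[OF assms(1), of 2] act_W[OF assms(1), of 3] by auto

lemma Bw_closed:
  assumes "w \<in> W k" "\<And>s. s \<in> W (Suc k) \<Longrightarrow> x s \<in> carrier A"
  shows "Bw x w \<in> carrier A"
  using W_act_closed[where x = x and H = "carrier A", OF assms] by (simp add: Bw_def)

lemma Bw_cong:
  assumes "w \<in> W k" "\<And>s. s \<in> W (Suc k) \<Longrightarrow> x s = y s"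
  shows "Bw x w = Bw y w"
  using assms act_W[OF assms(1), of 1] act_W[OF assms(1), of 2] act_W[OF assms(1), of 3] by (simp add: Bw_def)

lemma Bw_add:
  assumes "w \<in> W k" "\<And>s. s \<in> W (Suc k) \<Longrightarrow> x s \<in> carrier A" "\<And>s. s \<in> W (Suc k) \<Longrightarrow> y s \<in> carrier A"
  shows "Bw (\<lambda>s. x s \<oplus> y s) w = Bw x w \<oplus> Bw y w"
  using W_act_closed[where x = x and H = "carrier A", OF assms(1,2)]
    W_act_closed[where x = y and H = "carrier A", OF assms(1,3)]
  by (simp add: Bw_def r_distr a_ac)

lemma Bw_deg0:
  assumes "w \<in> W k" "\<And>s. s \<in> W (Suc k) \<Longrightarrow> x s \<in> G 0"
  shows "Bw x w \<in> G 1"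
  unfolding Bw_def by (intro G_add G_mult0 e_deg) (use W_act_closed[where x = x, OF assms] in auto)

lemma Bw_deg1:
  assumes "w \<in> W k" "\<And>s. s \<in> W (Suc k) \<Longrightarrow> x s \<in> G 1"
  shows "Bw x w \<in> G 2"
  unfolding Bw_def by (intro G_add G_mult11 e_deg) (use W_act_closed[where x = x, OF assms] in auto)

lemma Bw_null:
  assumes "w \<in> W k" "\<And>s u. s \<in> W (Suc k) \<Longrightarrow> u \<in> {1, 2, 3} \<Longrightarrow> e u \<otimes> x s = \<zero>"
  shows "Bw x w = \<zero>"
  using assms(2)[OF act_W[OF assms(1), of 1], of 1] assms(2)[OF act_W[OF assms(1), of 2], of 2]
    assms(2)[OF act_W[OF assms(1), of 3], of 3] by (simp add: Bw_def)

lemma drp_mem: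
  assumes "w \<in> W k" "\<And>k' v. k = Suc k' \<Longrightarrow> v \<in> W k' \<Longrightarrow> y v \<in> H" "\<zero> \<in> H"
  shows "drp u y w \<in> H"
  using remove_W[OF assms(1)] assms(2,3) unfolding drp_def by metis

lemma Cw_closed:
  assumes "w \<in> W k" "\<And>k' v. k = Suc k' \<Longrightarrow> v \<in> W k' \<Longrightarrow> y v \<in> carrier A"
  shows "Cw y w \<in> carrier A"
  using drp_mem[where y = y, OF assms zero_closed] by (simp add: Cw_def)

lemma Cw_cong:
  assumes "w \<in> W k" "\<And>k' v. k = Suc k' \<Longrightarrow> v \<in> W k' \<Longrightarrow> x v = y v"
  shows "Cw x w = Cw y w"
proof -
  have "drp u x w = drp u y w" for u
    using remove_W[OF assms(1), of u] assms(2) unfolding drp_def by metis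
  then show ?thesis by (simp add: Cw_def)
qed

lemma Cw_add:
  assumes "w \<in> W k" "\<And>k' v. k = Suc k' \<Longrightarrow> v \<in> W k' \<Longrightarrow> x v \<in> carrier A"
    "\<And>k' v. k = Suc k' \<Longrightarrow> v \<in> W k' \<Longrightarrow> y v \<in> carrier A"
  shows "Cw (\<lambda>v. x v \<oplus> y v) w = Cw x w \<oplus> Cw y w"
proof -
  have "drp u (\<lambda>v. x v \<oplus> y v) w = drp u x w \<oplus> drp u y w" for u
    by (simp add: drp_def)
  then show ?thesis
    using drp_mem[where y = x, OF assms(1,2) zero_closed] drp_mem[where y = y, OF assms(1,3) zero_closed]
    unfolding Cw_def by (subst three_distr) auto
qed

lemma ee_deg: "u \<in> {1, 2, 3} \<Longrightarrow> t \<in> {1, 2, 3} \<Longrightarrow> e u \<otimes> e t \<in> G 2"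
  by (intro G_mult11 e_deg)

lemma Cw_deg:
  assumes "w \<in> W k" "\<And>k' v. k = Suc k' \<Longrightarrow> v \<in> W k' \<Longrightarrow> y v \<in> G 0"
  shows "Cw y w \<in> G 2"
  unfolding Cw_def using drp_mem[where y = y, OF assms G_zero] by (intro G_add G_mult0 ee_deg) auto

lemma mult_Cw_null:
  assumes "u \<in> {1, 2, 3}" "w \<in> W k" "\<And>k' v. k = Suc k' \<Longrightarrow> v \<in> W k' \<Longrightarrow> y v \<in> carrier A"
  shows "e u \<otimes> Cw y w = \<zero>"
proof -
  have z: "e u \<otimes> (e s \<otimes> e t) = \<zero>" if "s \<in> {1, 2, 3}" "t \<in> {1, 2, 3}" for s t
    using G_null[OF e_deg[OF assms(1)] ee_deg[OF that]] by auto
  have eu: "e u \<in> carrier A" using e_deg[OF assms(1)] Gc by blast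
  have z': "e u \<otimes> (e s \<otimes> e t \<otimes> c) = \<zero>" if "s \<in> {1, 2, 3}" "t \<in> {1, 2, 3}" "c \<in> carrier A" for s t c
  proof -
    have "e s \<otimes> e t \<in> carrier A" using ee_deg[OF that(1,2)] Gc by blast
    then have "e u \<otimes> (e s \<otimes> e t \<otimes> c) = e u \<otimes> (e s \<otimes> e t) \<otimes> c"
      using eu that(3) by (rule_tac m_assoc[symmetric])
    then show ?thesis using z[OF that(1,2)] that(3) by simp
  qed
  show ?thesis
    using eu drp_mem[where y = y, OF assms(2,3) zero_closed] z'[of 1 2] z'[of 1 3] z'[of 2 3]
    unfolding Cw_def by (simp add: r_distr)
qed

text \<open>The coefficient of \<open>e\<^sub>u e\<^sub>t\<close> is symmetric in \<open>u\<close> and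
  \<open>t\<close> since \<open>act u\<close> and \<open>act t\<close> commute, while the product is
  antisymmetric.\<close>

lemma Bw_Bw:
  assumes "w \<in> W k" "\<And>s. s \<in> W (Suc (Suc k)) \<Longrightarrow> x s \<in> carrier A"
  shows "Bw (Bw x) w = \<zero>"
proof -
  have a: "x (act u (act t w)) \<in> carrier A" if "u \<in> {1, 2, 3}" "t \<in> {1, 2, 3}" for u t
    using that by (intro assms(2) act_W assms(1))
  have sq: "e u \<otimes> (e u \<otimes> c) = \<zero>" if "u \<in> {1, 2, 3}" "c \<in> carrier A" for u c
    using that e_sq[OF that(1)] e_deg[OF that(1)] Gc by (simp add: m_assoc[symmetric])
  have an: "e t \<otimes> (e u \<otimes> c) = \<ominus> (e u \<otimes> (e t \<otimes> c))"
    if "u \<in> {1, 2, 3}" "t \<in> {1, 2, 3}" "c \<in> carrier A" for u t c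
    using that e_anti[OF that(1,2)] e_deg[OF that(1)] e_deg[OF that(2)] Gc
    by (simp add: m_assoc[symmetric] l_minus)
  define a12 where "a12 = e 1 \<otimes> (e 2 \<otimes> x (act 1 (act 2 w)))"
  define a13 where "a13 = e 1 \<otimes> (e 3 \<otimes> x (act 1 (act 3 w)))"
  define a23 where "a23 = e 2 \<otimes> (e 3 \<otimes> x (act 2 (act 3 w)))"
  have cl: "a12 \<in> carrier A" "a13 \<in> carrier A" "a23 \<in> carrier A"
    using a by (auto simp: a12_def a13_def a23_def)
  have "e 1 \<otimes> Bw x (act 1 w) = a12 \<oplus> a13"
    using a sq[of 1] unfolding Bw_def by (simp add: r_distr a12_def a13_def act_commute)
  moreover have "e 2 \<otimes> Bw x (act 2 w) = \<ominus> a12 \<oplus> a23"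
    using a sq[of 2] an[of 1 2] unfolding Bw_def by (simp add: r_distr a12_def a23_def act_commute)
  moreover have "e 3 \<otimes> Bw x (act 3 w) = \<ominus> a13 \<oplus> \<ominus> a23"
    using a sq[of 3] an[of 1 3] an[of 2 3] unfolding Bw_def by (simp add: r_distr a13_def a23_def act_commute)
  ultimately have "Bw (Bw x) w = a12 \<oplus> a13 \<oplus> (\<ominus> a12 \<oplus> a23 \<oplus> (\<ominus> a13 \<oplus> \<ominus> a23))"
    unfolding Bw_def[of "Bw x"] by simp
  also have "\<dots> = \<zero>"
    using cl by (simp add: a_ac r_neg l_neg r_neg1 r_neg2)
  finally show ?thesis .
qed

text \<open>In coordinates, \<open>Bw\<close> measures the failure of the vector field \<open>(c\<^sub>1,
  c\<^sub>2, c\<^sub>3)\<close> to be a gradient, with \<open>act u\<close> in the role of the partial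
  derivatives.\<close>

lemma Bw_coord:
  fixes c :: "nat \<Rightarrow> nat list \<Rightarrow> 'a"
  assumes w: "w \<in> W k" and c: "\<And>s u. s \<in> W (Suc k) \<Longrightarrow> u \<in> {1, 2, 3} \<Longrightarrow> c u s \<in> G 0"
    and \<omega>: "\<And>s u. s \<in> W (Suc k) \<Longrightarrow> \<omega> s u \<in> G 0"
  shows "Bw (\<lambda>s. (e 1 \<otimes> c 1 s \<oplus> (e 2 \<otimes> c 2 s \<oplus> e 3 \<otimes> c 3 s)) \<oplus> lin g1 n1 (\<omega> s)) w =
    e 1 \<otimes> e 2 \<otimes> (c 2 (act 1 w) \<ominus> c 1 (act 2 w)) \<oplus>
    (e 1 \<otimes> e 3 \<otimes> (c 3 (act 1 w) \<ominus> c 1 (act 3 w)) \<oplus> e 2 \<otimes> e 3 \<otimes> (c 3 (act 2 w) \<ominus> c 2 (act 3 w)))"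
proof -
  have lc: "lin g1 n1 (\<omega> s) \<in> carrier A" if "s \<in> W (Suc k)" for s
    using that \<omega> Gc gen_closed by (auto intro!: lin_closed)
  have cc: "c u s \<in> carrier A" if "s \<in> W (Suc k)" "u \<in> {1, 2, 3}" for s u
    using that c Gc by blast
  have null: "Bw (\<lambda>s. lin g1 n1 (\<omega> s)) w = \<zero>"
    by (rule Bw_null[OF w]) (rule mult_lin, use \<omega> Gc gen_closed e_deg g1_null' in auto)
  have a: "c u (act t w) \<in> carrier A" if "u \<in> {1, 2, 3}" "t \<in> {1, 2, 3}" for u t
    using that by (intro cc act_W w)
  have sq: "e u \<otimes> (e u \<otimes> c) = \<zero>" if "u \<in> {1, 2, 3}" "c \<in> carrier A" for u c
    using that e_sq[OF that(1)] e_deg[OF that(1)] Gc by (simp add: m_assoc[symmetric])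
  have an: "e t \<otimes> (e u \<otimes> c) = \<ominus> (e u \<otimes> (e t \<otimes> c))"
    if "u \<in> {1, 2, 3}" "t \<in> {1, 2, 3}" "c \<in> carrier A" for u t c
    using that e_anti[OF that(1,2)] e_deg[OF that(1)] e_deg[OF that(2)] Gc
    by (simp add: m_assoc[symmetric] l_minus)
  let ?x = "\<lambda>s. e 1 \<otimes> c 1 s \<oplus> (e 2 \<otimes> c 2 s \<oplus> e 3 \<otimes> c 3 s)"
  have "Bw (\<lambda>s. ?x s \<oplus> lin g1 n1 (\<omega> s)) w = Bw ?x w \<oplus> Bw (\<lambda>s. lin g1 n1 (\<omega> s)) w"
    using cc lc by (intro Bw_add[OF w]) auto
  also have "\<dots> = Bw ?x w"
    unfolding null using cc by (intro r_zero Bw_closed[OF w]) auto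
  also have "\<dots> = e 1 \<otimes> e 2 \<otimes> (c 2 (act 1 w) \<ominus> c 1 (act 2 w)) \<oplus>
    (e 1 \<otimes> e 3 \<otimes> (c 3 (act 1 w) \<ominus> c 1 (act 3 w)) \<oplus> e 2 \<otimes> e 3 \<otimes> (c 3 (act 2 w) \<ominus> c 2 (act 3 w)))"
    using a sq[of 1] sq[of 2] sq[of 3] an[of 1 2] an[of 1 3] an[of 2 3]
    unfolding Bw_def by (simp add: r_distr a_minus_def m_assoc r_minus a_ac)
  finally show ?thesis .
qed

end

context class_T_algebra
begin

lemma coords1:
  assumes "\<And>s. s \<in> S \<Longrightarrow> x s \<in> G 1"
  obtains c :: "nat \<Rightarrow> 's \<Rightarrow> 'a" and \<omega> :: "'s \<Rightarrow> nat \<Rightarrow> 'a" where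
    "\<And>s u. s \<in> S \<Longrightarrow> c u s \<in> G 0" "\<And>s u. s \<in> S \<Longrightarrow> \<omega> s u \<in> G 0"
    "\<And>s. s \<in> S \<Longrightarrow> x s = (e 1 \<otimes> c 1 s \<oplus> (e 2 \<otimes> c 2 s \<oplus> e 3 \<otimes> c 3 s)) \<oplus> lin g1 n1 (\<omega> s)"
proof -
  have "\<exists>q. \<forall>s\<in>S. fst (q s) \<in> G 0 \<and> fst (snd (q s)) \<in> G 0 \<and> fst (snd (snd (q s))) \<in> G 0 \<and>
    (\<forall>u. snd (snd (snd (q s))) u \<in> G 0) \<and>
    x s = (e 1 \<otimes> fst (q s) \<oplus> (e 2 \<otimes> fst (snd (q s)) \<oplus> e 3 \<otimes> fst (snd (snd (q s))))) \<oplus> lin g1 n1 (snd (snd (snd (q s))))"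
  proof (intro bchoice ballI)
    fix s assume "s \<in> S"
    from span1[OF assms[OF this]] obtain c1 c2 c3 w where
      "c1 \<in> G 0" "c2 \<in> G 0" "c3 \<in> G 0" "\<forall>u. w u \<in> G 0"
      "x s = (e 1 \<otimes> c1 \<oplus> (e 2 \<otimes> c2 \<oplus> e 3 \<otimes> c3)) \<oplus> lin g1 n1 w"
      unfolding lin_def by blast
    then show "\<exists>q. fst q \<in> G 0 \<and> fst (snd q) \<in> G 0 \<and> fst (snd (snd q)) \<in> G 0 \<and>
      (\<forall>u. snd (snd (snd q)) u \<in> G 0) \<and>
      x s = (e 1 \<otimes> fst q \<oplus> (e 2 \<otimes> fst (snd q) \<oplus> e 3 \<otimes> fst (snd (snd q)))) \<oplus> lin g1 n1 (snd (snd (snd q)))"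
      by (intro exI[of _ "(c1, c2, c3, w)"]) auto
  qed
  then obtain q where q: "\<forall>s\<in>S. fst (q s) \<in> G 0 \<and> fst (snd (q s)) \<in> G 0 \<and> fst (snd (snd (q s))) \<in> G 0 \<and>
    (\<forall>u. snd (snd (snd (q s))) u \<in> G 0) \<and>
    x s = (e 1 \<otimes> fst (q s) \<oplus> (e 2 \<otimes> fst (snd (q s)) \<oplus> e 3 \<otimes> fst (snd (snd (q s))))) \<oplus> lin g1 n1 (snd (snd (snd (q s))))"
    by blast
  define c where "c = (\<lambda>u s. if u = 1 then fst (q s) else if u = (2::nat) then fst (snd (q s)) else fst (snd (snd (q s))))"
  show ?thesis
    by (rule that[of c "\<lambda>s. snd (snd (snd (q s)))"]) (use q in \<open>auto simp: c_def\<close>)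
qed

lemma coords2:
  assumes "\<And>s. s \<in> S \<Longrightarrow> x s \<in> G 2"
  obtains c12 c13 c23 :: "'s \<Rightarrow> 'a" and \<tau> :: "'s \<Rightarrow> nat \<Rightarrow> 'a" where
    "\<And>s. s \<in> S \<Longrightarrow> c12 s \<in> G 0" "\<And>s. s \<in> S \<Longrightarrow> c13 s \<in> G 0" "\<And>s. s \<in> S \<Longrightarrow> c23 s \<in> G 0"
    "\<And>s u. s \<in> S \<Longrightarrow> \<tau> s u \<in> G 0"
    "\<And>s. s \<in> S \<Longrightarrow> x s = (e 1 \<otimes> e 2 \<otimes> c12 s \<oplus> (e 1 \<otimes> e 3 \<otimes> c13 s \<oplus> e 2 \<otimes> e 3 \<otimes> c23 s)) \<oplus> lin g2 n2 (\<tau> s)"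
proof -
  have "\<exists>q. \<forall>s\<in>S. fst (q s) \<in> G 0 \<and> fst (snd (q s)) \<in> G 0 \<and> fst (snd (snd (q s))) \<in> G 0 \<and>
    (\<forall>u. snd (snd (snd (q s))) u \<in> G 0) \<and>
    x s = (e 1 \<otimes> e 2 \<otimes> fst (q s) \<oplus> (e 1 \<otimes> e 3 \<otimes> fst (snd (q s)) \<oplus> e 2 \<otimes> e 3 \<otimes> fst (snd (snd (q s))))) \<oplus> lin g2 n2 (snd (snd (snd (q s))))"
  proof (intro bchoice ballI)
    fix s assume "s \<in> S"
    from span2[OF assms[OF this]] obtain c1 c2 c3 w where
      "c1 \<in> G 0" "c2 \<in> G 0" "c3 \<in> G 0" "\<forall>u. w u \<in> G 0"
      "x s = (e 1 \<otimes> e 2 \<otimes> c1 \<oplus> (e 1 \<otimes> e 3 \<otimes> c2 \<oplus> e 2 \<otimes> e 3 \<otimes> c3)) \<oplus> lin g2 n2 w"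
      unfolding lin_def by blast
    then show "\<exists>q. fst q \<in> G 0 \<and> fst (snd q) \<in> G 0 \<and> fst (snd (snd q)) \<in> G 0 \<and>
      (\<forall>u. snd (snd (snd q)) u \<in> G 0) \<and>
      x s = (e 1 \<otimes> e 2 \<otimes> fst q \<oplus> (e 1 \<otimes> e 3 \<otimes> fst (snd q) \<oplus> e 2 \<otimes> e 3 \<otimes> fst (snd (snd q)))) \<oplus> lin g2 n2 (snd (snd (snd q)))"
      by (intro exI[of _ "(c1, c2, c3, w)"]) auto
  qed
  then obtain q where q: "\<forall>s\<in>S. fst (q s) \<in> G 0 \<and> fst (snd (q s)) \<in> G 0 \<and> fst (snd (snd (q s))) \<in> G 0 \<and>
    (\<forall>u. snd (snd (snd (q s))) u \<in> G 0) \<and>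
    x s = (e 1 \<otimes> e 2 \<otimes> fst (q s) \<oplus> (e 1 \<otimes> e 3 \<otimes> fst (snd (q s)) \<oplus> e 2 \<otimes> e 3 \<otimes> fst (snd (snd (q s))))) \<oplus> lin g2 n2 (snd (snd (snd (q s))))"
    by blast
  show ?thesis
    by (rule that[of "\<lambda>s. fst (q s)" "\<lambda>s. fst (snd (q s))" "\<lambda>s. fst (snd (snd (q s)))" "\<lambda>s. snd (snd (snd (q s)))"])
      (use q in auto)
qed

text \<open>All entries of a row are distinct basis elements of degree 1, so a relation with coefficients of
  degree 0 in a row \<open>w\<close> kills its coefficients; every word of length \<open>k + 1\<close>
  occurs in some row.\<close>

lemma Bw_indep:
  assumes x: "\<And>s. s \<in> W (Suc k) \<Longrightarrow> x s \<in> G 0" and t: "\<And>w u. w \<in> W k \<Longrightarrow> u < n1 \<Longrightarrow> t w u \<in> G 0"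
    and z: "\<And>w. w \<in> W k \<Longrightarrow> Bw x w \<oplus> lin g1 n1 (t w) = \<zero>"
  shows "s \<in> W (Suc k) \<Longrightarrow> x s = \<zero>" "w \<in> W k \<Longrightarrow> u < n1 \<Longrightarrow> t w u = \<zero>"
proof -
  have *: "x (act 1 w) = \<zero> \<and> x (act 2 w) = \<zero> \<and> x (act 3 w) = \<zero> \<and> (\<forall>u<n1. t w u = \<zero>)" if "w \<in> W k" for w
    using that z[OF that] t[OF that] unfolding Bw_def lin_def by (intro indep1 x act_W) auto
  then show "w \<in> W k \<Longrightarrow> u < n1 \<Longrightarrow> t w u = \<zero>" by blast
  assume "s \<in> W (Suc k)"
  then obtain u w where "u \<in> {1, 2, 3}" "w \<in> W k" "s = act u w" by (rule W_Suc_cases)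
  then show "x s = \<zero>" using *[of w] by auto
qed

lemma drp_act: "v \<in> W k \<Longrightarrow> drp u y (act u v) = y v"
  by (simp add: drp_def remove_act)

lemma diff_add_eq_zero_iff:
  "a \<in> carrier A \<Longrightarrow> b \<in> carrier A \<Longrightarrow> y \<in> carrier A \<Longrightarrow> (a \<ominus> b) \<oplus> y = \<zero> \<longleftrightarrow> a \<oplus> y = b"
proof -
  assume c: "a \<in> carrier A" "b \<in> carrier A" "y \<in> carrier A"
  have "(a \<ominus> b) \<oplus> y = (a \<oplus> y) \<ominus> b" using c by (simp add: a_minus_def a_ac)
  then show ?thesis using c by simp
qed

text \<open>Write \<open>c\<^sub>u(s)\<close> for the coefficient of \<open>e\<^sub>u\<close> in \<open>x
  s\<close>. If \<open>y = 0\<close>, the hypothesis is \<open>c\<^sub>t(u w) = c\<^sub>u(t w)\<close>, and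
  then \<open>g(u s) = c\<^sub>u(s)\<close> is a well-defined potential. That \<open>y\<close> vanishes
  comes from the three equations at the words \<open>3 v\<close>, \<open>2 v\<close>, \<open>1 v\<close>:
  they involve only the three coefficients \<open>c\<^sub>3(1 2 v)\<close>, \<open>c\<^sub>2(1 3 v)\<close>,
  \<open>c\<^sub>1(2 3 v)\<close>, and their alternating sum leaves \<open>y v\<close>.\<close>

lemma Bw_kernel:
  assumes x: "\<And>s. s \<in> W (Suc k) \<Longrightarrow> x s \<in> G 1"
    and y: "\<And>k' v. k = Suc k' \<Longrightarrow> v \<in> W k' \<Longrightarrow> y v \<in> G 0"
    and t: "\<And>w u. w \<in> W k \<Longrightarrow> u < n2 \<Longrightarrow> t w u \<in> G 0"
    and z: "\<And>w. w \<in> W k \<Longrightarrow> Bw x w \<oplus> (Cw y w \<oplus> lin g2 n2 (t w)) = \<zero>"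
  shows "k = Suc k' \<Longrightarrow> v \<in> W k' \<Longrightarrow> y v = \<zero>"
    and "w \<in> W k \<Longrightarrow> u < n2 \<Longrightarrow> t w u = \<zero>"
    and "\<exists>g \<omega>. (\<forall>s\<in>W (Suc (Suc k)). g s \<in> G 0) \<and> (\<forall>s\<in>W (Suc k). \<forall>u. \<omega> s u \<in> G 0) \<and>
      (\<forall>s\<in>W (Suc k). x s = Bw g s \<oplus> lin g1 n1 (\<omega> s))"
proof -
  obtain c :: "nat \<Rightarrow> nat list \<Rightarrow> 'a" and \<omega> where
    c: "\<And>s u. s \<in> W (Suc k) \<Longrightarrow> c u s \<in> G 0" and \<omega>: "\<And>s u. s \<in> W (Suc k) \<Longrightarrow> \<omega> s u \<in> G 0"
    and xc: "\<And>s. s \<in> W (Suc k) \<Longrightarrow> x s = (e 1 \<otimes> c 1 s \<oplus> (e 2 \<otimes> c 2 s \<oplus> e 3 \<otimes> c 3 s)) \<oplus> lin g1 n1 (\<omega> s)"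
    using coords1[of "W (Suc k)" x, OF x] by blast
  have d: "drp u y w \<in> G 0" if "w \<in> W k" for u w
    by (rule drp_mem[OF that y G_zero])
  have all: "(c 2 (act 1 w) \<ominus> c 1 (act 2 w)) \<oplus> drp 3 y w = \<zero> \<and>
      (c 3 (act 1 w) \<ominus> c 1 (act 3 w)) \<oplus> drp 2 y w = \<zero> \<and>
      (c 3 (act 2 w) \<ominus> c 2 (act 3 w)) \<oplus> drp 1 y w = \<zero> \<and> (\<forall>u<n2. t w u = \<zero>)" if w: "w \<in> W k" for w
  proof -
    have ca: "c u (act s w) \<in> G 0" if "u \<in> {1, 2, 3}" "s \<in> {1, 2, 3}" for u s
      using that by (intro c act_W w)
    have 1: "Bw x w = e 1 \<otimes> e 2 \<otimes> (c 2 (act 1 w) \<ominus> c 1 (act 2 w)) \<oplus>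
      (e 1 \<otimes> e 3 \<otimes> (c 3 (act 1 w) \<ominus> c 1 (act 3 w)) \<oplus> e 2 \<otimes> e 3 \<otimes> (c 3 (act 2 w) \<ominus> c 2 (act 3 w)))"
      using Bw_coord[of w k c \<omega>, OF w c \<omega>] Bw_cong[OF w xc] by simp
    let ?l = "lin g2 n2 (t w)"
    have l: "?l \<in> carrier A" using t[OF w] gen_closed Gc by (intro lin_closed) blast+
    have eec: "e 1 \<otimes> e 2 \<in> carrier A" "e 1 \<otimes> e 3 \<in> carrier A" "e 2 \<otimes> e 3 \<in> carrier A" by auto
    have cl: "c 2 (act 1 w) \<ominus> c 1 (act 2 w) \<in> G 0" "c 3 (act 1 w) \<ominus> c 1 (act 3 w) \<in> G 0"
        "c 3 (act 2 w) \<ominus> c 2 (act 3 w) \<in> G 0"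
      by (intro G_diff ca; simp)+
    note cl' = cl[THEN Gc] d[OF w, THEN Gc]
    have "(Bw x w \<oplus> Cw y w) \<oplus> ?l = \<zero>"
      using z[OF w] l Bw_closed[OF w Gc[OF x]] Cw_closed[OF w Gc[OF y]] by (simp add: a_assoc)
    moreover have "Bw x w \<oplus> Cw y w =
        e 1 \<otimes> e 2 \<otimes> ((c 2 (act 1 w) \<ominus> c 1 (act 2 w)) \<oplus> drp 3 y w) \<oplus>
        (e 1 \<otimes> e 3 \<otimes> ((c 3 (act 1 w) \<ominus> c 1 (act 3 w)) \<oplus> drp 2 y w) \<oplus>
         e 2 \<otimes> e 3 \<otimes> ((c 3 (act 2 w) \<ominus> c 2 (act 3 w)) \<oplus> drp 1 y w))"
      unfolding 1 Cw_def by (intro three_distr eec cl')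
    ultimately show ?thesis
      unfolding lin_def using t[OF w] by (intro indep2 G_add cl d[OF w]) auto
  qed
  from all show "w \<in> W k \<Longrightarrow> u < n2 \<Longrightarrow> t w u = \<zero>" by blast
  have E: "c 2 (act 1 w) \<oplus> drp 3 y w = c 1 (act 2 w)" "c 3 (act 1 w) \<oplus> drp 2 y w = c 1 (act 3 w)"
    "c 3 (act 2 w) \<oplus> drp 1 y w = c 2 (act 3 w)" if w: "w \<in> W k" for w
  proof -
    have ca: "c u (act s w) \<in> carrier A" if "u \<in> {1, 2, 3}" "s \<in> {1, 2, 3}" for u s
      using that by (intro Gc[OF c] act_W w)
    note dc = d[OF w, THEN Gc]
    show "c 2 (act 1 w) \<oplus> drp 3 y w = c 1 (act 2 w)" "c 3 (act 1 w) \<oplus> drp 2 y w = c 1 (act 3 w)"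
      "c 3 (act 2 w) \<oplus> drp 1 y w = c 2 (act 3 w)"
      using all[OF w] by (subst diff_add_eq_zero_iff[symmetric]; simp add: ca dc)+
  qed
  \<comment> \<open>the equations at \<open>3 v\<close>, \<open>2 v\<close>, \<open>1 v\<close>, in which only three coefficients occur\<close>
  have y0: "y v = \<zero>" if k: "k = Suc k'" and v: "v \<in> W k'" for k' v
  proof -
    have a: "act u v \<in> W k" if "u \<in> {1, 2, 3}" for u using act_W[OF v that] k by simp
    have ca: "c u (act s (act r v)) \<in> carrier A" if "s \<in> {1, 2, 3}" "r \<in> {1, 2, 3}" for u s r
      using that by (intro Gc[OF c] act_W a)
    have yv: "y v \<in> carrier A" using y[OF k v] Gc by blast
    have e3: "c 2 (act 1 (act 3 v)) \<oplus> y v = c 1 (act 2 (act 3 v))"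
      using E(1)[OF a, of 3] drp_act[OF v] by simp
    have e2: "c 3 (act 1 (act 2 v)) \<oplus> y v = c 1 (act 2 (act 3 v))"
      using E(2)[OF a, of 2] drp_act[OF v] by (simp add: act_commute)
    have e1: "c 3 (act 1 (act 2 v)) \<oplus> y v = c 2 (act 1 (act 3 v))"
      using E(3)[OF a, of 1] drp_act[OF v] by (simp add: act_commute)
    have "c 2 (act 1 (act 3 v)) = c 3 (act 1 (act 2 v))"
      using e3 e2 ca[of 1 3 2] ca[of 1 2 3] yv by (metis add.r_cancel insertI1 insertCI)
    then have "c 2 (act 1 (act 3 v)) \<oplus> y v = c 2 (act 1 (act 3 v)) \<oplus> \<zero>"
      using e1 ca[of 1 3 2] by simp
    then show ?thesis using ca[of 1 3 2] yv by (subst (asm) add.l_cancel) auto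
  qed
  then show "k = Suc k' \<Longrightarrow> v \<in> W k' \<Longrightarrow> y v = \<zero>" .
  have d0: "drp u y w = \<zero>" if "w \<in> W k" for u w
    using drp_mem[where y = y and H = "{\<zero>}" and u = u, OF that] y0 by auto
  have sym: "c t (act u w) = c u (act t w)" if w: "w \<in> W k" and "u \<in> {1, 2, 3}" "t \<in> {1, 2, 3}" for u t w
  proof -
    have ca: "c u (act s w) \<in> carrier A" if "u \<in> {1, 2, 3}" "s \<in> {1, 2, 3}" for u s
      using that by (intro Gc[OF c] act_W w)
    show ?thesis using E[OF w] d0[OF w] ca that(2,3) by auto
  qed
  have "\<exists>g. \<forall>s u r. s \<in> W (Suc k) \<longrightarrow> u \<in> {1, 2, 3} \<longrightarrow> r = act u s \<longrightarrow> g r = c u s"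
  proof -
    have "c u s = c t s'" if H: "s \<in> W (Suc k)" "s' \<in> W (Suc k)" "u \<in> {1, 2, 3}" "t \<in> {1, 2, 3}"
      "act u s = act t s'" for u t s s'
    proof (cases "u = t")
      case True
      then show ?thesis using act_inj_right[OF H(1,2), of t] H(5) by metis
    next
      case False
      then obtain k' v where "Suc k = Suc k'" "v \<in> W k'" "s = act t v" "s' = act u v"
        using act_eq_act[OF H(5) False H(1,2)] by blast
      then show ?thesis using sym[of v t u] H by simp
    qed
    then have "\<forall>r. \<exists>a. \<forall>s u. s \<in> W (Suc k) \<longrightarrow> u \<in> {1, 2, 3} \<longrightarrow> r = act u s \<longrightarrow> a = c u s"
      by metis
    from choice[OF this] show ?thesis by blast
  qed
  then obtain g where g: "\<And>s u. s \<in> W (Suc k) \<Longrightarrow> u \<in> {1, 2, 3} \<Longrightarrow> g (act u s) = c u s" by blast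
  have gG: "g r \<in> G 0" if r: "r \<in> W (Suc (Suc k))" for r
  proof -
    from r obtain u s where "u \<in> {1, 2, 3}" "s \<in> W (Suc k)" "r = act u s" by (rule W_Suc_cases)
    then show ?thesis using g c by simp
  qed
  show "\<exists>g \<omega>. (\<forall>s\<in>W (Suc (Suc k)). g s \<in> G 0) \<and> (\<forall>s\<in>W (Suc k). \<forall>u. \<omega> s u \<in> G 0) \<and>
      (\<forall>s\<in>W (Suc k). x s = Bw g s \<oplus> lin g1 n1 (\<omega> s))"
    by (rule exI[of _ g], rule exI[of _ \<omega>]) (use gG \<omega> xc g in \<open>auto simp: Bw_def\<close>)
qed

text \<open>The alternating sum of the three components of \<open>f\<close> at the words \<open>3 v\<close>,
  \<open>2 v\<close>, \<open>1 v\<close> vanishes on the image of \<open>Bw\<close>; it determines \<open>y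
  v\<close>. After \<open>Cw y\<close> is subtracted, the integrability condition holds, and
  \<open>c\<close> is the solution normalised by \<open>c\<^sub>1 = 0\<close>: the equations for the pairs
  \<open>(1, 2)\<close>, \<open>(1, 3)\<close> define \<open>c\<^sub>2\<close>, \<open>c\<^sub>3\<close> at
  the words that contain 1, and the one for \<open>(2, 3)\<close> defines \<open>c\<^sub>3\<close> at the
  remaining words that contain 2.\<close>

lemma Bw_Cw_surj:
  assumes f: "\<And>w. w \<in> W k \<Longrightarrow> f w \<in> G 2"
  shows "\<exists>x y \<tau>. (\<forall>s\<in>W (Suc k). x s \<in> G 1) \<and> (\<forall>k' v. k = Suc k' \<longrightarrow> v \<in> W k' \<longrightarrow> y v \<in> G 0) \<and>
    (\<forall>w\<in>W k. \<forall>u. \<tau> w u \<in> G 0) \<and>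
    (\<forall>w\<in>W k. f w = Bw x w \<oplus> (Cw y w \<oplus> lin g2 n2 (\<tau> w)))"
proof -
  obtain f12 f13 f23 :: "nat list \<Rightarrow> 'a" and \<tau> where
    fc: "\<And>s. s \<in> W k \<Longrightarrow> f12 s \<in> G 0" "\<And>s. s \<in> W k \<Longrightarrow> f13 s \<in> G 0" "\<And>s. s \<in> W k \<Longrightarrow> f23 s \<in> G 0"
    and \<tau>: "\<And>s u. s \<in> W k \<Longrightarrow> \<tau> s u \<in> G 0"
    and ff: "\<And>s. s \<in> W k \<Longrightarrow> f s = (e 1 \<otimes> e 2 \<otimes> f12 s \<oplus> (e 1 \<otimes> e 3 \<otimes> f13 s \<oplus> e 2 \<otimes> e 3 \<otimes> f23 s)) \<oplus> lin g2 n2 (\<tau> s)"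
    using coords2[of "W k" f, OF f] by blast
  \<comment> \<open>the alternating sum that is forced by the vanishing on the image of \<open>Bw\<close>\<close>
  define y where "y = (\<lambda>v. f12 (act 3 v) \<ominus> f13 (act 2 v) \<oplus> f23 (act 1 v))"
  have y: "y v \<in> G 0" if "k = Suc k'" "v \<in> W k'" for k' v
    unfolding y_def using that act_W[OF that(2)] by (intro G_add G_diff fc) auto
  have d: "drp u y w \<in> G 0" if "w \<in> W k" for u w
    by (rule drp_mem[OF that y G_zero])
  define h12 where "h12 = (\<lambda>w. f12 w \<ominus> drp 3 y w)"
  define h13 where "h13 = (\<lambda>w. f13 w \<ominus> drp 2 y w)"
  define h23 where "h23 = (\<lambda>w. f23 w \<ominus> drp 1 y w)"
  have h: "h12 w \<in> G 0" "h13 w \<in> G 0" "h23 w \<in> G 0" if "w \<in> W k" for w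
    using that by (auto simp: h12_def h13_def h23_def intro!: G_diff fc d)
  \<comment> \<open>the remaining integrability condition, which makes the third equation follow at words with a letter 1\<close>
  have cocycle: "h13 (act 2 v) \<ominus> h12 (act 3 v) = h23 (act 1 v)" if k: "k = Suc k'" and v: "v \<in> W k'" for k' v
  proof -
    have a: "act u v \<in> W k" if "u \<in> {1, 2, 3}" for u using act_W[OF v that] k by simp
    have c: "f12 (act 3 v) \<in> carrier A" "f13 (act 2 v) \<in> carrier A" "f23 (act 1 v) \<in> carrier A"
      using a by (auto intro!: Gc[OF fc(1)] Gc[OF fc(2)] Gc[OF fc(3)])
    have "(q \<ominus> (p \<ominus> q \<oplus> r)) \<ominus> (p \<ominus> (p \<ominus> q \<oplus> r)) = r \<ominus> (p \<ominus> q \<oplus> r)"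
      if "p \<in> carrier A" "q \<in> carrier A" "r \<in> carrier A" for p q r
      using that by algebra
    then show ?thesis
      unfolding h12_def h13_def h23_def drp_act[OF v] unfolding y_def using c by blast
  qed
  define c :: "nat \<Rightarrow> nat list \<Rightarrow> 'a" where
    "c = (\<lambda>u s. if u = 2 \<and> 1 \<in> set s then h12 (remove1 1 s)
      else if u = 3 \<and> 1 \<in> set s then h13 (remove1 1 s)
      else if u = 3 \<and> 2 \<in> set s then h23 (remove1 2 s) else \<zero>)"
  have c: "c u s \<in> G 0" if s: "s \<in> W (Suc k)" for u s
  proof -
    have "remove1 t s \<in> W k" if "t \<in> set s" for t using remove_W[OF s that] by (metis Suc_inject)
    then show ?thesis using h G_zero by (auto simp: c_def)
  qed
  define x where "x = (\<lambda>s. (e 1 \<otimes> c 1 s \<oplus> (e 2 \<otimes> c 2 s \<oplus> e 3 \<otimes> c 3 s)) \<oplus> lin g1 n1 (\<lambda>_. \<zero>))"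
  have x: "x s \<in> G 1" if "s \<in> W (Suc k)" for s
    unfolding x_def by (intro G_add G_mult0 e_deg c that lin_deg g1_deg G_zero) auto
  have E: "c 2 (act 1 w) \<ominus> c 1 (act 2 w) = h12 w \<and> c 3 (act 1 w) \<ominus> c 1 (act 3 w) = h13 w \<and>
    c 3 (act 2 w) \<ominus> c 2 (act 3 w) = h23 w" if w: "w \<in> W k" for w
  proof -
    note hc = h[OF w, THEN Gc]
    have r: "remove1 u (act u w) = w" for u by (rule remove_act[OF w])
    have "c 3 (act 2 w) \<ominus> c 2 (act 3 w) = h23 w"
    proof (cases "1 \<in> set w")
      case True
      then obtain k' where k': "k = Suc k'" "remove1 1 w \<in> W k'" "act 1 (remove1 1 w) = w"
        using remove_W[OF w] by metis
      have "remove1 1 (act 2 w) = act 2 (remove1 1 w)" "remove1 1 (act 3 w) = act 3 (remove1 1 w)"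
        using True by (auto intro!: remove_act_other[OF w, simplified])
      then show ?thesis using cocycle[OF k'(1,2)] True k'(3) by (simp add: c_def)
    next
      case False
      then show ?thesis using hc r by (simp add: c_def a_minus_def)
    qed
    then show ?thesis using hc r by (simp add: c_def a_minus_def)
  qed
  have fin: "f w = Bw x w \<oplus> (Cw y w \<oplus> lin g2 n2 (\<tau> w))" if w: "w \<in> W k" for w
  proof -
    note hc = h[OF w, THEN Gc] and dc = d[OF w, THEN Gc]
    have l: "lin g2 n2 (\<tau> w) \<in> carrier A" using \<tau>[OF w] gen_closed Gc by (intro lin_closed) blast+
    have "Bw x w = e 1 \<otimes> e 2 \<otimes> h12 w \<oplus> (e 1 \<otimes> e 3 \<otimes> h13 w \<oplus> e 2 \<otimes> e 3 \<otimes> h23 w)"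
      unfolding x_def using E[OF w] c G_zero by (subst Bw_coord[OF w]) auto
    moreover have "\<dots> \<oplus> Cw y w =
        e 1 \<otimes> e 2 \<otimes> (h12 w \<oplus> drp 3 y w) \<oplus> (e 1 \<otimes> e 3 \<otimes> (h13 w \<oplus> drp 2 y w) \<oplus> e 2 \<otimes> e 3 \<otimes> (h23 w \<oplus> drp 1 y w))"
      unfolding Cw_def using hc dc by (intro three_distr) auto
    moreover have "h12 w \<oplus> drp 3 y w = f12 w" "h13 w \<oplus> drp 2 y w = f13 w" "h23 w \<oplus> drp 1 y w = f23 w"
      using fc[OF w, THEN Gc] dc by (auto simp: h12_def h13_def h23_def a_minus_def a_assoc l_neg)
    ultimately have "Bw x w \<oplus> Cw y w = e 1 \<otimes> e 2 \<otimes> f12 w \<oplus> (e 1 \<otimes> e 3 \<otimes> f13 w \<oplus> e 2 \<otimes> e 3 \<otimes> f23 w)"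
      by simp
    then show ?thesis
      using ff[OF w] l Bw_closed[OF w Gc[OF x]] Cw_closed[OF w Gc[OF y]] by (simp add: a_assoc[symmetric])
  qed
  show ?thesis
    by (rule exI[of _ x], rule exI[of _ y], rule exI[of _ \<tau>]) (use x y \<tau> fin in auto)
qed

end

section \<open>Positions of words and blocks\<close>

text \<open>A nonempty word in the letters 2 and 3 begins with 2 or consists of letters 3.\<close>

lemma card_W23: "finite {w \<in> W k. set w \<subseteq> {2, 3}} \<and> card {w \<in> W k. set w \<subseteq> {2, 3}} = k + 1"
proof (induction k)
  case 0
  have "{w \<in> W 0. set w \<subseteq> {2, 3}} = {[]}" by (auto simp: W_0)
  then show ?case by simp
next
  case (Suc k)
  let ?V = "\<lambda>k. {w \<in> W k. set w \<subseteq> {2, 3}}"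
  have "?V (Suc k) = (#) 2 ` ?V k \<union> {replicate (Suc k) 3}"
  proof (intro equalityI subsetI)
    fix w assume w: "w \<in> ?V (Suc k)"
    then obtain u v where uv: "w = u # v" by (cases w) (auto simp: W_def)
    show "w \<in> (#) 2 ` ?V k \<union> {replicate (Suc k) 3}"
    proof (cases "u = 2")
      case True
      then show ?thesis using w uv by (auto simp: W_def)
    next
      case False
      then have "\<forall>x\<in>set w. x = 3" using w uv by (auto simp: W_def; force)
      moreover have "length w = Suc k" using w by (simp add: W_def)
      ultimately have "w = replicate (Suc k) 3" by (metis replicate_eqI)
      then show ?thesis by simp
    qed
  next
    fix w assume "w \<in> (#) 2 ` ?V k \<union> {replicate (Suc k) 3}"
    moreover have "replicate (Suc k) 3 \<in> ?V (Suc k)"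
      by (auto simp: W_def sorted_replicate simp del: replicate_Suc)
    moreover have "2 # v \<in> ?V (Suc k)" if "v \<in> ?V k" for v
      using that by (fastforce simp: W_def)
    ultimately show "w \<in> ?V (Suc k)" by blast
  qed
  moreover have "replicate (Suc k) 3 \<notin> (#) 2 ` ?V k" by auto
  ultimately show ?case using Suc by (simp add: card_image)
qed

lemma bnum_0: "bnum 0 = 1"
  by (simp add: bnum_def choose_two)

lemma card_W: "finite (W k) \<and> card (W k) = bnum k"
proof (induction k)
  case 0
  then show ?case by (simp add: W_0 bnum_def choose_two)
next
  case (Suc k)
  let ?V = "\<lambda>k. {w \<in> W k. set w \<subseteq> {2, 3}}"
  have "W (Suc k) = (#) 1 ` W k \<union> ?V (Suc k)"
  proof (intro equalityI subsetI)
    fix w assume w: "w \<in> W (Suc k)"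
    then obtain u v where uv: "w = u # v" by (cases w) (auto simp: W_def)
    show "w \<in> (#) 1 ` W k \<union> ?V (Suc k)"
    proof (cases "u = 1")
      case True
      then show ?thesis using w uv by (auto simp: W_def)
    next
      case False
      then have "\<forall>x\<in>set w. x \<in> {2, 3}" using w uv by (fastforce simp: W_def)
      then show ?thesis using w by auto
    qed
  qed (fastforce simp: W_def)
  moreover have "(#) 1 ` W k \<inter> ?V (Suc k) = {}" by auto
  moreover have "finite (?V (Suc k))" "card (?V (Suc k)) = k + 2"
    using card_W23[of "Suc k"] by auto
  moreover have "finite ((#) 1 ` W k)" "card ((#) 1 ` W k) = bnum k"
    using Suc by (auto simp: card_image)
  ultimately have "finite (W (Suc k))" "card (W (Suc k)) = bnum k + (k + 2)"
    by (metis finite_UnI, metis card_Un_disjoint)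
  then show ?case by (simp add: bnum_def numeral_2_eq_2)
qed

lemma set_words: "set (words k) = W k"
proof -
  have "list_all2 (\<lambda>x ys. x \<in> set ys) w (replicate k [1, 2, 3]) \<longleftrightarrow> length w = k \<and> set w \<subseteq> {1, 2, 3::nat}" for w
  proof (induction k arbitrary: w)
    case (Suc k)
    then show ?case by (cases w) auto
  qed auto
  then show ?thesis by (auto simp: words_def product_lists_set W_def)
qed

lemma distinct_words: "distinct (words k)"
  unfolding words_def by (intro distinct_filter distinct_product_lists) auto

lemma length_words: "length (words k) = bnum k"
  using distinct_card[OF distinct_words[of k]] card_W by (simp add: set_words)

text \<open>The position of a word in the lexicographic list, which numbers the rows and columns of
  \<open>\<beta>\<close> and \<open>\<beta>'\<close>.\<close>

definition pos :: "nat list \<Rightarrow> nat" where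
  "pos w = inv_into {..<bnum (length w)} ((!) (words (length w))) w"

lemma bij_words: "bij_betw ((!) (words k)) {..<bnum k} (W k)"
  using bij_betw_nth[OF distinct_words] by (metis length_words set_words)

lemma W_length: "w \<in> W k \<Longrightarrow> length w = k" by (simp add: W_def)

lemma bij_pos: "bij_betw pos (W k) {..<bnum k}"
proof -
  have "bij_betw (inv_into {..<bnum k} ((!) (words k))) (W k) {..<bnum k}"
    by (rule bij_betw_inv_into[OF bij_words])
  then show ?thesis
    by (rule bij_betw_cong[THEN iffD1, rotated]) (simp add: pos_def W_length)
qed

lemma words_pos: "w \<in> W k \<Longrightarrow> words k ! pos w = w"
  using bij_betw_inv_into_right[OF bij_words] by (simp add: pos_def W_length)

lemma pos_less: "w \<in> W k \<Longrightarrow> pos w < bnum k"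
  using bij_betwE[OF bij_pos] by blast

lemma words_W: "j < bnum k \<Longrightarrow> words k ! j \<in> W k"
  using bij_betwE[OF bij_words] by blast

lemma pos_words: "j < bnum k \<Longrightarrow> pos (words k ! j) = j"
  using bij_betw_inv_into_left[OF bij_words, of j k] W_length[OF words_W, of j k] by (simp add: pos_def)

lemma words_eq_iff: "j < bnum k \<Longrightarrow> w \<in> W k \<Longrightarrow> words k ! j = w \<longleftrightarrow> j = pos w"
  using words_pos pos_words by metis

text \<open>The number of rows before block \<open>m\<close> if the blocks have the sizes
  \<open>ds\<close>.\<close>

definition off :: "nat list \<Rightarrow> nat \<Rightarrow> nat" where
  "off ds m = sum_list (take m ds)"

lemma off_Suc: "m < length ds \<Longrightarrow> off ds (Suc m) = off ds m + ds ! m"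
  by (simp add: off_def take_Suc_conv_app_nth)

lemma off_mono: "m \<le> m' \<Longrightarrow> off ds m \<le> off ds m'"
proof (induction rule: dec_induct)
  case (step n)
  then show ?case
    by (cases "n < length ds") (auto simp: off_Suc, simp add: off_def)
qed simp

lemma off_less:
  assumes "m < length ds" "j < ds ! m"
  shows "off ds m + j < sum_list ds" "m < m' \<Longrightarrow> off ds m + j < off ds m'"
proof -
  have *: "off ds m + j < off ds (Suc m)" using assms by (simp add: off_Suc)
  show "m < m' \<Longrightarrow> off ds m + j < off ds m'" using * off_mono[of "Suc m" m' ds] by simp
  have "off ds (Suc m) \<le> off ds (length ds)" using assms by (intro off_mono) simp
  then show "off ds m + j < sum_list ds" using * by (simp add: off_def)
qed

lemma bij_off: "bij_betw (\<lambda>(m, j). off ds m + j) (SIGMA m:{..<length ds}. {..<ds ! m}) {..<sum_list ds}"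
proof -
  have inj: "inj_on (\<lambda>(m, j). off ds m + j) (SIGMA m:{..<length ds}. {..<ds ! m})"
  proof (rule inj_onI, clarsimp)
    fix m j m' j' assume *: "m < length ds" "j < ds ! m" "m' < length ds" "j' < ds ! m'"
      "off ds m + j = off ds m' + j'"
    have "m = m'" using off_less(2)[OF *(1,2), of m'] off_less(2)[OF *(3,4), of m] *(5)
      by (metis add_leD1 leD le_add1 linorder_neqE_nat)
    then show "m = m' \<and> j = j'" using *(5) by simp
  qed
  have "card (SIGMA m:{..<length ds}. {..<ds ! m}) = sum_list ds"
    by (simp add: sum_list_sum_nth atLeast0LessThan)
  then have "(\<lambda>(m, j). off ds m + j) ` (SIGMA m:{..<length ds}. {..<ds ! m}) = {..<sum_list ds}"
    using card_image[OF inj] off_less(1) by (intro card_subset_eq) auto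
  with inj show ?thesis by (simp add: bij_betw_def)
qed

text \<open>A list \<open>D\<close> of degrees describes the blocks of a matrix: block \<open>m\<close> has
  one row for each word of length \<open>D ! m\<close>. The rows are labelled by pairs of a block number and
  a word, \<open>idx D\<close> turns a label into a row number, and \<open>tb D\<close> is the total number
  of rows.\<close>

definition lab :: "nat list \<Rightarrow> (nat \<times> nat list) set" where
  "lab D = (SIGMA m:{..<length D}. W (D ! m))"

definition idx :: "nat list \<Rightarrow> nat \<times> nat list \<Rightarrow> nat" where
  "idx D = (\<lambda>(m, w). off (map bnum D) m + pos w)"

definition tb :: "nat list \<Rightarrow> nat" where
  "tb D = sum_list (map bnum D)"

lemma bij_idx: "bij_betw (idx D) (lab D) {..<tb D}"
proof -
  have "bij_betw (\<lambda>(m, w). (m, pos w)) (lab D) (SIGMA m:{..<length (map bnum D)}. {..<map bnum D ! m})"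
    unfolding lab_def bij_betw_def
  proof (intro conjI inj_onI equalityI subsetI)
    fix p q assume "p \<in> (SIGMA m:{..<length D}. W (D ! m))" "q \<in> (SIGMA m:{..<length D}. W (D ! m))"
      "(case p of (m, w) \<Rightarrow> (m, pos w)) = (case q of (m, w) \<Rightarrow> (m, pos w))"
    then show "p = q" using words_pos by (auto; metis)
  next
    fix p assume "p \<in> (SIGMA m:{..<length (map bnum D)}. {..<map bnum D ! m})"
    then obtain m j where p: "p = (m, j)" "m < length D" "j < bnum (D ! m)" by auto
    then show "p \<in> (\<lambda>(m, w). (m, pos w)) ` (SIGMA m:{..<length D}. W (D ! m))"
      by (intro image_eqI[of _ _ "(m, words (D ! m) ! j)"]) (auto simp: pos_words words_W)
  qed (auto simp: pos_less)
  note bij_betw_trans[OF this bij_off]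
  moreover have "(\<lambda>(m, j). off (map bnum D) m + j) \<circ> (\<lambda>(m, w). (m, pos w)) = idx D"
    by (auto simp: idx_def fun_eq_iff)
  ultimately show ?thesis by (simp add: tb_def)
qed

lemma idx_less: "l \<in> lab D \<Longrightarrow> idx D l < tb D"
  using bij_betwE[OF bij_idx] by blast

lemma idx_surj:
  assumes "j < tb D" obtains l where "l \<in> lab D" "j = idx D l"
  using assms bij_betw_imp_surj_on[OF bij_idx[of D]] by (metis imageE lessThan_iff)

lemma lab_iff: "(m, w) \<in> lab D \<longleftrightarrow> m < length D \<and> w \<in> W (D ! m)"
  by (auto simp: lab_def)

lemma tb_append: "tb (D @ D') = tb D + tb D'" by (simp add: tb_def)

lemma tb_zeros: "tb (replicate d 0) = d" by (simp add: tb_def bnum_0 sum_list_replicate)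

lemma idx_append: "m < length D \<Longrightarrow> idx (D @ D') (m, w) = idx D (m, w)"
  by (simp add: idx_def off_def)

lemma idx_zeros: "r < d \<Longrightarrow> idx (D @ replicate d 0) (length D + r, []) = tb D + r"
proof -
  assume r: "r < d"
  have "pos [] = 0" using pos_less[of "[]" 0] by (simp add: W_0 bnum_0)
  then show ?thesis using r by (simp add: idx_def off_def tb_def take_replicate min_def bnum_0 sum_list_replicate)
qed

lemma lab_append_zeros:
  assumes "(m, w) \<in> lab (D @ replicate d 0)"
  obtains "(m, w) \<in> lab D" | r where "r < d" "m = length D + r" "w = []"
proof (cases "m < length D")
  case True
  then show ?thesis using assms that(1) by (simp add: lab_iff nth_append)
next
  case False
  then show ?thesis using assms that(2)[of "m - length D"] by (auto simp: lab_iff nth_append W_0)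
qed

lemma mult_add_less: "i < t \<Longrightarrow> u < n \<Longrightarrow> i * n + u < t * (n::nat)"
proof -
  assume "i < t" "u < n"
  then have "i * n + u < Suc i * n" "Suc i * n \<le> t * n" by (simp, intro mult_le_mono1) simp
  then show ?thesis by simp
qed

text \<open>A vector can be prescribed by its values at the labels of one list, followed by \<open>n\<close>
  values for each label of a second list. This is the shape of the columns of
  \<open>\<alpha>\<^sub>k\<close> and of \<open>\<alpha>'\<^sub>k\<close>.\<close>

lemma idx_glue:
  assumes F: "\<And>l. l \<in> lab D1 \<Longrightarrow> F l \<in> H" and K: "\<And>l u. l \<in> lab D2 \<Longrightarrow> u < n \<Longrightarrow> K l u \<in> H" and o: "o' \<in> H"
  shows "\<exists>X. (\<forall>j. X j \<in> H) \<and> (\<forall>l\<in>lab D1. X (idx D1 l) = F l) \<and>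
    (\<forall>l\<in>lab D2. \<forall>u<n. X (tb D1 + idx D2 l * n + u) = K l u)"
proof -
  let ?i = "\<lambda>D. inv_into (lab D) (idx D)"
  define X where "X = (\<lambda>j. if j < tb D1 then F (?i D1 j)
    else if n > 0 \<and> (j - tb D1) div n < tb D2 then K (?i D2 ((j - tb D1) div n)) ((j - tb D1) mod n) else o')"
  have inv: "?i D (idx D l) = l" if "l \<in> lab D" for D l
    using that bij_idx by (metis bij_betw_inv_into_left)
  have inv': "?i D j \<in> lab D" if "j < tb D" for D j
    using that bij_betwE[OF bij_betw_inv_into[OF bij_idx]] by blast
  show ?thesis
  proof (rule exI[of _ X], intro conjI allI ballI impI)
    show "X j \<in> H" for j using F K o inv' by (auto simp: X_def)
    show "X (idx D1 l) = F l" if "l \<in> lab D1" for l using that by (simp add: X_def idx_less inv)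
    show "X (tb D1 + idx D2 l * n + u) = K l u" if "l \<in> lab D2" "u < n" for l u
      using that by (simp add: X_def idx_less inv)
  qed
qed

section \<open>Exactness of the blocks\<close>

context class_T_algebra
begin

text \<open>The ideal of elements of positive degree.\<close>

definition Ap :: "'a set" where
  "Ap = {x1 \<oplus> (x2 \<oplus> x3) | x1 x2 x3. x1 \<in> G 1 \<and> x2 \<in> G 2 \<and> x3 \<in> G 3}"

lemma Ap_G: "x \<in> G i \<Longrightarrow> i \<in> {1, 2, 3} \<Longrightarrow> x \<in> Ap"
proof -
  assume x: "x \<in> G i" "i \<in> {1, 2, 3}"
  note c = Gc[OF x(1)] and z = G_zero
  from x consider "x \<in> G 1" | "x \<in> G 2" | "x \<in> G 3" by auto
  then show ?thesis
  proof cases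
    case 1
    then show ?thesis unfolding Ap_def using z[of 2] z[of 3] c
      by (intro CollectI exI[of _ x] exI[of _ \<zero>]) auto
  next
    case 2
    then show ?thesis unfolding Ap_def using z[of 1] z[of 3] c
      by (intro CollectI exI[of _ \<zero>] exI[of _ x]) auto
  next
    case 3
    then show ?thesis unfolding Ap_def using z[of 1] z[of 2] c
      by (intro CollectI exI[of _ \<zero>] exI[of _ \<zero>] exI[of _ x]) auto
  qed
qed

lemma Ap_closed: "x \<in> Ap \<Longrightarrow> x \<in> carrier A"
  by (auto simp: Ap_def intro!: a_closed intro: Gc)

lemma Ap_add: assumes "x \<in> Ap" "y \<in> Ap" shows "x \<oplus> y \<in> Ap"
proof -
  obtain x1 x2 x3 where x: "x1 \<in> G 1" "x2 \<in> G 2" "x3 \<in> G 3" "x = x1 \<oplus> (x2 \<oplus> x3)"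
    using assms(1) by (auto simp: Ap_def)
  obtain y1 y2 y3 where y: "y1 \<in> G 1" "y2 \<in> G 2" "y3 \<in> G 3" "y = y1 \<oplus> (y2 \<oplus> y3)"
    using assms(2) by (auto simp: Ap_def)
  have "x \<oplus> y = (x1 \<oplus> y1) \<oplus> ((x2 \<oplus> y2) \<oplus> (x3 \<oplus> y3))"
    using x y by (simp add: Gc a_ac)
  then show ?thesis unfolding Ap_def using x y G_add by blast
qed

lemma Ap_decomp: "x \<in> carrier A \<Longrightarrow> \<exists>x0\<in>G 0. \<exists>xp\<in>Ap. x = x0 \<oplus> xp"
  using G_decomp[of x] unfolding Ap_def by blast

lemma mult_Ap:
  assumes y: "y \<in> G i" "i \<in> {1, 2, 3}" and x: "x \<in> carrier A"
  shows "y \<otimes> x \<in> Ap"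
proof -
  obtain x0 x1 x2 x3 where d: "x0 \<in> G 0" "x1 \<in> G 1" "x2 \<in> G 2" "x3 \<in> G 3" "x = x0 \<oplus> (x1 \<oplus> (x2 \<oplus> x3))"
    using G_decomp[OF x] by blast
  have yc: "y \<in> carrier A" using y Gc by blast
  have "y \<otimes> x = y \<otimes> x0 \<oplus> (y \<otimes> x1 \<oplus> (y \<otimes> x2 \<oplus> y \<otimes> x3))"
    using d yc by (simp add: Gc r_distr)
  moreover have "y \<otimes> x0 \<in> Ap" using G_mult0[OF y(1) d(1)] y(2) by (rule Ap_G)
  moreover have "y \<otimes> x2 = \<zero>" "y \<otimes> x3 = \<zero>"
    using G_null[OF y(1) d(3) y(2)] G_null[OF y(1) d(4) y(2)] by auto
  moreover have "y \<otimes> x1 \<in> Ap"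
  proof (cases "i = 1")
    case True
    then show ?thesis using G_mult11[of y x1] y d Ap_G[of _ 2] by simp
  next
    case False
    then show ?thesis using G_null[OF y(1) d(2) y(2)] Ap_G[OF G_zero, of 1] by simp
  qed
  ultimately show ?thesis using Ap_add Ap_closed by simp
qed

lemma null_Ap:
  assumes y: "y \<in> G i" "i \<in> {2, 3}" and x: "x \<in> Ap"
  shows "y \<otimes> x = \<zero>"
proof -
  obtain x1 x2 x3 where d: "x1 \<in> G 1" "x2 \<in> G 2" "x3 \<in> G 3" "x = x1 \<oplus> (x2 \<oplus> x3)"
    using x by (auto simp: Ap_def)
  have "y \<otimes> x1 = \<zero>" "y \<otimes> x2 = \<zero>" "y \<otimes> x3 = \<zero>"
    by (rule G_null[OF y(1) d(1)] G_null[OF y(1) d(2)] G_null[OF y(1) d(3)]; use y(2) in auto)+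
  then show ?thesis using d Gc[OF y(1)] by (simp add: Gc r_distr)
qed

lemma null_g1: assumes u: "u < n1" and x: "x \<in> Ap" shows "g1 u \<otimes> x = \<zero>"
proof -
  obtain x1 x2 x3 where d: "x1 \<in> G 1" "x2 \<in> G 2" "x3 \<in> G 3" "x = x1 \<oplus> (x2 \<oplus> x3)"
    using x by (auto simp: Ap_def)
  have "g1 u \<otimes> x1 = \<zero>" "g1 u \<otimes> x2 = \<zero>" "g1 u \<otimes> x3 = \<zero>"
    using u d g1_null G_null[OF g1_deg[OF u]] by auto
  then show ?thesis using d gen_closed(1)[OF u] by (simp add: Gc r_distr)
qed

text \<open>One row of \<open>\<Delta>\<^sub>k\<close>. \<open>D\<close> lists the degrees of the blocks of
  rows and \<open>E\<close> those of the blocks \<open>\<beta>'\<close>. The columns of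
  \<open>\<alpha>\<^sub>k\<close> are the blocks of degrees \<open>map Suc D\<close>, followed by
  \<open>n1\<close> columns for each row, and similarly for \<open>\<alpha>'\<^sub>k\<close> and
  \<open>\<alpha>''\<^sub>k\<close>. In block \<open>m\<close> the words for \<open>Cw\<close> have length
  \<open>D ! m - 1\<close>. They belong to block \<open>m\<close> of \<open>E\<close>, and there are none in
  the blocks of degree 0.\<close>

definition Row :: "nat list \<Rightarrow> nat list \<Rightarrow> (nat \<Rightarrow> 'a) \<Rightarrow> (nat \<Rightarrow> 'a) \<Rightarrow> (nat \<Rightarrow> 'a) \<Rightarrow> nat \<times> nat list \<Rightarrow> 'a" where
  "Row E D X Y T = (\<lambda>(m, w).
    Bw (\<lambda>s. X (idx (map Suc D) (m, s))) w \<oplus>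
    (lin g1 n1 (\<lambda>u. X (tb (map Suc D) + idx D (m, w) * n1 + u)) \<oplus>
    (Cw (\<lambda>v. Y (idx E (m, v))) w \<oplus>
    (lin g2 n2 (\<lambda>u. Y (tb E + idx D (m, w) * n2 + u)) \<oplus>
     lin g3 n3 (\<lambda>u. T (idx D (m, w) * n3 + u))))))"

lemma lin_carrier:
  assumes "\<And>u. w u \<in> carrier A"
  shows "lin g1 n1 w \<in> carrier A" "lin g2 n2 w \<in> carrier A" "lin g3 n3 w \<in> carrier A"
proof -
  show "lin g1 n1 w \<in> carrier A" by (rule lin_closed[OF gen_closed(1) assms])
  show "lin g2 n2 w \<in> carrier A" by (rule lin_closed[OF gen_closed(2) assms])
  show "lin g3 n3 w \<in> carrier A" by (rule lin_closed[OF gen_closed(3) assms])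
qed

lemma lin_Ap:
  assumes "\<And>u. w u \<in> Ap"
  shows "lin g1 n1 w = \<zero>" "lin g2 n2 w = \<zero>" "lin g3 n3 w = \<zero>"
proof -
  show "lin g1 n1 w = \<zero>" by (rule lin_zero, rule null_g1[OF _ assms])
  show "lin g2 n2 w = \<zero>" by (rule lin_zero, rule null_Ap[OF g2_deg _ assms]) auto
  show "lin g3 n3 w = \<zero>" by (rule lin_zero, rule null_Ap[OF g3_deg _ assms]) auto
qed

lemma Cw_Ap: assumes "\<And>v. y v \<in> Ap" shows "Cw y w = \<zero>"
proof -
  have z: "e s \<otimes> e t \<otimes> drp u y w = \<zero>" if "s \<in> {1, 2, 3}" "t \<in> {1, 2, 3}" for s t u
  proof (cases "u \<in> set w")
    case True
    then show ?thesis using null_Ap[OF ee_deg[OF that] _ assms] by (simp add: drp_def)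
  next
    case False
    then show ?thesis using Gc[OF ee_deg[OF that]] by (simp add: drp_def)
  qed
  from z[of 1 2] z[of 1 3] z[of 2 3] show ?thesis unfolding Cw_def by simp
qed

lemma Cw_Nil: "Cw y [] = \<zero>"
  by (simp add: Cw_def drp_def)

lemma lin_in_Ap:
  assumes "\<And>u. w u \<in> carrier A" "\<And>u. u < n \<Longrightarrow> g u \<in> G i" "i \<in> {1, 2, 3}"
  shows "lin g n w \<in> Ap"
  using assms(2)
proof (induction n)
  case 0
  then show ?case using Ap_G[OF G_zero, of 1] by (simp add: lin_def)
next
  case (Suc n)
  have "g n \<in> G i" using Suc.prems by simp
  then have gn: "g n \<otimes> w n \<in> Ap" using assms(1,3) by (intro mult_Ap)
  have "lin g (Suc n) w = g n \<otimes> w n \<oplus> lin g n w"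
    using Suc.prems unfolding lin_def lessThan_Suc
    by (subst finsum_insert) (auto intro!: m_closed Gc[of "g _" i] assms(1))
  then show ?case using Suc gn Ap_add by simp
qed

lemma Bw_Ap: "(\<And>j. X j \<in> carrier A) \<Longrightarrow> Bw (\<lambda>s. X (f s)) w \<in> Ap"
  unfolding Bw_def using e_deg by (intro Ap_add mult_Ap[of _ 1]) auto

lemma Cw_in_Ap: "(\<And>j. X j \<in> carrier A) \<Longrightarrow> Cw (\<lambda>s. X (f s)) w \<in> Ap"
  unfolding Cw_def using ee_deg by (intro Ap_add mult_Ap[of _ 2]) (auto simp: drp_def)

lemma Row_Ap:
  assumes "\<And>j. X j \<in> carrier A" "\<And>j. Y j \<in> carrier A" "\<And>j. T j \<in> carrier A"
  shows "Row E D X Y T l \<in> Ap"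
proof -
  obtain m w where l: "l = (m, w)" by (cases l)
  show ?thesis unfolding l Row_def prod.case
    by (intro Ap_add Bw_Ap Cw_in_Ap lin_in_Ap[of _ _ _ 1, OF _ g1_deg] lin_in_Ap[of _ _ _ 2, OF _ g2_deg]
        lin_in_Ap[of _ _ _ 3, OF _ g3_deg] assms) auto
qed

text \<open>For degree reasons only the compositions \<open>Bw (Bw x)\<close> could be nonzero, and these
  cancel. The columns of \<open>g1\<close> meet values of rows, which have positive degree; at the columns
  of \<open>Y\<close> and \<open>T\<close> positive degree is assumed.\<close>

lemma Row_Row:
  assumes X: "\<And>l. l \<in> lab (map Suc D @ replicate (tb D * n1) 0) \<Longrightarrow>
      X (idx (map Suc D @ replicate (tb D * n1) 0) l) = Row D (map Suc D @ replicate (tb D * n1) 0) X' Y' T' l"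
    and c: "\<And>j. X' j \<in> carrier A" "\<And>j. Y' j \<in> carrier A" "\<And>j. T' j \<in> carrier A"
    and Y: "\<And>j. Y j \<in> Ap" and T: "\<And>j. T j \<in> Ap" and l: "(m, w) \<in> lab D"
  shows "Row E D X Y T (m, w) = \<zero>"
proof -
  let ?D = "map Suc D @ replicate (tb D * n1) 0"
  have w: "w \<in> W (D ! m)" and m: "m < length D" using l by (auto simp: lab_iff)
  have "lin g1 n1 (\<lambda>u. X (tb (map Suc D) + idx D (m, w) * n1 + u)) = \<zero>"
  proof (rule lin_zero)
    fix u assume u: "u < n1"
    have r: "idx D (m, w) * n1 + u < tb D * n1"
      by (rule mult_add_less[OF idx_less[OF l] u])
    then have "X (idx ?D (length (map Suc D) + (idx D (m, w) * n1 + u), [])) \<in> Ap"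
      by (subst X) (auto simp: lab_iff nth_append W_0 intro!: Row_Ap c)
    then have "X (tb (map Suc D) + idx D (m, w) * n1 + u) \<in> Ap"
      using idx_zeros[OF r, of "map Suc D"] by (simp add: add.assoc)
    then show "g1 u \<otimes> X (tb (map Suc D) + idx D (m, w) * n1 + u) = \<zero>" by (rule null_g1[OF u])
  qed
  moreover have "Bw (\<lambda>s. X (idx (map Suc D) (m, s))) w = \<zero>"
  proof -
    let ?B = "Bw (\<lambda>s. X' (idx (map Suc ?D) (m, s)))"
    let ?r = "\<lambda>s. lin g1 n1 (\<lambda>u. X' (tb (map Suc ?D) + idx ?D (m, s) * n1 + u)) \<oplus>
      (Cw (\<lambda>v. Y' (idx D (m, v))) s \<oplus>
      (lin g2 n2 (\<lambda>u. Y' (tb D + idx ?D (m, s) * n2 + u)) \<oplus>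
       lin g3 n3 (\<lambda>u. T' (idx ?D (m, s) * n3 + u))))"
    have Bc: "?B s \<in> carrier A" for s using Bw_Ap[OF c(1)] Ap_closed by blast
    have rc: "?r s \<in> carrier A" for s
      by (intro a_closed lin_carrier c Ap_closed[OF Cw_in_Ap])
    have "Bw (\<lambda>s. X (idx (map Suc D) (m, s))) w = Bw (\<lambda>s. ?B s \<oplus> ?r s) w"
    proof (rule Bw_cong[OF w])
      fix s assume s: "s \<in> W (Suc (D ! m))"
      have "X (idx ?D (m, s)) = Row D ?D X' Y' T' (m, s)"
        using s m by (intro X) (simp add: lab_iff nth_append)
      then show "X (idx (map Suc D) (m, s)) = ?B s \<oplus> ?r s"
        using m by (simp add: Row_def idx_append)
    qed
    also have "\<dots> = Bw ?B w \<oplus> Bw ?r w"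
      by (intro Bw_add[OF w] Bc rc)
    also have "Bw ?B w = \<zero>"
      by (rule Bw_Bw[OF w]) (rule c)
    also have "Bw ?r w = \<zero>"
    proof (rule Bw_null[OF w])
      fix s u assume s: "s \<in> W (Suc (D ! m))" and u: "u \<in> {1, 2, 3::nat}"
      have ec: "e u \<in> carrier A" using e_deg[OF u] Gc by blast
      have "e u \<otimes> lin g1 n1 (\<lambda>u. X' (tb (map Suc ?D) + idx ?D (m, s) * n1 + u)) = \<zero>"
        by (rule mult_lin) (use ec c gen_closed g1_null' e_deg[OF u] in auto)
      moreover have "e u \<otimes> lin g2 n2 (\<lambda>u. Y' (tb D + idx ?D (m, s) * n2 + u)) = \<zero>"
        by (rule mult_lin) (use ec c gen_closed G_null[OF e_deg[OF u] g2_deg] in auto)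
      moreover have "e u \<otimes> lin g3 n3 (\<lambda>u. T' (idx ?D (m, s) * n3 + u)) = \<zero>"
        by (rule mult_lin) (use ec c gen_closed G_null[OF e_deg[OF u] g3_deg] in auto)
      moreover have "e u \<otimes> Cw (\<lambda>v. Y' (idx D (m, v))) s = \<zero>"
        by (rule mult_Cw_null[OF u s]) (rule c)
      ultimately show "e u \<otimes> ?r s = \<zero>"
        by (subst r_distr r_distr r_distr;
            (intro a_closed lin_carrier c Ap_closed[OF Cw_in_Ap] ec)?)+ simp
    qed
    finally show ?thesis by simp
  qed
  ultimately show ?thesis
    unfolding Row_def prod.case using lin_Ap Y T Cw_Ap by simp
qed

text \<open>A family of elements of positive degree is in the image as soon as its part of degree 1 is a
  gradient in each block of positive word degree; in the blocks of degree 0 the part of degree 1 is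
  arbitrary because the row contains a whole basis of \<open>G 1\<close>. The parts of degree 2 and 3 are
  reached by \<open>Bw_Cw_surj\<close> and \<open>g3\<close>.\<close>

lemma Row_image:
  assumes D: "D = map Suc E @ replicate d 0"
    and Z: "\<And>m s. (m, s) \<in> lab D \<Longrightarrow> Z1 m s \<in> G 1 \<and> Z2 m s \<in> G 2 \<and> Z3 m s \<in> G 3"
    and pot: "\<And>m. m < length E \<Longrightarrow> \<exists>g \<omega>. (\<forall>s\<in>W (Suc (D ! m)). g s \<in> G 0) \<and>
      (\<forall>s\<in>W (D ! m). \<forall>u. \<omega> s u \<in> G 0) \<and> (\<forall>s\<in>W (D ! m). Z1 m s = Bw g s \<oplus> lin g1 n1 (\<omega> s))"
  shows "\<exists>X Y T. (\<forall>j. X j \<in> carrier A) \<and> (\<forall>j. Y j \<in> carrier A) \<and> (\<forall>j. T j \<in> carrier A) \<and>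
    (\<forall>m s. (m, s) \<in> lab D \<longrightarrow> Z1 m s \<oplus> (Z2 m s \<oplus> Z3 m s) = Row E D X Y T (m, s))"
proof -
  have "\<exists>g \<omega>. (\<forall>s\<in>W (Suc (D ! m)). g s \<in> G 0) \<and>
      (\<forall>s\<in>W (D ! m). \<forall>u. \<omega> s u \<in> G 0) \<and> (\<forall>s\<in>W (D ! m). Z1 m s = Bw g s \<oplus> lin g1 n1 (\<omega> s))"
    if m: "m < length D" for m
  proof (cases "m < length E")
    case True
    then show ?thesis by (rule pot)
  next
    case False
    with m have D0: "D ! m = 0" by (simp add: D nth_append)
    have "[] \<in> W (D ! m)" by (simp add: D0 W_0)
    with m have "Z1 m [] \<in> G 1" using Z by (simp add: lab_iff)
    from span1[OF this] obtain c1 c2 c3 \<omega> where c: "c1 \<in> G 0" "c2 \<in> G 0" "c3 \<in> G 0" "\<forall>u. \<omega> u \<in> G 0"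
      "Z1 m [] = (e 1 \<otimes> c1 \<oplus> (e 2 \<otimes> c2 \<oplus> e 3 \<otimes> c3)) \<oplus> lin g1 n1 \<omega>"
      unfolding lin_def by blast
    have ac: "act u [] = [u]" for u by (simp add: act_def)
    show ?thesis
      by (rule exI[of _ "\<lambda>s. if s = [1] then c1 else if s = [2] then c2 else c3"], rule exI[of _ "\<lambda>_. \<omega>"])
        (use c in \<open>auto simp: D0 W_0 Bw_def ac\<close>)
  qed
  then have "\<forall>m. \<exists>g \<omega>. m < length D \<longrightarrow> (\<forall>s\<in>W (Suc (D ! m)). g s \<in> G 0) \<and>
      (\<forall>s\<in>W (D ! m). \<forall>u. \<omega> s u \<in> G 0) \<and> (\<forall>s\<in>W (D ! m). Z1 m s = Bw g s \<oplus> lin g1 n1 (\<omega> s))"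
    by blast
  then obtain g \<omega> where g: "\<And>m s. m < length D \<Longrightarrow> s \<in> W (Suc (D ! m)) \<Longrightarrow> g m s \<in> G 0"
    and \<omega>: "\<And>m s u. m < length D \<Longrightarrow> s \<in> W (D ! m) \<Longrightarrow> \<omega> m s u \<in> G 0"
    and Z1: "\<And>m s. m < length D \<Longrightarrow> s \<in> W (D ! m) \<Longrightarrow> Z1 m s = Bw (g m) s \<oplus> lin g1 n1 (\<omega> m s)"
    by metis
  have "\<forall>m. \<exists>x y \<tau>. m < length D \<longrightarrow> (\<forall>s\<in>W (Suc (D ! m)). x s \<in> G 1) \<and>
     (\<forall>k' v. D ! m = Suc k' \<longrightarrow> v \<in> W k' \<longrightarrow> y v \<in> G 0) \<and> (\<forall>w\<in>W (D ! m). \<forall>u. \<tau> w u \<in> G 0) \<and>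
    (\<forall>w\<in>W (D ! m). Z2 m w = Bw x w \<oplus> (Cw y w \<oplus> lin g2 n2 (\<tau> w)))"
  proof
    fix m
    show "\<exists>x y \<tau>. m < length D \<longrightarrow> (\<forall>s\<in>W (Suc (D ! m)). x s \<in> G 1) \<and>
     (\<forall>k' v. D ! m = Suc k' \<longrightarrow> v \<in> W k' \<longrightarrow> y v \<in> G 0) \<and> (\<forall>w\<in>W (D ! m). \<forall>u. \<tau> w u \<in> G 0) \<and>
    (\<forall>w\<in>W (D ! m). Z2 m w = Bw x w \<oplus> (Cw y w \<oplus> lin g2 n2 (\<tau> w)))"
    proof (cases "m < length D")
      case True
      have "Z2 m w \<in> G 2" if "w \<in> W (D ! m)" for w using Z True that by (simp add: lab_iff)
      from Bw_Cw_surj[of "D ! m" "Z2 m", OF this] show ?thesis by blast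
    qed auto
  qed
  from this[THEN choice] obtain x where "\<forall>m. \<exists>y \<tau>. m < length D \<longrightarrow> (\<forall>s\<in>W (Suc (D ! m)). x m s \<in> G 1) \<and>
     (\<forall>k' v. D ! m = Suc k' \<longrightarrow> v \<in> W k' \<longrightarrow> y v \<in> G 0) \<and> (\<forall>w\<in>W (D ! m). \<forall>u. \<tau> w u \<in> G 0) \<and>
    (\<forall>w\<in>W (D ! m). Z2 m w = Bw (x m) w \<oplus> (Cw y w \<oplus> lin g2 n2 (\<tau> w)))" by blast
  from this[THEN choice] obtain y where "\<forall>m. \<exists>\<tau>. m < length D \<longrightarrow> (\<forall>s\<in>W (Suc (D ! m)). x m s \<in> G 1) \<and>
     (\<forall>k' v. D ! m = Suc k' \<longrightarrow> v \<in> W k' \<longrightarrow> y m v \<in> G 0) \<and> (\<forall>w\<in>W (D ! m). \<forall>u. \<tau> w u \<in> G 0) \<and>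
    (\<forall>w\<in>W (D ! m). Z2 m w = Bw (x m) w \<oplus> (Cw (y m) w \<oplus> lin g2 n2 (\<tau> w)))" by blast
  from this[THEN choice] obtain \<tau> where L3: "\<forall>m. m < length D \<longrightarrow> (\<forall>s\<in>W (Suc (D ! m)). x m s \<in> G 1) \<and>
     (\<forall>k' v. D ! m = Suc k' \<longrightarrow> v \<in> W k' \<longrightarrow> y m v \<in> G 0) \<and> (\<forall>w\<in>W (D ! m). \<forall>u. \<tau> m w u \<in> G 0) \<and>
    (\<forall>w\<in>W (D ! m). Z2 m w = Bw (x m) w \<oplus> (Cw (y m) w \<oplus> lin g2 n2 (\<tau> m w)))" by blast
  then have x: "\<And>m s. m < length D \<Longrightarrow> s \<in> W (Suc (D ! m)) \<Longrightarrow> x m s \<in> G 1"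
    and y: "\<And>m k' v. m < length D \<Longrightarrow> D ! m = Suc k' \<Longrightarrow> v \<in> W k' \<Longrightarrow> y m v \<in> G 0"
    and \<tau>: "\<And>m w u. m < length D \<Longrightarrow> w \<in> W (D ! m) \<Longrightarrow> \<tau> m w u \<in> G 0"
    and Z2: "\<And>m w. m < length D \<Longrightarrow> w \<in> W (D ! m) \<Longrightarrow>
      Z2 m w = Bw (x m) w \<oplus> (Cw (y m) w \<oplus> lin g2 n2 (\<tau> m w))" by blast+
  have "\<forall>l\<in>lab D. \<exists>\<sigma>. (\<forall>u. \<sigma> u \<in> G 0) \<and> Z3 (fst l) (snd l) = lin g3 n3 \<sigma>"
    using span3 Z unfolding lin_def by (metis prod.collapse)
  from bchoice[OF this] obtain \<sigma> where \<sigma>: "\<And>l u. l \<in> lab D \<Longrightarrow> \<sigma> l u \<in> G 0"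
    "\<And>l. l \<in> lab D \<Longrightarrow> Z3 (fst l) (snd l) = lin g3 n3 (\<sigma> l)" by blast
  have "\<exists>X. (\<forall>j. X j \<in> carrier A) \<and> (\<forall>l\<in>lab (map Suc D). X (idx (map Suc D) l) = (\<lambda>(m, s). g m s \<oplus> x m s) l) \<and>
    (\<forall>l\<in>lab D. \<forall>u<n1. X (tb (map Suc D) + idx D l * n1 + u) = (\<lambda>(m, s). \<omega> m s) l u)"
    by (rule idx_glue) (auto simp: lab_iff intro!: a_closed Gc[OF g] Gc[OF x] Gc[OF \<omega>])
  then obtain X where X: "\<And>j. X j \<in> carrier A"
    and X1: "\<forall>l\<in>lab (map Suc D). X (idx (map Suc D) l) = (\<lambda>(m, s). g m s \<oplus> x m s) l"
    and X2: "\<forall>l\<in>lab D. \<forall>u<n1. X (tb (map Suc D) + idx D l * n1 + u) = (\<lambda>(m, s). \<omega> m s) l u"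
    by blast
  have "\<exists>Y. (\<forall>j. Y j \<in> carrier A) \<and> (\<forall>l\<in>lab E. Y (idx E l) = (\<lambda>(m, s). y m s) l) \<and>
    (\<forall>l\<in>lab D. \<forall>u<n2. Y (tb E + idx D l * n2 + u) = (\<lambda>(m, s). \<tau> m s) l u)"
    by (rule idx_glue) (auto simp: lab_iff D nth_append intro!: Gc[OF y] Gc[OF \<tau>])
  then obtain Y where Y: "\<And>j. Y j \<in> carrier A"
    and Y1: "\<forall>l\<in>lab E. Y (idx E l) = (\<lambda>(m, s). y m s) l"
    and Y2: "\<forall>l\<in>lab D. \<forall>u<n2. Y (tb E + idx D l * n2 + u) = (\<lambda>(m, s). \<tau> m s) l u"
    by blast
  have "\<exists>T. (\<forall>j. T j \<in> carrier A) \<and> (\<forall>l\<in>lab []. T (idx [] l) = \<zero>) \<and>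
    (\<forall>l\<in>lab D. \<forall>u<n3. T (tb [] + idx D l * n3 + u) = \<sigma> l u)"
    by (rule idx_glue) (auto intro!: Gc[OF \<sigma>(1)])
  then obtain T where T: "\<And>j. T j \<in> carrier A"
    and T2: "\<forall>l\<in>lab D. \<forall>u<n3. T (idx D l * n3 + u) = \<sigma> l u"
    by (auto simp: tb_def)
  have "Z1 m s \<oplus> (Z2 m s \<oplus> Z3 m s) = Row E D X Y T (m, s)" if l: "(m, s) \<in> lab D" for m s
  proof -
    have m: "m < length D" and s: "s \<in> W (D ! m)" using l by (auto simp: lab_iff)
    have B: "Bw (\<lambda>r. X (idx (map Suc D) (m, r))) s = Bw (g m) s \<oplus> Bw (x m) s"
    proof -
      have "Bw (\<lambda>r. X (idx (map Suc D) (m, r))) s = Bw (\<lambda>r. g m r \<oplus> x m r) s"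
        using X1 m by (intro Bw_cong[OF s]) (auto simp: lab_iff)
      also have "\<dots> = Bw (g m) s \<oplus> Bw (x m) s"
        by (intro Bw_add[OF s] Gc[OF g[OF m]] Gc[OF x[OF m]])
      finally show ?thesis .
    qed
    have l1: "lin g1 n1 (\<lambda>u. X (tb (map Suc D) + idx D (m, s) * n1 + u)) = lin g1 n1 (\<omega> m s)"
      by (rule lin_cong[OF gen_closed(1) Gc[OF \<omega>[OF m s]]]) (use X2 l in auto)
    have l2: "lin g2 n2 (\<lambda>u. Y (tb E + idx D (m, s) * n2 + u)) = lin g2 n2 (\<tau> m s)"
      by (rule lin_cong[OF gen_closed(2) Gc[OF \<tau>[OF m s]]]) (use Y2 l in auto)
    have "lin g3 n3 (\<lambda>u. T (idx D (m, s) * n3 + u)) = lin g3 n3 (\<sigma> (m, s))"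
      by (rule lin_cong[OF gen_closed(3) Gc[OF \<sigma>(1)[OF l]]]) (use T2 l in auto)
    then have l3: "lin g3 n3 (\<lambda>u. T (idx D (m, s) * n3 + u)) = Z3 m s"
      using \<sigma>(2)[OF l] by simp
    have C: "Cw (\<lambda>v. Y (idx E (m, v))) s = Cw (y m) s"
    proof (cases "m < length E")
      case True
      then show ?thesis using Y1 by (intro Cw_cong[OF s]) (auto simp: D nth_append lab_iff)
    next
      case False
      then have "s = []" using m s by (simp add: D nth_append W_0)
      then show ?thesis by (simp add: Cw_Nil)
    qed
    have cl: "Bw (g m) s \<in> carrier A" "Bw (x m) s \<in> carrier A" "Cw (y m) s \<in> carrier A"
      "lin g1 n1 (\<omega> m s) \<in> carrier A" "lin g2 n2 (\<tau> m s) \<in> carrier A" "Z3 m s \<in> carrier A"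
      by (rule Bw_closed[OF s Gc[OF g[OF m]]], assumption, rule Bw_closed[OF s Gc[OF x[OF m]]], assumption,
          rule Cw_closed[OF s Gc[OF y[OF m]]], assumption, assumption,
          rule lin_carrier(1)[OF Gc[OF \<omega>[OF m s]]], rule lin_carrier(2)[OF Gc[OF \<tau>[OF m s]]],
          rule Gc, use Z[OF l] in blast)
    show ?thesis
      unfolding Row_def prod.case B l1 l2 l3 C Z1[OF m s] Z2[OF m s] using cl by (simp add: a_ac)
  qed
  then show ?thesis using X Y T by blast
qed

text \<open>The components of degree 1, 2 and 3 of the equation \<open>z\<close> give that all parts of degree 0 vanish and that the
  part of \<open>X\<close> of degree 1 is a gradient in each block of \<open>Bw\<close>, so that \<open>Row_image\<close> applies to \<open>X\<close>. The list
  \<open>map Suc D @ replicate (tb D * n1) 0\<close> describes the rows of the next matrix, which are the columns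
  for \<open>X\<close> in this one.\<close>

lemma Row_kernel:
  assumes D: "D = map Suc E @ replicate d 0"
    and X: "\<And>j. X j \<in> carrier A" and Y: "\<And>j. Y j \<in> carrier A" and T: "\<And>j. T j \<in> carrier A"
    and z: "\<And>l. l \<in> lab D \<Longrightarrow> Row E D X Y T l = \<zero>"
  shows "\<exists>X' Y' T'. (\<forall>j. X' j \<in> carrier A) \<and> (\<forall>j. Y' j \<in> carrier A) \<and> (\<forall>j. T' j \<in> carrier A) \<and>
      (\<forall>l\<in>lab (map Suc D @ replicate (tb D * n1) 0).
        X (idx (map Suc D @ replicate (tb D * n1) 0) l) =
        Row D (map Suc D @ replicate (tb D * n1) 0) X' Y' T' l)" (is ?image)
    and "j < tb E + tb D * n2 \<Longrightarrow> Y j \<in> Ap"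
    and "j < tb D * n3 \<Longrightarrow> T j \<in> Ap"
proof -
  let ?D = "map Suc D @ replicate (tb D * n1) 0"
  have "\<forall>j. \<exists>q. fst q \<in> G 0 \<and> fst (snd q) \<in> G 1 \<and> fst (snd (snd q)) \<in> G 2 \<and> snd (snd (snd q)) \<in> G 3 \<and>
    X j = fst q \<oplus> (fst (snd q) \<oplus> (fst (snd (snd q)) \<oplus> snd (snd (snd q))))"
    using G_decomp[OF X] by (metis fst_conv snd_conv)
  from choice[OF this] obtain q where q: "\<forall>j. fst (q j) \<in> G 0 \<and> fst (snd (q j)) \<in> G 1 \<and>
    fst (snd (snd (q j))) \<in> G 2 \<and> snd (snd (snd (q j))) \<in> G 3 \<and>
    X j = fst (q j) \<oplus> (fst (snd (q j)) \<oplus> (fst (snd (snd (q j))) \<oplus> snd (snd (snd (q j)))))" by blast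
  define X0 X1 X2 X3 where "X0 = (\<lambda>j. fst (q j))" and "X1 = (\<lambda>j. fst (snd (q j)))"
    and "X2 = (\<lambda>j. fst (snd (snd (q j))))" and "X3 = (\<lambda>j. snd (snd (snd (q j))))"
  have X0: "X0 j \<in> G 0" and X1: "X1 j \<in> G 1" and X2: "X2 j \<in> G 2" and X3: "X3 j \<in> G 3"
    and Xj: "X j = X0 j \<oplus> (X1 j \<oplus> (X2 j \<oplus> X3 j))" for j
    using q by (auto simp: X0_def X1_def X2_def X3_def)
  have "\<forall>j. \<exists>a b. a \<in> G 0 \<and> b \<in> Ap \<and> Y j = a \<oplus> b" "\<forall>j. \<exists>a b. a \<in> G 0 \<and> b \<in> Ap \<and> T j = a \<oplus> b"
    using Ap_decomp[OF Y] Ap_decomp[OF T] by metis+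
  then obtain Y0 Yp T0 Tp where Y0: "\<And>j. Y0 j \<in> G 0" and Yp: "\<And>j. Yp j \<in> Ap" and Yj: "\<And>j. Y j = Y0 j \<oplus> Yp j"
    and T0: "\<And>j. T0 j \<in> G 0" and Tp: "\<And>j. Tp j \<in> Ap" and Tj: "\<And>j. T j = T0 j \<oplus> Tp j"
    by metis
  define P where "P = (\<lambda>j. X1 j \<oplus> (X2 j \<oplus> X3 j))"
  have Pp: "P j \<in> Ap" for j unfolding P_def Ap_def using X1 X2 X3 by blast
  note c = Gc[OF X0] Gc[OF X1] Gc[OF X2] Gc[OF X3] Gc[OF Y0] Gc[OF T0] Ap_closed[OF Pp] Ap_closed[OF Yp] Ap_closed[OF Tp]
  have XP: "X j = X0 j \<oplus> P j" for j by (simp add: Xj P_def)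
  let ?x = "\<lambda>X m s. X (idx (map Suc D) (m, s))"
  let ?xt = "\<lambda>X m w u. X (tb (map Suc D) + idx D (m, w) * n1 + u)"
  let ?y = "\<lambda>Y m v. Y (idx E (m, v))"
  let ?yt = "\<lambda>Y m w u. Y (tb E + idx D (m, w) * n2 + u)"
  let ?t = "\<lambda>T m w u. T (idx D (m, w) * n3 + u)"
  \<comment> \<open>the components of degree 1, 2 and 3 of the hypothesis \<open>z\<close>\<close>
  have parts: "Bw (?x X0 m) w \<oplus> lin g1 n1 (?xt X0 m w) = \<zero> \<and>
      Bw (?x X1 m) w \<oplus> (Cw (?y Y0 m) w \<oplus> lin g2 n2 (?yt Y0 m w)) = \<zero> \<and> lin g3 n3 (?t T0 m w) = \<zero>"
    if l: "(m, w) \<in> lab D" for m w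
  proof -
    have w: "w \<in> W (D ! m)" using l by (simp add: lab_iff)
    have B: "Bw (?x X m) w = Bw (?x X0 m) w \<oplus> Bw (?x X1 m) w"
    proof -
      have "Bw (?x X m) w = Bw (\<lambda>s. ?x X0 m s \<oplus> (?x X1 m s \<oplus> (?x X2 m s \<oplus> ?x X3 m s))) w"
        unfolding Xj ..
      also have "\<dots> = Bw (?x X0 m) w \<oplus> (Bw (?x X1 m) w \<oplus> (Bw (?x X2 m) w \<oplus> Bw (?x X3 m) w))"
        by (subst Bw_add[OF w], (intro a_closed c)+, subst Bw_add[OF w], (intro a_closed c)+,
            subst Bw_add[OF w], (intro a_closed c)+, rule refl)
      also have "Bw (?x X2 m) w = \<zero>"
        by (rule Bw_null[OF w], rule G_null[OF e_deg X2]) simp_all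
      also have "Bw (?x X3 m) w = \<zero>"
        by (rule Bw_null[OF w], rule G_null[OF e_deg X3]) simp_all
      moreover have "Bw (?x X0 m) w \<in> carrier A" "Bw (?x X1 m) w \<in> carrier A"
        by (rule Bw_closed[OF w c(1)], rule Bw_closed[OF w c(2)])
      ultimately show ?thesis by simp
    qed
    have l1: "lin g1 n1 (?xt X m w) = lin g1 n1 (?xt X0 m w)"
    proof -
      have "lin g1 n1 (?xt X m w) = lin g1 n1 (?xt X0 m w) \<oplus> lin g1 n1 (?xt P m w)"
        unfolding XP by (rule lin_add) (intro gen_closed c | assumption)+
      then show ?thesis using lin_Ap(1)[of "?xt P m w", OF Pp] lin_carrier(1)[of "?xt X0 m w", OF c(1)] by simp
    qed
    have C: "Cw (?y Y m) w = Cw (?y Y0 m) w"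
    proof -
      have "Cw (?y Y m) w = Cw (?y Y0 m) w \<oplus> Cw (?y Yp m) w"
        unfolding Yj by (rule Cw_add[OF w]) (intro c)+
      moreover have "Cw (?y Y0 m) w \<in> carrier A" by (rule Cw_closed[OF w c(5)])
      ultimately show ?thesis using Cw_Ap[of "?y Yp m" w, OF Yp] by simp
    qed
    have l2: "lin g2 n2 (?yt Y m w) = lin g2 n2 (?yt Y0 m w)"
    proof -
      have "lin g2 n2 (?yt Y m w) = lin g2 n2 (?yt Y0 m w) \<oplus> lin g2 n2 (?yt Yp m w)"
        unfolding Yj by (rule lin_add) (intro gen_closed c | assumption)+
      then show ?thesis using lin_Ap(2)[of "?yt Yp m w", OF Yp] lin_carrier(2)[of "?yt Y0 m w", OF c(5)] by simp
    qed
    have l3: "lin g3 n3 (?t T m w) = lin g3 n3 (?t T0 m w)"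
    proof -
      have "lin g3 n3 (?t T m w) = lin g3 n3 (?t T0 m w) \<oplus> lin g3 n3 (?t Tp m w)"
        unfolding Tj by (rule lin_add) (intro gen_closed c | assumption)+
      then show ?thesis using lin_Ap(3)[of "?t Tp m w", OF Tp] lin_carrier(3)[of "?t T0 m w", OF c(6)] by simp
    qed
    have d1: "Bw (?x X0 m) w \<in> G 1" by (rule Bw_deg0[OF w X0])
    have d1': "lin g1 n1 (?xt X0 m w) \<in> G 1" by (rule lin_deg[OF g1_deg X0])
    have d2: "Bw (?x X1 m) w \<in> G 2" by (rule Bw_deg1[OF w X1])
    have d2': "Cw (?y Y0 m) w \<in> G 2" by (rule Cw_deg[OF w Y0])
    have d2'': "lin g2 n2 (?yt Y0 m w) \<in> G 2" by (rule lin_deg[OF g2_deg Y0])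
    have d3: "lin g3 n3 (?t T0 m w) \<in> G 3" by (rule lin_deg[OF g3_deg T0])
    note cc = d1[THEN Gc] d1'[THEN Gc] d2[THEN Gc] d2'[THEN Gc] d2''[THEN Gc] d3[THEN Gc]
    have "\<zero> = Row E D X Y T (m, w)" using z[OF l] by simp
    also have "\<dots> = \<zero> \<oplus> ((Bw (?x X0 m) w \<oplus> lin g1 n1 (?xt X0 m w)) \<oplus>
      ((Bw (?x X1 m) w \<oplus> (Cw (?y Y0 m) w \<oplus> lin g2 n2 (?yt Y0 m w))) \<oplus> lin g3 n3 (?t T0 m w)))"
      unfolding Row_def prod.case B l1 C l2 l3 using cc by (simp add: a_ac)
    finally have "\<zero> \<oplus> ((Bw (?x X0 m) w \<oplus> lin g1 n1 (?xt X0 m w)) \<oplus>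
      ((Bw (?x X1 m) w \<oplus> (Cw (?y Y0 m) w \<oplus> lin g2 n2 (?yt Y0 m w))) \<oplus> lin g3 n3 (?t T0 m w))) = \<zero>"
      by (rule sym)
    from G_indep[OF G_zero G_add[OF d1 d1'] G_add[OF d2 G_add[OF d2' d2'']] d3 this]
    show ?thesis by blast
  qed
  have blk: "Bw (?x X0 m) w \<oplus> lin g1 n1 (?xt X0 m w) = \<zero>"
      "Bw (?x X1 m) w \<oplus> (Cw (?y Y0 m) w \<oplus> lin g2 n2 (?yt Y0 m w)) = \<zero>" "lin g3 n3 (?t T0 m w) = \<zero>"
    if "m < length D" "w \<in> W (D ! m)" for m w
    using parts that by (auto simp: lab_iff)
  \<comment> \<open>the columns of \<open>g1\<close>, \<open>g2\<close>, \<open>g3\<close> come in groups of \<open>n\<close>, one group for each row\<close>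
  have div: "\<exists>i u. i < t \<and> u < n \<and> r = i * n + u" if "r < t * n" for r t n :: nat
  proof -
    have "0 < n" using that by (cases n) auto
    then show ?thesis using that
      by (intro exI[of _ "r div n"] exI[of _ "r mod n"]) (auto simp: less_mult_imp_div_less)
  qed
  have X0z: "X0 (idx ?D (m, s)) = \<zero>" if l: "(m, s) \<in> lab ?D" for m s
    using l
  proof (cases rule: lab_append_zeros)
    case 1
    then have m: "m < length D" "s \<in> W (Suc (D ! m))" by (auto simp: lab_iff)
    have "?x X0 m s = \<zero>"
      by (rule Bw_indep(1)[OF X0 X0 blk(1)[OF m(1)] m(2)])
    then show ?thesis using m by (simp add: idx_append)
  next
    case (2 r)
    then obtain i u where iu: "i < tb D" "u < n1" "r = i * n1 + u" using div by blast
    then obtain m' w where l: "(m', w) \<in> lab D" "i = idx D (m', w)" by (metis idx_surj surj_pair)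
    then have m: "m' < length D" "w \<in> W (D ! m')" by (auto simp: lab_iff)
    have "?xt X0 m' w u = \<zero>"
      by (rule Bw_indep(2)[OF X0 X0 blk(1)[OF m(1)] m(2) iu(2)])
    then show ?thesis using 2 l iu idx_zeros[OF 2(1), of "map Suc D"] by (simp add: add.assoc)
  qed
  show "Y j \<in> Ap" if j: "j < tb E + tb D * n2" for j
  proof -
    have "Y0 j = \<zero>"
    proof (cases "j < tb E")
      case True
      then obtain m v where l: "(m, v) \<in> lab E" "j = idx E (m, v)" by (metis idx_surj surj_pair)
      then have m: "m < length D" "v \<in> W (E ! m)" "D ! m = Suc (E ! m)"
        by (auto simp: lab_iff D nth_append)
      show ?thesis unfolding l(2)
        by (rule Bw_kernel(1)[OF X1 Y0 Y0 blk(2)[OF m(1)] m(3,2)])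
    next
      case False
      then obtain r where r: "j = tb E + r" "r < tb D * n2" using j
        by (metis add_diff_inverse nat_add_left_cancel_less)
      then obtain i u where iu: "i < tb D" "u < n2" "r = i * n2 + u" using div by blast
      then obtain m' w where l: "(m', w) \<in> lab D" "i = idx D (m', w)" by (metis idx_surj surj_pair)
      then have m: "m' < length D" "w \<in> W (D ! m')" by (auto simp: lab_iff)
      have "?yt Y0 m' w u = \<zero>"
        by (rule Bw_kernel(2)[OF X1 Y0 Y0 blk(2)[OF m(1)] m(2) iu(2)])
      then show ?thesis using r iu l by (simp add: add.assoc)
    qed
    then show ?thesis using Yj Yp Ap_closed by simp
  qed
  show "T j \<in> Ap" if j: "j < tb D * n3" for j
  proof -
    obtain i u where iu: "i < tb D" "u < n3" "j = i * n3 + u" using div j by blast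
    then obtain m' w where l: "(m', w) \<in> lab D" "i = idx D (m', w)" by (metis idx_surj surj_pair)
    then have m: "m' < length D" "w \<in> W (D ! m')" by (auto simp: lab_iff)
    have "T0 j = \<zero>" using indep3[of "?t T0 m' w"] T0 blk(3)[OF m] iu l by (simp add: lin_def)
    then show ?thesis using Tj Tp Ap_closed by simp
  qed
  have "\<exists>X' Y' T'. (\<forall>j. X' j \<in> carrier A) \<and> (\<forall>j. Y' j \<in> carrier A) \<and> (\<forall>j. T' j \<in> carrier A) \<and>
    (\<forall>m s. (m, s) \<in> lab ?D \<longrightarrow> X1 (idx ?D (m, s)) \<oplus> (X2 (idx ?D (m, s)) \<oplus> X3 (idx ?D (m, s))) =
      Row D ?D X' Y' T' (m, s))"
  proof (rule Row_image[OF refl])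
    fix m assume m: "m < length D"
    have Dm: "?D ! m = Suc (D ! m)" using m by (simp add: nth_append)
    have "X1 (idx ?D (m, s)) = ?x X1 m s" for s using m by (simp add: idx_append)
    then show "\<exists>g \<omega>. (\<forall>s\<in>W (Suc (?D ! m)). g s \<in> G 0) \<and> (\<forall>s\<in>W (?D ! m). \<forall>u. \<omega> s u \<in> G 0) \<and>
      (\<forall>s\<in>W (?D ! m). X1 (idx ?D (m, s)) = Bw g s \<oplus> lin g1 n1 (\<omega> s))"
      unfolding Dm using Bw_kernel(3)[OF X1 Y0 Y0 blk(2)[OF m]] by presburger
  qed (use X1 X2 X3 in blast)
  then obtain X' Y' T' where *: "\<forall>j. X' j \<in> carrier A" "\<forall>j. Y' j \<in> carrier A" "\<forall>j. T' j \<in> carrier A"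
    "\<And>m s. (m, s) \<in> lab ?D \<Longrightarrow> X1 (idx ?D (m, s)) \<oplus> (X2 (idx ?D (m, s)) \<oplus> X3 (idx ?D (m, s))) =
      Row D ?D X' Y' T' (m, s)" by blast
  have "X (idx ?D l) = Row D ?D X' Y' T' l" if "l \<in> lab ?D" for l
  proof -
    obtain m s where l: "l = (m, s)" by (cases l)
    have "Row D ?D X' Y' T' (m, s) \<in> carrier A" by (intro Ap_closed[OF Row_Ap]) (use *(1-3) in auto)
    then show ?thesis using that X0z[of m s] *(4)[of m s] Xj[of "idx ?D (m, s)"] unfolding l by simp
  qed
  then show ?image using *(1-3) by blast
qed

end

section \<open>Koszul homology of class T\<close>

locale class_T_koszul = noetherian_local_ring R \<mm> for R (structure) and \<mm> +
  fixes xs :: "'a list" and z :: "nat \<Rightarrow> nat \<Rightarrow> nat set \<Rightarrow> 'a"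
  assumes gens: "minimal_generators R \<mm> xs" and cycles: "class_T_cycles R xs z"
begin

sublocale koszul_complex R xs
  by unfold_locales (use gens in \<open>simp add: minimal_generators_def\<close>)

lemma genideal_xs: "genideal R (set xs) = \<mm>"
  using gens by (simp add: minimal_generators_def)

abbreviation rk where "rk \<equiv> homology_rank R xs"
abbreviation HG where "HG \<equiv> homology_deg R xs"

definition const :: "'a \<Rightarrow> nat set \<Rightarrow> 'a" where
  "const r = (\<lambda>S\<in>Pow N. if S = {} then r else \<zero>)"

lemma const_deg: "r \<in> carrier R \<Longrightarrow> const r \<in> deg 0"
  by (rule degI) (auto simp: const_def koszul_carrier)

lemma deg0_const: "f \<in> deg 0 \<Longrightarrow> f = const (f {}) \<and> f {} \<in> carrier R"
proof
  assume f: "f \<in> deg 0"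
  show fc: "f {} \<in> carrier R" using koszul_closed[OF deg_closed[OF f]] by simp
  show "f = const (f {})"
  proof (rule koszul_ext)
    fix S assume S: "S \<subseteq> N"
    show "f S = const (f {}) S"
      using deg_zero[OF f S] S finite_sub[OF S] by (cases "S = {}") (auto simp: const_def)
  qed (use f const_deg[OF fc] deg_closed in blast)+
qed

lemma const_mult:
  assumes r: "r \<in> carrier R" and f: "f \<in> carrier KK" and S: "S \<subseteq> N"
  shows "(const r \<otimes>\<^bsub>KK\<^esub> f) S = r \<otimes> f S" "(f \<otimes>\<^bsub>KK\<^esub> const r) S = r \<otimes> f S"
proof -
  have fS: "f T \<in> carrier R" if "T \<subseteq> S" for T using koszul_closed[OF f] that S by auto
  have c: "const r T = (if T = {} then r else \<zero>)" if "T \<subseteq> S" for T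
    using that S by (auto simp: const_def)
  have "(\<Oplus>T\<in>Pow S. sg T (S - T) \<otimes> (const r T \<otimes> f (S - T))) = sg {} (S - {}) \<otimes> (const r {} \<otimes> f (S - {}))"
    using finite_sub[OF S] r fS by (intro finsum_single) (auto simp: c)
  then show "(const r \<otimes>\<^bsub>KK\<^esub> f) S = r \<otimes> f S"
    unfolding koszul_mult[OF S] using c[of "{}"] fS[of S] r by simp
  have "(\<Oplus>T\<in>Pow S. sg T (S - T) \<otimes> (f T \<otimes> const r (S - T))) = sg S (S - S) \<otimes> (f S \<otimes> const r (S - S))"
  proof (rule finsum_single)
    fix T assume "T \<in> Pow S" "T \<noteq> S"
    then have "S - T \<noteq> {}" "S - T \<subseteq> S" "T \<subseteq> S" by auto
    then show "sg T (S - T) \<otimes> (f T \<otimes> const r (S - T)) = \<zero>" using c[of "S - T"] fS[of T] by simp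
  qed (use finite_sub[OF S] r fS c[of "{}"] in auto)
  then show "(f \<otimes>\<^bsub>KK\<^esub> const r) S = r \<otimes> f S"
    unfolding koszul_mult[OF S] using c[of "{}"] fS[of S] r by (simp add: m_comm)
qed

lemma diff_empty_mem: "f \<in> carrier KK \<Longrightarrow> dd f {} \<in> \<mm>"
proof -
  assume f: "f \<in> carrier KK"
  have xm: "xs ! i \<in> \<mm>" if "i \<in> N" for i
    using genideal_self[OF xs_closed] genideal_xs that by auto
  have "(\<Oplus>i\<in>I. xs ! i \<otimes> contract i f {}) \<in> \<mm>" if "finite I" "I \<subseteq> N" for I
    using that
  proof (induction I)
    case (insert i I)
    have "(\<lambda>i. xs ! i \<otimes> contract i f {}) \<in> insert i I \<rightarrow> carrier R"
      using insert.prems nth_closed contract_closed[OF f] by auto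
    then have "(\<Oplus>i\<in>insert i I. xs ! i \<otimes> contract i f {}) =
        xs ! i \<otimes> contract i f {} \<oplus> (\<Oplus>i\<in>I. xs ! i \<otimes> contract i f {})"
      using insert.hyps by (intro finsum_insert) auto
    moreover have "xs ! i \<otimes> contract i f {} \<in> \<mm>"
      using insert.prems xm contract_closed[OF f] by (intro I_r_closed) auto
    ultimately show ?case using insert by (simp add: a_closed)
  qed simp
  then show ?thesis using diff_apply[OF f, of "{}"] by simp
qed

lemma mem_diff_empty:
  assumes r: "r \<in> \<mm>" obtains f where "f \<in> carrier KK" "dd f {} = r"
proof -
  let ?J = "{dd f {} | f. f \<in> carrier KK}"
  have sub: "?J \<subseteq> carrier R" using koszul_closed[OF diff_closed] by auto
  have "ideal ?J R"
  proof (rule idealI[OF ring_axioms])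
    show "subgroup ?J (add_monoid R)"
    proof (rule group.subgroupI)
      show "group (add_monoid R)" by (rule a_group)
      show "?J \<subseteq> carrier (add_monoid R)" using sub by simp
      show "?J \<noteq> {}" by auto
      fix a assume "a \<in> ?J"
      then obtain f where f: "f \<in> carrier KK" "a = dd f {}" by auto
      have "inv\<^bsub>add_monoid R\<^esub> a = dd (\<ominus>\<^bsub>KK\<^esub> f) {}"
        unfolding a_inv_def[symmetric] using f by (simp add: diff_minus koszul_a_inv diff_closed)
      then show "inv\<^bsub>add_monoid R\<^esub> a \<in> ?J" using f by auto
      fix b assume "b \<in> ?J"
      then obtain g where g: "g \<in> carrier KK" "b = dd g {}" by auto
      have "a \<otimes>\<^bsub>add_monoid R\<^esub> b = dd (f \<oplus>\<^bsub>KK\<^esub> g) {}"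
        using f g by (simp add: diff_add koszul_add)
      then show "a \<otimes>\<^bsub>add_monoid R\<^esub> b \<in> ?J" using f g by auto
    qed
    fix a r assume "a \<in> ?J" and r: "r \<in> carrier R"
    then obtain f where f: "f \<in> carrier KK" "a = dd f {}" by auto
    have c: "const r \<in> carrier KK" using const_deg[OF r] deg_closed by blast
    have t: "twist (const r) = const r" using twist_deg[OF const_deg[OF r]] by simp
    have "dd (const r \<otimes>\<^bsub>KK\<^esub> f) = const r \<otimes>\<^bsub>KK\<^esub> dd f"
      using leibniz[OF c f(1)] diff_deg_0[OF const_deg[OF r]] f(1) c by (simp add: t diff_closed)
    then have "r \<otimes> a = dd (const r \<otimes>\<^bsub>KK\<^esub> f) {}"
      using const_mult(1)[OF r diff_closed[OF f(1)], of "{}"] f(2) by simp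
    then show 1: "r \<otimes> a \<in> ?J" using c f(1) koszul_mult_closed by blast
    have "a \<in> carrier R" using f koszul_closed[OF diff_closed[OF f(1)]] by simp
    then show "a \<otimes> r \<in> ?J" using 1 r by (simp add: m_comm)
  qed
  moreover have "set xs \<subseteq> ?J"
  proof
    fix x assume "x \<in> set xs"
    then obtain i where i: "i \<in> N" "x = xs ! i" by (auto simp: in_set_conv_nth)
    let ?f = "\<lambda>S\<in>Pow N. if S = {i} then \<one> else \<zero>"
    have f: "?f \<in> carrier KK" by (auto simp: koszul_carrier)
    have "dd ?f {} = xs ! i \<otimes> contract i ?f {}"
      unfolding diff_apply[OF f empty_subsetI]
      by (rule finsum_single) (use i nth_closed in \<open>auto simp: contract_def\<close>)
    also have "\<dots> = x" using i nth_closed by (simp add: contract_def)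
    finally show "x \<in> ?J" using f by auto
  qed
  ultimately have "\<mm> \<subseteq> ?J" using genideal_minimal genideal_xs by blast
  then show ?thesis using r that by auto
qed

text \<open>The boundaries of degree 0 are the combinations of the generators \<open>xs\<close> of the
  maximal ideal.\<close>

lemma deg0_boundary_iff: "f \<in> deg 0 \<Longrightarrow> f \<in> BB \<longleftrightarrow> f {} \<in> \<mm>"
proof
  assume "f \<in> BB"
  then show "f {} \<in> \<mm>" using diff_empty_mem by (auto simp: koszul_boundaries_def)
next
  assume f: "f \<in> deg 0" and "f {} \<in> \<mm>"
  then obtain g where g: "g \<in> carrier KK" "dd g {} = f {}" using mem_diff_empty by metis
  have "f = dd (comp 1 g)"
  proof -
    have "dd (comp 1 g) = comp 0 (dd g)" using diff_comp[OF g(1), of 0] by simp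
    also have "\<dots> = const (comp 0 (dd g) {})" using deg0_const[OF comp_deg[OF diff_closed[OF g(1)], of 0]] by simp
    also have "comp 0 (dd g) {} = f {}" using g by (simp add: comp_apply)
    finally show ?thesis using deg0_const[OF f] by simp
  qed
  then show "f \<in> BB" using boundariesI[OF comp_closed[OF g(1)]] by simp
qed

subsection \<open>The grading of the homology\<close>

lemma HG_iff: "x \<in> HG i \<longleftrightarrow> (\<exists>f. f \<in> ZZ \<and> f \<in> deg i \<and> x = hc f)"
  by (auto simp: homology_deg_def)

lemma HG_I: "f \<in> ZZ \<Longrightarrow> f \<in> deg i \<Longrightarrow> hc f \<in> HG i"
  by (auto simp: homology_deg_def)

lemma HG_closed: "HG i \<subseteq> carrier AA"
  by (auto simp: HG_iff)

lemma HG_zero: "\<zero>\<^bsub>AA\<^esub> \<in> HG i"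
  using HG_I[OF zero_cycle zero_deg] by (simp add: hclass_zero)

lemma HG_add: "x \<in> HG i \<Longrightarrow> y \<in> HG i \<Longrightarrow> x \<oplus>\<^bsub>AA\<^esub> y \<in> HG i"
  unfolding HG_iff by (metis hclass_add add_cycle add_deg)

lemma HG_minus: "x \<in> HG i \<Longrightarrow> \<ominus>\<^bsub>AA\<^esub> x \<in> HG i"
  unfolding HG_iff by (metis hclass_minus minus_cycle minus_deg)

lemma HG_mult: "x \<in> HG i \<Longrightarrow> y \<in> HG j \<Longrightarrow> x \<otimes>\<^bsub>AA\<^esub> y \<in> HG (i + j)"
  unfolding HG_iff by (metis hclass_mult cycles_mult mult_deg)

lemma HG_one: "\<one>\<^bsub>AA\<^esub> \<in> HG 0"
  using HG_I[OF deg_0_cycles[OF one_deg] one_deg] by (simp add: hclass_one)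

lemma HG0_cases:
  assumes "x \<in> HG 0" obtains r where "r \<in> carrier R" "x = hc (const r)"
  using assms deg0_const unfolding HG_iff by metis

text \<open>Constants commute with the whole Koszul complex.\<close>

lemma HG0_central:
  assumes c: "c \<in> HG 0" and x: "x \<in> carrier AA"
  shows "c \<otimes>\<^bsub>AA\<^esub> x = x \<otimes>\<^bsub>AA\<^esub> c"
proof -
  obtain r where r: "r \<in> carrier R" "c = hc (const r)" using c by (rule HG0_cases)
  obtain f where f: "f \<in> ZZ" "x = hc f" using x by (auto simp: homology_carrier)
  have rc: "const r \<in> ZZ" using deg_0_cycles[OF const_deg[OF r(1)]] .
  have "const r \<otimes>\<^bsub>KK\<^esub> f = f \<otimes>\<^bsub>KK\<^esub> const r"
    by (rule koszul_ext)
      (use const_mult[OF r(1) cycles_closed[OF f(1)]] cycles_closed[OF f(1)] cycles_closed[OF rc] in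
        \<open>auto intro!: koszul_mult_closed\<close>)
  then show ?thesis using hclass_mult[OF rc f(1)] hclass_mult[OF f(1) rc] r f by simp
qed

text \<open>An element of degree 0 is the class of a constant. If it is not zero, the constant is outside
  the maximal ideal, and an inverse modulo this ideal represents the inverse class.\<close>

lemma HG0_subfield: "subfield (HG 0) AA"
proof (rule A.subfieldI)
  have sr: "subring (HG 0) AA"
    by (rule A.subringI) (use HG_closed HG_one HG_minus HG_add HG_mult[of _ 0 _ 0] in auto)
  show "subcring (HG 0) AA"
  proof (rule A.subcringI[OF sr])
    fix x y assume "x \<in> HG 0" "y \<in> HG 0"
    then show "x \<otimes>\<^bsub>AA\<^esub> y = y \<otimes>\<^bsub>AA\<^esub> x" using HG0_central HG_closed by blast
  qed
  have inv: "\<exists>y\<in>HG 0. y \<otimes>\<^bsub>AA\<^esub> x = \<one>\<^bsub>AA\<^esub> \<and> x \<otimes>\<^bsub>AA\<^esub> y = \<one>\<^bsub>AA\<^esub>" if x: "x \<in> HG 0" "x \<noteq> \<zero>\<^bsub>AA\<^esub>" for x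
  proof -
    obtain r where r: "r \<in> carrier R" "x = hc (const r)" using x(1) by (rule HG0_cases)
    note rd = const_deg[OF r(1)]
    have rz: "const r {} = r" by (simp add: const_def)
    have "r \<notin> \<mm>"
      using x(2) r(2) hclass_eq_zero[OF deg_0_cycles[OF rd]] deg0_boundary_iff[OF rd] rz by simp
    have fi: "field (R Quot \<mm>)" by (rule quotient_is_field[OF is_cring])
    have rn: "\<mm> +> r \<noteq> \<zero>\<^bsub>R Quot \<mm>\<^esub>"
      using \<open>r \<notin> \<mm>\<close> a_rcos_self[OF r(1)] by (auto simp: FactRing_def)
    have rq: "\<mm> +> r \<in> carrier (R Quot \<mm>)" using r(1) by (auto simp: FactRing_def A_RCOSETS_def')
    interpret F: field "R Quot \<mm>" by (rule fi)
    obtain Y where Y: "Y \<in> carrier (R Quot \<mm>)" "(\<mm> +> r) \<otimes>\<^bsub>R Quot \<mm>\<^esub> Y = \<one>\<^bsub>R Quot \<mm>\<^esub>"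
    proof -
      have "\<mm> +> r \<in> Units (R Quot \<mm>)" using rq rn F.field_Units by simp
      then show ?thesis by (intro that[OF _ F.Units_r_inv] F.Units_inv_closed)
    qed
    obtain s where s: "s \<in> carrier R" "Y = \<mm> +> s" using Y(1) by (auto simp: FactRing_def A_RCOSETS_def')
    have "\<mm> +> (r \<otimes> s) = \<mm> +> \<one>"
      using Y(2) s r(1) by (simp add: FactRing_def rcoset_mult_add)
    then have rs: "r \<otimes> s \<ominus> \<one> \<in> \<mm>"
      using quotient_eq_iff_same_a_r_cos[OF ideal_axioms, of "r \<otimes> s" \<one>] s r(1) by simp
    note sd = const_deg[OF s(1)]
    have zr: "const r \<in> ZZ" "const s \<in> ZZ" "\<one>\<^bsub>KK\<^esub> \<in> ZZ" using deg_0_cycles rd sd one_deg by auto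
    have "(const r \<otimes>\<^bsub>KK\<^esub> const s) {} = r \<otimes> s"
      using const_mult(1)[OF r(1) cycles_closed[OF zr(2)], of "{}"] by (simp add: const_def)
    then have "(const r \<otimes>\<^bsub>KK\<^esub> const s \<oplus>\<^bsub>KK\<^esub> \<ominus>\<^bsub>KK\<^esub> \<one>\<^bsub>KK\<^esub>) {} = r \<otimes> s \<ominus> \<one>"
      by (simp add: koszul_add koszul_a_inv koszul_one a_minus_def)
    moreover have d: "const r \<otimes>\<^bsub>KK\<^esub> const s \<oplus>\<^bsub>KK\<^esub> \<ominus>\<^bsub>KK\<^esub> \<one>\<^bsub>KK\<^esub> \<in> deg 0"
      using mult_deg[OF rd sd] one_deg by (auto intro!: add_deg minus_deg)
    ultimately have "hc (const r \<otimes>\<^bsub>KK\<^esub> const s \<oplus>\<^bsub>KK\<^esub> \<ominus>\<^bsub>KK\<^esub> \<one>\<^bsub>KK\<^esub>) = \<zero>\<^bsub>AA\<^esub>"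
      using rs deg0_boundary_iff[OF d] hclass_eq_zero[OF deg_0_cycles[OF d]] by simp
    then have "hc (const r) \<otimes>\<^bsub>AA\<^esub> hc (const s) \<oplus>\<^bsub>AA\<^esub> \<ominus>\<^bsub>AA\<^esub> \<one>\<^bsub>AA\<^esub> = \<zero>\<^bsub>AA\<^esub>"
      using zr cycles_mult[OF zr(1,2)] by (simp add: hclass_add hclass_minus hclass_mult hclass_one minus_cycle)
    then have "x \<otimes>\<^bsub>AA\<^esub> hc (const s) = \<one>\<^bsub>AA\<^esub>"
      using zr r(2) by (metis A.r_right_minus_eq a_minus_def A.m_closed A.one_closed hclass_closed)
    moreover have "hc (const s) \<in> HG 0" using HG_I[OF zr(2) sd] .
    ultimately show ?thesis using HG0_central[OF x(1), of "hc (const s)"] zr(2) by (metis hclass_closed)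
  qed
  have ne: "\<one>\<^bsub>AA\<^esub> \<noteq> \<zero>\<^bsub>AA\<^esub>"
  proof
    assume "\<one>\<^bsub>AA\<^esub> = \<zero>\<^bsub>AA\<^esub>"
    then have "\<one>\<^bsub>KK\<^esub> \<in> BB" using hclass_eq_zero[OF deg_0_cycles[OF one_deg]] by (simp add: hclass_one)
    then have "\<one> \<in> \<mm>" using deg0_boundary_iff[OF one_deg] by (simp add: koszul_one)
    then show False using I_notcarr one_imp_carrier by auto
  qed
  show "Units (AA\<lparr>carrier := HG 0\<rparr>) = HG 0 - {\<zero>\<^bsub>AA\<^esub>}"
  proof (intro equalityI subsetI)
    fix x assume x: "x \<in> HG 0 - {\<zero>\<^bsub>AA\<^esub>}"
    then show "x \<in> Units (AA\<lparr>carrier := HG 0\<rparr>)" using inv[of x] by (auto simp: Units_def)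
  next
    fix x assume "x \<in> Units (AA\<lparr>carrier := HG 0\<rparr>)"
    then obtain y where y: "x \<in> HG 0" "y \<in> HG 0" "x \<otimes>\<^bsub>AA\<^esub> y = \<one>\<^bsub>AA\<^esub>" by (auto simp: Units_def)
    have "y \<in> carrier AA" using y(2) HG_closed by blast
    then have "x \<noteq> \<zero>\<^bsub>AA\<^esub>" using y(3) ne A.l_null[of y] by metis
    then show "x \<in> HG 0 - {\<zero>\<^bsub>AA\<^esub>}" using y by auto
  qed
qed

lemma comp_cycle: "f \<in> ZZ \<Longrightarrow> comp j f \<in> ZZ"
proof (cases j)
  case 0
  assume "f \<in> ZZ"
  then show ?thesis using 0 comp_deg[of f 0] deg_0_cycles cycles_closed by simp
next
  case (Suc i)
  assume f: "f \<in> ZZ"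
  have "dd (comp j f) = comp i \<zero>\<^bsub>KK\<^esub>"
    using diff_comp[OF cycles_closed[OF f]] cycles_diff[OF f] Suc by simp
  then have "dd (comp j f) = \<zero>\<^bsub>KK\<^esub>" using comp_deg_same[OF zero_deg, of i] by simp
  then show ?thesis by (rule cyclesI[OF comp_closed[OF cycles_closed[OF f]]])
qed

lemma HG_high: "i > 3 \<Longrightarrow> HG i = {\<zero>\<^bsub>AA\<^esub>}"
  using cycles by (auto simp: class_T_cycles_def Let_def)

text \<open>The homogeneous components of a cycle are cycles, and in class T those of degree above 3 are
  boundaries.\<close>

lemma HG_decomp:
  assumes "x \<in> carrier AA"
  shows "\<exists>x0\<in>HG 0. \<exists>x1\<in>HG 1. \<exists>x2\<in>HG 2. \<exists>x3\<in>HG 3. x = x0 \<oplus>\<^bsub>AA\<^esub> (x1 \<oplus>\<^bsub>AA\<^esub> (x2 \<oplus>\<^bsub>AA\<^esub> x3))"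
proof -
  obtain f where f: "f \<in> ZZ" "x = hc f" using assms by (auto simp: homology_carrier)
  note fc = cycles_closed[OF f(1)]
  let ?I = "{..length xs + 3}"
  have z: "comp j f = \<zero>\<^bsub>KK\<^esub>" if "j > length xs" for j
  proof (rule koszul_ext)
    fix S assume S: "S \<subseteq> N"
    have "card S \<le> length xs" using card_mono[OF _ S] by simp
    then show "comp j f S = \<zero>\<^bsub>KK\<^esub> S" using S that by (simp add: comp_apply koszul_zero)
  qed (use comp_closed[OF fc] in auto)
  have "(\<Oplus>\<^bsub>KK\<^esub>j\<in>?I. comp j f) = (\<Oplus>\<^bsub>KK\<^esub>j\<in>{..length xs}. comp j f)"
    by (intro K.add.finprod_mono_neutral_cong_right) (use z comp_closed[OF fc] in auto)
  then have fs: "f = (\<Oplus>\<^bsub>KK\<^esub>j\<in>?I. comp j f)" using sum_comp[OF fc] by simp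
  have h: "hc (comp j f) \<in> HG j" for j using comp_cycle[OF f(1)] comp_deg[OF fc] by (rule HG_I)
  have hcl: "hc (comp j f) \<in> carrier AA" for j using h HG_closed by blast
  have "x = (\<Oplus>\<^bsub>AA\<^esub>j\<in>?I. hc (comp j f))"
    using hclass_finsum[of ?I "\<lambda>j. comp j f"] comp_cycle[OF f(1)] fs f(2) by simp
  also have "\<dots> = (\<Oplus>\<^bsub>AA\<^esub>j\<in>{0, 1, 2, 3}. hc (comp j f))"
  proof (rule A.add.finprod_mono_neutral_cong_right)
    fix j assume "j \<in> ?I - {0, 1, 2, 3}"
    then have "j > 3" by auto
    then show "hc (comp j f) = \<zero>\<^bsub>AA\<^esub>" using HG_high h by blast
  qed (use hcl in auto)
  also have "\<dots> = hc (comp 0 f) \<oplus>\<^bsub>AA\<^esub> (hc (comp 1 f) \<oplus>\<^bsub>AA\<^esub> (hc (comp 2 f) \<oplus>\<^bsub>AA\<^esub> hc (comp 3 f)))"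
    using hcl by simp
  finally show ?thesis using h by blast
qed

text \<open>The homogeneous components of a boundary are boundaries.\<close>

lemma HG_indep:
  assumes "x0 \<in> HG 0" "x1 \<in> HG 1" "x2 \<in> HG 2" "x3 \<in> HG 3"
    "x0 \<oplus>\<^bsub>AA\<^esub> (x1 \<oplus>\<^bsub>AA\<^esub> (x2 \<oplus>\<^bsub>AA\<^esub> x3)) = \<zero>\<^bsub>AA\<^esub>"
  shows "x0 = \<zero>\<^bsub>AA\<^esub> \<and> x1 = \<zero>\<^bsub>AA\<^esub> \<and> x2 = \<zero>\<^bsub>AA\<^esub> \<and> x3 = \<zero>\<^bsub>AA\<^esub>"
proof -
  obtain f0 f1 f2 f3 where f: "f0 \<in> ZZ" "f0 \<in> deg 0" "x0 = hc f0" "f1 \<in> ZZ" "f1 \<in> deg 1" "x1 = hc f1"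
    "f2 \<in> ZZ" "f2 \<in> deg 2" "x2 = hc f2" "f3 \<in> ZZ" "f3 \<in> deg 3" "x3 = hc f3"
    using assms(1-4) unfolding HG_iff by blast
  note fc = f(1,4,7,10)[THEN cycles_closed]
  let ?f = "f0 \<oplus>\<^bsub>KK\<^esub> (f1 \<oplus>\<^bsub>KK\<^esub> (f2 \<oplus>\<^bsub>KK\<^esub> f3))"
  have "?f \<in> ZZ" using f by (intro add_cycle)
  moreover have "hc ?f = \<zero>\<^bsub>AA\<^esub>" using assms(5) f by (simp add: hclass_add add_cycle)
  ultimately obtain g where g: "g \<in> carrier KK" "?f = dd g"
    using hclass_eq_zero by (auto simp: koszul_boundaries_def)
  have b: "comp j ?f \<in> BB" for j
    unfolding g(2) diff_comp[OF g(1), symmetric] by (intro boundariesI comp_closed g(1))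
  have e: "comp j ?f = comp j f0 \<oplus>\<^bsub>KK\<^esub> (comp j f1 \<oplus>\<^bsub>KK\<^esub> (comp j f2 \<oplus>\<^bsub>KK\<^esub> comp j f3))" for j
    using fc by (simp add: comp_add)
  note cs = f(2,5,8,11)[THEN comp_deg_same]
  note co = f(2,5,8,11)[THEN comp_deg_other]
  have "comp 0 ?f = f0" unfolding e cs using co fc by simp
  moreover have "comp 1 ?f = f1" unfolding e cs using co fc by simp
  moreover have "comp 2 ?f = f2" unfolding e cs using co fc by simp
  moreover have "comp 3 ?f = f3" unfolding e cs using co fc by simp
  ultimately have "f0 \<in> BB" "f1 \<in> BB" "f2 \<in> BB" "f3 \<in> BB"
    using b[of 0] b[of 1] b[of 2] b[of 3] by simp_all
  then show ?thesis using hclass_eq_zero[OF f(1)] hclass_eq_zero[OF f(4)] hclass_eq_zero[OF f(7)]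
      hclass_eq_zero[OF f(10)] f(3,6,9,12) by simp
qed

text \<open>Both products live on the two-element sets, where the two shuffle signs differ by \<open>-1\<close>.\<close>

lemma deg1_anticommute:
  assumes f: "f \<in> deg 1" and g: "g \<in> deg 1"
  shows "f \<otimes>\<^bsub>KK\<^esub> g = \<ominus>\<^bsub>KK\<^esub> (g \<otimes>\<^bsub>KK\<^esub> f)"
proof (rule koszul_ext)
  note c = deg_closed[OF f] deg_closed[OF g]
  fix S assume S: "S \<subseteq> N"
  have cf: "f T \<in> carrier R" "g T \<in> carrier R" if "T \<subseteq> S" for T
    using koszul_closed[OF c(1), of T] koszul_closed[OF c(2), of T] that S by auto
  have neg: "(\<ominus>\<^bsub>KK\<^esub> (g \<otimes>\<^bsub>KK\<^esub> f)) S = \<ominus> ((g \<otimes>\<^bsub>KK\<^esub> f) S)"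
    using S c by (intro koszul_a_inv koszul_mult_closed)
  show "(f \<otimes>\<^bsub>KK\<^esub> g) S = (\<ominus>\<^bsub>KK\<^esub> (g \<otimes>\<^bsub>KK\<^esub> f)) S"
  proof (cases "card S = 2")
    case False
    then have "(f \<otimes>\<^bsub>KK\<^esub> g) S = \<zero>" "(g \<otimes>\<^bsub>KK\<^esub> f) S = \<zero>"
      using deg_zero[OF mult_deg[OF f g] S] deg_zero[OF mult_deg[OF g f] S] by auto
    then show ?thesis unfolding neg by simp
  next
    case True
    then obtain i j where ij: "S = {i, j}" "i < j"
      by (metis card_2_iff doubleton_eq_iff linorder_neqE_nat)
    have two: "(p \<otimes>\<^bsub>KK\<^esub> q) S = p {i} \<otimes> q {j} \<ominus> p {j} \<otimes> q {i}" if p: "p \<in> deg 1" and q: "q \<in> deg 1" for p q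
    proof -
      have cc: "p T \<in> carrier R" "q T \<in> carrier R" if "T \<subseteq> S" for T
        using koszul_closed[OF deg_closed[OF p], of T] koszul_closed[OF deg_closed[OF q], of T] that S by auto
      have "(p \<otimes>\<^bsub>KK\<^esub> q) S = (\<Oplus>T\<in>{{i}, {j}}. sg T (S - T) \<otimes> (p T \<otimes> q (S - T)))"
        unfolding koszul_mult[OF S]
      proof (rule add.finprod_mono_neutral_cong_right)
        fix T assume T: "T \<in> Pow S - {{i}, {j}}"
        then have "T = {} \<or> T = S" using ij by blast
        then have "card T \<noteq> 1" using True by auto
        then show "sg T (S - T) \<otimes> (p T \<otimes> q (S - T)) = \<zero>"
          using deg_zero[OF p, of T] T S cc[of "S - T"] by auto
      qed (use ij cc finite_sub[OF S] in \<open>auto intro!: m_closed\<close>)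
      also have "\<dots> = sg {i} {j} \<otimes> (p {i} \<otimes> q {j}) \<oplus> sg {j} {i} \<otimes> (p {j} \<otimes> q {i})"
      proof -
        have "S - {i} = {j}" "S - {j} = {i}" using ij by auto
        then show ?thesis using ij cc by (subst finsum_insert) auto
      qed
      also have "\<dots> = p {i} \<otimes> q {j} \<ominus> p {j} \<otimes> q {i}"
        using ij cc by (simp add: sg_singletons a_minus_def l_minus)
      finally show ?thesis .
    qed
    show ?thesis unfolding neg two[OF f g] two[OF g f]
      using cf[of "{i}"] cf[of "{j}"] ij by (simp add: a_minus_def minus_add m_comm a_comm)
  qed
qed (use f g deg_closed koszul_mult_closed in \<open>auto\<close>)

end

lemma (in abelian_monoid) finsum_lessThan_Suc_shift:
  assumes "\<And>u. u < Suc n \<Longrightarrow> f u \<in> carrier G"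
  shows "(\<Oplus>u\<in>{..<Suc n}. f u) = f 0 \<oplus> (\<Oplus>u\<in>{..<n}. f (Suc u))"
proof -
  have "(\<Oplus>u\<in>{..<Suc n}. f u) = f 0 \<oplus> (\<Oplus>u\<in>Suc ` {..<n}. f u)"
    unfolding lessThan_Suc_eq_insert_0 using assms by (intro finsum_insert) auto
  also have "(\<Oplus>u\<in>Suc ` {..<n}. f u) = (\<Oplus>u\<in>{..<n}. f (Suc u))"
    using assms by (intro finsum_reindex) auto
  finally show ?thesis .
qed

context ring
begin

lemma combine_map:
  assumes "length Ks = n" "set Ks \<subseteq> carrier R" "\<And>u. u < n \<Longrightarrow> g (s + u) \<in> carrier R"
  shows "combine Ks (map g [s..<s + n]) = (\<Oplus>u\<in>{..<n}. (Ks ! u) \<otimes> g (s + u))"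
  using assms
proof (induction n arbitrary: Ks s)
  case 0
  then show ?case by simp
next
  case (Suc n)
  then obtain k Ks' where Ks: "Ks = k # Ks'" "length Ks' = n" by (cases Ks) auto
  have g: "g (s + u) \<in> carrier R" if "u < Suc n" for u using Suc.prems(3) that by blast
  have g': "g (Suc s + u) \<in> carrier R" if "u < n" for u using g[of "Suc u"] that by simp
  have cl: "Ks ! u \<in> carrier R" if "u < Suc n" for u
    using Suc.prems(1,2) that nth_mem[of u Ks] by auto
  have "combine Ks (map g [s..<s + Suc n]) = k \<otimes> g s \<oplus> combine Ks' (map g [Suc s..<Suc s + n])"
    by (simp add: Ks upt_conv_Cons del: upt_Suc)
  also have "combine Ks' (map g [Suc s..<Suc s + n]) = (\<Oplus>u\<in>{..<n}. (Ks' ! u) \<otimes> g (Suc s + u))"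
    using Suc.prems(2) Ks g' by (intro Suc.IH) auto
  also have "k \<otimes> g s \<oplus> \<dots> = (\<Oplus>u\<in>{..<Suc n}. (Ks ! u) \<otimes> g (s + u))"
    using g cl by (subst finsum_lessThan_Suc_shift) (auto simp: Ks(1))
  finally show ?case .
qed

lemma combine_mult_null:
  assumes "set Ks \<subseteq> carrier R" "set Us \<subseteq> carrier R" "v \<in> carrier R" "\<And>u. u \<in> set Us \<Longrightarrow> u \<otimes> v = \<zero>"
  shows "combine Ks Us \<otimes> v = \<zero>"
  using assms
proof (induction Ks Us rule: combine.induct)
  case (1 k Ks u Us)
  have "combine Ks Us \<otimes> v = \<zero>" by (rule "1.IH") (use "1.prems" in auto)
  moreover have "u \<otimes> v = \<zero>" using "1.prems" by simp
  ultimately show ?case using "1.prems" by (simp add: l_distr m_assoc)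
qed auto

lemma mult_combine_null:
  assumes "set Ks \<subseteq> carrier R" "set Us \<subseteq> carrier R" "v \<in> carrier R" "\<And>u. u \<in> set Us \<Longrightarrow> v \<otimes> u = \<zero>"
    "\<And>k. k \<in> set Ks \<Longrightarrow> v \<otimes> k = k \<otimes> v"
  shows "v \<otimes> combine Ks Us = \<zero>"
  using assms
proof (induction Ks Us rule: combine.induct)
  case (1 k Ks u Us)
  have "v \<otimes> combine Ks Us = \<zero>" by (rule "1.IH") (use "1.prems" in auto)
  moreover have "v \<otimes> (k \<otimes> u) = \<zero>"
  proof -
    have c: "k \<in> carrier R" "u \<in> carrier R" "v \<in> carrier R" using "1.prems"(1-3) by auto
    have "v \<otimes> (k \<otimes> u) = (v \<otimes> k) \<otimes> u" using c by (simp add: m_assoc)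
    also have "v \<otimes> k = k \<otimes> v" using "1.prems"(5)[of k] by simp
    also have "k \<otimes> v \<otimes> u = k \<otimes> (v \<otimes> u)" using c by (simp add: m_assoc)
    also have "v \<otimes> u = \<zero>" using "1.prems"(4)[of u] by simp
    finally show ?thesis using c by simp
  qed
  ultimately show ?case using "1.prems" by (simp add: r_distr)
qed auto

end

context class_T_koszul
begin

abbreviation hz where "hz j u \<equiv> hc (z j u)"

lemma rk_ge: "3 \<le> rk 1" "3 \<le> rk 2"
  using cycles by (auto simp: class_T_cycles_def Let_def)

lemma z_cycles:
  "u \<in> {1..rk 1} \<Longrightarrow> z 1 u \<in> ZZ \<and> z 1 u \<in> deg 1"
  "u \<in> {1..rk 2 - 3} \<Longrightarrow> z 2 u \<in> ZZ \<and> z 2 u \<in> deg 2"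
  "u \<in> {1..rk 3} \<Longrightarrow> z 3 u \<in> ZZ \<and> z 3 u \<in> deg 3"
  using cycles by (auto simp: class_T_cycles_def Let_def)

lemma hz_HG:
  "u \<in> {1..rk 1} \<Longrightarrow> hz 1 u \<in> HG 1"
  "u \<in> {1..rk 2 - 3} \<Longrightarrow> hz 2 u \<in> HG 2"
  "u \<in> {1..rk 3} \<Longrightarrow> hz 3 u \<in> HG 3"
  using z_cycles by (auto intro: HG_I)

lemma hz1_null: "u \<in> {1..rk 1} \<Longrightarrow> v \<in> {1..rk 1} \<Longrightarrow> \<not> (u \<le> 3 \<and> v \<le> 3 \<and> u \<noteq> v) \<Longrightarrow>
    hz 1 u \<otimes>\<^bsub>AA\<^esub> hz 1 v = \<zero>\<^bsub>AA\<^esub>"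
  using cycles by (simp add: class_T_cycles_def Let_def)

lemma basis:
  assumes "i \<in> {0..3}"
  shows "A.independent (HG 0) (class_T_basis R xs z i)" "A.Span (HG 0) (class_T_basis R xs z i) = HG i"
  using cycles assms by (auto simp: class_T_cycles_def Let_def is_homology_basis_def)

lemma basis_null:
  assumes "i \<in> {1..3}" "j \<in> {1..3}" "(i, j) \<noteq> (1, 1)" "x \<in> set (class_T_basis R xs z i)" "y \<in> set (class_T_basis R xs z j)"
  shows "x \<otimes>\<^bsub>AA\<^esub> y = \<zero>\<^bsub>AA\<^esub>"
proof -
  have "\<forall>i\<in>{1..3}. \<forall>j\<in>{1..3}. (i, j) \<noteq> (1, 1) \<longrightarrow>
         (\<forall>x\<in>set (class_T_basis R xs z i). \<forall>y\<in>set (class_T_basis R xs z j). x \<otimes>\<^bsub>AA\<^esub> y = \<zero>\<^bsub>AA\<^esub>)"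
    using cycles unfolding class_T_cycles_def Let_def by (elim conjE)
  then show ?thesis using assms by blast
qed

lemma basis_closed: "i \<in> {0..3} \<Longrightarrow> set (class_T_basis R xs z i) \<subseteq> carrier AA"
  using A.independent_in_carrier[OF basis(1)] .

lemma basis_combine:
  assumes "i \<in> {0..3}" "x \<in> HG i"
  obtains Ks where "set Ks \<subseteq> HG 0" "length Ks = length (class_T_basis R xs z i)"
    "x = A.combine Ks (class_T_basis R xs z i)"
proof -
  have "x \<in> {A.combine Ks (class_T_basis R xs z i) |Ks. length Ks = length (class_T_basis R xs z i) \<and> set Ks \<subseteq> HG 0}"
    using A.Span_eq_combine_set_length_version[OF HG0_subfield basis_closed[OF assms(1)]]
      basis(2)[OF assms(1)] assms(2) by blast
  then show ?thesis using that by blast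
qed

lemma basis_indep:
  assumes "i \<in> {0..3}" "set Ks \<subseteq> HG 0" "length Ks = length (class_T_basis R xs z i)"
    "A.combine Ks (class_T_basis R xs z i) = \<zero>\<^bsub>AA\<^esub>"
  shows "set Ks \<subseteq> {\<zero>\<^bsub>AA\<^esub>}"
  using A.independent_imp_trivial_combine[OF HG0_subfield basis(1)[OF assms(1)] assms(2,4)] assms(3) by simp

abbreviation "e \<equiv> hz 1"
abbreviation "g1 \<equiv> \<lambda>u. hz 1 (u + 4)"
abbreviation "g2 \<equiv> \<lambda>u. hz 2 (u + 1)"
abbreviation "g3 \<equiv> \<lambda>u. hz 3 (u + 1)"
abbreviation "n1 \<equiv> rk 1 - 3"
abbreviation "n2 \<equiv> rk 2 - 3"
abbreviation "n3 \<equiv> rk 3"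

lemma eg_HG: "u \<in> {1, 2, 3} \<Longrightarrow> e u \<in> HG 1" "u < n1 \<Longrightarrow> g1 u \<in> HG 1" "u < n2 \<Longrightarrow> g2 u \<in> HG 2" "u < n3 \<Longrightarrow> g3 u \<in> HG 3"
proof -
  show "e u \<in> HG 1" if "u \<in> {1, 2, 3}" by (rule hz_HG(1)) (use that rk_ge(1) in auto)
  show "g1 u \<in> HG 1" if "u < n1" by (rule hz_HG(1)) (use that in auto)
  show "g2 u \<in> HG 2" if "u < n2" by (rule hz_HG(2)) (use that in auto)
  show "g3 u \<in> HG 3" if "u < n3" by (rule hz_HG(3)) (use that in auto)
qed

lemma eg_closed: "u \<in> {1, 2, 3} \<Longrightarrow> e u \<in> carrier AA" "u < n1 \<Longrightarrow> g1 u \<in> carrier AA"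
  "u < n2 \<Longrightarrow> g2 u \<in> carrier AA" "u < n3 \<Longrightarrow> g3 u \<in> carrier AA"
  using eg_HG HG_closed by blast+

lemma basis_1: "class_T_basis R xs z 1 = e 1 # e 2 # e 3 # map e [4..<4 + n1]"
proof -
  have "[1..<Suc (rk 1)] = 1 # 2 # 3 # [4..<4 + n1]"
  proof -
    have "[1..<Suc (rk 1)] = [1..<4] @ [4..<4 + n1]"
      using upt_add_eq_append[of 1 4 n1] rk_ge(1) by (simp del: upt_Suc)
    also have "[1..<4] = [1, 2, 3::nat]" by (simp add: upt_rec)
    finally show ?thesis by simp
  qed
  then show ?thesis by (simp add: class_T_basis_def Let_def del: upt_Suc)
qed

lemma basis_2: "class_T_basis R xs z 2 =
    (e 1 \<otimes>\<^bsub>AA\<^esub> e 2) # (e 2 \<otimes>\<^bsub>AA\<^esub> e 3) # (e 1 \<otimes>\<^bsub>AA\<^esub> e 3) # map (hz 2) [1..<1 + n2]"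
  by (simp add: class_T_basis_def Let_def del: upt_Suc)

lemma basis_3: "class_T_basis R xs z 3 = map (hz 3) [1..<1 + n3]"
  by (simp add: class_T_basis_def Let_def del: upt_Suc)

lemma basis_length:
  "length (class_T_basis R xs z 1) = n1 + 3" "length (class_T_basis R xs z 2) = n2 + 3"
  "length (class_T_basis R xs z 3) = n3"
  unfolding basis_1 basis_2 basis_3 by (simp_all del: upt_Suc)

lemma sum_swap:
  assumes "\<And>u. u < n \<Longrightarrow> w u \<in> HG 0" "\<And>u. u < n \<Longrightarrow> g u \<in> carrier AA"
  shows "(\<Oplus>\<^bsub>AA\<^esub>u\<in>{..<n}. g u \<otimes>\<^bsub>AA\<^esub> w u) = (\<Oplus>\<^bsub>AA\<^esub>u\<in>{..<n}. w u \<otimes>\<^bsub>AA\<^esub> g u)"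
  using assms HG0_central HG_closed by (intro A.finsum_cong' refl) (fastforce intro!: A.m_closed)+

lemma combine_tail:
  assumes "\<And>u. u < n \<Longrightarrow> w u \<in> HG 0" "\<And>u. u < n \<Longrightarrow> g (s + u) \<in> carrier AA"
  shows "A.combine (map w [0..<n]) (map g [s..<s + n]) = (\<Oplus>\<^bsub>AA\<^esub>u\<in>{..<n}. g (s + u) \<otimes>\<^bsub>AA\<^esub> w u)"
proof -
  have wc: "w u \<in> carrier AA" if "u < n" for u using assms(1)[OF that] HG_closed by blast
  have "A.combine (map w [0..<n]) (map g [s..<s + n]) = (\<Oplus>\<^bsub>AA\<^esub>u\<in>{..<n}. (map w [0..<n] ! u) \<otimes>\<^bsub>AA\<^esub> g (s + u))"
    using wc assms(2) by (intro A.combine_map) auto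
  also have "\<dots> = (\<Oplus>\<^bsub>AA\<^esub>u\<in>{..<n}. w u \<otimes>\<^bsub>AA\<^esub> g (s + u))"
    using wc assms(2) by (intro A.finsum_cong' refl) auto
  also have "\<dots> = (\<Oplus>\<^bsub>AA\<^esub>u\<in>{..<n}. g (s + u) \<otimes>\<^bsub>AA\<^esub> w u)"
    using assms by (intro sum_swap[symmetric]) auto
  finally show ?thesis .
qed

lemma list_map_nth: "length Ks = n \<Longrightarrow> Ks = map (\<lambda>u. if u < n then Ks ! u else d) [0..<n]"
  by (intro nth_equalityI) auto

text \<open>Products of basis elements are zero outside degrees \<open>(1, 1)\<close>; coefficients from the
  central subfield can be moved out of the way.\<close>

lemma HG_null:
  assumes x: "x \<in> HG i" and y: "y \<in> HG j" and ij: "i \<in> {1, 2, 3}" "j \<in> {1, 2, 3}" "(i, j) \<noteq> (1, 1)"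
  shows "x \<otimes>\<^bsub>AA\<^esub> y = \<zero>\<^bsub>AA\<^esub>"
proof -
  have ij': "i \<in> {1..3}" "j \<in> {1..3}" "i \<in> {0..3}" "j \<in> {0..3}" using ij by auto
  obtain Ks where Ks: "set Ks \<subseteq> HG 0" "x = A.combine Ks (class_T_basis R xs z i)"
    using basis_combine[OF ij'(3) x] by metis
  obtain Ls where Ls: "set Ls \<subseteq> HG 0" "y = A.combine Ls (class_T_basis R xs z j)"
    using basis_combine[OF ij'(4) y] by metis
  have xc: "x \<in> carrier AA" using x HG_closed by blast
  have "x \<otimes>\<^bsub>AA\<^esub> v = \<zero>\<^bsub>AA\<^esub>" if v: "v \<in> set (class_T_basis R xs z j)" for v
    unfolding Ks(2) using Ks(1) HG_closed basis_closed[OF ij'(3)] basis_closed[OF ij'(4)] v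
    by (intro A.combine_mult_null basis_null[OF ij'(1,2) ij(3)]) auto
  then show ?thesis
    unfolding Ls(2) using Ls(1) HG_closed basis_closed[OF ij'(4)] xc HG0_central[OF _ xc]
    by (intro A.mult_combine_null) (auto simp: subset_iff)
qed

lemma HG1_null:
  assumes u: "u < n1" and x: "x \<in> HG 1"
  shows "g1 u \<otimes>\<^bsub>AA\<^esub> x = \<zero>\<^bsub>AA\<^esub>" "x \<otimes>\<^bsub>AA\<^esub> g1 u = \<zero>\<^bsub>AA\<^esub>"
proof -
  have 1: "1 \<in> {0..3::nat}" by simp
  obtain Ks where Ks: "set Ks \<subseteq> HG 0" "x = A.combine Ks (class_T_basis R xs z 1)"
    using basis_combine[OF 1 x] by metis
  have b: "set (class_T_basis R xs z 1) = hz 1 ` {1..rk 1}"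
    by (auto simp: class_T_basis_def Let_def)
  have u4: "u + 4 \<in> {1..rk 1}" using u by auto
  have gc: "g1 u \<in> carrier AA" using eg_closed u by blast
  have nb: "g1 u \<otimes>\<^bsub>AA\<^esub> v = \<zero>\<^bsub>AA\<^esub>" "v \<otimes>\<^bsub>AA\<^esub> g1 u = \<zero>\<^bsub>AA\<^esub>" if v: "v \<in> set (class_T_basis R xs z 1)" for v
  proof -
    obtain w where w: "w \<in> {1..rk 1}" "v = hz 1 w" using v unfolding b by blast
    show "g1 u \<otimes>\<^bsub>AA\<^esub> v = \<zero>\<^bsub>AA\<^esub>" unfolding w(2) by (rule hz1_null[OF u4 w(1)]) simp
    show "v \<otimes>\<^bsub>AA\<^esub> g1 u = \<zero>\<^bsub>AA\<^esub>" unfolding w(2) by (rule hz1_null[OF w(1) u4]) simp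
  qed
  have Kc: "set Ks \<subseteq> carrier AA" using Ks(1) HG_closed by blast
  show "g1 u \<otimes>\<^bsub>AA\<^esub> x = \<zero>\<^bsub>AA\<^esub>"
    unfolding Ks(2) by (rule A.mult_combine_null[OF Kc basis_closed[OF 1] gc nb(1)])
      (use Ks(1) HG0_central[OF _ gc] in auto)
  show "x \<otimes>\<^bsub>AA\<^esub> g1 u = \<zero>\<^bsub>AA\<^esub>"
    unfolding Ks(2) by (rule A.combine_mult_null[OF Kc basis_closed[OF 1] gc nb(2)])
qed

sublocale T: class_T_algebra AA HG e g1 g2 g3 n1 n2 n3
proof (unfold_locales, goal_cases)
  case (7 x) then show ?case using HG_mult[of x _ _ 0] by simp
next
  case (8 x y) then show ?case using HG_mult[of x 1 y 1] by (simp add: numeral_2_eq_2)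
next
  case (14 u) then show ?case using rk_ge by (intro hz1_null) auto
next
  case (15 u t)
  then have "z 1 u \<in> ZZ" "z 1 u \<in> deg 1" "z 1 t \<in> ZZ" "z 1 t \<in> deg 1"
    using z_cycles(1) rk_ge by auto
  then show ?case
    using deg1_anticommute[of "z 1 t" "z 1 u"] cycles_mult
    by (simp add: hclass_mult[symmetric] hclass_minus[symmetric])
next
  case (18 x)
  have 1: "1 \<in> {0..3::nat}" by simp
  obtain Ks where Ks: "set Ks \<subseteq> HG 0" "length Ks = length (class_T_basis R xs z 1)"
    "x = A.combine Ks (class_T_basis R xs z 1)"
    using basis_combine[OF 1 18] by metis
  then obtain k1 k2 k3 Ls where L: "Ks = k1 # k2 # k3 # Ls" "length Ls = n1"
    unfolding basis_1 by (auto simp: length_Suc_conv simp del: upt_Suc)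
  have k: "k1 \<in> HG 0" "k2 \<in> HG 0" "k3 \<in> HG 0" "set Ls \<subseteq> HG 0" using Ks(1) L by auto
  note kc = k(1-3)[THEN subsetD[OF HG_closed]]
  define w where "w = (\<lambda>u. if u < n1 then Ls ! u else \<zero>\<^bsub>AA\<^esub>)"
  have w: "w u \<in> HG 0" for u using k(4) L(2) HG_zero nth_mem[of u Ls] by (auto simp: w_def)
  have Lw: "Ls = map w [0..<n1]" unfolding w_def by (rule list_map_nth[OF L(2)])
  have t: "A.combine Ls (map e [4..<4 + n1]) = (\<Oplus>\<^bsub>AA\<^esub>u\<in>{..<n1}. g1 u \<otimes>\<^bsub>AA\<^esub> w u)"
    unfolding Lw using w eg_closed(2) by (subst combine_tail) (auto simp: add.commute)
  have tc: "(\<Oplus>\<^bsub>AA\<^esub>u\<in>{..<n1}. g1 u \<otimes>\<^bsub>AA\<^esub> w u) \<in> carrier AA"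
    using eg_closed(2) w HG_closed by (intro A.finsum_closed Pi_I A.m_closed) auto
  have "x = (e 1 \<otimes>\<^bsub>AA\<^esub> k1 \<oplus>\<^bsub>AA\<^esub> (e 2 \<otimes>\<^bsub>AA\<^esub> k2 \<oplus>\<^bsub>AA\<^esub> e 3 \<otimes>\<^bsub>AA\<^esub> k3)) \<oplus>\<^bsub>AA\<^esub> (\<Oplus>\<^bsub>AA\<^esub>u\<in>{..<n1}. g1 u \<otimes>\<^bsub>AA\<^esub> w u)"
    unfolding Ks(3) basis_1 L(1) using t tc kc eg_closed(1) HG0_central[OF k(1)] HG0_central[OF k(2)] HG0_central[OF k(3)]
    by (simp add: A.a_assoc)
  then show ?case using k w by blast
next
  case (19 x)
  have 2: "2 \<in> {0..3::nat}" by simp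
  obtain Ks where Ks: "set Ks \<subseteq> HG 0" "length Ks = length (class_T_basis R xs z 2)"
    "x = A.combine Ks (class_T_basis R xs z 2)"
    using basis_combine[OF 2 19] by metis
  then obtain k1 k2 k3 Ls where L: "Ks = k1 # k2 # k3 # Ls" "length Ls = n2"
    unfolding basis_2 by (auto simp: length_Suc_conv simp del: upt_Suc)
  have k: "k1 \<in> HG 0" "k2 \<in> HG 0" "k3 \<in> HG 0" "set Ls \<subseteq> HG 0" using Ks(1) L by auto
  note kc = k(1-3)[THEN subsetD[OF HG_closed]]
  define w where "w = (\<lambda>u. if u < n2 then Ls ! u else \<zero>\<^bsub>AA\<^esub>)"
  have w: "w u \<in> HG 0" for u using k(4) L(2) HG_zero nth_mem[of u Ls] by (auto simp: w_def)
  have Lw: "Ls = map w [0..<n2]" unfolding w_def by (rule list_map_nth[OF L(2)])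
  have t: "A.combine Ls (map (hz 2) [1..<1 + n2]) = (\<Oplus>\<^bsub>AA\<^esub>u\<in>{..<n2}. g2 u \<otimes>\<^bsub>AA\<^esub> w u)"
    unfolding Lw using w eg_closed(3) by (subst combine_tail) (auto simp: add.commute)
  have tc: "(\<Oplus>\<^bsub>AA\<^esub>u\<in>{..<n2}. g2 u \<otimes>\<^bsub>AA\<^esub> w u) \<in> carrier AA"
    using eg_closed(3) w HG_closed by (intro A.finsum_closed Pi_I A.m_closed) auto
  have ec: "e 1 \<otimes>\<^bsub>AA\<^esub> e 2 \<in> carrier AA" "e 1 \<otimes>\<^bsub>AA\<^esub> e 3 \<in> carrier AA" "e 2 \<otimes>\<^bsub>AA\<^esub> e 3 \<in> carrier AA"
    using eg_closed(1) by auto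
  have "x = (e 1 \<otimes>\<^bsub>AA\<^esub> e 2 \<otimes>\<^bsub>AA\<^esub> k1 \<oplus>\<^bsub>AA\<^esub> (e 1 \<otimes>\<^bsub>AA\<^esub> e 3 \<otimes>\<^bsub>AA\<^esub> k3 \<oplus>\<^bsub>AA\<^esub> e 2 \<otimes>\<^bsub>AA\<^esub> e 3 \<otimes>\<^bsub>AA\<^esub> k2)) \<oplus>\<^bsub>AA\<^esub> (\<Oplus>\<^bsub>AA\<^esub>u\<in>{..<n2}. g2 u \<otimes>\<^bsub>AA\<^esub> w u)"
    unfolding Ks(3) basis_2 L(1) using t tc kc ec HG0_central[OF k(1) ec(1)] HG0_central[OF k(2) ec(3)] HG0_central[OF k(3) ec(2)]
    by (simp add: A.a_ac)
  then show ?case using k w by blast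
next
  case (20 x)
  have 3: "3 \<in> {0..3::nat}" by simp
  obtain Ls where Ls: "set Ls \<subseteq> HG 0" "length Ls = length (class_T_basis R xs z 3)"
    "x = A.combine Ls (class_T_basis R xs z 3)"
    using basis_combine[OF 3 20] by metis
  have Ks: "set Ls \<subseteq> HG 0" "length Ls = n3" "x = A.combine Ls (map (hz 3) [1..<1 + n3])"
    using Ls(1) Ls(2,3)[unfolded basis_3] by (simp_all only: length_map length_upt add_diff_cancel_left')
  define w where "w = (\<lambda>u. if u < n3 then Ls ! u else \<zero>\<^bsub>AA\<^esub>)"
  have w: "w u \<in> HG 0" for u using Ks HG_zero nth_mem[of u Ls] by (auto simp: w_def)
  have Lw: "Ls = map w [0..<n3]" unfolding w_def by (rule list_map_nth[OF Ks(2)])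
  have "A.combine Ls (map (hz 3) [1..<1 + n3]) = (\<Oplus>\<^bsub>AA\<^esub>u\<in>{..<n3}. g3 u \<otimes>\<^bsub>AA\<^esub> w u)"
    unfolding Lw using w eg_closed(4) by (subst combine_tail) (auto simp: add.commute)
  then show ?case using Ks(3) w by blast
next
  case (21 c1 c2 c3 w)
  have 1: "1 \<in> {0..3::nat}" by simp
  note cc = 21(1-3)[THEN subsetD[OF HG_closed]]
  have t: "A.combine (map w [0..<n1]) (map e [4..<4 + n1]) = (\<Oplus>\<^bsub>AA\<^esub>u\<in>{..<n1}. g1 u \<otimes>\<^bsub>AA\<^esub> w u)"
    using 21(4) eg_closed(2) by (subst combine_tail) (auto simp: add.commute)
  have tc: "(\<Oplus>\<^bsub>AA\<^esub>u\<in>{..<n1}. g1 u \<otimes>\<^bsub>AA\<^esub> w u) \<in> carrier AA"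
    using eg_closed(2) 21(4) HG_closed by (intro A.finsum_closed Pi_I A.m_closed) auto
  have "A.combine (c1 # c2 # c3 # map w [0..<n1]) (class_T_basis R xs z 1) = \<zero>\<^bsub>AA\<^esub>"
    using 21(5) unfolding basis_1
    using t tc cc eg_closed(1) HG0_central[OF 21(1)] HG0_central[OF 21(2)] HG0_central[OF 21(3)]
    by (simp add: A.a_assoc)
  then have "set (c1 # c2 # c3 # map w [0..<n1]) \<subseteq> {\<zero>\<^bsub>AA\<^esub>}"
    by (rule basis_indep[OF 1, rotated 2]) (use 21(1-4) in \<open>auto simp: basis_length basis_length(1)[unfolded One_nat_def]\<close>)
  then show ?case by (simp add: image_subset_iff)
next
  case (22 c1 c2 c3 w)
  have 2: "2 \<in> {0..3::nat}" by simp
  note cc = 22(1-3)[THEN subsetD[OF HG_closed]]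
  have t: "A.combine (map w [0..<n2]) (map (hz 2) [1..<1 + n2]) = (\<Oplus>\<^bsub>AA\<^esub>u\<in>{..<n2}. g2 u \<otimes>\<^bsub>AA\<^esub> w u)"
    using 22(4) eg_closed(3) by (subst combine_tail) (auto simp: add.commute)
  have tc: "(\<Oplus>\<^bsub>AA\<^esub>u\<in>{..<n2}. g2 u \<otimes>\<^bsub>AA\<^esub> w u) \<in> carrier AA"
    using eg_closed(3) 22(4) HG_closed by (intro A.finsum_closed Pi_I A.m_closed) auto
  have ec: "e 1 \<otimes>\<^bsub>AA\<^esub> e 2 \<in> carrier AA" "e 1 \<otimes>\<^bsub>AA\<^esub> e 3 \<in> carrier AA" "e 2 \<otimes>\<^bsub>AA\<^esub> e 3 \<in> carrier AA"
    using eg_closed(1) by auto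
  have "A.combine (c1 # c3 # c2 # map w [0..<n2]) (class_T_basis R xs z 2) =
      (e 1 \<otimes>\<^bsub>AA\<^esub> e 2 \<otimes>\<^bsub>AA\<^esub> c1 \<oplus>\<^bsub>AA\<^esub> (e 1 \<otimes>\<^bsub>AA\<^esub> e 3 \<otimes>\<^bsub>AA\<^esub> c2 \<oplus>\<^bsub>AA\<^esub> e 2 \<otimes>\<^bsub>AA\<^esub> e 3 \<otimes>\<^bsub>AA\<^esub> c3)) \<oplus>\<^bsub>AA\<^esub> (\<Oplus>\<^bsub>AA\<^esub>u\<in>{..<n2}. g2 u \<otimes>\<^bsub>AA\<^esub> w u)"
    unfolding basis_2
    using t tc cc ec HG0_central[OF 22(1) ec(1)] HG0_central[OF 22(3) ec(3)] HG0_central[OF 22(2) ec(2)]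
    by (simp add: A.a_ac)
  then have "A.combine (c1 # c3 # c2 # map w [0..<n2]) (class_T_basis R xs z 2) = \<zero>\<^bsub>AA\<^esub>"
    using 22(5) by simp
  then have "set (c1 # c3 # c2 # map w [0..<n2]) \<subseteq> {\<zero>\<^bsub>AA\<^esub>}"
    by (rule basis_indep[OF 2, rotated 2]) (use 22(1-4) in \<open>auto simp: basis_length basis_length(1)[unfolded One_nat_def]\<close>)
  then show ?case by (simp add: image_subset_iff)
next
  case (23 w)
  have 3: "3 \<in> {0..3::nat}" by simp
  have t: "A.combine (map w [0..<n3]) (map (hz 3) [1..<1 + n3]) = (\<Oplus>\<^bsub>AA\<^esub>u\<in>{..<n3}. g3 u \<otimes>\<^bsub>AA\<^esub> w u)"
    using 23(1) eg_closed(4) by (subst combine_tail) (auto simp: add.commute)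
  have "A.combine (map w [0..<n3]) (class_T_basis R xs z 3) = \<zero>\<^bsub>AA\<^esub>"
    unfolding basis_3 t by (rule 23(2))
  then have "set (map w [0..<n3]) \<subseteq> {\<zero>\<^bsub>AA\<^esub>}"
    by (rule basis_indep[OF 3, rotated 2]) (use 23(1) in \<open>auto simp: basis_length basis_length(1)[unfolded One_nat_def]\<close>)
  then show ?case by (simp add: image_subset_iff)
qed (fact HG_closed HG_zero | rule HG_add HG_minus HG_decomp HG_indep HG1_null eg_HG HG_null; assumption)+

end

section \<open>Block matrices\<close>

lemma block_diag_Nil [simp]: "block_diag d [] = mat 0 0 (\<lambda>_. d)"
  by (simp add: block_diag_def)

lemma block_diag_Cons: "block_diag d (M # Ms) = four_block_mat M (mat (dim_row M) (dim_col (block_diag d Ms)) (\<lambda>_. d))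
    (mat (dim_row (block_diag d Ms)) (dim_col M) (\<lambda>_. d)) (block_diag d Ms)"
  by (simp add: block_diag_def)

lemma dim_block_diag [simp]:
  "dim_row (block_diag d Ms) = sum_list (map dim_row Ms)" "dim_col (block_diag d Ms) = sum_list (map dim_col Ms)"
  by (induction Ms) (simp_all add: block_diag_Cons)

lemma off_Cons: "off (x # xs) (Suc m) = x + off xs m" "off xs 0 = 0"
  by (simp_all add: off_def)

lemma block_diag_entry:
  assumes "m < length Ms" "m' < length Ms" "i < dim_row (Ms ! m)" "j < dim_col (Ms ! m')"
  shows "block_diag d Ms $$ (off (map dim_row Ms) m + i, off (map dim_col Ms) m' + j) =
    (if m = m' then Ms ! m $$ (i, j) else d)"
  using assms
proof (induction Ms arbitrary: m m')
  case Nil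
  then show ?case by simp
next
  case (Cons M Ms)
  have r: "off (map dim_row Ms) k + i < sum_list (map dim_row Ms)" if "k < length Ms" "i < dim_row (Ms ! k)" for k
    using off_less(1)[of k "map dim_row Ms" i] that by simp
  have c: "off (map dim_col Ms) k + j < sum_list (map dim_col Ms)" if "k < length Ms" "j < dim_col (Ms ! k)" for k
    using off_less(1)[of k "map dim_col Ms" j] that by simp
  show ?case
    using Cons.prems r c Cons.IH
    by (cases m; cases m') (auto simp: block_diag_Cons off_Cons add.assoc)
qed

lemma block_diag_all:
  assumes "\<And>M i j. M \<in> set Ms \<Longrightarrow> i < dim_row M \<Longrightarrow> j < dim_col M \<Longrightarrow> P (M $$ (i, j))" "P d"
    "i < dim_row (block_diag d Ms)" "j < dim_col (block_diag d Ms)"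
  shows "P (block_diag d Ms $$ (i, j))"
  using assms(1,3,4)
proof (induction Ms arbitrary: i j)
  case Nil
  then show ?case by simp
next
  case (Cons M Ms)
  then show ?case using assms(2) by (auto simp: block_diag_Cons)
qed

lemma dim_hcat [simp]: "dim_row (hcat M N) = dim_row M" "dim_col (hcat M N) = dim_col M + dim_col N"
  by (simp_all add: hcat_def)

lemma dim_vcat [simp]: "dim_row (vcat M N) = dim_row M + dim_row N" "dim_col (vcat M N) = dim_col M"
  by (simp_all add: vcat_def)

context ring
begin

text \<open>Left multiplication by a matrix whose entries are sent to the ring by \<open>\<eta>\<close>.\<close>

definition mvec :: "('k \<Rightarrow> 'a) \<Rightarrow> 'k mat \<Rightarrow> (nat \<Rightarrow> 'a) \<Rightarrow> nat \<Rightarrow> 'a" where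
  "mvec \<eta> M x i = (\<Oplus>j\<in>{..<dim_col M}. \<eta> (M $$ (i, j)) \<otimes> x j)"

definition entries_in :: "('k \<Rightarrow> 'a) \<Rightarrow> 'k mat \<Rightarrow> bool" where
  "entries_in \<eta> M \<longleftrightarrow> (\<forall>i<dim_row M. \<forall>j<dim_col M. \<eta> (M $$ (i, j)) \<in> carrier R)"

lemma finsum_lessThan_add:
  fixes m n :: nat
  assumes "\<And>j. j < m + n \<Longrightarrow> f j \<in> carrier R"
  shows "(\<Oplus>j\<in>{..<m + n}. f j) = (\<Oplus>j\<in>{..<m}. f j) \<oplus> (\<Oplus>j\<in>{..<n}. f (m + j))"
proof -
  have e: "{..<m + n} = {..<m} \<union> (+) m ` {..<n}"
  proof (intro equalityI subsetI)
    fix j assume "j \<in> {..<m + n}"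
    then show "j \<in> {..<m} \<union> (+) m ` {..<n}"
      by (cases "j < m") (auto intro!: image_eqI[of _ _ "j - m"])
  qed auto
  have "(\<Oplus>j\<in>{..<m + n}. f j) = (\<Oplus>j\<in>{..<m}. f j) \<oplus> (\<Oplus>j\<in>(+) m ` {..<n}. f j)"
    unfolding e using assms by (intro finsum_Un_disjoint) auto
  also have "(\<Oplus>j\<in>(+) m ` {..<n}. f j) = (\<Oplus>j\<in>{..<n}. f (m + j))"
    using assms by (intro finsum_reindex) auto
  finally show ?thesis .
qed

lemma mvec_hcat:
  assumes "dim_row N = dim_row M" "entries_in \<eta> M" "entries_in \<eta> N" "\<And>j. x j \<in> carrier R" "i < dim_row M"
  shows "mvec \<eta> (hcat M N) x i = mvec \<eta> M x i \<oplus> mvec \<eta> N (\<lambda>j. x (dim_col M + j)) i"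
proof -
  have "mvec \<eta> (hcat M N) x i = (\<Oplus>j\<in>{..<dim_col M}. \<eta> (hcat M N $$ (i, j)) \<otimes> x j) \<oplus>
      (\<Oplus>j\<in>{..<dim_col N}. \<eta> (hcat M N $$ (i, dim_col M + j)) \<otimes> x (dim_col M + j))"
    unfolding mvec_def dim_hcat
    using assms by (intro finsum_lessThan_add) (auto simp: hcat_def entries_in_def)
  also have "(\<Oplus>j\<in>{..<dim_col M}. \<eta> (hcat M N $$ (i, j)) \<otimes> x j) = mvec \<eta> M x i"
    unfolding mvec_def using assms by (intro finsum_cong' refl) (auto simp: hcat_def entries_in_def)
  also have "(\<Oplus>j\<in>{..<dim_col N}. \<eta> (hcat M N $$ (i, dim_col M + j)) \<otimes> x (dim_col M + j)) =
      mvec \<eta> N (\<lambda>j. x (dim_col M + j)) i"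
    unfolding mvec_def using assms by (intro finsum_cong' refl) (auto simp: hcat_def entries_in_def)
  finally show ?thesis .
qed

text \<open>A row of a block diagonal matrix only sees its own block.\<close>

lemma mvec_block_diag:
  assumes d: "\<eta> d = \<zero>" and Ms: "\<And>M. M \<in> set Ms \<Longrightarrow> entries_in \<eta> M" and x: "\<And>j. x j \<in> carrier R"
    and m: "m < length Ms" and i: "i < dim_row (Ms ! m)"
  shows "mvec \<eta> (block_diag d Ms) x (off (map dim_row Ms) m + i) =
    mvec \<eta> (Ms ! m) (\<lambda>j. x (off (map dim_col Ms) m + j)) i"
proof -
  let ?r = "off (map dim_row Ms) m + i" and ?c = "map dim_col Ms"
  have r: "?r < sum_list (map dim_row Ms)" using off_less(1)[of m "map dim_row Ms" i] m i by simp
  have bij: "bij_betw (\<lambda>(m, j). off ?c m + j) (SIGMA m:{..<length Ms}. {..<?c ! m}) {..<sum_list ?c}"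
    using bij_off[of ?c] by simp
  have cl: "\<eta> (block_diag d Ms $$ (?r, j)) \<otimes> x j \<in> carrier R" if "j < sum_list ?c" for j
  proof -
    have "\<eta> (block_diag d Ms $$ (?r, j)) \<in> carrier R"
      by (rule block_diag_all[where P = "\<lambda>a. \<eta> a \<in> carrier R"])
        (use Ms d r that in \<open>auto simp: entries_in_def\<close>)
    then show ?thesis using x by simp
  qed
  let ?I = "(+) (off ?c m) ` {..<dim_col (Ms ! m)}"
  have sub: "?I \<subseteq> {..<sum_list ?c}" using off_less(1)[of m ?c] m by auto
  have "mvec \<eta> (block_diag d Ms) x ?r = (\<Oplus>j\<in>?I. \<eta> (block_diag d Ms $$ (?r, j)) \<otimes> x j)"
    unfolding mvec_def dim_block_diag
  proof (rule add.finprod_mono_neutral_cong_right[OF _ sub])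
    fix j assume j: "j \<in> {..<sum_list ?c} - ?I"
    then have "j \<in> (\<lambda>(m, j). off ?c m + j) ` (SIGMA m:{..<length Ms}. {..<?c ! m})"
      using bij_betw_imp_surj_on[OF bij] by blast
    then obtain p where p: "j = (\<lambda>(m, j). off ?c m + j) p" "p \<in> (SIGMA m:{..<length Ms}. {..<?c ! m})"
      by (rule imageE)
    obtain m' j' where "p = (m', j')" by (cases p)
    with p have *: "m' < length Ms" "j' < ?c ! m'" "j = off ?c m' + j'" by auto
    have "m' \<noteq> m" using j * m by auto
    then have "block_diag d Ms $$ (?r, j) = d"
      unfolding *(3) using block_diag_entry[of m Ms m' i j' d] m i * by simp
    then show "\<eta> (block_diag d Ms $$ (?r, j)) \<otimes> x j = \<zero>" using d x by simp
  qed (use cl in auto)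
  also have "\<dots> = (\<Oplus>j\<in>{..<dim_col (Ms ! m)}. \<eta> (block_diag d Ms $$ (?r, off ?c m + j)) \<otimes> x (off ?c m + j))"
    using cl sub by (intro finsum_reindex) auto
  also have "\<dots> = mvec \<eta> (Ms ! m) (\<lambda>j. x (off ?c m + j)) i"
    unfolding mvec_def
    using block_diag_entry[of m Ms m i _ d] m i Ms[of "Ms ! m"] x
    by (intro finsum_cong' refl) (auto simp: entries_in_def)
  finally show ?thesis .
qed

lemma mvec_block_diag_row:
  assumes "\<eta> d = \<zero>" "dim_row g = 1" "entries_in \<eta> g" "\<And>j. x j \<in> carrier R" "i < l"
  shows "mvec \<eta> (block_diag d (replicate l g)) x i = (\<Oplus>u\<in>{..<dim_col g}. \<eta> (g $$ (0, u)) \<otimes> x (i * dim_col g + u))"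
proof -
  have o: "off (replicate l n) i = i * n" for n using assms(5) by (simp add: off_def sum_list_replicate min_def)
  have "mvec \<eta> (block_diag d (replicate l g)) x (off (map dim_row (replicate l g)) i + 0) =
      mvec \<eta> (replicate l g ! i) (\<lambda>j. x (off (map dim_col (replicate l g)) i + j)) 0"
    using assms by (intro mvec_block_diag) auto
  then show ?thesis using assms(2,5) by (simp add: map_replicate o mvec_def)
qed

lemma finsum_select:
  fixes n :: nat
  assumes U: "finite U" and h: "\<And>u. u \<in> U \<Longrightarrow> Q u \<Longrightarrow> h u < n"
    and b: "\<And>u. u \<in> U \<Longrightarrow> Q u \<Longrightarrow> b u \<in> carrier R" and x: "\<And>j. x j \<in> carrier R"
    and c: "\<And>j. j < n \<Longrightarrow> c j \<otimes> x j = (\<Oplus>u\<in>U. if Q u \<and> j = h u then b u \<otimes> x (h u) else \<zero>)"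
  shows "(\<Oplus>j\<in>{..<n}. c j \<otimes> x j) = (\<Oplus>u\<in>U. if Q u then b u \<otimes> x (h u) else \<zero>)"
proof -
  have "(\<Oplus>j\<in>{..<n}. c j \<otimes> x j) = (\<Oplus>j\<in>{..<n}. \<Oplus>u\<in>U. if Q u \<and> j = h u then b u \<otimes> x (h u) else \<zero>)"
    using b x by (intro finsum_cong' refl Pi_I finsum_closed) (auto simp: c)
  also have "\<dots> = (\<Oplus>u\<in>U. \<Oplus>j\<in>{..<n}. if Q u \<and> j = h u then b u \<otimes> x (h u) else \<zero>)"
    using b x U by (intro finsum_sum_swap) auto
  also have "\<dots> = (\<Oplus>u\<in>U. if Q u then b u \<otimes> x (h u) else \<zero>)"
  proof (intro finsum_cong' refl)
    fix u assume u: "u \<in> U"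
    show "(\<Oplus>j\<in>{..<n}. if Q u \<and> j = h u then b u \<otimes> x (h u) else \<zero>) = (if Q u then b u \<otimes> x (h u) else \<zero>)"
    proof (cases "Q u")
      case True
      then show ?thesis using h[OF u] b[OF u] x
        by (subst finsum_single[where a = "h u"]) auto
    qed (simp add: finsum_zero)
  qed (use b x in auto)
  finally show ?thesis .
qed

end

section \<open>The rows of the matrices of the resolution\<close>

context class_T_koszul
begin

abbreviation mv where "mv \<equiv> A.mvec hc"
abbreviation ein where "ein \<equiv> A.entries_in hc"

lemma hc_zero: "hc \<zero>\<^bsub>KK\<^esub> = \<zero>\<^bsub>AA\<^esub>" by (rule hclass_zero)

lemma z1_mem: "u \<in> {1, 2, 3} \<Longrightarrow> z 1 u \<in> ZZ \<and> z 1 u \<in> deg 1"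
  using z_cycles(1) rk_ge(1) by auto

definition omit :: "nat \<Rightarrow> nat set \<Rightarrow> 'a" where
  "omit u = z 1 (Min ({1, 2, 3} - {u})) \<otimes>\<^bsub>KK\<^esub> z 1 (Max ({1, 2, 3} - {u}))"

lemma omit_simps: "omit 1 = z 1 2 \<otimes>\<^bsub>KK\<^esub> z 1 3" "omit 2 = z 1 1 \<otimes>\<^bsub>KK\<^esub> z 1 3" "omit 3 = z 1 1 \<otimes>\<^bsub>KK\<^esub> z 1 2"
proof -
  have "{1, 2, 3} - {1} = {2, 3::nat}" "{1, 2, 3} - {2} = {1, 3::nat}" "{1, 2, 3} - {3} = {1, 2::nat}" by auto
  then show "omit 1 = z 1 2 \<otimes>\<^bsub>KK\<^esub> z 1 3" "omit 2 = z 1 1 \<otimes>\<^bsub>KK\<^esub> z 1 3" "omit 3 = z 1 1 \<otimes>\<^bsub>KK\<^esub> z 1 2"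
    unfolding omit_def by (simp_all add: numeral_2_eq_2 numeral_3_eq_3)
qed

lemma omit_mem: "u \<in> {1, 2, 3} \<Longrightarrow> omit u \<in> ZZ \<and> omit u \<in> deg 2"
proof -
  have m: "z 1 a \<otimes>\<^bsub>KK\<^esub> z 1 b \<in> ZZ \<and> z 1 a \<otimes>\<^bsub>KK\<^esub> z 1 b \<in> deg 2" if "a \<in> {1, 2, 3}" "b \<in> {1, 2, 3}" for a b
    using z1_mem[OF that(1)] z1_mem[OF that(2)] mult_deg[of "z 1 a" 1 "z 1 b" 1] cycles_mult
    unfolding one_add_one by blast
  assume "u \<in> {1, 2, 3}"
  then consider "u = 1" | "u = 2" | "u = 3" by blast
  then show ?thesis
  proof cases
    case 1
    show ?thesis unfolding 1 omit_simps by (rule m; blast)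
  next
    case 2
    show ?thesis unfolding 2 omit_simps by (rule m; blast)
  next
    case 3
    show ?thesis unfolding 3 omit_simps by (rule m; blast)
  qed
qed

lemma beta_entry:
  assumes "i < bnum k" "j < bnum (Suc k)"
  shows "mat_beta R xs z (Suc k) $$ (i, j) =
    (if \<exists>u\<in>{1, 2, 3}. j = pos (act u (words k ! i)) then z 1 (THE u. u \<in> {1, 2, 3} \<and> j = pos (act u (words k ! i)))
     else \<zero>\<^bsub>KK\<^esub>)"
proof -
  have "words (Suc k) ! j = sort (words k ! i @ [u]) \<longleftrightarrow> j = pos (act u (words k ! i))" if "u \<in> {1, 2, 3}" for u
    using words_eq_iff[OF assms(2) act_W[OF words_W[OF assms(1)] that]] by (simp add: act_def)
  then have *: "(\<lambda>u. u \<in> {1, 2, 3} \<and> words (Suc k) ! j = sort (words k ! i @ [u])) =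
      (\<lambda>u. u \<in> {1, 2, 3} \<and> j = pos (act u (words k ! i)))" by (intro ext) blast
  have "mat_beta R xs z (Suc k) $$ (i, j) = (let P = (\<lambda>u. u \<in> {1, 2, 3} \<and> words (Suc k) ! j = sort (words k ! i @ [u]))
     in if \<exists>u. P u then z 1 (THE u. P u) else \<zero>\<^bsub>KK\<^esub>)"
    using assms unfolding mat_beta_def by simp
  then show ?thesis unfolding Let_def * Bex_def .
qed

lemma beta_entry_pos:
  assumes "i < bnum k" "u \<in> {1, 2, 3}"
  shows "mat_beta R xs z (Suc k) $$ (i, pos (act u (words k ! i))) = z 1 u"
proof -
  let ?w = "words k ! i"
  note w = words_W[OF assms(1)]
  have uniq: "t = u" if "t \<in> {1, 2, 3}" "pos (act u ?w) = pos (act t ?w)" for t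
  proof -
    have "act u ?w = act t ?w" using that words_pos[OF act_W[OF w]] assms(2) by metis
    then show ?thesis using act_inj_left by metis
  qed
  have "(THE t. t \<in> {1, 2, 3} \<and> pos (act u ?w) = pos (act t ?w)) = u"
    by (rule the_equality) (use assms(2) uniq in blast)+
  moreover have "pos (act u ?w) < bnum (Suc k)" by (rule pos_less[OF act_W[OF w assms(2)]])
  ultimately show ?thesis
    using assms(2) by (subst beta_entry[OF assms(1)]) auto
qed

lemma dim_beta: "dim_row (mat_beta R xs z k) = bnum (k - 1)" "dim_col (mat_beta R xs z k) = bnum k"
  by (simp_all add: mat_beta_def)

lemma dim_beta': "dim_row (mat_beta' R xs z k) = bnum (k - 1)" "dim_col (mat_beta' R xs z k) = bnum (k - 2)"
  by (simp_all add: mat_beta'_def)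

lemma beta_all:
  assumes "\<And>u. u \<in> {1, 2, 3} \<Longrightarrow> P (z 1 u)" "P \<zero>\<^bsub>KK\<^esub>" "i < bnum k" "j < bnum (Suc k)"
  shows "P (mat_beta R xs z (Suc k) $$ (i, j))"
proof (cases "\<exists>u\<in>{1, 2, 3}. j = pos (act u (words k ! i))")
  case True
  then obtain u where "u \<in> {1, 2, 3}" "j = pos (act u (words k ! i))" by blast
  then show ?thesis using beta_entry_pos[OF assms(3)] assms(1) by metis
next
  case False
  then show ?thesis unfolding beta_entry[OF assms(3,4)] using assms(2) by (simp only: if_False)
qed

lemma beta'_entry:
  assumes "i < bnum (Suc k)" "j < bnum k"
  shows "mat_beta' R xs z (Suc (Suc k)) $$ (i, j) =
    (if \<exists>u\<in>{1, 2, 3}. words (Suc k) ! i = act u (words k ! j)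
     then omit (THE u. u \<in> {1, 2, 3} \<and> words (Suc k) ! i = act u (words k ! j)) else \<zero>\<^bsub>KK\<^esub>)"
proof -
  have "mat_beta' R xs z (Suc (Suc k)) $$ (i, j) =
    (let P = (\<lambda>u. u \<in> {1, 2, 3} \<and> words (Suc k) ! i = sort (words k ! j @ [u]));
         V = {1, 2, 3} - {THE u. P u}
     in if \<exists>u. P u then z 1 (Min V) \<otimes>\<^bsub>KK\<^esub> z 1 (Max V) else \<zero>\<^bsub>KK\<^esub>)"
    using assms unfolding mat_beta'_def by (simp add: numeral_2_eq_2)
  then show ?thesis unfolding Let_def omit_def act_def Bex_def .
qed

lemma beta'_entry_pos:
  assumes "i < bnum (Suc k)" "j < bnum k" "u \<in> {1, 2, 3}" "words (Suc k) ! i = act u (words k ! j)"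
  shows "mat_beta' R xs z (Suc (Suc k)) $$ (i, j) = omit u"
proof -
  have "(THE t. t \<in> {1, 2, 3} \<and> words (Suc k) ! i = act t (words k ! j)) = u"
    by (rule the_equality) (use assms(3,4) act_inj_left in \<open>blast, metis\<close>)
  then show ?thesis using assms by (subst beta'_entry) auto
qed

lemma beta'_all:
  assumes "\<And>u. u \<in> {1, 2, 3} \<Longrightarrow> P (omit u)" "P \<zero>\<^bsub>KK\<^esub>" "i < bnum (Suc k)" "j < bnum k"
  shows "P (mat_beta' R xs z (Suc (Suc k)) $$ (i, j))"
proof (cases "\<exists>u\<in>{1, 2, 3}. words (Suc k) ! i = act u (words k ! j)")
  case True
  then obtain u where "u \<in> {1, 2, 3}" "words (Suc k) ! i = act u (words k ! j)" by blast
  then show ?thesis using beta'_entry_pos[OF assms(3,4)] assms(1) by metis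
next
  case False
  then show ?thesis unfolding beta'_entry[OF assms(3,4)] using assms(2) by (simp only: if_False)
qed

lemma sum123: "(\<And>u. u \<in> {1, 2, 3} \<Longrightarrow> f u \<in> carrier AA) \<Longrightarrow>
  (\<Oplus>\<^bsub>AA\<^esub>u\<in>{1, 2, 3::nat}. f u) = f 1 \<oplus>\<^bsub>AA\<^esub> (f 2 \<oplus>\<^bsub>AA\<^esub> f 3)"
  by simp

lemma ein_beta: "ein (mat_beta R xs z (Suc k))"
  unfolding A.entries_in_def dim_beta diff_Suc_1
  using beta_all[of "\<lambda>a. hc a \<in> carrier AA"] z1_mem zero_cycle by (meson hclass_closed)

lemma ein_beta': "ein (mat_beta' R xs z (Suc (Suc k)))"
proof -
  have dc: "dim_col (mat_beta' R xs z (Suc (Suc k))) = bnum k" by (simp add: dim_beta')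
  show ?thesis
    unfolding A.entries_in_def dc dim_beta'(1) diff_Suc_1
    using beta'_all[of "\<lambda>a. hc a \<in> carrier AA"] omit_mem zero_cycle by (meson hclass_closed)
qed

text \<open>The rows and columns of \<open>\<beta>\<close> are positions of words; among the columns only
  \<open>act u w\<close> with \<open>u \<in> {1, 2, 3}\<close> has a nonzero entry in row
  \<open>w\<close>.\<close>

lemma mv_beta:
  assumes x: "\<And>j. x j \<in> carrier AA" and w: "w \<in> W k"
  shows "mv (mat_beta R xs z (Suc k)) x (pos w) = T.Bw (\<lambda>s. x (pos s)) w"
proof -
  have i: "pos w < bnum k" and wi: "words k ! pos w = w" using pos_less[OF w] words_pos[OF w] by auto
  have ec: "e u \<in> carrier AA" if "u \<in> {1, 2, 3}" for u using eg_closed(1)[OF that] .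
  have inj: "t = u" if "t \<in> {1, 2, 3}" "u \<in> {1, 2, 3}" "pos (act u w) = pos (act t w)" for t u
  proof -
    have "act u w = act t w" using that words_pos[OF act_W[OF w]] by metis
    then show ?thesis using act_inj_left by metis
  qed
  have "mv (mat_beta R xs z (Suc k)) x (pos w) =
      (\<Oplus>\<^bsub>AA\<^esub>u\<in>{1, 2, 3}. if True then e u \<otimes>\<^bsub>AA\<^esub> x (pos (act u w)) else \<zero>\<^bsub>AA\<^esub>)"
    unfolding A.mvec_def dim_beta
  proof (rule A.finsum_select)
    fix j assume j: "j < bnum (Suc k)"
    show "hc (mat_beta R xs z (Suc k) $$ (pos w, j)) \<otimes>\<^bsub>AA\<^esub> x j =
      (\<Oplus>\<^bsub>AA\<^esub>u\<in>{1, 2, 3}. if True \<and> j = pos (act u w) then e u \<otimes>\<^bsub>AA\<^esub> x (pos (act u w)) else \<zero>\<^bsub>AA\<^esub>)"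
    proof (cases "\<exists>u\<in>{1, 2, 3}. j = pos (act u w)")
      case True
      then obtain u where u: "u \<in> {1, 2, 3}" "j = pos (act u w)" by blast
      have "(\<Oplus>\<^bsub>AA\<^esub>t\<in>{1, 2, 3}. if True \<and> j = pos (act t w) then e t \<otimes>\<^bsub>AA\<^esub> x (pos (act t w)) else \<zero>\<^bsub>AA\<^esub>) =
          (if True \<and> j = pos (act u w) then e u \<otimes>\<^bsub>AA\<^esub> x (pos (act u w)) else \<zero>\<^bsub>AA\<^esub>)"
      proof (rule A.finsum_single)
        fix t assume t: "t \<in> {1, 2, 3::nat}" "t \<noteq> u"
        then have "j \<noteq> pos (act t w)" using inj[OF t(1) u(1)] u(2) by metis
        then show "(if True \<and> j = pos (act t w) then e t \<otimes>\<^bsub>AA\<^esub> x (pos (act t w)) else \<zero>\<^bsub>AA\<^esub>) = \<zero>\<^bsub>AA\<^esub>" by simp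
      qed (use u ec x in auto)
      then show ?thesis using beta_entry_pos[OF i u(1)] u(2) wi by simp
    next
      case False
      then have "mat_beta R xs z (Suc k) $$ (pos w, j) = \<zero>\<^bsub>KK\<^esub>"
        unfolding beta_entry[OF i j] wi by (simp only: if_False)
      then show ?thesis using False x by (simp add: hc_zero)
    qed
  qed (use ec x pos_less[OF act_W[OF w]] in auto)
  also have "\<dots> = T.Bw (\<lambda>s. x (pos s)) w"
    unfolding T.Bw_def using ec x by (subst sum123) auto
  finally show ?thesis .
qed

text \<open>The transposed pattern of \<open>\<beta>\<close>: row \<open>w\<close> meets the columns
  \<open>v\<close> with \<open>w = act u v\<close>, hence the division \<open>drp u\<close>.\<close>

lemma mv_beta':
  assumes x: "\<And>j. x j \<in> carrier AA" and w: "w \<in> W (Suc k)"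
  shows "mv (mat_beta' R xs z (Suc (Suc k))) x (pos w) = T.Cw (\<lambda>s. x (pos s)) w"
proof -
  have i: "pos w < bnum (Suc k)" and wi: "words (Suc k) ! pos w = w" using pos_less[OF w] words_pos[OF w] by auto
  have oc: "hc (omit u) \<in> carrier AA" if "u \<in> {1, 2, 3}" for u using omit_mem[OF that] by simp
  have rm: "remove1 u w \<in> W k \<and> act u (remove1 u w) = w" if "u \<in> set w" for u
    using remove_W[OF w that] by (metis Suc_inject)
  have set: "u \<in> set w \<and> j = pos (remove1 u w) \<longleftrightarrow> w = act u (words k ! j)" if j: "j < bnum k" for u j
  proof
    assume "u \<in> set w \<and> j = pos (remove1 u w)"
    then show "w = act u (words k ! j)" using rm[of u] words_pos[of "remove1 u w" k] by simp
  next
    assume w': "w = act u (words k ! j)"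
    then have "remove1 u w = words k ! j" using remove_act[OF words_W[OF j]] by simp
    moreover have "u \<in> set w" using w' by simp
    ultimately show "u \<in> set w \<and> j = pos (remove1 u w)" using pos_words[OF j] by simp
  qed
  have dc: "dim_col (mat_beta' R xs z (Suc (Suc k))) = bnum k" by (simp add: dim_beta')
  have "mv (mat_beta' R xs z (Suc (Suc k))) x (pos w) =
      (\<Oplus>\<^bsub>AA\<^esub>u\<in>{1, 2, 3}. if u \<in> set w then hc (omit u) \<otimes>\<^bsub>AA\<^esub> x (pos (remove1 u w)) else \<zero>\<^bsub>AA\<^esub>)"
    unfolding A.mvec_def dc
  proof (rule A.finsum_select)
    fix j assume j: "j < bnum k"
    show "hc (mat_beta' R xs z (Suc (Suc k)) $$ (pos w, j)) \<otimes>\<^bsub>AA\<^esub> x j =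
      (\<Oplus>\<^bsub>AA\<^esub>u\<in>{1, 2, 3}. if u \<in> set w \<and> j = pos (remove1 u w) then hc (omit u) \<otimes>\<^bsub>AA\<^esub> x (pos (remove1 u w)) else \<zero>\<^bsub>AA\<^esub>)"
    proof (cases "\<exists>u\<in>{1, 2, 3}. w = act u (words k ! j)")
      case True
      then obtain u where u: "u \<in> {1, 2, 3}" "w = act u (words k ! j)" by blast
      have "(\<Oplus>\<^bsub>AA\<^esub>t\<in>{1, 2, 3}. if t \<in> set w \<and> j = pos (remove1 t w) then hc (omit t) \<otimes>\<^bsub>AA\<^esub> x (pos (remove1 t w)) else \<zero>\<^bsub>AA\<^esub>) =
          (if u \<in> set w \<and> j = pos (remove1 u w) then hc (omit u) \<otimes>\<^bsub>AA\<^esub> x (pos (remove1 u w)) else \<zero>\<^bsub>AA\<^esub>)"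
      proof (rule A.finsum_single)
        fix t assume t: "t \<in> {1, 2, 3::nat}" "t \<noteq> u"
        then have "\<not> (t \<in> set w \<and> j = pos (remove1 t w))"
          unfolding set[OF j] using u(2) act_inj_left by metis
        then show "(if t \<in> set w \<and> j = pos (remove1 t w) then hc (omit t) \<otimes>\<^bsub>AA\<^esub> x (pos (remove1 t w)) else \<zero>\<^bsub>AA\<^esub>) = \<zero>\<^bsub>AA\<^esub>"
          by (simp only: if_False)
      qed (use u(1) oc x in auto)
      moreover have uj: "u \<in> set w \<and> j = pos (remove1 u w)" using set[OF j] u(2) by blast
      moreover have "mat_beta' R xs z (Suc (Suc k)) $$ (pos w, j) = omit u"
        by (rule beta'_entry_pos[OF i j u(1)]) (unfold wi, rule u(2))
      ultimately show "hc (mat_beta' R xs z (Suc (Suc k)) $$ (pos w, j)) \<otimes>\<^bsub>AA\<^esub> x j =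
        (\<Oplus>\<^bsub>AA\<^esub>u\<in>{1, 2, 3}. if u \<in> set w \<and> j = pos (remove1 u w) then hc (omit u) \<otimes>\<^bsub>AA\<^esub> x (pos (remove1 u w)) else \<zero>\<^bsub>AA\<^esub>)"
        by (simp only: if_True) metis
    next
      case False
      then have "mat_beta' R xs z (Suc (Suc k)) $$ (pos w, j) = \<zero>\<^bsub>KK\<^esub>"
        unfolding beta'_entry[OF i j] wi by (simp only: if_False)
      moreover have "(\<Oplus>\<^bsub>AA\<^esub>u\<in>{1, 2, 3}. if u \<in> set w \<and> j = pos (remove1 u w) then hc (omit u) \<otimes>\<^bsub>AA\<^esub> x (pos (remove1 u w)) else \<zero>\<^bsub>AA\<^esub>) = \<zero>\<^bsub>AA\<^esub>"
      proof (rule A.add.finprod_one_eqI)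
        fix t assume t: "t \<in> {1, 2, 3::nat}"
        have "\<not> (t \<in> set w \<and> j = pos (remove1 t w))"
          unfolding set[OF j] using False t by blast
        then show "(if t \<in> set w \<and> j = pos (remove1 t w) then hc (omit t) \<otimes>\<^bsub>AA\<^esub> x (pos (remove1 t w)) else \<zero>\<^bsub>AA\<^esub>) = \<zero>\<^bsub>AA\<^esub>"
          by (simp only: if_False)
      qed
      ultimately show "hc (mat_beta' R xs z (Suc (Suc k)) $$ (pos w, j)) \<otimes>\<^bsub>AA\<^esub> x j =
        (\<Oplus>\<^bsub>AA\<^esub>u\<in>{1, 2, 3}. if u \<in> set w \<and> j = pos (remove1 u w) then hc (omit u) \<otimes>\<^bsub>AA\<^esub> x (pos (remove1 u w)) else \<zero>\<^bsub>AA\<^esub>)"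
        using x by (simp add: hc_zero)
    qed
  next
    fix u assume "u \<in> set w"
    then show "pos (remove1 u w) < bnum k" using rm pos_less by blast
  qed (use oc x in auto)
  also have "\<dots> = (\<Oplus>\<^bsub>AA\<^esub>u\<in>{1, 2, 3}. hc (omit u) \<otimes>\<^bsub>AA\<^esub> T.drp u (\<lambda>s. x (pos s)) w)"
    using oc x by (intro A.finsum_cong' refl) (auto simp: T.drp_def)
  also have "\<dots> = T.Cw (\<lambda>s. x (pos s)) w"
  proof -
    have d: "T.drp u (\<lambda>s. x (pos s)) w \<in> carrier AA" for u using x by (simp add: T.drp_def)
    have o: "hc (omit 1) = e 2 \<otimes>\<^bsub>AA\<^esub> e 3" "hc (omit 2) = e 1 \<otimes>\<^bsub>AA\<^esub> e 3" "hc (omit 3) = e 1 \<otimes>\<^bsub>AA\<^esub> e 2"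
      unfolding omit_simps using z1_mem by (auto intro!: hclass_mult)
    have ec: "e u \<in> carrier AA" if "u \<in> {1, 2, 3}" for u using eg_closed(1)[OF that] .
    have c: "e 2 \<otimes>\<^bsub>AA\<^esub> e 3 \<otimes>\<^bsub>AA\<^esub> T.drp 1 (\<lambda>s. x (pos s)) w \<in> carrier AA"
      "e 1 \<otimes>\<^bsub>AA\<^esub> e 3 \<otimes>\<^bsub>AA\<^esub> T.drp 2 (\<lambda>s. x (pos s)) w \<in> carrier AA"
      "e 1 \<otimes>\<^bsub>AA\<^esub> e 2 \<otimes>\<^bsub>AA\<^esub> T.drp 3 (\<lambda>s. x (pos s)) w \<in> carrier AA"
      by (intro A.m_closed ec d; simp)+
    show ?thesis
      unfolding T.Cw_def
    proof (subst sum123)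
      show "hc (omit u) \<otimes>\<^bsub>AA\<^esub> T.drp u (\<lambda>s. x (pos s)) w \<in> carrier AA" if "u \<in> {1, 2, 3}" for u
        using oc[OF that] d by simp
    qed (unfold o, use c in \<open>simp only: A.a_ac\<close>)
  qed
  finally show ?thesis .
qed

end

lemma tb_concat: "tb (concat Ds) = sum_list (map tb Ds)"
  by (induction Ds) (simp_all add: tb_def)

lemma tb_replicate: "tb (replicate n p) = n * bnum p"
  by (simp add: tb_def sum_list_replicate)

lemma hcat_all:
  assumes "dim_row N = dim_row M" "\<And>i j. i < dim_row M \<Longrightarrow> j < dim_col M \<Longrightarrow> P (M $$ (i, j))"
    "\<And>i j. i < dim_row N \<Longrightarrow> j < dim_col N \<Longrightarrow> P (N $$ (i, j))"
    "i < dim_row (hcat M N)" "j < dim_col (hcat M N)"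
  shows "P (hcat M N $$ (i, j))"
  using assms by (auto simp: hcat_def)

lemma vcat_all:
  assumes "dim_col N = dim_col M" "\<And>i j. i < dim_row M \<Longrightarrow> j < dim_col M \<Longrightarrow> P (M $$ (i, j))"
    "\<And>i j. i < dim_row N \<Longrightarrow> j < dim_col N \<Longrightarrow> P (N $$ (i, j))"
    "i < dim_row (vcat M N)" "j < dim_col (vcat M N)"
  shows "P (vcat M N $$ (i, j))"
  using assms by (auto simp: vcat_def)

lemma (in ring) mvec_vcat_upper:
  "entries_in \<eta> M \<Longrightarrow> (\<And>j. x j \<in> carrier R) \<Longrightarrow> i < dim_row M \<Longrightarrow> mvec \<eta> (vcat M N) x i = mvec \<eta> M x i"
  unfolding mvec_def by (intro finsum_cong') (auto simp: vcat_def entries_in_def)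

lemma (in ring) mvec_vcat_zero:
  assumes "dim_row M \<le> i" "i < dim_row M + n" "\<eta> d = \<zero>" "\<And>j. x j \<in> carrier R"
  shows "mvec \<eta> (vcat M (mat n (dim_col M) (\<lambda>_. d))) x i = \<zero>"
  unfolding mvec_def by (rule add.finprod_one_eqI) (use assms in \<open>auto simp: vcat_def\<close>)

context class_T_koszul
begin

text \<open>The word degrees of the rows of the matrix with number \<open>Suc k\<close>, block by block; the
  last blocks belong to the columns \<open>g1\<close> of the preceding matrix.\<close>

primrec degs :: "nat \<Rightarrow> nat list" where
  "degs 0 = [0]"
| "degs (Suc k) = map Suc (degs k) @ replicate (tb (degs k) * n1) 0"

definition pdegs :: "nat \<Rightarrow> nat list" where
  "pdegs k = (case k of 0 \<Rightarrow> [] | Suc j \<Rightarrow> degs j)"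

lemma pdegs_simps [simp]: "pdegs 0 = []" "pdegs (Suc k) = degs k"
  by (simp_all add: pdegs_def)

text \<open>The recursion for \<open>degs\<close> resolved: the blocks of degree \<open>k - i\<close> are
  those created \<open>i\<close> steps after the start, \<open>d\<^sub>i\<close> in number. Summing the
  sizes gives \<open>\<ell>\<^sub>k\<close>.\<close>

lemma degs_concat: "degs k = concat (map (\<lambda>i. replicate (dnum rk i) (k - i)) [0..<Suc k]) \<and> tb (degs k) = ell rk k"
proof (induction k)
  case 0
  show ?case by (simp add: dnum_def tb_def bnum_0 ell_eq)
next
  case (Suc k)
  have *: "degs (Suc k) = concat (map (\<lambda>i. replicate (dnum rk i) (Suc k - i)) [0..<Suc (Suc k)])"
  proof -
    have "map Suc (degs k) = concat (map (\<lambda>i. replicate (dnum rk i) (Suc k - i)) [0..<Suc k])"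
      unfolding Suc[THEN conjunct1] map_concat map_map
      by (intro arg_cong[where f = concat] map_cong) (auto simp: Suc_diff_le simp del: upt_Suc)
    moreover have "tb (degs k) * n1 = dnum rk (Suc k)" using Suc[THEN conjunct2] by (simp add: dnum_def mult.commute)
    ultimately show ?thesis by simp
  qed
  have "tb (degs (Suc k)) = (\<Sum>i\<leftarrow>[0..<Suc (Suc k)]. dnum rk i * bnum (Suc k - i))"
    unfolding * tb_concat map_map by (simp only: tb_replicate o_def)
  also have "\<dots> = (\<Sum>i\<in>{0..<Suc (Suc k)}. dnum rk i * bnum (Suc k - i))"
    by (subst interv_sum_list_conv_sum_set_nat) simp
  also have "\<dots> = ell rk (Suc k)"
    unfolding ell_eq by (simp add: atLeast0LessThan lessThan_Suc_atMost mult.commute)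
  finally show ?case using * by blast
qed

lemma tb_degs: "tb (degs k) = ell rk k"
  using degs_concat by blast

lemma tb_pdegs: "tb (pdegs k) = ell_m2 rk (Suc k)"
proof (cases k)
  case 0
  then show ?thesis by (simp add: ell_m2_def tb_def)
next
  case (Suc j)
  then show ?thesis by (simp add: ell_m2_def tb_degs)
qed

lemma degs_pdegs: "degs k = map Suc (pdegs k) @ replicate (dnum rk k) 0"
  by (cases k) (simp_all add: dnum_def tb_degs mult.commute)

lemma beta_list: "concat (map (\<lambda>i. replicate (dnum rk i) (mat_beta R xs z (Suc k - i))) [0..<Suc k]) =
    map (mat_beta R xs z) (map Suc (degs k))"
  unfolding degs_concat[THEN conjunct1] map_concat map_map
  by (intro arg_cong[where f = concat] map_cong) (auto simp: Suc_diff_le simp del: upt_Suc)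

lemma beta'_list: "concat (map (\<lambda>i. replicate (dnum rk i) (mat_beta' R xs z (Suc k - i))) [0..<k]) =
    map (\<lambda>p. mat_beta' R xs z (Suc (Suc p))) (pdegs k)"
proof (cases k)
  case (Suc j)
  show ?thesis
    unfolding Suc pdegs_simps degs_concat[THEN conjunct1] map_concat map_map
    by (intro arg_cong[where f = concat] map_cong) (auto simp: Suc_diff_le simp del: upt_Suc)
qed simp

abbreviation bdiag where "bdiag \<equiv> block_diag \<zero>\<^bsub>KK\<^esub>"

lemma mat_alpha_eq: "mat_alpha R xs z (Suc k) =
    hcat (bdiag (map (mat_beta R xs z) (map Suc (degs k)))) (bdiag (replicate (ell rk k) (mat_gamma1 R xs z)))"
  unfolding mat_alpha_def beta_list diff_Suc_1 ..

lemma mat_N_eq: "mat_N R xs z (Suc k) =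
    vcat (bdiag (map (\<lambda>p. mat_beta' R xs z (Suc (Suc p))) (pdegs k)))
      (mat (dnum rk k) (ell_m2 rk (Suc k)) (\<lambda>_. \<zero>\<^bsub>KK\<^esub>))"
  unfolding mat_N_def diff_Suc_1 beta'_list ..

lemma mat_alpha'_eq: "mat_alpha' R xs z (Suc k) =
    hcat (mat_N R xs z (Suc k)) (bdiag (replicate (ell rk k) (mat_gamma2 R xs z)))"
  unfolding mat_alpha'_def diff_Suc_1 ..

lemma mat_alpha''_eq: "mat_alpha'' R xs z (Suc k) = bdiag (replicate (ell rk k) (mat_gamma3 R xs z))"
  unfolding mat_alpha''_def diff_Suc_1 ..

lemma dim_gamma [simp]: "dim_row (mat_gamma1 R xs z) = 1" "dim_col (mat_gamma1 R xs z) = n1"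
  "dim_row (mat_gamma2 R xs z) = 1" "dim_col (mat_gamma2 R xs z) = n2"
  "dim_row (mat_gamma3 R xs z) = 1" "dim_col (mat_gamma3 R xs z) = n3"
  by (simp_all add: mat_gamma1_def mat_gamma2_def mat_gamma3_def)

lemma gamma_entries:
  "u < n1 \<Longrightarrow> mat_gamma1 R xs z $$ (0, u) = z 1 (u + 4)"
  "u < n2 \<Longrightarrow> mat_gamma2 R xs z $$ (0, u) = z 2 (u + 1)"
  "u < n3 \<Longrightarrow> mat_gamma3 R xs z $$ (0, u) = z 3 (u + 1)"
  by (simp_all add: mat_gamma1_def mat_gamma2_def mat_gamma3_def)

lemma dim_beta_blocks:
  "map dim_row (map (mat_beta R xs z) (map Suc (degs k))) = map bnum (degs k)"
  "map dim_col (map (mat_beta R xs z) (map Suc (degs k))) = map bnum (map Suc (degs k))"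
  by (simp_all add: dim_beta comp_def)

lemma dim_beta'_blocks:
  "map dim_row (map (\<lambda>p. mat_beta' R xs z (Suc (Suc p))) (pdegs k)) = map bnum (map Suc (pdegs k))"
  "map dim_col (map (\<lambda>p. mat_beta' R xs z (Suc (Suc p))) (pdegs k)) = map bnum (pdegs k)"
  by (simp_all add: dim_beta' comp_def)

lemma sum_replicate: "sum_list (map f (replicate n x)) = n * (f x :: nat)"
  by (simp add: sum_list_replicate)

lemma dim_N: "dim_row (mat_N R xs z (Suc k)) = ell rk k" "dim_col (mat_N R xs z (Suc k)) = tb (pdegs k)"
proof -
  have "tb (degs k) = tb (map Suc (pdegs k)) + dnum rk k"
    by (subst degs_pdegs) (simp only: tb_append tb_zeros)
  then show "dim_row (mat_N R xs z (Suc k)) = ell rk k"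
    unfolding mat_N_eq dim_vcat dim_block_diag dim_beta'_blocks tb_def[symmetric] by (simp add: tb_degs)
  show "dim_col (mat_N R xs z (Suc k)) = tb (pdegs k)"
    unfolding mat_N_eq dim_vcat dim_block_diag dim_beta'_blocks by (simp add: tb_def)
qed

lemma dim_alpha:
  "dim_row (mat_alpha R xs z (Suc k)) = ell rk k" "dim_col (mat_alpha R xs z (Suc k)) = ell rk (Suc k)"
  "dim_row (mat_alpha' R xs z (Suc k)) = ell rk k" "dim_col (mat_alpha' R xs z (Suc k)) = ell' rk (Suc k)"
  "dim_row (mat_alpha'' R xs z (Suc k)) = ell rk k" "dim_col (mat_alpha'' R xs z (Suc k)) = ell'' rk (Suc k)"
proof -
  show "dim_row (mat_alpha R xs z (Suc k)) = ell rk k"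
    unfolding mat_alpha_eq dim_hcat dim_block_diag dim_beta_blocks by (simp add: tb_def[symmetric] tb_degs)
  show "dim_col (mat_alpha R xs z (Suc k)) = ell rk (Suc k)"
    unfolding mat_alpha_eq dim_hcat dim_block_diag dim_beta_blocks sum_replicate tb_def[symmetric] tb_degs[symmetric]
    by (simp add: tb_append tb_zeros)
  show "dim_row (mat_alpha' R xs z (Suc k)) = ell rk k"
    unfolding mat_alpha'_eq dim_hcat by (rule dim_N)
  show "dim_col (mat_alpha' R xs z (Suc k)) = ell' rk (Suc k)"
    unfolding mat_alpha'_eq dim_hcat dim_block_diag sum_replicate dim_N
    by (simp add: tb_pdegs ell'_def)
  show "dim_row (mat_alpha'' R xs z (Suc k)) = ell rk k"
    unfolding mat_alpha''_eq dim_block_diag sum_replicate by simp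
  show "dim_col (mat_alpha'' R xs z (Suc k)) = ell'' rk (Suc k)"
    unfolding mat_alpha''_eq dim_block_diag sum_replicate by (simp add: ell''_def)
qed

abbreviation hom_cycle where "hom_cycle i f \<equiv> f \<in> ZZ \<and> f \<in> deg i"

lemma hom_cycle_zero: "hom_cycle i \<zero>\<^bsub>KK\<^esub>"
  by (simp add: zero_cycle zero_deg)

lemma gamma_cycle:
  "i < dim_row (mat_gamma1 R xs z) \<Longrightarrow> u < dim_col (mat_gamma1 R xs z) \<Longrightarrow> hom_cycle 1 (mat_gamma1 R xs z $$ (i, u))"
  "i < dim_row (mat_gamma2 R xs z) \<Longrightarrow> u < dim_col (mat_gamma2 R xs z) \<Longrightarrow> hom_cycle 2 (mat_gamma2 R xs z $$ (i, u))"
  "i < dim_row (mat_gamma3 R xs z) \<Longrightarrow> u < dim_col (mat_gamma3 R xs z) \<Longrightarrow> hom_cycle 3 (mat_gamma3 R xs z $$ (i, u))"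
proof -
  assume "i < dim_row (mat_gamma1 R xs z)" "u < dim_col (mat_gamma1 R xs z)"
  then have "i = 0" "u < n1" "u + 4 \<in> {1..rk 1}" by auto
  then show "hom_cycle 1 (mat_gamma1 R xs z $$ (i, u))" using z_cycles(1)[of "u + 4"] by (simp only: gamma_entries)
next
  assume "i < dim_row (mat_gamma2 R xs z)" "u < dim_col (mat_gamma2 R xs z)"
  then have "i = 0" "u < n2" "u + 1 \<in> {1..rk 2 - 3}" by auto
  then show "hom_cycle 2 (mat_gamma2 R xs z $$ (i, u))" using z_cycles(2)[of "u + 1"] by (simp only: gamma_entries)
next
  assume "i < dim_row (mat_gamma3 R xs z)" "u < dim_col (mat_gamma3 R xs z)"
  then have "i = 0" "u < n3" "u + 1 \<in> {1..rk 3}" by auto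
  then show "hom_cycle 3 (mat_gamma3 R xs z $$ (i, u))" using z_cycles(3)[of "u + 1"] by (simp only: gamma_entries)
qed

lemma bdiag_gamma_cycle:
  assumes "\<And>i u. i < dim_row g \<Longrightarrow> u < dim_col g \<Longrightarrow> hom_cycle c (g $$ (i, u))"
    "i < dim_row (bdiag (replicate l g))" "j < dim_col (bdiag (replicate l g))"
  shows "hom_cycle c (bdiag (replicate l g) $$ (i, j))"
  by (rule block_diag_all[where P = "hom_cycle c", OF _ hom_cycle_zero assms(2,3)])
    (use assms(1) in \<open>simp only: in_set_replicate\<close>)

lemma bdiag_beta_cycle:
  assumes "i < dim_row (bdiag (map (mat_beta R xs z) (map Suc D)))" "j < dim_col (bdiag (map (mat_beta R xs z) (map Suc D)))"
  shows "hom_cycle 1 (bdiag (map (mat_beta R xs z) (map Suc D)) $$ (i, j))"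
proof (rule block_diag_all[where P = "hom_cycle 1", OF _ hom_cycle_zero assms])
  fix M i j assume "M \<in> set (map (mat_beta R xs z) (map Suc D))" and ij: "i < dim_row M" "j < dim_col M"
  then obtain p where M: "M = mat_beta R xs z (Suc p)" by auto
  show "hom_cycle 1 (M $$ (i, j))"
    using ij unfolding M dim_beta diff_Suc_1 by (intro beta_all[where P = "hom_cycle 1", OF z1_mem hom_cycle_zero])
qed

lemma bdiag_beta'_cycle:
  assumes "i < dim_row (bdiag (map (\<lambda>p. mat_beta' R xs z (Suc (Suc p))) D))"
    "j < dim_col (bdiag (map (\<lambda>p. mat_beta' R xs z (Suc (Suc p))) D))"
  shows "hom_cycle 2 (bdiag (map (\<lambda>p. mat_beta' R xs z (Suc (Suc p))) D) $$ (i, j))"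
proof (rule block_diag_all[where P = "hom_cycle 2", OF _ hom_cycle_zero assms])
  fix M i j assume "M \<in> set (map (\<lambda>p. mat_beta' R xs z (Suc (Suc p))) D)" and ij: "i < dim_row M" "j < dim_col M"
  then obtain p where M: "M = mat_beta' R xs z (Suc (Suc p))" by auto
  have ij': "i < bnum (Suc p)" "j < bnum p" using ij unfolding M by (simp_all add: dim_beta')
  show "hom_cycle 2 (M $$ (i, j))"
    unfolding M by (rule beta'_all[where P = "hom_cycle 2", OF omit_mem hom_cycle_zero ij'])
qed

lemma alpha_cycle:
  "q < ell rk k \<Longrightarrow> p < ell rk (Suc k) \<Longrightarrow> hom_cycle 1 (mat_alpha R xs z (Suc k) $$ (q, p))"
  "q < ell rk k \<Longrightarrow> p < ell' rk (Suc k) \<Longrightarrow> hom_cycle 2 (mat_alpha' R xs z (Suc k) $$ (q, p))"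
  "q < ell rk k \<Longrightarrow> p < ell'' rk (Suc k) \<Longrightarrow> hom_cycle 3 (mat_alpha'' R xs z (Suc k) $$ (q, p))"
proof -
  have r: "dim_row (bdiag (replicate (ell rk k) g)) = ell rk k" if "dim_row g = 1" for g :: "(nat set \<Rightarrow> 'a) mat"
    unfolding dim_block_diag sum_replicate using that by simp
  show "hom_cycle 1 (mat_alpha R xs z (Suc k) $$ (q, p))" if "q < ell rk k" "p < ell rk (Suc k)"
  proof -
    have qp: "q < dim_row (mat_alpha R xs z (Suc k))" "p < dim_col (mat_alpha R xs z (Suc k))"
      using that by (simp_all only: dim_alpha)
    have d: "dim_row (bdiag (map (mat_beta R xs z) (map Suc (degs k)))) = ell rk k"
      unfolding dim_block_diag dim_beta_blocks by (simp add: tb_def[symmetric] tb_degs)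
    show ?thesis
      using qp unfolding mat_alpha_eq
      by (intro hcat_all[where P = "hom_cycle 1"] bdiag_beta_cycle bdiag_gamma_cycle gamma_cycle) (simp_all only: d r dim_gamma)
  qed
  show "hom_cycle 2 (mat_alpha' R xs z (Suc k) $$ (q, p))" if "q < ell rk k" "p < ell' rk (Suc k)"
  proof -
    have qp: "q < dim_row (mat_alpha' R xs z (Suc k))" "p < dim_col (mat_alpha' R xs z (Suc k))"
      using that by (simp_all only: dim_alpha)
    have N: "hom_cycle 2 (mat_N R xs z (Suc k) $$ (i, j))"
      if "i < dim_row (mat_N R xs z (Suc k))" "j < dim_col (mat_N R xs z (Suc k))" for i j
      using that unfolding mat_N_eq
    proof (intro vcat_all[where P = "hom_cycle 2"] bdiag_beta'_cycle)
      show "dim_col (mat (dnum rk k) (ell_m2 rk (Suc k)) (\<lambda>_. \<zero>\<^bsub>KK\<^esub>)) =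
          dim_col (bdiag (map (\<lambda>p. mat_beta' R xs z (Suc (Suc p))) (pdegs k)))"
        unfolding dim_block_diag dim_beta'_blocks tb_pdegs[symmetric] by (simp add: tb_def)
    qed (auto simp: hom_cycle_zero)
    show ?thesis
      using qp unfolding mat_alpha'_eq
      by (intro hcat_all[where P = "hom_cycle 2"] N bdiag_gamma_cycle gamma_cycle) (simp_all only: dim_N r dim_gamma)
  qed
  show "hom_cycle 3 (mat_alpha'' R xs z (Suc k) $$ (q, p))" if "q < ell rk k" "p < ell'' rk (Suc k)"
  proof -
    have qp: "q < dim_row (mat_alpha'' R xs z (Suc k))" "p < dim_col (mat_alpha'' R xs z (Suc k))"
      using that by (simp_all only: dim_alpha)
    show ?thesis using qp unfolding mat_alpha''_eq by (intro bdiag_gamma_cycle gamma_cycle)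
  qed
qed

text \<open>The link between the matrices and the operators on words. The blocks of
  \<open>\<alpha>\<^sub>k\<^sub>+\<^sub>1\<close> have the word degrees \<open>degs k\<close>, those of
  \<open>\<alpha>'\<^sub>k\<^sub>+\<^sub>1\<close> the degrees \<open>pdegs k\<close>. The zero rows of
  \<open>N\<^sub>k\<^sub>+\<^sub>1\<close> are the rows in blocks of degree 0, where \<open>Cw\<close>
  vanishes.\<close>

lemma row_formula:
  assumes X: "\<And>j. X j \<in> carrier AA" and Y: "\<And>j. Y j \<in> carrier AA" and T: "\<And>j. T j \<in> carrier AA"
    and l: "l \<in> lab (degs k)"
  shows "mv (mat_alpha R xs z (Suc k)) X (idx (degs k) l) \<oplus>\<^bsub>AA\<^esub>
      (mv (mat_alpha' R xs z (Suc k)) Y (idx (degs k) l) \<oplus>\<^bsub>AA\<^esub> mv (mat_alpha'' R xs z (Suc k)) T (idx (degs k) l)) =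
    T.Row (pdegs k) (degs k) X Y T l"
proof -
  obtain m w where lm: "l = (m, w)" by (cases l)
  have m: "m < length (degs k)" and w: "w \<in> W (degs k ! m)" using l by (auto simp: lm lab_iff)
  let ?i = "idx (degs k) (m, w)"
  have i: "?i < ell rk k" using idx_less[OF l] by (simp add: lm tb_degs)
  let ?B = "map (mat_beta R xs z) (map Suc (degs k))"
  let ?B' = "map (\<lambda>p. mat_beta' R xs z (Suc (Suc p))) (pdegs k)"
  have hz: "hc \<zero>\<^bsub>KK\<^esub> = \<zero>\<^bsub>AA\<^esub>" by (rule hc_zero)
  have ein_of: "ein M" if "\<And>i j. i < dim_row M \<Longrightarrow> j < dim_col M \<Longrightarrow> hom_cycle c (M $$ (i, j))" for M c
    using that unfolding A.entries_in_def by simp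
  have einB: "\<And>M. M \<in> set ?B \<Longrightarrow> ein M" using ein_beta by auto
  have einB': "\<And>M. M \<in> set ?B' \<Longrightarrow> ein M" using ein_beta' by auto
  have eing: "ein (mat_gamma1 R xs z)" "ein (mat_gamma2 R xs z)" "ein (mat_gamma3 R xs z)"
    by (rule ein_of, rule gamma_cycle, assumption, assumption)+
  have eingd: "ein (bdiag (replicate (ell rk k) (mat_gamma1 R xs z)))" "ein (bdiag (replicate (ell rk k) (mat_gamma2 R xs z)))"
    by (rule ein_of, rule bdiag_gamma_cycle, rule gamma_cycle, assumption, assumption, assumption, assumption)+
  have einBd: "ein (bdiag ?B)" by (rule ein_of, rule bdiag_beta_cycle, assumption, assumption)
  have einBd': "ein (bdiag ?B')" by (rule ein_of, rule bdiag_beta'_cycle, assumption, assumption)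
  have rB: "dim_row (bdiag ?B) = ell rk k"
    unfolding dim_block_diag dim_beta_blocks by (simp add: tb_def[symmetric] tb_degs)
  have cB: "dim_col (bdiag ?B) = tb (map Suc (degs k))"
    unfolding dim_block_diag dim_beta_blocks by (simp add: tb_def)
  have rg: "dim_row (bdiag (replicate (ell rk k) g)) = ell rk k" if "dim_row g = 1" for g :: "(nat set \<Rightarrow> 'a) mat"
    unfolding dim_block_diag sum_replicate using that by simp
  have 1: "mv (mat_alpha R xs z (Suc k)) X ?i = T.Bw (\<lambda>s. X (idx (map Suc (degs k)) (m, s))) w \<oplus>\<^bsub>AA\<^esub>
      T.lin g1 n1 (\<lambda>u. X (tb (map Suc (degs k)) + ?i * n1 + u))"
  proof -
    have "mv (mat_alpha R xs z (Suc k)) X ?i = mv (bdiag ?B) X ?i \<oplus>\<^bsub>AA\<^esub>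
        mv (bdiag (replicate (ell rk k) (mat_gamma1 R xs z))) (\<lambda>j. X (tb (map Suc (degs k)) + j)) ?i"
      unfolding mat_alpha_eq cB[symmetric]
      by (rule A.mvec_hcat[OF _ einBd eingd(1) X]) (simp_all only: rg rB dim_gamma i)
    also have "mv (bdiag ?B) X ?i = mv (?B ! m) (\<lambda>j. X (off (map dim_col ?B) m + j)) (pos w)"
    proof -
      have "mv (bdiag ?B) X (off (map dim_row ?B) m + pos w) = mv (?B ! m) (\<lambda>j. X (off (map dim_col ?B) m + j)) (pos w)"
        by (rule A.mvec_block_diag[OF hz einB X]) (use m pos_less[OF w] in \<open>simp_all add: dim_beta\<close>)
      then show ?thesis unfolding dim_beta_blocks idx_def prod.case .
    qed
    also have "\<dots> = T.Bw (\<lambda>s. X (idx (map Suc (degs k)) (m, s))) w"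
      unfolding dim_beta_blocks using mv_beta[of "\<lambda>j. X (off (map bnum (map Suc (degs k))) m + j)", OF X w] m
      by (simp add: idx_def)
    also have "mv (bdiag (replicate (ell rk k) (mat_gamma1 R xs z))) (\<lambda>j. X (tb (map Suc (degs k)) + j)) ?i =
        T.lin g1 n1 (\<lambda>u. X (tb (map Suc (degs k)) + ?i * n1 + u))"
      unfolding A.mvec_block_diag_row[where x = "\<lambda>j. X (tb (map Suc (degs k)) + j)", OF hz dim_gamma(1) eing(1) X i]
        T.lin_def dim_gamma
      by (rule A.finsum_cong') (use eg_closed(2) X in \<open>auto simp: gamma_entries add.assoc\<close>)
    finally show ?thesis .
  qed
  have 2: "mv (mat_alpha' R xs z (Suc k)) Y ?i = T.Cw (\<lambda>v. Y (idx (pdegs k) (m, v))) w \<oplus>\<^bsub>AA\<^esub>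
      T.lin g2 n2 (\<lambda>u. Y (tb (pdegs k) + ?i * n2 + u))"
  proof -
    have einN: "ein (mat_N R xs z (Suc k))"
      unfolding A.entries_in_def
    proof (intro allI impI)
      fix i j assume ij: "i < dim_row (mat_N R xs z (Suc k))" "j < dim_col (mat_N R xs z (Suc k))"
      have "hom_cycle 2 (mat_N R xs z (Suc k) $$ (i, j))"
        using ij unfolding mat_N_eq
      proof (intro vcat_all[where P = "hom_cycle 2"] bdiag_beta'_cycle)
        show "dim_col (mat (dnum rk k) (ell_m2 rk (Suc k)) (\<lambda>_. \<zero>\<^bsub>KK\<^esub>)) = dim_col (bdiag ?B')"
          unfolding dim_block_diag dim_beta'_blocks tb_pdegs[symmetric] by (simp add: tb_def)
      qed (auto simp: hom_cycle_zero)
      then show "hc (mat_N R xs z (Suc k) $$ (i, j)) \<in> carrier AA" by simp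
    qed
    have "mv (mat_alpha' R xs z (Suc k)) Y ?i = mv (mat_N R xs z (Suc k)) Y ?i \<oplus>\<^bsub>AA\<^esub>
        mv (bdiag (replicate (ell rk k) (mat_gamma2 R xs z))) (\<lambda>j. Y (tb (pdegs k) + j)) ?i"
      unfolding mat_alpha'_eq dim_N(2)[symmetric]
      by (rule A.mvec_hcat[OF _ einN eingd(2) Y]) (simp_all only: rg dim_N dim_gamma i)
    also have "mv (mat_N R xs z (Suc k)) Y ?i = T.Cw (\<lambda>v. Y (idx (pdegs k) (m, v))) w"
    proof (cases "m < length (pdegs k)")
      case True
      have dm: "degs k ! m = Suc (pdegs k ! m)" using True by (subst degs_pdegs) (simp add: nth_append)
      have ieq: "?i = off (map dim_row ?B') m + pos w"
        unfolding dim_beta'_blocks by (subst degs_pdegs) (use True in \<open>simp add: idx_append, simp add: idx_def\<close>)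
      have pw: "pos w < bnum (Suc (pdegs k ! m))" using pos_less[OF w] by (simp add: dm)
      have "?i < dim_row (bdiag ?B')"
        unfolding ieq dim_block_diag by (rule off_less(1)) (use True pw in \<open>simp_all add: dim_beta'\<close>)
      then have "mv (mat_N R xs z (Suc k)) Y ?i = mv (bdiag ?B') Y ?i"
        unfolding mat_N_eq by (rule A.mvec_vcat_upper[OF einBd' Y])
      also have "\<dots> = mv (?B' ! m) (\<lambda>j. Y (off (map dim_col ?B') m + j)) (pos w)"
        unfolding ieq by (rule A.mvec_block_diag[OF hz einB' Y]) (use True pw in \<open>simp_all add: dim_beta'\<close>)
      also have "\<dots> = T.Cw (\<lambda>v. Y (idx (pdegs k) (m, v))) w"
        unfolding dim_beta'_blocks
        using mv_beta'[of "\<lambda>j. Y (off (map bnum (pdegs k)) m + j)", OF Y w[unfolded dm]] True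
        by (simp add: idx_def)
      finally show ?thesis .
    next
      case False
      have "(m, w) \<in> lab (map Suc (pdegs k) @ replicate (dnum rk k) 0)"
        using l unfolding lm degs_pdegs[symmetric] .
      then obtain r where r: "r < dnum rk k" "m = length (map Suc (pdegs k)) + r" "w = []"
        using False by (elim lab_append_zeros) (auto simp: lab_iff)
      have ieq: "?i = tb (map Suc (pdegs k)) + r"
        unfolding r(2,3) by (subst degs_pdegs) (rule idx_zeros[OF r(1)])
      have rB': "dim_row (bdiag ?B') = tb (map Suc (pdegs k))"
        unfolding dim_block_diag dim_beta'_blocks by (simp add: tb_def)
      have cB': "dim_col (bdiag ?B') = ell_m2 rk (Suc k)"
        unfolding dim_block_diag dim_beta'_blocks tb_pdegs[symmetric] by (simp add: tb_def)
      have "mv (mat_N R xs z (Suc k)) Y ?i = \<zero>\<^bsub>AA\<^esub>"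
        unfolding mat_N_eq cB'[symmetric]
        by (rule A.mvec_vcat_zero) (use r(1) hz Y in \<open>simp_all only: ieq rB' le_add1 add_less_cancel_left\<close>)
      then show ?thesis by (simp only: r(3) T.Cw_Nil)
    qed
    also have "mv (bdiag (replicate (ell rk k) (mat_gamma2 R xs z))) (\<lambda>j. Y (tb (pdegs k) + j)) ?i =
        T.lin g2 n2 (\<lambda>u. Y (tb (pdegs k) + ?i * n2 + u))"
      unfolding A.mvec_block_diag_row[where x = "\<lambda>j. Y (tb (pdegs k) + j)", OF hz dim_gamma(3) eing(2) Y i]
        T.lin_def dim_gamma
      by (rule A.finsum_cong') (use eg_closed(3) Y in \<open>auto simp: gamma_entries add.assoc\<close>)
    finally show ?thesis .
  qed
  have 3: "mv (mat_alpha'' R xs z (Suc k)) T ?i = T.lin g3 n3 (\<lambda>u. T (?i * n3 + u))"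
    unfolding mat_alpha''_eq A.mvec_block_diag_row[OF hz dim_gamma(5) eing(3) T i] T.lin_def dim_gamma
    by (rule A.finsum_cong') (use eg_closed(4) T in \<open>auto simp: gamma_entries\<close>)
  have c: "T.Bw (\<lambda>s. X (idx (map Suc (degs k)) (m, s))) w \<in> carrier AA"
    "T.lin g1 n1 (\<lambda>u. X (tb (map Suc (degs k)) + ?i * n1 + u)) \<in> carrier AA"
    "T.Cw (\<lambda>v. Y (idx (pdegs k) (m, v))) w \<in> carrier AA"
    "T.lin g2 n2 (\<lambda>u. Y (tb (pdegs k) + ?i * n2 + u)) \<in> carrier AA"
    "T.lin g3 n3 (\<lambda>u. T (?i * n3 + u)) \<in> carrier AA"
    by (rule T.Ap_closed[OF T.Bw_Ap], rule X, rule T.lin_carrier, rule X, rule T.Ap_closed[OF T.Cw_in_Ap], rule Y,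
        rule T.lin_carrier, rule Y, rule T.lin_carrier, rule T)
  show ?thesis unfolding lm 1 2 3 T.Row_def prod.case using c by (simp only: A.a_assoc A.a_closed)
qed

end

section \<open>Monomials and the ranks of the resolution\<close>

text \<open>The positions at the factors of a monomial are chosen independently.\<close>

lemma card_positions:
  fixes a :: "nat \<Rightarrow> nat \<Rightarrow> nat"
  shows "finite {c. list_all2 (\<lambda>(i, r) p. p < a i r) m c} \<and>
    card {c. list_all2 (\<lambda>(i, r) p. p < a i r) m c} = prod_list (map (\<lambda>(i, r). a i r) m)"
proof (induction m)
  case Nil
  have "{c. list_all2 (\<lambda>(i, r) p. p < a i r) [] c} = {[]}" by auto
  then show ?case by simp
next
  case (Cons x m)
  obtain i r where x: "x = (i, r)" by (cases x)
  let ?C = "{c. list_all2 (\<lambda>(i, r) p. p < a i r) m c}"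
  have "{c. list_all2 (\<lambda>(i, r) p. p < a i r) (x # m) c} = (\<lambda>(p, c). p # c) ` ({..<a i r} \<times> ?C)"
    by (auto simp: x list_all2_Cons1)
  moreover have "inj_on (\<lambda>(p, c). p # c) ({..<a i r} \<times> ?C)" by (auto simp: inj_on_def)
  ultimately show ?case using Cons by (simp add: card_image x card_cartesian_product)
qed

text \<open>All factors have positive first degree, so the first degree bounds the length.\<close>

lemma finite_bounded_lists:
  "finite {m :: (nat \<times> nat) list. (\<forall>x\<in>set m. 1 \<le> fst x) \<and> sum_list (map fst m) = k \<and> sum_list (map snd m) = s}"
proof (rule finite_subset)
  show "{m :: (nat \<times> nat) list. (\<forall>x\<in>set m. 1 \<le> fst x) \<and> sum_list (map fst m) = k \<and> sum_list (map snd m) = s}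
    \<subseteq> {m. set m \<subseteq> {..k} \<times> {..s} \<and> length m \<le> k}"
  proof (intro subsetI, clarify, intro conjI subsetI)
    fix m :: "(nat \<times> nat) list" and x assume "x \<in> set m"
    then have "fst x \<in> set (map fst m)" "snd x \<in> set (map snd m)" by auto
    then show "x \<in> {..sum_list (map fst m)} \<times> {..sum_list (map snd m)}"
      using member_le_sum_list[of "fst x" "map fst m"] member_le_sum_list[of "snd x" "map snd m"] by (cases x) auto
  next
    fix m :: "(nat \<times> nat) list" assume "\<forall>x\<in>set m. 1 \<le> fst x"
    then show "length m \<le> sum_list (map fst m)"
      by (induction m) auto
  qed
  show "finite {m. set m \<subseteq> {..k} \<times> {..s} \<and> length m \<le> k}"
    by (rule finite_lists_length_le) auto
qed

lemma monomials_bounds: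
  assumes "m \<in> monomials k"
  shows "k \<le> sum_list (map snd m)" "sum_list (map snd m) \<le> 3 * k"
proof -
  have k: "k = sum_list (map fst m)" using assms by (simp add: monomials_def)
  have "\<forall>(i, r)\<in>set m. 1 \<le> i \<and> i \<le> r \<and> r \<le> i + 2"
    using assms by (simp add: monomials_def)
  then have "sum_list (map fst m) \<le> sum_list (map snd m) \<and> sum_list (map snd m) \<le> 3 * sum_list (map fst m)"
    by (induction m) fastforce+
  then show "k \<le> sum_list (map snd m)" "sum_list (map snd m) \<le> 3 * k" using k by auto
qed

lemma finite_monomials: "finite (monomials k)"
proof (rule finite_subset)
  show "monomials k \<subseteq> (\<Union>s\<in>{..3 * k}. {m. (\<forall>x\<in>set m. 1 \<le> fst x) \<and> sum_list (map fst m) = k \<and> sum_list (map snd m) = s})"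
    using monomials_bounds(2) by (fastforce simp: monomials_def)
  show "finite (\<Union>s\<in>{..3 * k}. {m :: (nat \<times> nat) list. (\<forall>x\<in>set m. 1 \<le> fst x) \<and> sum_list (map fst m) = k \<and> sum_list (map snd m) = s})"
    using finite_bounded_lists by blast
qed

lemma cx_index_Sigma: "cx_index R xs k =
    (SIGMA m:monomials k. {c. list_all2 (\<lambda>(i, r) p. p < ell2 (homology_rank R xs) i r) m c})"
  by (auto simp: cx_index_def)

lemma finite_cx_index: "finite (cx_index R xs k)"
  unfolding cx_index_Sigma using finite_monomials card_positions by (intro finite_SigmaI) blast+

lemma cx_index_bounds: "b \<in> cx_index R xs k \<Longrightarrow> k \<le> cx_shift b \<and> cx_shift b \<le> 3 * k"
  using monomials_bounds by (auto simp: cx_index_def cx_shift_def)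

lemma monomials_0: "monomials 0 = {[]}"
proof -
  have "m = []" if "m \<in> monomials 0" for m
    using that by (cases m) (auto simp: monomials_def)
  then show ?thesis by (auto simp: monomials_def)
qed

lemma cx_index_0: "cx_index R xs 0 = {([], [])}"
  by (auto simp: cx_index_def monomials_0)

text \<open>The lists with an exponent outside the admissible range contribute nothing to the sum that defines
  the ranks, because the corresponding numbers vanish.\<close>

lemma card_cx_index_shift:
  "card {b \<in> cx_index R xs k. cx_shift b = s} = unum (homology_rank R xs) k s"
proof (cases "k = 0")
  case True
  have "{b \<in> cx_index R xs k. cx_shift b = s} = (if s = 0 then {([], [])} else {})"
    by (auto simp: True cx_index_0 cx_shift_def)
  then show ?thesis by (simp add: True unum_def)
next
  case False
  let ?a = "homology_rank R xs"
  let ?C = "\<lambda>m. {c. list_all2 (\<lambda>(i, r) p. p < ell2 ?a i r) m c}"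
  let ?f = "\<lambda>m. prod_list (map (\<lambda>(i, r). ell2 ?a i r) m)"
  let ?M = "{m \<in> monomials k. sum_list (map snd m) = s}"
  let ?L = "{m :: (nat \<times> nat) list. m \<noteq> [] \<and> (\<forall>i<length m. 1 \<le> fst (m ! i)) \<and>
                 sum_list (map fst m) = k \<and> sum_list (map snd m) = s \<and>
                 (\<forall>i<length m. 1 \<le> i \<longrightarrow> snd (m ! i) \<noteq> fst (m ! i))}"
  have "{b \<in> cx_index R xs k. cx_shift b = s} = (SIGMA m:?M. ?C m)"
    by (auto simp: cx_index_Sigma cx_shift_def)
  then have "card {b \<in> cx_index R xs k. cx_shift b = s} = (\<Sum>m\<in>?M. card (?C m))"
    using finite_monomials[of k] card_positions[of "ell2 ?a"] by simp
  also have "\<dots> = (\<Sum>m\<in>?M. ?f m)"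
    using card_positions[of "ell2 ?a"] by simp
  also have "\<dots> = (\<Sum>m\<in>?L. ?f m)"
  proof (rule sum.mono_neutral_left)
    have "?L \<subseteq> {m. (\<forall>x\<in>set m. 1 \<le> fst x) \<and> sum_list (map fst m) = k \<and> sum_list (map snd m) = s}"
      by (auto simp: in_set_conv_nth) (metis fst_conv)
    then show "finite ?L" using finite_bounded_lists finite_subset by blast
    show "?M \<subseteq> ?L"
    proof
      fix m assume m: "m \<in> ?M"
      have ne: "m \<noteq> []" using m False by (auto simp: monomials_def)
      have 1: "1 \<le> fst (m ! i)" if i: "i < length m" for i
      proof -
        obtain j r where "m ! i = (j, r)" by (cases "m ! i")
        then show ?thesis using m nth_mem[OF i] by (fastforce simp: monomials_def)
      qed
      have 2: "snd (m ! i) \<noteq> fst (m ! i)" if i: "i < length m" "1 \<le> i" for i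
      proof -
        have "m ! i = tl m ! (i - 1)" "i - 1 < length (tl m)" using i by (auto simp: nth_tl)
        then have "m ! i \<in> set (tl m)" by simp
        moreover obtain j r where "m ! i = (j, r)" by (cases "m ! i")
        ultimately show ?thesis using m by (fastforce simp: monomials_def)
      qed
      show "m \<in> ?L" using m ne 1 2 by (auto simp: monomials_def)
    qed
    show "\<forall>m\<in>?L - ?M. ?f m = 0"
    proof
      fix m assume m: "m \<in> ?L - ?M"
      have "\<exists>(i, r)\<in>set m. ell2 ?a i r = 0"
      proof (rule ccontr)
        assume "\<not> (\<exists>(i, r)\<in>set m. ell2 ?a i r = 0)"
        then have nz: "\<forall>(i, r)\<in>set m. i \<le> r \<and> r \<le> i + 2" by (force simp: ell2_def split: if_splits)
        have pos: "\<forall>(i, r)\<in>set m. 1 \<le> i"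
        proof clarify
          fix i r assume "(i, r) \<in> set m"
          then obtain j where "j < length m" "m ! j = (i, r)" by (auto simp: in_set_conv_nth)
          then show "1 \<le> i" using m by force
        qed
        have "\<forall>(i, r)\<in>set (tl m). i < r"
        proof clarify
          fix i r assume ir: "(i, r) \<in> set (tl m)"
          then obtain j where j: "j < length (tl m)" "tl m ! j = (i, r)" by (auto simp: in_set_conv_nth)
          then have "m ! Suc j = (i, r)" "Suc j < length m" by (auto simp: nth_tl)
          then have "r \<noteq> i" using m by force
          moreover have "i \<le> r" using nz ir by (cases m) auto
          ultimately show "i < r" by simp
        qed
        then have "m \<in> ?M" using m nz pos by (auto simp: monomials_def)
        then show False using m by simp
      qed
      then have "0 \<in> set (map (\<lambda>(i, r). ell2 ?a i r) m)" by force
      then show "?f m = 0" by (simp only: prod_list_zero_iff)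
    qed
  qed
  also have "\<dots> = unum ?a k s" using False by (simp add: unum_def)
  finally show ?thesis .
qed

subsection \<open>The two descriptions of a basis element\<close>

text \<open>A nonempty monomial is a factor times a monomial \<open>n\<close> without factors
  \<open>X\<^bsub>i,i\<^esub>\<close>; splitting off only a first factor
  \<open>X\<^bsub>j,j\<^esub>\<close>, with \<open>X\<^bsub>0,0\<^esub> = 1\<close>, the rest is again of
  this type. The columns of the differential follow the first description, its rows the second one.\<close>

type_synonym elt = "(nat \<times> nat) list \<times> nat list"

text \<open>The basis elements for the monomials without factors \<open>X\<^bsub>i,i\<^esub>\<close>, to
  which the copies of the matrices \<open>\<Delta>\<^sub>i\<close> are attached.\<close>

definition base :: "(nat \<Rightarrow> nat) \<Rightarrow> elt \<Rightarrow> bool" where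
  "base a = (\<lambda>(n, c). (\<forall>(i, r)\<in>set n. 1 \<le> i \<and> i < r \<and> r \<le> i + 2) \<and> list_all2 (\<lambda>(i, r) p. p < ell2 a i r) n c)"

text \<open>The first degree of the monomial.\<close>

definition wt :: "elt \<Rightarrow> nat" where "wt N = sum_list (map fst (fst N))"

text \<open>Row \<open>q\<close> of the copy of \<open>\<Delta>\<^bsub>j+1\<^esub>\<close> attached to
  \<open>N\<close>. There is a single row if \<open>j = 0\<close>, and it is \<open>N\<close>
  itself.\<close>

definition emb :: "nat \<Rightarrow> nat \<Rightarrow> elt \<Rightarrow> elt" where
  "emb j q N = (if j = 0 then N else ((j, j) # fst N, q # snd N))"

text \<open>Column \<open>p\<close> of the block \<open>\<alpha>\<^bsub>i,r\<^esub>\<close> in the copy of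
  \<open>\<Delta>\<^sub>i\<close> attached to \<open>N\<close>.\<close>

definition ext :: "nat \<Rightarrow> nat \<Rightarrow> nat \<Rightarrow> elt \<Rightarrow> elt" where
  "ext i r p N = ((i, r) # fst N, p # snd N)"

lemma emb_Suc: "emb (Suc j) q N = ext (Suc j) (Suc j) q N"
  by (simp add: emb_def ext_def)

lemma base_index: "base (homology_rank R xs) N \<Longrightarrow> N \<in> cx_index R xs (wt N)"
proof -
  assume b: "base (homology_rank R xs) N"
  obtain n c where N: "N = (n, c)" by (cases N)
  have "set (tl n) \<subseteq> set n" by (cases n) auto
  then show ?thesis using b by (fastforce simp: N base_def cx_index_def monomials_def wt_def)
qed

lemma ext_index:
  assumes "base (homology_rank R xs) N" "1 \<le> i" "i \<le> r" "r \<le> i + 2" "p < ell2 (homology_rank R xs) i r"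
  shows "ext i r p N \<in> cx_index R xs (i + wt N)"
  using assms by (cases N) (auto simp: base_def cx_index_def monomials_def wt_def ext_def)

lemma ell_0: "ell a 0 = 1"
  by (simp add: ell_eq bnum_0 dnum_def)

lemma emb_index:
  assumes "base (homology_rank R xs) N" "q < ell (homology_rank R xs) j"
  shows "emb j q N \<in> cx_index R xs (j + wt N)"
proof (cases j)
  case 0
  then show ?thesis using base_index[OF assms(1)] by (simp add: emb_def)
next
  case (Suc i)
  then show ?thesis using ext_index[OF assms(1), of j j q] assms(2) by (simp add: emb_Suc ell2_def)
qed

lemma index_ext:
  assumes "b \<in> cx_index R xs k" "1 \<le> k"
  obtains i r p N where "b = ext i r p N" "base (homology_rank R xs) N" "1 \<le> i" "i \<le> r" "r \<le> i + 2"
    "p < ell2 (homology_rank R xs) i r" "k = i + wt N"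
proof -
  obtain m c where b: "b = (m, c)" "m \<in> monomials k" "list_all2 (\<lambda>(i, r) p. p < ell2 (homology_rank R xs) i r) m c"
    using assms(1) by (auto simp: cx_index_def)
  have "m \<noteq> []" using b(2) assms(2) by (auto simp: monomials_def)
  then obtain i r n where m: "m = (i, r) # n" by (cases m) auto
  then obtain p c' where c: "c = p # c'" using b(3) by (auto simp: list_all2_Cons1)
  show ?thesis
    by (rule that[of i r p "(n, c')"]) (use b m c in \<open>auto simp: ext_def base_def monomials_def wt_def\<close>)
qed

lemma ext_base: "base a N \<Longrightarrow> 1 \<le> i \<Longrightarrow> i < r \<Longrightarrow> r \<le> i + 2 \<Longrightarrow> p < ell2 a i r \<Longrightarrow> base a (ext i r p N)"
  by (cases N) (auto simp: base_def ext_def)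

lemma wt_ext: "wt (ext i r p N) = i + wt N"
  by (simp add: wt_def ext_def)

lemma base_wt_0: "base a N \<Longrightarrow> wt N = 0 \<Longrightarrow> N = ([], [])"
  by (cases N; cases "fst N") (auto simp: base_def wt_def)

lemma base_ext:
  assumes "base a N" "1 \<le> wt N"
  obtains i r p N' where "N = ext i r p N'" "base a N'" "1 \<le> i" "i < r" "r \<le> i + 2" "p < ell2 a i r" "wt N = i + wt N'"
proof -
  obtain n c where N: "N = (n, c)" by (cases N)
  have "n \<noteq> []" using assms(2) by (auto simp: N wt_def)
  then obtain i r n' where n: "n = (i, r) # n'" by (cases n) auto
  then obtain p c' where c: "c = p # c'" using assms(1) by (auto simp: N base_def list_all2_Cons1)
  show ?thesis
    by (rule that[of i r p "(n', c')"]) (use assms(1) n c in \<open>auto simp: N ext_def base_def wt_def\<close>)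
qed

text \<open>The case \<open>j = 0\<close> covers the monomials that do not begin with a factor
  \<open>X\<^bsub>i,i\<^esub>\<close>.\<close>

lemma index_emb:
  assumes "b \<in> cx_index R xs k"
  obtains j q N where "b = emb j q N" "base (homology_rank R xs) N" "q < ell (homology_rank R xs) j" "k = j + wt N"
proof (cases "k = 0")
  case True
  then have "b = emb 0 0 ([], [])" using assms by (simp add: cx_index_0 emb_def)
  then show ?thesis using that[of 0 0 "([], [])"] True by (simp add: base_def wt_def ell_0)
next
  case False
  then have k1: "1 \<le> k" by simp
  obtain i r p N where b: "b = ext i r p N" "base (homology_rank R xs) N" "1 \<le> i" "i \<le> r" "r \<le> i + 2"
    "p < ell2 (homology_rank R xs) i r" "k = i + wt N" by (rule index_ext[OF assms k1])
  show ?thesis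
  proof (cases "i = r")
    case True
    obtain j where i: "i = Suc j" using b(3) by (cases i) auto
    show ?thesis by (rule that[of i p N]) (use b True in \<open>auto simp: i emb_Suc ell2_def\<close>)
  next
    case False
    show ?thesis by (rule that[of 0 0 b]) (use b False ext_base in \<open>auto simp: emb_def ell_0 wt_ext\<close>)
  qed
qed

lemma base_not_emb: "base a (emb j q N) \<Longrightarrow> j = 0"
  by (cases N) (auto simp: base_def emb_def split: if_splits)

text \<open>In the two descriptions the differential is visibly block diagonal, with a copy of
  \<open>\<Delta>\<^bsub>j+1\<^esub>\<close> for each \<open>N\<close>. In the case \<open>j = 0\<close>,
  \<open>i > 1\<close> the entry vanishes because \<open>N'\<close> does not begin with
  \<open>X\<^bsub>i-1,i-1\<^esub>\<close>.\<close>

lemma phi_entry_emb: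
  assumes "base a N" "base a N'" "q < ell a j" "1 \<le> i"
  shows "phi_entry R xs z (emb j q N') (ext i r p N) =
    (if i = Suc j \<and> N' = N then mat_alpha2 R xs z (Suc j) r $$ (q, p) else \<zero>\<^bsub>koszul_ring R xs\<^esub>)"
proof (cases "i = 1")
  case True
  have *: "phi_entry R xs z b' (ext i r p N) = (if b' = N then mat_alpha2 R xs z 1 r $$ (0, p) else \<zero>\<^bsub>koszul_ring R xs\<^esub>)" for b'
    by (cases N) (simp add: ext_def True)
  have "emb j q N' = N \<longleftrightarrow> j = 0 \<and> N' = N"
  proof
    assume e: "emb j q N' = N"
    then have "j = 0" using assms(1) base_not_emb[of a j q N'] by simp
    then show "j = 0 \<and> N' = N" using e by (simp add: emb_def)
  qed (simp add: emb_def)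
  moreover have "q = 0" if "j = 0" using assms(3) that by (simp add: ell_0)
  ultimately show ?thesis unfolding * using True by simp
next
  case False
  have *: "phi_entry R xs z (y # n', q # c') (ext i r p N) =
      (if y = (i - 1, i - 1) \<and> (n', c') = N then mat_alpha2 R xs z i r $$ (q, p) else \<zero>\<^bsub>koszul_ring R xs\<^esub>)" for y n' q c'
    using False by (cases N) (simp add: ext_def)
  have **: "phi_entry R xs z (n', c') (ext i r p N) = \<zero>\<^bsub>koszul_ring R xs\<^esub>" if "n' = [] \<or> c' = []" for n' c'
    using False that by (cases N; cases n'; cases c') (auto simp: ext_def)
  obtain n' c' where N': "N' = (n', c')" by (cases N')
  show ?thesis
  proof (cases j)
    case 0
    have "phi_entry R xs z (n', c') (ext i r p N) = \<zero>\<^bsub>koszul_ring R xs\<^esub>"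
    proof (cases "n' = [] \<or> c' = []")
      case True
      then show ?thesis by (rule **)
    next
      case ne: False
      then obtain y n'' q' c'' where n': "n' = y # n''" "c' = q' # c''" by (cases n'; cases c') auto
      have "y \<noteq> (i - 1, i - 1)" using assms(2) by (auto simp: base_def N' n')
      then show ?thesis unfolding n' * by simp
    qed
    then show ?thesis using False 0 by (simp add: emb_def N')
  next
    case (Suc j')
    have "emb j q N' = ((j, j) # n', q # c')" by (simp add: emb_def N' Suc)
    moreover have "(j, j) = (i - 1, i - 1) \<longleftrightarrow> i = Suc j" using assms(4) by auto
    ultimately show ?thesis by (simp only: * N') auto
  qed
qed

lemma (in abelian_monoid) finsum_mem:
  assumes "finite I" "H \<subseteq> carrier G" "\<zero> \<in> H" "\<And>a b. a \<in> H \<Longrightarrow> b \<in> H \<Longrightarrow> a \<oplus> b \<in> H" "\<And>i. i \<in> I \<Longrightarrow> f i \<in> H"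
  shows "(\<Oplus>i\<in>I. f i) \<in> H"
  using assms(1,5)
proof (induction I rule: finite_induct)
  case (insert i I)
  have "(\<Oplus>i\<in>insert i I. f i) = f i \<oplus> (\<Oplus>i\<in>I. f i)"
    using insert assms(2) by (intro finsum_insert) auto
  then show ?case using insert assms(4) by auto
qed (simp add: assms(3))

lemma (in abelian_monoid) additive_finsum:
  assumes "finite I" "f \<in> I \<rightarrow> carrier G" "h \<zero> = \<zero>" "\<And>a. a \<in> carrier G \<Longrightarrow> h a \<in> carrier G"
    "\<And>a b. a \<in> carrier G \<Longrightarrow> b \<in> carrier G \<Longrightarrow> h (a \<oplus> b) = h a \<oplus> h b"
  shows "h (\<Oplus>i\<in>I. f i) = (\<Oplus>i\<in>I. h (f i))"
  using assms(1,2)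
proof (induction I rule: finite_induct)
  case (insert i I)
  have f: "f i \<in> carrier G" "f \<in> I \<rightarrow> carrier G" using insert by auto
  have hf: "h (f i) \<in> carrier G" "(\<lambda>i. h (f i)) \<in> I \<rightarrow> carrier G" using f assms(4) by auto
  have "h (\<Oplus>i\<in>insert i I. f i) = h (f i \<oplus> (\<Oplus>i\<in>I. f i))"
    using insert(1,2) f by (simp add: finsum_insert)
  also have "\<dots> = h (f i) \<oplus> (\<Oplus>i\<in>I. h (f i))"
    using f insert(3) by (simp add: assms(5) finsum_closed)
  also have "\<dots> = (\<Oplus>i\<in>insert i I. h (f i))"
    using insert(1,2) hf by (simp add: finsum_insert)
  finally show ?case .
qed (simp add: assms(3))

text \<open>For the addition of homology classes of a direct sum, which are product sets.\<close>

lemma PiE_sum_box: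
  assumes "\<And>i. i \<in> I \<Longrightarrow> V i \<noteq> {}" "\<And>i. i \<in> I \<Longrightarrow> U i \<noteq> {}"
  shows "(\<Union>h\<in>Pi\<^sub>E I V. \<Union>k\<in>Pi\<^sub>E I U. {\<lambda>i\<in>I. f (h i) (k i)}) =
    Pi\<^sub>E I (\<lambda>i. \<Union>a\<in>V i. \<Union>b\<in>U i. {f a b})" (is "?L = ?R")
proof
  show "?L \<subseteq> ?R"
  proof
    fix u assume "u \<in> ?L"
    then obtain h k where hk: "h \<in> Pi\<^sub>E I V" "k \<in> Pi\<^sub>E I U" "u = (\<lambda>i\<in>I. f (h i) (k i))" by blast
    have "f (h i) (k i) \<in> (\<Union>a\<in>V i. \<Union>b\<in>U i. {f a b})" if "i \<in> I" for i
      using PiE_mem[OF hk(1) that] PiE_mem[OF hk(2) that] by blast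
    then show "u \<in> ?R" unfolding hk(3) by simp
  qed
  show "?R \<subseteq> ?L"
  proof
    fix u assume u: "u \<in> ?R"
    then have "\<forall>i\<in>I. \<exists>a b. a \<in> V i \<and> b \<in> U i \<and> u i = f a b" by (fastforce simp: PiE_iff)
    then obtain h k where hk: "\<forall>i\<in>I. h i \<in> V i \<and> k i \<in> U i \<and> u i = f (h i) (k i)" by metis
    have "u = (\<lambda>i\<in>I. f (restrict h I i) (restrict k I i))"
    proof
      fix i
      show "u i = (\<lambda>i\<in>I. f (restrict h I i) (restrict k I i)) i"
        using PiE_arb[OF u, of i] hk by (cases "i \<in> I") simp_all
    qed
    moreover have "restrict h I \<in> Pi\<^sub>E I V" "restrict k I \<in> Pi\<^sub>E I U" using hk by auto
    ultimately show "u \<in> ?L" by blast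
  qed
qed

lemma PiE_image_coordinate:
  assumes "v \<in> extensional I" "\<And>i. i \<in> I \<Longrightarrow> v i \<noteq> {}"
  shows "(\<lambda>i\<in>I. (\<lambda>x. x i) ` Pi\<^sub>E I v) = v"
proof
  fix i
  have "Pi\<^sub>E I v \<noteq> {}" using assms(2) by (simp add: PiE_eq_empty_iff)
  then show "(\<lambda>i\<in>I. (\<lambda>x. x i) ` Pi\<^sub>E I v) i = v i"
    using assms(1) by (simp add: image_projection_PiE extensional_def)
qed

context class_T_koszul
begin

subsection \<open>The chain maps\<close>

abbreviation II where "II \<equiv> cx_index R xs"
abbreviation entry where "entry \<equiv> phi_entry R xs z"

lemma shift_emb: "cx_shift (emb j q B) = j + cx_shift B"
  by (simp add: cx_shift_def emb_def)

lemma shift_ext: "cx_shift (ext i r p B) = r + cx_shift B"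
  by (simp add: cx_shift_def ext_def)

text \<open>The entries of \<open>\<alpha>\<^bsub>i,r\<^esub>\<close> have degree \<open>r - i + 1\<close>,
  which is the difference of the second degrees of \<open>X\<^bsub>i,r\<^esub> n\<close> and
  \<open>X\<^bsub>i-1,i-1\<^esub> n\<close>.\<close>

lemma entry_cases:
  assumes "1 \<le> k" "b \<in> II k" "b' \<in> II (k - 1)"
  shows "entry b' b = \<zero>\<^bsub>KK\<^esub> \<or> (\<exists>s\<in>{1, 2, 3}. cx_shift b = cx_shift b' + s \<and> hom_cycle s (entry b' b))"
proof -
  obtain i r p B where b: "b = ext i r p B" "base rk B" "1 \<le> i" "i \<le> r" "r \<le> i + 2"
    "p < ell2 rk i r" "k = i + wt B" by (rule index_ext[OF assms(2,1)])
  obtain j q B' where b': "b' = emb j q B'" "base rk B'" "q < ell rk j" by (rule index_emb[OF assms(3)])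
  note e = phi_entry_emb[OF b(2) b'(2,3) b(3), of R xs z r p, folded b(1) b'(1)]
  show ?thesis
  proof (cases "i = Suc j \<and> B' = B")
    case True
    have e': "entry b' b = mat_alpha2 R xs z (Suc j) r $$ (q, p)" using e True by simp
    consider "r = Suc j" | "r = Suc (Suc j)" | "r = Suc (Suc (Suc j))" using b(4,5) True by linarith
    then show ?thesis
    proof cases
      case 1
      have "hom_cycle 1 (entry b' b)" unfolding e' using alpha_cycle(1)[of q j p] b'(3) b(6) True 1
        by (simp add: mat_alpha2_def ell2_def)
      moreover have "cx_shift b = cx_shift b' + 1" using True 1 by (simp add: b(1) b'(1) shift_ext shift_emb)
      ultimately show ?thesis by blast
    next
      case 2
      have "hom_cycle 2 (entry b' b)" unfolding e' using alpha_cycle(2)[of q j p] b'(3) b(6) True 2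
        by (simp add: mat_alpha2_def ell2_def)
      moreover have "cx_shift b = cx_shift b' + 2" using True 2 by (simp add: b(1) b'(1) shift_ext shift_emb)
      ultimately show ?thesis by blast
    next
      case 3
      have "hom_cycle 3 (entry b' b)" unfolding e' using alpha_cycle(3)[of q j p] b'(3) b(6) True 3
        by (simp add: mat_alpha2_def ell2_def)
      moreover have "cx_shift b = cx_shift b' + 3" using True 3 by (simp add: b(1) b'(1) shift_ext shift_emb)
      ultimately show ?thesis by blast
    qed
  next
    case False
    then have "entry b' b = \<zero>\<^bsub>KK\<^esub>" using e by (simp only: if_False)
    then show ?thesis ..
  qed
qed

lemma entry_cycle:
  assumes "1 \<le> k" "b \<in> II k" "b' \<in> II (k - 1)" shows "entry b' b \<in> ZZ" "entry b' b \<in> carrier KK"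
proof -
  show "entry b' b \<in> ZZ" using entry_cases[OF assms] zero_cycle by auto
  then show "entry b' b \<in> carrier KK" by (rule cycles_closed)
qed

lemma cx_simps:
  "carrier (cx R xs k) = (\<Pi>\<^sub>E b\<in>II k. carrier KK)"
  "x \<otimes>\<^bsub>cx R xs k\<^esub> y = (\<lambda>b\<in>II k. x b \<oplus>\<^bsub>KK\<^esub> y b)"
  "\<one>\<^bsub>cx R xs k\<^esub> = (\<lambda>b\<in>II k. \<zero>\<^bsub>KK\<^esub>)"
  by (simp_all add: cx_def)

text \<open>The differential of the copy of the Koszul complex that is shifted by \<open>s\<close>.\<close>

definition sdiff :: "nat \<Rightarrow> (nat set \<Rightarrow> 'a) \<Rightarrow> nat set \<Rightarrow> 'a" where
  "sdiff s f = (if even s then dd f else \<ominus>\<^bsub>KK\<^esub> dd f)"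

lemma cx_diff_sdiff: "cx_diff R xs k x = (\<lambda>b\<in>II k. sdiff (cx_shift b) (x b))"
  unfolding cx_diff_def sdiff_def ..

lemma sdiff_closed: "f \<in> carrier KK \<Longrightarrow> sdiff s f \<in> carrier KK"
  by (simp add: sdiff_def diff_closed)

lemma sdiff_zero: "sdiff s \<zero>\<^bsub>KK\<^esub> = \<zero>\<^bsub>KK\<^esub>"
  by (simp add: sdiff_def diff_zero)

lemma sdiff_add: "f \<in> carrier KK \<Longrightarrow> g \<in> carrier KK \<Longrightarrow> sdiff s (f \<oplus>\<^bsub>KK\<^esub> g) = sdiff s f \<oplus>\<^bsub>KK\<^esub> sdiff s g"
  by (simp add: sdiff_def diff_add diff_closed K.minus_add)

lemma sdiff_eq_zero: "f \<in> carrier KK \<Longrightarrow> sdiff s f = \<zero>\<^bsub>KK\<^esub> \<longleftrightarrow> f \<in> ZZ"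
proof -
  assume f: "f \<in> carrier KK"
  have "\<ominus>\<^bsub>KK\<^esub> dd f = \<zero>\<^bsub>KK\<^esub> \<longleftrightarrow> dd f = \<zero>\<^bsub>KK\<^esub>"
    using K.minus_minus[OF diff_closed[OF f]] K.minus_zero by metis
  then have "sdiff s f = \<zero>\<^bsub>KK\<^esub> \<longleftrightarrow> dd f = \<zero>\<^bsub>KK\<^esub>" by (simp add: sdiff_def)
  then show ?thesis using cycles_diff[of f] cyclesI[OF f] by blast
qed

text \<open>For a cycle \<open>y\<close> of degree \<open>s\<close> the Leibniz rule reads
  \<open>\<partial>(y f) = (-1)\<^sup>s y \<partial>f\<close>. The sign is the difference between the signs
  of the differentials shifted by \<open>n\<close> and by \<open>n + s\<close>.\<close>

lemma sdiff_mult: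
  assumes y: "y \<in> ZZ" "y \<in> deg s" and f: "f \<in> carrier KK"
  shows "sdiff n (y \<otimes>\<^bsub>KK\<^esub> f) = y \<otimes>\<^bsub>KK\<^esub> sdiff (n + s) f"
proof -
  have yc: "y \<in> carrier KK" using y(1) by (rule cycles_closed)
  have df: "dd f \<in> carrier KK" using f by (rule diff_closed)
  have "dd (y \<otimes>\<^bsub>KK\<^esub> f) = twist y \<otimes>\<^bsub>KK\<^esub> dd f"
    using leibniz[OF yc f] df yc f by (simp add: cycles_diff[OF y(1)] twist_closed)
  also have "\<dots> = (if even s then y \<otimes>\<^bsub>KK\<^esub> dd f else \<ominus>\<^bsub>KK\<^esub> (y \<otimes>\<^bsub>KK\<^esub> dd f))"
    using yc df by (simp add: twist_deg[OF y(2)] K.l_minus)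
  finally show ?thesis using yc df by (simp add: sdiff_def K.r_minus)
qed

lemma phi_term_closed:
  "1 \<le> k \<Longrightarrow> x \<in> carrier (cx R xs k) \<Longrightarrow> b' \<in> II (k - 1) \<Longrightarrow>
    (\<lambda>b. entry b' b \<otimes>\<^bsub>KK\<^esub> x b) \<in> II k \<rightarrow> carrier KK"
  by (rule Pi_I, rule K.m_closed, rule entry_cycle(2), assumption+) (simp add: cx_simps PiE_iff)

lemma phi_closed:
  assumes k: "1 \<le> k" and x: "x \<in> carrier (cx R xs k)"
  shows "phi R xs z k x \<in> carrier (cx R xs (k - 1))"
  using K.finsum_closed[OF phi_term_closed[OF assms]] by (simp add: phi_def cx_simps PiE_iff)

lemma phi_add:
  assumes k: "1 \<le> k" and x: "x \<in> carrier (cx R xs k)" and y: "y \<in> carrier (cx R xs k)"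
  shows "phi R xs z k (x \<otimes>\<^bsub>cx R xs k\<^esub> y) = phi R xs z k x \<otimes>\<^bsub>cx R xs (k - 1)\<^esub> phi R xs z k y"
proof -
  have "(\<Oplus>\<^bsub>KK\<^esub>b\<in>II k. entry b' b \<otimes>\<^bsub>KK\<^esub> (\<lambda>b\<in>II k. x b \<oplus>\<^bsub>KK\<^esub> y b) b) =
      (\<Oplus>\<^bsub>KK\<^esub>b\<in>II k. entry b' b \<otimes>\<^bsub>KK\<^esub> x b) \<oplus>\<^bsub>KK\<^esub> (\<Oplus>\<^bsub>KK\<^esub>b\<in>II k. entry b' b \<otimes>\<^bsub>KK\<^esub> y b)"
    if b': "b' \<in> II (k - 1)" for b'
  proof -
    note t = phi_term_closed[OF k _ b']
    have "(\<Oplus>\<^bsub>KK\<^esub>b\<in>II k. entry b' b \<otimes>\<^bsub>KK\<^esub> (\<lambda>b\<in>II k. x b \<oplus>\<^bsub>KK\<^esub> y b) b) =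
        (\<Oplus>\<^bsub>KK\<^esub>b\<in>II k. entry b' b \<otimes>\<^bsub>KK\<^esub> x b \<oplus>\<^bsub>KK\<^esub> entry b' b \<otimes>\<^bsub>KK\<^esub> y b)"
    proof (rule K.finsum_cong'[OF refl])
      show "(\<lambda>b. entry b' b \<otimes>\<^bsub>KK\<^esub> x b \<oplus>\<^bsub>KK\<^esub> entry b' b \<otimes>\<^bsub>KK\<^esub> y b) \<in> II k \<rightarrow> carrier KK"
        using t[OF x] t[OF y] by auto
      fix b assume b: "b \<in> II k"
      then have "x b \<in> carrier KK" "y b \<in> carrier KK" using x y by (auto simp: cx_simps)
      then show "entry b' b \<otimes>\<^bsub>KK\<^esub> (\<lambda>b\<in>II k. x b \<oplus>\<^bsub>KK\<^esub> y b) b =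
          entry b' b \<otimes>\<^bsub>KK\<^esub> x b \<oplus>\<^bsub>KK\<^esub> entry b' b \<otimes>\<^bsub>KK\<^esub> y b"
        using b entry_cycle(2)[OF k b b'] by (simp add: K.r_distr)
    qed
    then show ?thesis using K.finsum_addf[OF t[OF x] t[OF y]] by simp
  qed
  then show ?thesis unfolding phi_def cx_simps by (intro restrict_ext) simp
qed

lemma phi_diff:
  assumes k: "1 \<le> k" and x: "x \<in> carrier (cx R xs k)"
  shows "phi R xs z k (cx_diff R xs k x) = cx_diff R xs (k - 1) (phi R xs z k x)"
proof -
  have "(\<Oplus>\<^bsub>KK\<^esub>b\<in>II k. entry b' b \<otimes>\<^bsub>KK\<^esub> (\<lambda>b\<in>II k. sdiff (cx_shift b) (x b)) b) =
      sdiff (cx_shift b') (\<Oplus>\<^bsub>KK\<^esub>b\<in>II k. entry b' b \<otimes>\<^bsub>KK\<^esub> x b)" if b': "b' \<in> II (k - 1)" for b'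
  proof -
    note t = phi_term_closed[OF k x b']
    have "sdiff (cx_shift b') (\<Oplus>\<^bsub>KK\<^esub>b\<in>II k. entry b' b \<otimes>\<^bsub>KK\<^esub> x b) =
        (\<Oplus>\<^bsub>KK\<^esub>b\<in>II k. sdiff (cx_shift b') (entry b' b \<otimes>\<^bsub>KK\<^esub> x b))"
      by (rule K.additive_finsum[OF finite_cx_index t sdiff_zero sdiff_closed sdiff_add])
    also have "\<dots> = (\<Oplus>\<^bsub>KK\<^esub>b\<in>II k. entry b' b \<otimes>\<^bsub>KK\<^esub> (\<lambda>b\<in>II k. sdiff (cx_shift b) (x b)) b)"
    proof (rule K.finsum_cong'[OF refl])
      show "(\<lambda>b. entry b' b \<otimes>\<^bsub>KK\<^esub> (\<lambda>b\<in>II k. sdiff (cx_shift b) (x b)) b) \<in> II k \<rightarrow> carrier KK"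
        using entry_cycle(2)[OF k _ b'] x by (intro Pi_I) (simp add: cx_simps sdiff_closed PiE_iff)
      fix b assume b: "b \<in> II k"
      then have xb: "x b \<in> carrier KK" using x by (auto simp: cx_simps)
      show "sdiff (cx_shift b') (entry b' b \<otimes>\<^bsub>KK\<^esub> x b) = entry b' b \<otimes>\<^bsub>KK\<^esub> (\<lambda>b\<in>II k. sdiff (cx_shift b) (x b)) b"
        using entry_cases[OF k b b']
      proof
        assume "entry b' b = \<zero>\<^bsub>KK\<^esub>"
        then show ?thesis using xb b by (simp add: sdiff_zero sdiff_closed)
      next
        assume "\<exists>s\<in>{1, 2, 3}. cx_shift b = cx_shift b' + s \<and> hom_cycle s (entry b' b)"
        then obtain s where "cx_shift b = cx_shift b' + s" "hom_cycle s (entry b' b)" by blast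
        then show ?thesis using b sdiff_mult[of "entry b' b" s "x b" "cx_shift b'"] xb by simp
      qed
    qed
    finally show ?thesis by simp
  qed
  then show ?thesis unfolding phi_def cx_diff_sdiff by (intro restrict_ext) simp
qed

lemma phi_deg:
  assumes k: "1 \<le> k" and x: "x \<in> cx_deg R xs k j"
  shows "phi R xs z k x \<in> cx_deg R xs (k - 1) j"
proof -
  let ?D = "\<lambda>b. if cx_shift b \<le> j then deg (j - cx_shift b) else {\<zero>\<^bsub>KK\<^esub>}"
  have xD: "x \<in> Pi\<^sub>E (II k) ?D" using x unfolding cx_deg_def shifted_sum_deg_def .
  have "(\<Oplus>\<^bsub>KK\<^esub>b\<in>II k. entry b' b \<otimes>\<^bsub>KK\<^esub> x b) \<in> ?D b'" if b': "b' \<in> II (k - 1)" for b'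
  proof (rule K.finsum_mem[OF finite_cx_index])
    show "?D b' \<subseteq> carrier KK" using deg_closed by auto
    show "\<zero>\<^bsub>KK\<^esub> \<in> ?D b'" by (simp add: zero_deg)
    show "u \<oplus>\<^bsub>KK\<^esub> v \<in> ?D b'" if "u \<in> ?D b'" "v \<in> ?D b'" for u v
      using that add_deg by (auto split: if_splits)
    fix b assume b: "b \<in> II k"
    have xb: "x b \<in> ?D b" using xD b by (rule PiE_mem)
    then have xc: "x b \<in> carrier KK" using deg_closed by (auto split: if_splits)
    show "entry b' b \<otimes>\<^bsub>KK\<^esub> x b \<in> ?D b'"
      using entry_cases[OF k b b']
    proof
      assume "entry b' b = \<zero>\<^bsub>KK\<^esub>"
      then show ?thesis using xc by (simp add: zero_deg)
    next
      assume "\<exists>s\<in>{1, 2, 3}. cx_shift b = cx_shift b' + s \<and> hom_cycle s (entry b' b)"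
      then obtain s where s: "cx_shift b = cx_shift b' + s" "hom_cycle s (entry b' b)" by blast
      show ?thesis
      proof (cases "cx_shift b \<le> j")
        case True
        then have "s + (j - cx_shift b) = j - cx_shift b'" using s(1) by simp
        moreover have "entry b' b \<otimes>\<^bsub>KK\<^esub> x b \<in> deg (s + (j - cx_shift b))"
          using mult_deg[of "entry b' b" s "x b" "j - cx_shift b"] s(2) xb True by simp
        ultimately show ?thesis using True s(1) by simp
      next
        case False
        then have "x b = \<zero>\<^bsub>KK\<^esub>" using xb by simp
        then have "entry b' b \<otimes>\<^bsub>KK\<^esub> x b = \<zero>\<^bsub>KK\<^esub>" using s(2) cycles_closed by simp
        then show ?thesis by (simp add: zero_deg)
      qed
    qed
  qed
  then show ?thesis unfolding cx_deg_def shifted_sum_deg_def phi_def by simp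
qed

lemma chain_map: "1 \<le> k \<Longrightarrow> is_chain_map R xs k (k - 1) (phi R xs z k)"
  unfolding is_chain_map_def hom_def using phi_closed phi_add phi_diff phi_deg by auto

subsection \<open>The homology of the complexes\<close>

text \<open>The classes of the direct sum of shifted copies of the Koszul complex are the boxes
  with the classes of the components as sides.\<close>

lemma sdiff_boundary: "f \<in> carrier KK \<Longrightarrow> sdiff s f \<in> BB"
  using boundariesI[of f] boundariesI[of "\<ominus>\<^bsub>KK\<^esub> f"] by (simp add: sdiff_def diff_minus)

lemma cx_cycles_eq: "cx_cycles R xs k = (\<Pi>\<^sub>E b\<in>II k. ZZ)"
proof -
  have 0: "cx_diff R xs k x = \<one>\<^bsub>cx R xs k\<^esub> \<longleftrightarrow> (\<forall>b\<in>II k. x b \<in> ZZ)" if x: "x \<in> carrier (cx R xs k)" for x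
  proof -
    have "cx_diff R xs k x = \<one>\<^bsub>cx R xs k\<^esub> \<longleftrightarrow> (\<forall>b\<in>II k. sdiff (cx_shift b) (x b) = \<zero>\<^bsub>KK\<^esub>)"
      unfolding cx_diff_sdiff cx_simps
    proof
      assume eq: "(\<lambda>b\<in>II k. sdiff (cx_shift b) (x b)) = (\<lambda>b\<in>II k. \<zero>\<^bsub>KK\<^esub>)"
      show "\<forall>b\<in>II k. sdiff (cx_shift b) (x b) = \<zero>\<^bsub>KK\<^esub>"
      proof
        fix b assume "b \<in> II k"
        then show "sdiff (cx_shift b) (x b) = \<zero>\<^bsub>KK\<^esub>" using fun_cong[OF eq, of b] by simp
      qed
    next
      assume "\<forall>b\<in>II k. sdiff (cx_shift b) (x b) = \<zero>\<^bsub>KK\<^esub>"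
      then show "(\<lambda>b\<in>II k. sdiff (cx_shift b) (x b)) = (\<lambda>b\<in>II k. \<zero>\<^bsub>KK\<^esub>)" by (intro restrict_ext) simp
    qed
    moreover have "x b \<in> carrier KK" if "b \<in> II k" for b using x that by (simp add: cx_simps PiE_iff)
    ultimately show ?thesis by (simp only: sdiff_eq_zero cong: ball_cong)
  qed
  have 1: "x \<in> cx_cycles R xs k \<longleftrightarrow> x \<in> carrier (cx R xs k) \<and> (\<forall>b\<in>II k. x b \<in> ZZ)" for x
    unfolding cx_cycles_def mem_Collect_eq by (rule conj_cong[OF refl 0])
  have 2: "x \<in> carrier (cx R xs k) \<and> (\<forall>b\<in>II k. x b \<in> ZZ) \<longleftrightarrow> x \<in> (\<Pi>\<^sub>E b\<in>II k. ZZ)" for x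
  proof
    assume "x \<in> (\<Pi>\<^sub>E b\<in>II k. ZZ)"
    then show "x \<in> carrier (cx R xs k) \<and> (\<forall>b\<in>II k. x b \<in> ZZ)" by (simp add: cx_simps PiE_iff cycles_closed)
  qed (simp add: cx_simps PiE_iff)
  show ?thesis by (rule Set.set_eqI) (rule trans[OF 1 2])
qed

lemma cx_boundaries_eq: "cx_boundaries R xs k = (\<Pi>\<^sub>E b\<in>II k. BB)"
proof
  show "cx_boundaries R xs k \<subseteq> (\<Pi>\<^sub>E b\<in>II k. BB)"
  proof
    fix y assume "y \<in> cx_boundaries R xs k"
    then obtain x where x: "x \<in> carrier (cx R xs k)" "y = (\<lambda>b\<in>II k. sdiff (cx_shift b) (x b))"
      unfolding cx_boundaries_def cx_diff_sdiff by (rule imageE)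
    then show "y \<in> (\<Pi>\<^sub>E b\<in>II k. BB)" unfolding x(2) by (simp add: cx_simps PiE_iff sdiff_boundary)
  qed
  show "(\<Pi>\<^sub>E b\<in>II k. BB) \<subseteq> cx_boundaries R xs k"
  proof
    fix y assume y: "y \<in> (\<Pi>\<^sub>E b\<in>II k. BB)"
    have *: "\<exists>f\<in>carrier KK. sdiff s f = g" if g: "g \<in> BB" for g s
    proof -
      obtain f where f: "f \<in> carrier KK" "g = dd f" using g by (auto simp: koszul_boundaries_def)
      show ?thesis
      proof (cases "even s")
        case True
        then show ?thesis using f by (auto simp: sdiff_def)
      next
        case False
        then have "sdiff s (\<ominus>\<^bsub>KK\<^esub> f) = g" using f by (simp add: sdiff_def diff_minus diff_closed)
        then show ?thesis using f(1) by blast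
      qed
    qed
    have "\<forall>b\<in>II k. \<exists>f. f \<in> carrier KK \<and> sdiff (cx_shift b) f = y b"
      using *[OF PiE_mem[OF y]] by blast
    then obtain x where x: "\<forall>b\<in>II k. x b \<in> carrier KK \<and> sdiff (cx_shift b) (x b) = y b" by metis
    have "y = cx_diff R xs k (restrict x (II k))"
      unfolding cx_diff_sdiff
    proof
      fix b
      show "y b = (\<lambda>b\<in>II k. sdiff (cx_shift b) (restrict x (II k) b)) b"
        using PiE_arb[OF y, of b] x by (cases "b \<in> II k") simp_all
    qed
    moreover have "restrict x (II k) \<in> carrier (cx R xs k)" using x by (simp add: cx_simps PiE_iff)
    ultimately show "y \<in> cx_boundaries R xs k" unfolding cx_boundaries_def by blast
  qed
qed

lemma set_mult_cx:
  "set_mult (cx R xs k) H L = (\<Union>h\<in>H. \<Union>l\<in>L. {\<lambda>b\<in>II k. h b \<oplus>\<^bsub>KK\<^esub> l b})"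
  unfolding set_mult_def cx_simps ..

lemma AA_add: "X \<oplus>\<^bsub>AA\<^esub> Y = (\<Union>a\<in>X. \<Union>b\<in>Y. {a \<oplus>\<^bsub>KK\<^esub> b})"
  by (simp add: homology_eq FactRing_def set_add_def set_mult_def)

lemma hclass_alt: "hc f = (\<Union>a\<in>BB. \<Union>b\<in>{f}. {a \<oplus>\<^bsub>KK\<^esub> b})"
  by (simp add: hclass_def a_r_coset_def r_coset_def)

lemma carrier_ne: "v \<in> carrier AA \<Longrightarrow> v \<noteq> {}"
  using hclass_self by (auto simp: homology_carrier)

abbreviation "box k v \<equiv> Pi\<^sub>E (II k) v"

text \<open>Boundaries are formed componentwise, so the class of a cycle in a sum of complexes is the
  product set of the classes of its components.\<close>

lemma coset_box:
  assumes x: "x \<in> box k (\<lambda>_. ZZ)"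
  shows "set_mult (cx R xs k) (cx_boundaries R xs k) {x} = box k (\<lambda>b. hc (x b))"
proof -
  have "{x} = box k (\<lambda>b. {x b})" using x by (simp add: PiE_singleton PiE_iff)
  moreover have "BB \<noteq> {}" using zero_boundary by blast
  ultimately show ?thesis
    unfolding set_mult_cx cx_boundaries_eq hclass_alt
    using PiE_sum_box[of "II k" "\<lambda>_. BB" "\<lambda>b. {x b}" "add KK"] by simp
qed

lemma choose_cycles:
  assumes "v \<in> box k (\<lambda>_. carrier AA)"
  obtains x where "x \<in> box k (\<lambda>_. ZZ)" "\<And>b. b \<in> II k \<Longrightarrow> v b = hc (x b)" "box k v = box k (\<lambda>b. hc (x b))"
proof -
  have "\<forall>b\<in>II k. \<exists>f. f \<in> ZZ \<and> v b = hc f" using assms by (auto simp: PiE_iff homology_carrier)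
  then obtain x where x: "\<forall>b\<in>II k. x b \<in> ZZ \<and> v b = hc (x b)" by metis
  show ?thesis
  proof (rule that[of "restrict x (II k)"])
    show "restrict x (II k) \<in> box k (\<lambda>_. ZZ)" using x by (simp add: PiE_iff)
    show "v b = hc (restrict x (II k) b)" if "b \<in> II k" for b using x that by simp
    show "box k v = box k (\<lambda>b. hc (restrict x (II k) b))" by (rule PiE_cong) (use x in simp)
  qed
qed

lemma carrier_cx_homology: "carrier (cx_homology R xs k) = (\<lambda>v. box k v) ` box k (\<lambda>_. carrier AA)"
proof -
  have "carrier (cx_homology R xs k) = (\<lambda>x. set_mult (cx R xs k) (cx_boundaries R xs k) {x}) ` cx_cycles R xs k"
  proof -
    have r: "r_coset (cx R xs k\<lparr>carrier := cx_cycles R xs k\<rparr>) (cx_boundaries R xs k) x =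
        set_mult (cx R xs k) (cx_boundaries R xs k) {x}" for x
      unfolding r_coset_def set_mult_def by simp
    show ?thesis unfolding cx_homology_def FactGroup_def RCOSETS_def r by (simp add: UNION_singleton_eq_range)
  qed
  also have "\<dots> = (\<lambda>v. box k v) ` box k (\<lambda>_. carrier AA)"
  proof (intro equalityI subsetI)
    fix X assume "X \<in> (\<lambda>x. set_mult (cx R xs k) (cx_boundaries R xs k) {x}) ` cx_cycles R xs k"
    then obtain x where x: "x \<in> box k (\<lambda>_. ZZ)" "X = set_mult (cx R xs k) (cx_boundaries R xs k) {x}"
      unfolding cx_cycles_eq by (rule imageE)
    note x = x(1) x(2)[unfolded coset_box[OF x(1)]]
    have "X = box k (\<lambda>b\<in>II k. hc (x b))" unfolding x(2) by (rule PiE_cong) simp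
    moreover have "(\<lambda>b\<in>II k. hc (x b)) \<in> box k (\<lambda>_. carrier AA)" using x(1) by (simp add: PiE_iff)
    ultimately show "X \<in> (\<lambda>v. box k v) ` box k (\<lambda>_. carrier AA)" by blast
  next
    fix X assume "X \<in> (\<lambda>v. box k v) ` box k (\<lambda>_. carrier AA)"
    then obtain v where v: "v \<in> box k (\<lambda>_. carrier AA)" "X = box k v" by blast
    obtain x where x: "x \<in> box k (\<lambda>_. ZZ)" "box k v = box k (\<lambda>b. hc (x b))" by (rule choose_cycles[OF v(1)])
    then show "X \<in> (\<lambda>x. set_mult (cx R xs k) (cx_boundaries R xs k) {x}) ` cx_cycles R xs k"
      using coset_box[OF x(1)] v(2) unfolding cx_cycles_eq by blast
  qed
  finally show ?thesis .
qed

lemma coords_box: "v \<in> box k (\<lambda>_. carrier AA) \<Longrightarrow> homology_coords R xs k (box k v) = v"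
  unfolding homology_coords_def using carrier_ne by (intro PiE_image_coordinate) (simp_all add: PiE_iff)

lemma box_add:
  assumes v: "v \<in> box k (\<lambda>_. carrier AA)" and w: "w \<in> box k (\<lambda>_. carrier AA)"
  shows "set_mult (cx R xs k) (box k v) (box k w) = box k (\<lambda>b\<in>II k. v b \<oplus>\<^bsub>AA\<^esub> w b)"
proof -
  have "set_mult (cx R xs k) (box k v) (box k w) = box k (\<lambda>b. v b \<oplus>\<^bsub>AA\<^esub> w b)"
    unfolding set_mult_cx AA_add
  proof (rule PiE_sum_box[where f = "add KK"])
    show "v b \<noteq> {}" "w b \<noteq> {}" if "b \<in> II k" for b
      using carrier_ne PiE_mem[OF v that] PiE_mem[OF w that] by blast+
  qed
  also have "\<dots> = box k (\<lambda>b\<in>II k. v b \<oplus>\<^bsub>AA\<^esub> w b)" by (rule PiE_cong) simp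
  finally show ?thesis .
qed

lemma inj_coords: "inj_on (homology_coords R xs k) (carrier (cx_homology R xs k))"
  unfolding carrier_cx_homology by (rule inj_on_imageI, rule inj_onI) (simp only: o_def coords_box)

lemma homology_iso: "homology_coords R xs k \<in>
    iso (cx_homology R xs k) (product_group (II k) (\<lambda>_. add_monoid AA))"
proof (rule isoI)
  let ?P = "product_group (II k) (\<lambda>_. add_monoid AA)"
  have cP: "carrier ?P = box k (\<lambda>_. carrier AA)" by simp
  have mP: "v \<otimes>\<^bsub>?P\<^esub> w = (\<lambda>b\<in>II k. v b \<oplus>\<^bsub>AA\<^esub> w b)" for v w by simp
  have m: "X \<otimes>\<^bsub>cx_homology R xs k\<^esub> Y = set_mult (cx R xs k) X Y" for X Y
    by (simp add: cx_homology_def FactGroup_def set_mult_def)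
  show "homology_coords R xs k \<in> hom (cx_homology R xs k) ?P"
  proof (rule homI)
    fix X assume "X \<in> carrier (cx_homology R xs k)"
    then obtain v where v: "v \<in> box k (\<lambda>_. carrier AA)" "X = box k v"
      unfolding carrier_cx_homology by (rule imageE)
    show "homology_coords R xs k X \<in> carrier ?P" unfolding cP v(2) coords_box[OF v(1)] by (rule v(1))
  next
    fix X Y assume "X \<in> carrier (cx_homology R xs k)" "Y \<in> carrier (cx_homology R xs k)"
    then obtain v w where vw: "v \<in> box k (\<lambda>_. carrier AA)" "X = box k v" "w \<in> box k (\<lambda>_. carrier AA)" "Y = box k w"
      unfolding carrier_cx_homology by blast
    have "(\<lambda>b\<in>II k. v b \<oplus>\<^bsub>AA\<^esub> w b) \<in> box k (\<lambda>_. carrier AA)" using vw by (simp add: PiE_iff)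
    then show "homology_coords R xs k (X \<otimes>\<^bsub>cx_homology R xs k\<^esub> Y) =
        homology_coords R xs k X \<otimes>\<^bsub>?P\<^esub> homology_coords R xs k Y"
      unfolding m mP vw(2,4) box_add[OF vw(1,3)] using vw(1,3) by (simp only: coords_box)
  qed
  show "bij_betw (homology_coords R xs k) (carrier (cx_homology R xs k)) (carrier ?P)"
    unfolding bij_betw_def cP
  proof
    show "inj_on (homology_coords R xs k) (carrier (cx_homology R xs k))" by (rule inj_coords)
    show "homology_coords R xs k ` carrier (cx_homology R xs k) = box k (\<lambda>_. carrier AA)"
      unfolding carrier_cx_homology image_image by (rule trans[OF image_cong[OF refl coords_box] image_ident])
  qed
qed

subsection \<open>The induced maps\<close>

text \<open>The matrix of the classes of the entries, acting on the free module over the homology.\<close>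

definition DD :: "nat \<Rightarrow> (elt \<Rightarrow> (nat set \<Rightarrow> 'a) set) \<Rightarrow> elt \<Rightarrow> (nat set \<Rightarrow> 'a) set" where
  "DD k v = (\<lambda>b'\<in>II (k - 1). \<Oplus>\<^bsub>AA\<^esub>b\<in>II k. hc (entry b' b) \<otimes>\<^bsub>AA\<^esub> v b)"

lemma DD_term_closed:
  "1 \<le> k \<Longrightarrow> v \<in> box k (\<lambda>_. carrier AA) \<Longrightarrow> b' \<in> II (k - 1) \<Longrightarrow>
    (\<lambda>b. hc (entry b' b) \<otimes>\<^bsub>AA\<^esub> v b) \<in> II k \<rightarrow> carrier AA"
  by (rule Pi_I, rule A.m_closed, rule hclass_closed, rule entry_cycle(1), assumption+) (rule PiE_mem)

lemma DD_closed: "1 \<le> k \<Longrightarrow> v \<in> box k (\<lambda>_. carrier AA) \<Longrightarrow> DD k v \<in> box (k - 1) (\<lambda>_. carrier AA)"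
  unfolding DD_def restrict_PiE_iff using A.finsum_closed[OF DD_term_closed] by blast

lemma phi_class:
  assumes k: "1 \<le> k" and y: "y \<in> box k (\<lambda>_. ZZ)" "\<And>b. b \<in> II k \<Longrightarrow> v b = hc (y b)"
  shows "phi R xs z k y \<in> box (k - 1) (\<lambda>_. ZZ)" "b' \<in> II (k - 1) \<Longrightarrow> hc (phi R xs z k y b') = DD k v b'"
proof -
  have *: "(\<Oplus>\<^bsub>KK\<^esub>b\<in>II k. entry b' b \<otimes>\<^bsub>KK\<^esub> y b) \<in> ZZ \<and>
      hc (\<Oplus>\<^bsub>KK\<^esub>b\<in>II k. entry b' b \<otimes>\<^bsub>KK\<^esub> y b) = (\<Oplus>\<^bsub>AA\<^esub>b\<in>II k. hc (entry b' b) \<otimes>\<^bsub>AA\<^esub> v b)"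
    if b': "b' \<in> II (k - 1)" for b'
  proof -
    have t: "(\<lambda>b. entry b' b \<otimes>\<^bsub>KK\<^esub> y b) \<in> II k \<rightarrow> ZZ"
      using entry_cycle(1)[OF k _ b'] y(1) by (intro Pi_I) (simp add: cycles_mult PiE_iff)
    have "(\<Oplus>\<^bsub>AA\<^esub>b\<in>II k. hc (entry b' b \<otimes>\<^bsub>KK\<^esub> y b)) = (\<Oplus>\<^bsub>AA\<^esub>b\<in>II k. hc (entry b' b) \<otimes>\<^bsub>AA\<^esub> v b)"
    proof (rule A.finsum_cong'[OF refl])
      show "(\<lambda>b. hc (entry b' b) \<otimes>\<^bsub>AA\<^esub> v b) \<in> II k \<rightarrow> carrier AA"
        using entry_cycle(1)[OF k _ b'] y by (intro Pi_I) (simp add: PiE_iff)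
      fix b assume b: "b \<in> II k"
      then show "hc (entry b' b \<otimes>\<^bsub>KK\<^esub> y b) = hc (entry b' b) \<otimes>\<^bsub>AA\<^esub> v b"
        using entry_cycle(1)[OF k b b'] y by (simp add: hclass_mult PiE_iff)
    qed
    then show ?thesis using hclass_finsum[OF finite_cx_index t] by simp
  qed
  show "phi R xs z k y \<in> box (k - 1) (\<lambda>_. ZZ)" using * by (simp add: phi_def)
  show "b' \<in> II (k - 1) \<Longrightarrow> hc (phi R xs z k y b') = DD k v b'" using * by (simp add: phi_def DD_def)
qed

text \<open>By \<open>phi_class\<close> all elements of the class \<open>box k v\<close> are sent to
  elements of the same class.\<close>

lemma phi_induced_box:
  assumes k: "1 \<le> k" and v: "v \<in> box k (\<lambda>_. carrier AA)"
  shows "phi_induced R xs z k (box k v) = box (k - 1) (DD k v)"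
proof -
  have one: "set_mult (cx R xs (k - 1)) (cx_boundaries R xs (k - 1)) {phi R xs z k y} = box (k - 1) (DD k v)"
    if y: "y \<in> box k v" for y
  proof -
    have "y b \<in> ZZ \<and> v b = hc (y b)" if b: "b \<in> II k" for b
    proof -
      obtain f where f: "f \<in> ZZ" "v b = hc f" using PiE_mem[OF v b] by (auto simp: homology_carrier)
      then show ?thesis using hclass_mem[OF f(1), of "y b"] PiE_mem[OF y b] by simp
    qed
    then have yZ: "y \<in> box k (\<lambda>_. ZZ)" "\<And>b. b \<in> II k \<Longrightarrow> v b = hc (y b)" using y by (simp_all add: PiE_iff)
    have "box (k - 1) (\<lambda>b. hc (phi R xs z k y b)) = box (k - 1) (DD k v)"
      by (rule PiE_cong) (rule phi_class(2)[OF k yZ])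
    then show ?thesis using coset_box[OF phi_class(1)[OF k yZ]] by (simp only:)
  qed
  have "box k v \<noteq> {}" using carrier_ne PiE_mem[OF v] unfolding PiE_eq_empty_iff by blast
  moreover have "phi_induced R xs z k (box k v) =
      (\<Union>y\<in>box k v. set_mult (cx R xs (k - 1)) (cx_boundaries R xs (k - 1)) {phi R xs z k y})"
    unfolding phi_induced_def set_mult_def by blast
  ultimately show ?thesis using one by simp
qed

lemma res_diff_eq:
  assumes k: "1 \<le> k" and v: "v \<in> box k (\<lambda>_. carrier AA)"
  shows "res_diff R xs z k v = DD k v"
proof -
  have "inv_into (carrier (cx_homology R xs k)) (homology_coords R xs k) (homology_coords R xs k (box k v)) = box k v"
    by (rule inv_into_f_f[OF inj_coords]) (unfold carrier_cx_homology, rule imageI, rule v)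
  then have "inv_into (carrier (cx_homology R xs k)) (homology_coords R xs k) v = box k v"
    by (simp only: coords_box[OF v])
  then show ?thesis
    unfolding res_diff_def by (simp only: phi_induced_box[OF k v] coords_box[OF DD_closed[OF k v]])
qed

end

lemma (in abelian_monoid) finsum_support:
  assumes "finite B" "A \<subseteq> B" "h \<in> B \<rightarrow> carrier G" "\<And>i. i \<in> B \<Longrightarrow> i \<notin> A \<Longrightarrow> h i = \<zero>"
  shows "finsum G h B = finsum G h A"
  using add.finprod_mono_neutral_cong_left[OF assms(1,2) _ _ assms(3), of h] assms(4) by (simp add: finsum_def)

context class_T_koszul
begin

lemma dim_alpha2:
  assumes "Suc j \<le> r" "r \<le> Suc (Suc (Suc j))"
  shows "dim_col (mat_alpha2 R xs z (Suc j) r) = ell2 rk (Suc j) r"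
proof -
  consider "r = Suc j" | "r = Suc (Suc j)" | "r = Suc (Suc (Suc j))" using assms by linarith
  then show ?thesis by cases (simp_all add: mat_alpha2_def ell2_def dim_alpha)
qed

lemma alpha2_cycle:
  assumes "Suc j \<le> r" "r \<le> Suc (Suc (Suc j))" "q < ell rk j" "p < ell2 rk (Suc j) r"
  shows "mat_alpha2 R xs z (Suc j) r $$ (q, p) \<in> ZZ"
proof -
  consider "r = Suc j" | "r = Suc (Suc j)" | "r = Suc (Suc (Suc j))" using assms by linarith
  then show ?thesis
  proof cases
    case 1
    then show ?thesis using alpha_cycle(1)[of q j p] assms(3,4) by (simp add: mat_alpha2_def ell2_def)
  next
    case 2
    then show ?thesis using alpha_cycle(2)[of q j p] assms(3,4) by (simp add: mat_alpha2_def ell2_def)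
  next
    case 3
    then show ?thesis using alpha_cycle(3)[of q j p] assms(3,4) by (simp add: mat_alpha2_def ell2_def)
  qed
qed

lemma mv_alpha2_cong:
  assumes "Suc j \<le> r" "r \<le> Suc (Suc (Suc j))" "q < ell rk j"
    "\<And>p. p < ell2 rk (Suc j) r \<Longrightarrow> x p = y p" "\<And>p. y p \<in> carrier AA"
  shows "mv (mat_alpha2 R xs z (Suc j) r) x q = mv (mat_alpha2 R xs z (Suc j) r) y q"
  unfolding A.mvec_def dim_alpha2[OF assms(1,2)]
  by (rule A.finsum_cong'[OF refl]) (simp_all add: assms(4,5) alpha2_cycle[OF assms(1-3)])

text \<open>The part of a vector that belongs to the summand of \<open>X\<^bsub>i,r\<^esub> n\<close> and to
  one basis element of the summand of \<open>n\<close>.\<close>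

definition coef :: "(elt \<Rightarrow> (nat set \<Rightarrow> 'a) set) \<Rightarrow> nat \<Rightarrow> nat \<Rightarrow> elt \<Rightarrow> nat \<Rightarrow> (nat set \<Rightarrow> 'a) set" where
  "coef v i r B p = (if p < ell2 rk i r then v (ext i r p B) else \<zero>\<^bsub>AA\<^esub>)"

abbreviation FF where "FF k \<equiv> Pi\<^sub>E (II k) (\<lambda>_. carrier AA)"

lemma coef_closed:
  assumes "v \<in> FF (i + wt B)" "base rk B" "1 \<le> i" "i \<le> r" "r \<le> i + 2"
  shows "coef v i r B p \<in> carrier AA"
  using PiE_mem[OF assms(1) ext_index[OF assms(2-5)]] by (simp add: coef_def)

lemma ext_inject: "ext i r p B = ext i' r' p' B' \<longleftrightarrow> i = i' \<and> r = r' \<and> p = p' \<and> B = B'"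
  by (cases B; cases B') (auto simp: ext_def)

text \<open>Among the columns only those of the copy of \<open>\<Delta>\<^bsub>j+1\<^esub>\<close> attached
  to \<open>B\<close> have a nonzero entry in this row, by \<open>phi_entry_emb\<close>; they form three
  families, one for each of the blocks of \<open>\<Delta>\<^bsub>j+1\<^esub>\<close>.\<close>

lemma DD_emb:
  assumes v: "v \<in> FF (Suc j + wt B)" and B: "base rk B" and q: "q < ell rk j"
  shows "DD (Suc j + wt B) v (emb j q B) =
    mv (mat_alpha2 R xs z (Suc j) (Suc j)) (coef v (Suc j) (Suc j) B) q \<oplus>\<^bsub>AA\<^esub>
    (mv (mat_alpha2 R xs z (Suc j) (Suc (Suc j))) (coef v (Suc j) (Suc (Suc j)) B) q \<oplus>\<^bsub>AA\<^esub>
     mv (mat_alpha2 R xs z (Suc j) (Suc (Suc (Suc j)))) (coef v (Suc j) (Suc (Suc (Suc j))) B) q)"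
proof -
  let ?k = "Suc j + wt B"
  let ?b' = "emb j q B"
  let ?h = "\<lambda>b. hc (entry ?b' b) \<otimes>\<^bsub>AA\<^esub> v b"
  let ?J = "\<lambda>r. (\<lambda>p. ext (Suc j) r p B) ` {..<ell2 rk (Suc j) r}"
  let ?r1 = "Suc j" and ?r2 = "Suc (Suc j)" and ?r3 = "Suc (Suc (Suc j))"
  have k1: "1 \<le> ?k" by simp
  have b': "?b' \<in> II (?k - 1)" using emb_index[OF B q] by simp
  have h: "?h \<in> II ?k \<rightarrow> carrier AA" by (rule DD_term_closed[OF k1 v b'])
  have sub: "?J r \<subseteq> II ?k" if "?r1 \<le> r" "r \<le> ?r3" for r
  proof
    fix b assume "b \<in> ?J r"
    then obtain p where "p < ell2 rk (Suc j) r" "b = ext (Suc j) r p B" by auto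
    then show "b \<in> II ?k" using ext_index[OF B, of "Suc j" r p] that by simp
  qed
  have sub': "?J ?r1 \<union> (?J ?r2 \<union> ?J ?r3) \<subseteq> II ?k" using sub[of ?r1] sub[of ?r2] sub[of ?r3] by simp
  have zero: "?h b = \<zero>\<^bsub>AA\<^esub>" if b: "b \<in> II ?k" "b \<notin> ?J ?r1 \<union> (?J ?r2 \<union> ?J ?r3)" for b
  proof -
    obtain i r p B' where e: "b = ext i r p B'" "base rk B'" "1 \<le> i" "i \<le> r" "r \<le> i + 2" "p < ell2 rk i r"
      by (rule index_ext[OF b(1) k1])
    have nb: "\<not> (i = Suc j \<and> B = B')"
    proof
      assume eq: "i = Suc j \<and> B = B'"
      then have "r = ?r1 \<or> r = ?r2 \<or> r = ?r3" using e(4,5) by linarith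
      moreover have "b \<in> ?J r" using e(1,6) eq by simp
      ultimately show False using b(2) by blast
    qed
    have "entry ?b' b = \<zero>\<^bsub>KK\<^esub>"
      using phi_entry_emb[OF e(2) B q e(3), of R xs z r p] by (simp only: e(1) if_not_P[OF nb])
    then show ?thesis using PiE_mem[OF v b(1)] by (simp add: hclass_zero)
  qed
  have part: "finsum AA ?h (?J r) = mv (mat_alpha2 R xs z (Suc j) r) (coef v (Suc j) r B) q"
    if r: "?r1 \<le> r" "r \<le> ?r3" for r
  proof -
    have inj: "inj_on (\<lambda>p. ext (Suc j) r p B) {..<ell2 rk (Suc j) r}" by (rule inj_onI) (simp add: ext_inject)
    have hJ: "?h \<in> ?J r \<rightarrow> carrier AA" using h sub[OF r] by blast
    have eq: "?h (ext (Suc j) r p B) = hc (mat_alpha2 R xs z (Suc j) r $$ (q, p)) \<otimes>\<^bsub>AA\<^esub> coef v (Suc j) r B p"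
      if p: "p < ell2 rk (Suc j) r" for p
      using phi_entry_emb[OF B B q, of "Suc j" R xs z r p] p by (simp add: coef_def)
    have "finsum AA ?h (?J r) = (\<Oplus>\<^bsub>AA\<^esub>p\<in>{..<ell2 rk (Suc j) r}. ?h (ext (Suc j) r p B))"
      by (rule A.finsum_reindex[OF hJ inj])
    also have "\<dots> = (\<Oplus>\<^bsub>AA\<^esub>p\<in>{..<ell2 rk (Suc j) r}. hc (mat_alpha2 R xs z (Suc j) r $$ (q, p)) \<otimes>\<^bsub>AA\<^esub> coef v (Suc j) r B p)"
    proof (rule A.finsum_cong'[OF refl])
      show "(\<lambda>p. hc (mat_alpha2 R xs z (Suc j) r $$ (q, p)) \<otimes>\<^bsub>AA\<^esub> coef v (Suc j) r B p)
          \<in> {..<ell2 rk (Suc j) r} \<rightarrow> carrier AA"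
      proof (rule Pi_I)
        fix p assume "p \<in> {..<ell2 rk (Suc j) r}"
        then show "hc (mat_alpha2 R xs z (Suc j) r $$ (q, p)) \<otimes>\<^bsub>AA\<^esub> coef v (Suc j) r B p \<in> carrier AA"
          using alpha2_cycle[OF r q, of p] coef_closed[OF v B, of r p] r by simp
      qed
    qed (use eq in simp)
    finally show ?thesis unfolding A.mvec_def dim_alpha2[OF r] .
  qed
  have fin: "finite (?J r)" for r by simp
  have cl: "?h \<in> ?J ?r1 \<rightarrow> carrier AA" "?h \<in> ?J ?r2 \<rightarrow> carrier AA" "?h \<in> ?J ?r3 \<rightarrow> carrier AA"
    "?h \<in> ?J ?r2 \<union> ?J ?r3 \<rightarrow> carrier AA"
    using h sub' by blast+
  have disj: "?J ?r2 \<inter> ?J ?r3 = {}" "?J ?r1 \<inter> (?J ?r2 \<union> ?J ?r3) = {}"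
    by (auto simp: ext_inject)
  have "DD ?k v ?b' = finsum AA ?h (II ?k)" using b' by (simp add: DD_def)
  also have "\<dots> = finsum AA ?h (?J ?r1 \<union> (?J ?r2 \<union> ?J ?r3))"
    by (rule A.finsum_support[OF finite_cx_index sub' h zero])
  also have "\<dots> = finsum AA ?h (?J ?r1) \<oplus>\<^bsub>AA\<^esub> (finsum AA ?h (?J ?r2) \<oplus>\<^bsub>AA\<^esub> finsum AA ?h (?J ?r3))"
    unfolding A.finsum_Un_disjoint[OF fin finite_UnI[OF fin fin] disj(2) cl(1,4)]
      A.finsum_Un_disjoint[OF fin fin disj(1) cl(2,3)] ..
  finally show ?thesis by (simp only: part le_refl le_SucI)
qed

lemma mat_alpha2_simps:
  "mat_alpha2 R xs z (Suc j) (Suc j) = mat_alpha R xs z (Suc j)"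
  "mat_alpha2 R xs z (Suc j) (Suc (Suc j)) = mat_alpha' R xs z (Suc j)"
  "mat_alpha2 R xs z (Suc j) (Suc (Suc (Suc j))) = mat_alpha'' R xs z (Suc j)"
  by (simp_all add: mat_alpha2_def)

lemma DD_row:
  assumes v: "v \<in> FF (Suc j + wt B)" and B: "base rk B" and l: "l \<in> lab (degs j)"
  shows "DD (Suc j + wt B) v (emb j (idx (degs j) l) B) = T.Row (pdegs j) (degs j)
    (coef v (Suc j) (Suc j) B) (coef v (Suc j) (Suc (Suc j)) B) (coef v (Suc j) (Suc (Suc (Suc j))) B) l"
proof -
  have q: "idx (degs j) l < ell rk j" using idx_less[OF l] by (simp add: tb_degs)
  show ?thesis
    unfolding DD_emb[OF v B q] mat_alpha2_simps
    by (rule row_formula[OF _ _ _ l]; rule coef_closed[OF v B]; simp)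
qed

text \<open>A row only depends on the coordinates at the columns of the matrix. So vectors that are defined
  at all numbers may be used in place of the coordinates.\<close>

lemma DD_row_truncated:
  assumes X: "\<And>p. X p \<in> carrier AA" and Y: "\<And>p. Y p \<in> carrier AA" and T: "\<And>p. T p \<in> carrier AA"
    and v: "v \<in> FF (Suc j + wt B)" and B: "base rk B" and l: "l \<in> lab (degs j)"
    and "\<And>p. p < ell2 rk (Suc j) (Suc j) \<Longrightarrow> v (ext (Suc j) (Suc j) p B) = X p"
    and "\<And>p. p < ell2 rk (Suc j) (Suc (Suc j)) \<Longrightarrow> v (ext (Suc j) (Suc (Suc j)) p B) = Y p"
    and "\<And>p. p < ell2 rk (Suc j) (Suc (Suc (Suc j))) \<Longrightarrow> v (ext (Suc j) (Suc (Suc (Suc j))) p B) = T p"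
  shows "DD (Suc j + wt B) v (emb j (idx (degs j) l) B) = T.Row (pdegs j) (degs j) X Y T l"
proof -
  have q: "idx (degs j) l < ell rk j" using idx_less[OF l] by (simp add: tb_degs)
  have 1: "mv (mat_alpha2 R xs z (Suc j) (Suc j)) (coef v (Suc j) (Suc j) B) (idx (degs j) l) =
      mv (mat_alpha2 R xs z (Suc j) (Suc j)) X (idx (degs j) l)"
    by (rule mv_alpha2_cong[OF _ _ q _ X]) (simp_all add: coef_def assms(7))
  have 2: "mv (mat_alpha2 R xs z (Suc j) (Suc (Suc j))) (coef v (Suc j) (Suc (Suc j)) B) (idx (degs j) l) =
      mv (mat_alpha2 R xs z (Suc j) (Suc (Suc j))) Y (idx (degs j) l)"
    by (rule mv_alpha2_cong[OF _ _ q _ Y]) (simp_all add: coef_def assms(8))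
  have 3: "mv (mat_alpha2 R xs z (Suc j) (Suc (Suc (Suc j)))) (coef v (Suc j) (Suc (Suc (Suc j))) B) (idx (degs j) l) =
      mv (mat_alpha2 R xs z (Suc j) (Suc (Suc (Suc j)))) T (idx (degs j) l)"
    by (rule mv_alpha2_cong[OF _ _ q _ T]) (simp_all add: coef_def assms(9))
  show ?thesis
    unfolding DD_emb[OF v B q] unfolding 1 2 3 unfolding mat_alpha2_simps by (rule row_formula[OF X Y T l])
qed

lemma lab_0: "lab (degs 0) = {(0, [])}"
proof -
  have "(m, w) \<in> lab (degs 0) \<longleftrightarrow> m = 0 \<and> w = []" for m w
    by (cases m) (auto simp: lab_iff W_0)
  then show ?thesis by auto
qed

lemma emb_0: "emb 0 q B = B"
  by (simp add: emb_def)

lemma zero_Ap: "\<zero>\<^bsub>AA\<^esub> \<in> T.Ap"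
  using T.Ap_G[OF HG_zero[of 1]] by simp

text \<open>The row at \<open>B\<close> is a copy of \<open>\<Delta>\<^sub>1\<close>, whose entries have positive degree.\<close>

lemma DD_base_Ap:
  assumes v: "v \<in> FF (Suc (wt B))" and B: "base rk B"
  shows "DD (Suc (wt B)) v B \<in> T.Ap"
proof -
  have v': "v \<in> FF (Suc 0 + wt B)" using v by simp
  have l: "(0, []) \<in> lab (degs 0)" unfolding lab_0 by simp
  have "DD (Suc 0 + wt B) v (emb 0 (idx (degs 0) (0, [])) B) \<in> T.Ap"
    unfolding DD_row[OF v' B l] by (rule T.Row_Ap; rule coef_closed[OF v' B]; simp)
  then show ?thesis unfolding emb_0 by simp
qed

text \<open>The row of \<open>\<Delta>\<^bsub>j+1\<^esub>\<close> is applied to rows of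
  \<open>\<Delta>\<^bsub>j+2\<^esub>\<close> at the columns of \<open>\<alpha>\<^bsub>j+1\<^esub>\<close>,
  and to rows of \<open>\<Delta>\<^sub>1\<close>, which are values in \<open>A\<^sub>+\<close>, at the other
  columns. This is the situation of \<open>Row_Row\<close>.\<close>

lemma DD_DD:
  assumes k: "1 \<le> k" and u: "u \<in> FF (Suc k)" and b': "b' \<in> II (k - 1)"
  shows "DD k (DD (Suc k) u) b' = \<zero>\<^bsub>AA\<^esub>"
proof -
  obtain j q B where b: "b' = emb j q B" "base rk B" "q < ell rk j" "k - 1 = j + wt B"
    by (rule index_emb[OF b'])
  obtain l where l: "l \<in> lab (degs j)" "q = idx (degs j) l" using idx_surj[of q "degs j"] b(3) by (auto simp: tb_degs)
  have kj: "k = Suc j + wt B" using b(4) k by simp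
  let ?v = "DD (Suc k) u"
  have v: "?v \<in> FF k" using DD_closed[of "Suc k" u] u by simp
  have v': "?v \<in> FF (Suc j + wt B)" using v unfolding kj .
  have u': "u \<in> FF (Suc (Suc j) + wt B)" using u unfolding kj by simp
  have Ap: "coef ?v (Suc j) r B p \<in> T.Ap" if r: "Suc j < r" "r \<le> Suc j + 2" for r p
  proof (cases "p < ell2 rk (Suc j) r")
    case True
    have B': "base rk (ext (Suc j) r p B)" using ext_base[OF b(2) _ r True] by simp
    have w: "wt (ext (Suc j) r p B) = k" by (simp add: wt_ext kj)
    have "DD (Suc (wt (ext (Suc j) r p B))) u (ext (Suc j) r p B) \<in> T.Ap"
      by (rule DD_base_Ap[OF _ B']) (use u in \<open>simp add: w\<close>)
    then show ?thesis using True by (simp add: coef_def w)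
  qed (simp add: coef_def zero_Ap)
  have X: "coef ?v (Suc j) (Suc j) B (idx (degs (Suc j)) l') = T.Row (degs j) (degs (Suc j))
      (coef u (Suc (Suc j)) (Suc (Suc j)) B) (coef u (Suc (Suc j)) (Suc (Suc (Suc j))) B)
      (coef u (Suc (Suc j)) (Suc (Suc (Suc (Suc j)))) B) l'" if l': "l' \<in> lab (degs (Suc j))" for l'
  proof -
    have "idx (degs (Suc j)) l' < ell2 rk (Suc j) (Suc j)"
      using idx_less[OF l'] by (simp add: ell2_def tb_degs del: degs.simps)
    then have "coef ?v (Suc j) (Suc j) B (idx (degs (Suc j)) l') =
        DD (Suc (Suc j) + wt B) u (emb (Suc j) (idx (degs (Suc j)) l') B)"
      by (simp only: coef_def if_True emb_Suc kj add_Suc)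
    then show ?thesis unfolding DD_row[OF u' b(2) l'] pdegs_simps .
  qed
  obtain m w where mw: "l = (m, w)" by (cases l)
  have "T.Row (pdegs j) (degs j) (coef ?v (Suc j) (Suc j) B) (coef ?v (Suc j) (Suc (Suc j)) B)
      (coef ?v (Suc j) (Suc (Suc (Suc j))) B) (m, w) = \<zero>\<^bsub>AA\<^esub>"
  proof (rule T.Row_Row[where D = "degs j"])
    show "(m, w) \<in> lab (degs j)" using l(1) mw by simp
    show "coef ?v (Suc j) (Suc (Suc j)) B p \<in> T.Ap" for p by (rule Ap) simp_all
    show "coef ?v (Suc j) (Suc (Suc (Suc j))) B p \<in> T.Ap" for p by (rule Ap) simp_all
    show "coef ?v (Suc j) (Suc j) B (idx (map Suc (degs j) @ replicate (tb (degs j) * n1) 0) l') =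
        T.Row (degs j) (map Suc (degs j) @ replicate (tb (degs j) * n1) 0)
          (coef u (Suc (Suc j)) (Suc (Suc j)) B) (coef u (Suc (Suc j)) (Suc (Suc (Suc j))) B)
          (coef u (Suc (Suc j)) (Suc (Suc (Suc (Suc j)))) B) l'"
      if "l' \<in> lab (map Suc (degs j) @ replicate (tb (degs j) * n1) 0)" for l'
      using X that unfolding degs.simps(2) .
    show "coef u (Suc (Suc j)) (Suc (Suc j)) B p \<in> carrier AA" for p by (rule coef_closed[OF u' b(2)]) simp_all
    show "coef u (Suc (Suc j)) (Suc (Suc (Suc j))) B p \<in> carrier AA" for p by (rule coef_closed[OF u' b(2)]) simp_all
    show "coef u (Suc (Suc j)) (Suc (Suc (Suc (Suc j)))) B p \<in> carrier AA" for p by (rule coef_closed[OF u' b(2)]) simp_all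
  qed
  then have "DD (Suc j + wt B) ?v (emb j (idx (degs j) l) B) = \<zero>\<^bsub>AA\<^esub>"
    unfolding DD_row[OF v' b(2) l(1)] unfolding mw .
  then show ?thesis unfolding b(1) l(2) kj .
qed

text \<open>The two conclusions of \<open>Row_kernel\<close> for the copy of
  \<open>\<Delta>\<^bsub>i+1\<^esub>\<close> attached to \<open>B\<close>: at the columns of
  \<open>\<alpha>\<^bsub>i+1\<^esub>\<close> a kernel vector comes from the next matrix, and at the other
  columns it lies in \<open>A\<^sub>+\<close>.\<close>

lemma kernel_rows:
  assumes B: "base rk B" and v: "v \<in> FF (Suc i + wt B)"
    and z: "\<And>b'. b' \<in> II (i + wt B) \<Longrightarrow> DD (Suc i + wt B) v b' = \<zero>\<^bsub>AA\<^esub>"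
  shows "\<exists>X Y T. (\<forall>p. X p \<in> carrier AA) \<and> (\<forall>p. Y p \<in> carrier AA) \<and> (\<forall>p. T p \<in> carrier AA) \<and>
      (\<forall>l\<in>lab (degs (Suc i)). v (emb (Suc i) (idx (degs (Suc i)) l) B) = T.Row (degs i) (degs (Suc i)) X Y T l)"
    and "\<And>r p. Suc i < r \<Longrightarrow> r \<le> Suc i + 2 \<Longrightarrow> p < ell2 rk (Suc i) r \<Longrightarrow> v (ext (Suc i) r p B) \<in> T.Ap"
proof -
  let ?X = "coef v (Suc i) (Suc i) B" and ?Y = "coef v (Suc i) (Suc (Suc i)) B"
    and ?T = "coef v (Suc i) (Suc (Suc (Suc i))) B"
  have X: "?X p \<in> carrier AA" "?Y p \<in> carrier AA" "?T p \<in> carrier AA" for p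
    by (rule coef_closed[OF v B]; simp)+
  have R: "T.Row (pdegs i) (degs i) ?X ?Y ?T l = \<zero>\<^bsub>AA\<^esub>" if l: "l \<in> lab (degs i)" for l
  proof -
    have "emb i (idx (degs i) l) B \<in> II (i + wt B)"
      by (rule emb_index[OF B]) (use idx_less[OF l] in \<open>simp add: tb_degs\<close>)
    then show ?thesis unfolding DD_row[OF v B l, symmetric] by (rule z)
  qed
  note K = T.Row_kernel[OF degs_pdegs X R]
  obtain X' Y' T' where XYT: "\<forall>p. X' p \<in> carrier AA" "\<forall>p. Y' p \<in> carrier AA" "\<forall>p. T' p \<in> carrier AA"
    and eq: "\<forall>l\<in>lab (degs (Suc i)). ?X (idx (degs (Suc i)) l) = T.Row (degs i) (degs (Suc i)) X' Y' T' l"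
    using K(1) unfolding degs.simps(2) by blast
  have "v (emb (Suc i) (idx (degs (Suc i)) l) B) = T.Row (degs i) (degs (Suc i)) X' Y' T' l" if l: "l \<in> lab (degs (Suc i))" for l
  proof -
    have "idx (degs (Suc i)) l < ell2 rk (Suc i) (Suc i)"
      using idx_less[OF l] by (simp add: ell2_def tb_degs del: degs.simps)
    then have "?X (idx (degs (Suc i)) l) = v (emb (Suc i) (idx (degs (Suc i)) l) B)"
      by (simp only: coef_def if_True emb_Suc)
    then show ?thesis using eq l by simp
  qed
  then show "\<exists>X Y T. (\<forall>p. X p \<in> carrier AA) \<and> (\<forall>p. Y p \<in> carrier AA) \<and> (\<forall>p. T p \<in> carrier AA) \<and>
      (\<forall>l\<in>lab (degs (Suc i)). v (emb (Suc i) (idx (degs (Suc i)) l) B) = T.Row (degs i) (degs (Suc i)) X Y T l)"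
    using XYT by blast
  fix r p assume r: "Suc i < r" "r \<le> Suc i + 2" and p: "p < ell2 rk (Suc i) r"
  consider "r = Suc (Suc i)" | "r = Suc (Suc (Suc i))" using r by linarith
  then show "v (ext (Suc i) r p B) \<in> T.Ap"
  proof cases
    case 1
    have "p < tb (pdegs i) + tb (degs i) * n2" using p by (simp add: 1 ell2_def ell'_def tb_pdegs tb_degs mult.commute)
    then have "?Y p \<in> T.Ap" by (intro K(2))
    then show ?thesis using p by (simp add: 1 coef_def)
  next
    case 2
    have "p < tb (degs i) * n3" using p by (simp add: 2 ell2_def ell''_def tb_degs mult.commute)
    then have "?T p \<in> T.Ap" by (intro K(3))
    then show ?thesis using p by (simp add: 2 coef_def)
  qed
qed

text \<open>\<open>\<Delta>\<^sub>1\<close> is a single row, and its entries generate the ideal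
  \<open>A\<^sub>+\<close>.\<close>

lemma Ap_image:
  assumes "x \<in> T.Ap"
  shows "\<exists>X Y T. (\<forall>p. X p \<in> carrier AA) \<and> (\<forall>p. Y p \<in> carrier AA) \<and> (\<forall>p. T p \<in> carrier AA) \<and>
    (\<forall>l\<in>lab (degs 0). x = T.Row (pdegs 0) (degs 0) X Y T l)"
proof -
  obtain x1 x2 x3 where x: "x = x1 \<oplus>\<^bsub>AA\<^esub> (x2 \<oplus>\<^bsub>AA\<^esub> x3)" "x1 \<in> HG 1" "x2 \<in> HG 2" "x3 \<in> HG 3"
    using assms unfolding T.Ap_def by blast
  have D: "degs 0 = map Suc [] @ replicate 1 0" by simp
  have "\<exists>X Y T. (\<forall>j. X j \<in> carrier AA) \<and> (\<forall>j. Y j \<in> carrier AA) \<and> (\<forall>j. T j \<in> carrier AA) \<and>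
    (\<forall>m s. (m, s) \<in> lab (degs 0) \<longrightarrow> x1 \<oplus>\<^bsub>AA\<^esub> (x2 \<oplus>\<^bsub>AA\<^esub> x3) = T.Row [] (degs 0) X Y T (m, s))"
    by (rule T.Row_image[OF D, of "\<lambda>_ _. x1" "\<lambda>_ _. x2" "\<lambda>_ _. x3"]) (use x in simp_all)
  then show ?thesis unfolding lab_0 x(1) pdegs_simps by simp
qed

text \<open>The copies of the matrices \<open>\<Delta>\<^sub>i\<close> in the differential have disjoint
  rows and disjoint columns, so preimages can be chosen for each of them separately.\<close>

lemma lift:
  assumes v: "v \<in> FF k"
    and ex: "\<And>B. base rk B \<Longrightarrow> wt B \<le> k \<Longrightarrow> \<exists>X Y T. (\<forall>p. X p \<in> carrier AA) \<and> (\<forall>p. Y p \<in> carrier AA) \<and> (\<forall>p. T p \<in> carrier AA) \<and>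
      (\<forall>l\<in>lab (degs (k - wt B)). v (emb (k - wt B) (idx (degs (k - wt B)) l) B) =
        T.Row (pdegs (k - wt B)) (degs (k - wt B)) X Y T l)"
  shows "\<exists>u\<in>FF (Suc k). DD (Suc k) u = v"
proof -
  let ?P = "\<lambda>B X Y T. base rk B \<and> wt B \<le> k \<longrightarrow> (\<forall>p. X p \<in> carrier AA) \<and> (\<forall>p. Y p \<in> carrier AA) \<and> (\<forall>p. T p \<in> carrier AA) \<and>
      (\<forall>l\<in>lab (degs (k - wt B)). v (emb (k - wt B) (idx (degs (k - wt B)) l) B) =
        T.Row (pdegs (k - wt B)) (degs (k - wt B)) X Y T l)"
  have "\<forall>B. \<exists>X Y T. ?P B X Y T"
  proof
    fix B
    show "\<exists>X Y T. ?P B X Y T"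
    proof (cases "base rk B \<and> wt B \<le> k")
      case True
      then show ?thesis using ex[of B] by simp
    next
      case False
      then show ?thesis by blast
    qed
  qed
  from choice[OF this] obtain X where "\<forall>B. \<exists>Y T. ?P B (X B) Y T" ..
  from choice[OF this] obtain Y where "\<forall>B. \<exists>T. ?P B (X B) (Y B) T" ..
  from choice[OF this] obtain T where P: "\<forall>B. ?P B (X B) (Y B) (T B)" ..
  \<comment> \<open>the coordinate at the column \<open>ext i r p B\<close> is the one chosen for \<open>B\<close>\<close>
  define u where "u = (\<lambda>b\<in>II (Suc k). let i = fst (hd (fst b)); r = snd (hd (fst b)); p = hd (snd b);
    B = (tl (fst b), tl (snd b)) in if r = i then X B p else if r = Suc i then Y B p else T B p)"
  have u_ext: "u (ext i r p B) = (if r = i then X B p else if r = Suc i then Y B p else T B p)"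
    if "ext i r p B \<in> II (Suc k)" for i r p B
    using that by (simp add: u_def ext_def)
  have u: "u \<in> FF (Suc k)"
  proof (rule PiE_I)
    fix b assume b: "b \<in> II (Suc k)"
    obtain i r p B where e: "b = ext i r p B" "base rk B" "1 \<le> i" "i \<le> r" "r \<le> i + 2" "p < ell2 rk i r" "Suc k = i + wt B"
      by (rule index_ext[OF b]) simp
    then have "wt B \<le> k" by simp
    then have c: "X B p \<in> carrier AA" "Y B p \<in> carrier AA" "T B p \<in> carrier AA" using P e(2) by blast+
    show "u b \<in> carrier AA" using b c unfolding e(1) by (simp add: u_ext)
  next
    fix b assume "b \<notin> II (Suc k)"
    then show "u b = undefined" by (simp add: u_def)
  qed
  have "DD (Suc k) u b = v b" if b: "b \<in> II k" for b
  proof -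
    obtain j q B where e: "b = emb j q B" "base rk B" "q < ell rk j" "k = j + wt B"
      by (rule index_emb[OF b])
    obtain l where l: "l \<in> lab (degs j)" "q = idx (degs j) l"
      using idx_surj[of q "degs j"] e(3) by (auto simp: tb_degs)
    have w: "wt B \<le> k" "k - wt B = j" using e(4) by simp_all
    have c: "X B p \<in> carrier AA" "Y B p \<in> carrier AA" "T B p \<in> carrier AA" for p using P e(2) w(1) by blast+
    have "\<forall>l\<in>lab (degs (k - wt B)). v (emb (k - wt B) (idx (degs (k - wt B)) l) B) =
        T.Row (pdegs (k - wt B)) (degs (k - wt B)) (X B) (Y B) (T B) l" using P e(2) w(1) by blast
    then have vb: "v b = T.Row (pdegs j) (degs j) (X B) (Y B) (T B) l"
      using l(1) unfolding w(2) e(1) l(2) by (rule bspec)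
    have u': "u \<in> FF (Suc j + wt B)" using u e(4) by simp
    have i: "ext (Suc j) r p B \<in> II (Suc k)" if "Suc j \<le> r" "r \<le> Suc j + 2" "p < ell2 rk (Suc j) r" for r p
      using ext_index[OF e(2) _ that] e(4) by simp
    have "DD (Suc j + wt B) u (emb j (idx (degs j) l) B) = T.Row (pdegs j) (degs j) (X B) (Y B) (T B) l"
      by (rule DD_row_truncated[OF c u' e(2) l(1)]) (simp_all add: u_ext i)
    then show ?thesis unfolding vb unfolding e(1,4) l(2) by simp
  qed
  moreover have "DD (Suc k) u \<in> FF k" using DD_closed[of "Suc k" u] u by simp
  ultimately have "DD (Suc k) u = v" using v by (intro PiE_ext)
  then show ?thesis using u by blast
qed

text \<open>For the copy attached to \<open>B\<close> with \<open>j = k - wt B\<close> there are two cases.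
  If \<open>j > 0\<close>, its rows are the columns of \<open>\<alpha>\<^sub>j\<close> in the copy of
  \<open>\<Delta>\<^sub>j\<close> attached to the same \<open>B\<close>. If \<open>j = 0\<close>, its only
  row is a column outside \<open>\<alpha>\<^sub>i\<close> of a copy of \<open>\<Delta>\<^sub>i\<close>
  attached to the rest of the monomial, and \<open>\<Delta>\<^sub>1\<close> maps onto
  \<open>A\<^sub>+\<close>.\<close>

lemma kernel_image:
  assumes k: "1 \<le> k" and v: "v \<in> FF k" and z: "\<And>b'. b' \<in> II (k - 1) \<Longrightarrow> DD k v b' = \<zero>\<^bsub>AA\<^esub>"
  shows "\<exists>u\<in>FF (Suc k). DD (Suc k) u = v"
proof (rule lift[OF v])
  fix B assume B: "base rk B" "wt B \<le> k"
  show "\<exists>X Y T. (\<forall>p. X p \<in> carrier AA) \<and> (\<forall>p. Y p \<in> carrier AA) \<and> (\<forall>p. T p \<in> carrier AA) \<and>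
      (\<forall>l\<in>lab (degs (k - wt B)). v (emb (k - wt B) (idx (degs (k - wt B)) l) B) =
        T.Row (pdegs (k - wt B)) (degs (k - wt B)) X Y T l)"
  proof (cases "k - wt B")
    case (Suc i)
    then have ki: "k = Suc i + wt B" "k - 1 = i + wt B" by simp_all
    show ?thesis unfolding Suc pdegs_simps
      by (rule kernel_rows(1)[OF B(1)]) (use v z ki in simp_all)
  next
    case 0
    have wB: "wt B = k" using 0 B(2) by simp
    have "1 \<le> wt B" using wB k by simp
    then obtain i r p B' where e: "B = ext i r p B'" "base rk B'" "1 \<le> i" "i < r" "r \<le> i + 2" "p < ell2 rk i r" "wt B = i + wt B'"
      by (rule base_ext[OF B(1)])
    obtain i' where i: "i = Suc i'" using e(3) by (cases i) auto
    have ki: "k = Suc i' + wt B'" "k - 1 = i' + wt B'" using e(7) wB i by simp_all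
    have "v (ext (Suc i') r p B') \<in> T.Ap"
      by (rule kernel_rows(2)[OF e(2)]) (use v z ki e(4-6) i in simp_all)
    then have "v B \<in> T.Ap" unfolding e(1) i .
    from Ap_image[OF this] show ?thesis unfolding 0 emb_0 .
  qed
qed

end

context class_T_koszul
begin

subsection \<open>The augmentation\<close>

abbreviation QQ where "QQ \<equiv> R Quot \<mm>"
abbreviation aug where "aug \<equiv> koszul_aug R \<mm>"

lemma maximal_ideal: "ideal \<mm> R"
  by (rule is_ideal)

lemma quotient_hom: "(+>) \<mm> \<in> Ring.ring_hom R QQ"
  by (rule ideal.rcos_ring_hom[OF maximal_ideal])

lemma quotient_zero_iff: "r \<in> carrier R \<Longrightarrow> \<mm> +> r = \<zero>\<^bsub>QQ\<^esub> \<longleftrightarrow> r \<in> \<mm>"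
  using a_rcos_zero[OF maximal_ideal] ideal.rcos_const_imp_mem[OF maximal_ideal]
  by (auto simp: FactRing_def)

lemma quotient_ring: "ring QQ"
  by (rule ideal.quotient_is_ring[OF maximal_ideal])

lemma empty_closed: "f \<in> carrier KK \<Longrightarrow> f {} \<in> carrier R"
  by (rule koszul_closed) simp_all

text \<open>The component of degree 0 of a boundary lies in the maximal ideal.\<close>

lemma aug_hc: "f \<in> ZZ \<Longrightarrow> aug (hc f) = \<mm> +> f {}"
proof -
  assume f: "f \<in> ZZ"
  interpret QQ: ring QQ by (rule quotient_ring)
  have fe: "f {} \<in> carrier R" using empty_closed cycles_closed[OF f] by simp
  have "\<mm> +> g {} = \<mm> +> f {}" if "g \<in> hc f" for g
  proof -
    obtain b where b: "b \<in> BB" "g = b \<oplus>\<^bsub>KK\<^esub> f" using \<open>g \<in> hc f\<close> unfolding hclass_alt by blast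
    obtain h where h: "h \<in> carrier KK" "b = dd h" using b(1) by (auto simp: koszul_boundaries_def)
    have be: "b {} \<in> \<mm>" unfolding h(2) by (rule diff_empty_mem[OF h(1)])
    have bc: "b {} \<in> carrier R" by (rule ideal.Icarr[OF maximal_ideal be])
    have "\<mm> +> g {} = (\<mm> +> b {}) \<oplus>\<^bsub>QQ\<^esub> (\<mm> +> f {})"
      unfolding b(2) using ring_hom_add[OF quotient_hom bc fe] by (simp add: koszul_add)
    then show ?thesis
      using be bc quotient_zero_iff[OF bc] ring_hom_closed[OF quotient_hom fe] by simp
  qed
  then show ?thesis unfolding koszul_aug_def using hclass_self[OF f] by blast
qed

lemma aug_closed: "x \<in> carrier AA \<Longrightarrow> aug x \<in> carrier QQ"
  using ring_hom_closed[OF quotient_hom empty_closed[OF cycles_closed]] by (auto simp: homology_carrier aug_hc)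

lemma aug_add:
  assumes "x \<in> carrier AA" "y \<in> carrier AA"
  shows "aug (x \<oplus>\<^bsub>AA\<^esub> y) = aug x \<oplus>\<^bsub>QQ\<^esub> aug y"
proof -
  obtain f g where f: "f \<in> ZZ" "x = hc f" and g: "g \<in> ZZ" "y = hc g" using assms by (auto simp: homology_carrier)
  show ?thesis
    unfolding f(2) g(2) hclass_add[OF f(1) g(1), symmetric] aug_hc[OF f(1)] aug_hc[OF g(1)] aug_hc[OF add_cycle[OF f(1) g(1)]]
    using ring_hom_add[OF quotient_hom empty_closed[OF cycles_closed[OF f(1)]] empty_closed[OF cycles_closed[OF g(1)]]]
    by (simp add: koszul_add)
qed

lemma aug_mult:
  assumes "x \<in> carrier AA" "y \<in> carrier AA"
  shows "aug (x \<otimes>\<^bsub>AA\<^esub> y) = aug x \<otimes>\<^bsub>QQ\<^esub> aug y"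
proof -
  obtain f g where f: "f \<in> ZZ" "x = hc f" and g: "g \<in> ZZ" "y = hc g" using assms by (auto simp: homology_carrier)
  have c: "f {} \<in> carrier R" "g {} \<in> carrier R"
    using empty_closed cycles_closed f(1) g(1) by blast+
  have "(f \<otimes>\<^bsub>KK\<^esub> g) {} = f {} \<otimes> g {}"
    using c by (simp add: koszul_mult finsum_insert)
  then show ?thesis
    unfolding f(2) g(2) hclass_mult[OF f(1) g(1), symmetric] aug_hc[OF f(1)] aug_hc[OF g(1)] aug_hc[OF cycles_mult[OF f(1) g(1)]]
    using ring_hom_mult[OF quotient_hom c] by simp
qed

lemma aug_HG: "x \<in> HG i \<Longrightarrow> 1 \<le> i \<Longrightarrow> aug x = \<zero>\<^bsub>QQ\<^esub>"
proof -
  assume "x \<in> HG i" and i: "1 \<le> i"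
  then obtain f where f: "f \<in> ZZ" "f \<in> deg i" "x = hc f" using HG_iff by blast
  have "f {} = \<zero>" using deg_zero[OF f(2), of "{}"] i by simp
  moreover have "\<zero> \<in> \<mm>" using additive_subgroup.zero_closed[OF ideal.axioms(1)[OF maximal_ideal]] .
  ultimately show ?thesis using aug_hc[OF f(1)] quotient_zero_iff[of \<zero>] f(3) by simp
qed

text \<open>A constant in the maximal ideal is a boundary, so the augmentation is injective in degree 0.\<close>

lemma aug_zero_iff: "x \<in> carrier AA \<Longrightarrow> aug x = \<zero>\<^bsub>QQ\<^esub> \<longleftrightarrow> x \<in> T.Ap"
proof
  interpret QQ: ring QQ by (rule quotient_ring)
  have Ap: "aug x = \<zero>\<^bsub>QQ\<^esub>" if "x \<in> T.Ap" for x
  proof -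
    obtain x1 x2 x3 where x: "x = x1 \<oplus>\<^bsub>AA\<^esub> (x2 \<oplus>\<^bsub>AA\<^esub> x3)" "x1 \<in> HG 1" "x2 \<in> HG 2" "x3 \<in> HG 3"
      using \<open>x \<in> T.Ap\<close> unfolding T.Ap_def by blast
    have c: "x1 \<in> carrier AA" "x2 \<in> carrier AA" "x3 \<in> carrier AA" using x(2-4) HG_closed by blast+
    show ?thesis
      using aug_HG[OF x(2)] aug_HG[OF x(3)] aug_HG[OF x(4)] c by (simp add: x(1) aug_add)
  qed
  then show "x \<in> T.Ap \<Longrightarrow> aug x = \<zero>\<^bsub>QQ\<^esub>" .
  assume "x \<in> carrier AA" and z: "aug x = \<zero>\<^bsub>QQ\<^esub>"
  then obtain x0 xp where x: "x0 \<in> HG 0" "xp \<in> T.Ap" "x = x0 \<oplus>\<^bsub>AA\<^esub> xp" using T.Ap_decomp by blast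
  obtain f where f: "f \<in> ZZ" "f \<in> deg 0" "x0 = hc f" using x(1) HG_iff by blast
  have c: "x0 \<in> carrier AA" "xp \<in> carrier AA" using x(1,2) HG_closed T.Ap_closed by blast+
  have "aug x0 = \<zero>\<^bsub>QQ\<^esub>"
    using z Ap[OF x(2)] aug_closed[OF c(1)] unfolding x(3) aug_add[OF c] by simp
  then have "f {} \<in> \<mm>"
    using aug_hc[OF f(1)] quotient_zero_iff[OF empty_closed[OF cycles_closed[OF f(1)]]] f(3) by simp
  then have "f \<in> BB" using deg0_boundary_iff[OF f(2)] by simp
  then have "x0 = \<zero>\<^bsub>AA\<^esub>" using hclass_eq_zero[OF f(1)] f(3) by simp
  then show "x \<in> T.Ap" using x c by simp
qed

lemma aug_surj: "aug ` carrier AA = carrier QQ"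
proof
  show "aug ` carrier AA \<subseteq> carrier QQ" using aug_closed by blast
  show "carrier QQ \<subseteq> aug ` carrier AA"
  proof
    fix X assume "X \<in> carrier QQ"
    then obtain r where r: "r \<in> carrier R" "X = \<mm> +> r" by (auto simp: FactRing_def A_RCOSETS_def')
    have Z: "const r \<in> ZZ" by (rule deg_0_cycles[OF const_deg[OF r(1)]])
    have "aug (hc (const r)) = X" unfolding aug_hc[OF Z] r(2) by (simp add: const_def)
    then show "X \<in> aug ` carrier AA" using hclass_closed[OF Z] by blast
  qed
qed

subsection \<open>The resolution\<close>

lemma DD_add:
  assumes k: "1 \<le> k" and v: "v \<in> FF k" and w: "w \<in> FF k"
  shows "DD k (free_add AA (II k) v w) = free_add AA (II (k - 1)) (DD k v) (DD k w)"
proof -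
  have "(\<Oplus>\<^bsub>AA\<^esub>b\<in>II k. hc (entry b' b) \<otimes>\<^bsub>AA\<^esub> free_add AA (II k) v w b) =
      (\<Oplus>\<^bsub>AA\<^esub>b\<in>II k. hc (entry b' b) \<otimes>\<^bsub>AA\<^esub> v b) \<oplus>\<^bsub>AA\<^esub> (\<Oplus>\<^bsub>AA\<^esub>b\<in>II k. hc (entry b' b) \<otimes>\<^bsub>AA\<^esub> w b)"
    if b': "b' \<in> II (k - 1)" for b'
  proof -
    note t = DD_term_closed[OF k v b'] DD_term_closed[OF k w b']
    have "(\<Oplus>\<^bsub>AA\<^esub>b\<in>II k. hc (entry b' b) \<otimes>\<^bsub>AA\<^esub> free_add AA (II k) v w b) =
        (\<Oplus>\<^bsub>AA\<^esub>b\<in>II k. hc (entry b' b) \<otimes>\<^bsub>AA\<^esub> v b \<oplus>\<^bsub>AA\<^esub> hc (entry b' b) \<otimes>\<^bsub>AA\<^esub> w b)"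
    proof (rule A.finsum_cong'[OF refl])
      show "(\<lambda>b. hc (entry b' b) \<otimes>\<^bsub>AA\<^esub> v b \<oplus>\<^bsub>AA\<^esub> hc (entry b' b) \<otimes>\<^bsub>AA\<^esub> w b) \<in> II k \<rightarrow> carrier AA"
        using t unfolding Pi_iff by (intro ballI A.a_closed) (drule bspec, assumption, assumption)+
      fix b assume b: "b \<in> II k"
      show "hc (entry b' b) \<otimes>\<^bsub>AA\<^esub> free_add AA (II k) v w b =
          hc (entry b' b) \<otimes>\<^bsub>AA\<^esub> v b \<oplus>\<^bsub>AA\<^esub> hc (entry b' b) \<otimes>\<^bsub>AA\<^esub> w b"
        using b A.r_distr[OF PiE_mem[OF v b] PiE_mem[OF w b] hclass_closed[OF entry_cycle(1)[OF k b b']]]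
        by (simp add: free_add_def)
    qed
    then show ?thesis using A.finsum_addf[OF t] by (simp only:)
  qed
  then show ?thesis unfolding DD_def free_add_def[of AA "II (k - 1)"] by (intro restrict_ext) (simp only: restrict_apply if_True)
qed

lemma DD_act:
  assumes k: "1 \<le> k" and v: "v \<in> FF k" and r: "r \<in> carrier AA"
  shows "DD k (free_act AA (II k) v r) = free_act AA (II (k - 1)) (DD k v) r"
proof -
  have "(\<Oplus>\<^bsub>AA\<^esub>b\<in>II k. hc (entry b' b) \<otimes>\<^bsub>AA\<^esub> free_act AA (II k) v r b) =
      (\<Oplus>\<^bsub>AA\<^esub>b\<in>II k. hc (entry b' b) \<otimes>\<^bsub>AA\<^esub> v b) \<otimes>\<^bsub>AA\<^esub> r"
    if b': "b' \<in> II (k - 1)" for b'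
  proof -
    note t = DD_term_closed[OF k v b']
    have "(\<Oplus>\<^bsub>AA\<^esub>b\<in>II k. hc (entry b' b) \<otimes>\<^bsub>AA\<^esub> free_act AA (II k) v r b) =
        (\<Oplus>\<^bsub>AA\<^esub>b\<in>II k. hc (entry b' b) \<otimes>\<^bsub>AA\<^esub> v b \<otimes>\<^bsub>AA\<^esub> r)"
    proof (rule A.finsum_cong'[OF refl])
      show "(\<lambda>b. hc (entry b' b) \<otimes>\<^bsub>AA\<^esub> v b \<otimes>\<^bsub>AA\<^esub> r) \<in> II k \<rightarrow> carrier AA"
        by (intro Pi_I A.m_closed[OF _ r]) (rule funcset_mem[OF t])
      fix b assume b: "b \<in> II k"
      show "hc (entry b' b) \<otimes>\<^bsub>AA\<^esub> free_act AA (II k) v r b = hc (entry b' b) \<otimes>\<^bsub>AA\<^esub> v b \<otimes>\<^bsub>AA\<^esub> r"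
        using b A.m_assoc[OF hclass_closed[OF entry_cycle(1)[OF k b b']] PiE_mem[OF v b] r]
        by (simp add: free_act_def)
    qed
    also have "\<dots> = (\<Oplus>\<^bsub>AA\<^esub>b\<in>II k. hc (entry b' b) \<otimes>\<^bsub>AA\<^esub> v b) \<otimes>\<^bsub>AA\<^esub> r"
      by (rule A.finsum_ldistr[OF finite_cx_index r t, symmetric])
    finally show ?thesis .
  qed
  then show ?thesis unfolding DD_def free_act_def[of AA "II (k - 1)"] by (intro restrict_ext) (simp only: restrict_apply if_True)
qed

abbreviation FFdeg where "FFdeg k \<equiv> shifted_sum_deg \<zero>\<^bsub>AA\<^esub> HG (II k) cx_shift"

lemma FFdeg_sub: "FFdeg k j \<subseteq> FF k"
proof
  fix v assume v: "v \<in> FFdeg k j"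
  show "v \<in> FF k"
  proof (rule PiE_I)
    fix b assume "b \<in> II k"
    then have "v b \<in> (if cx_shift b \<le> j then HG (j - cx_shift b) else {\<zero>\<^bsub>AA\<^esub>})"
      using v unfolding shifted_sum_deg_def by (rule PiE_mem[rotated])
    then show "v b \<in> carrier AA" using HG_closed[of "j - cx_shift b"] by (auto split: if_splits)
  next
    fix b assume "b \<notin> II k"
    then show "v b = undefined" using v unfolding shifted_sum_deg_def by (rule PiE_arb[rotated])
  qed
qed

lemma DD_deg:
  assumes k: "1 \<le> k" and v: "v \<in> FFdeg k j"
  shows "DD k v \<in> FFdeg (k - 1) j"
proof -
  let ?D = "\<lambda>b. if cx_shift b \<le> j then HG (j - cx_shift b) else {\<zero>\<^bsub>AA\<^esub>}"
  have vD: "v \<in> Pi\<^sub>E (II k) ?D" using v unfolding shifted_sum_deg_def .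
  have "(\<Oplus>\<^bsub>AA\<^esub>b\<in>II k. hc (entry b' b) \<otimes>\<^bsub>AA\<^esub> v b) \<in> ?D b'" if b': "b' \<in> II (k - 1)" for b'
  proof (rule A.finsum_mem[OF finite_cx_index])
    show "?D b' \<subseteq> carrier AA" using HG_closed by auto
    show "\<zero>\<^bsub>AA\<^esub> \<in> ?D b'" by (simp add: HG_zero)
    show "x \<oplus>\<^bsub>AA\<^esub> y \<in> ?D b'" if "x \<in> ?D b'" "y \<in> ?D b'" for x y
      using that HG_add by (auto split: if_splits)
    fix b assume b: "b \<in> II k"
    have vb: "v b \<in> ?D b" using vD b by (rule PiE_mem)
    then have vc: "v b \<in> carrier AA" using HG_closed[of "j - cx_shift b"] by (auto split: if_splits)
    show "hc (entry b' b) \<otimes>\<^bsub>AA\<^esub> v b \<in> ?D b'"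
      using entry_cases[OF k b b']
    proof
      assume "entry b' b = \<zero>\<^bsub>KK\<^esub>"
      then show ?thesis using vc by (simp add: hclass_zero HG_zero)
    next
      assume "\<exists>s\<in>{1, 2, 3}. cx_shift b = cx_shift b' + s \<and> hom_cycle s (entry b' b)"
      then obtain s where s: "cx_shift b = cx_shift b' + s" "hom_cycle s (entry b' b)" by blast
      show ?thesis
      proof (cases "cx_shift b \<le> j")
        case True
        then have "s + (j - cx_shift b) = j - cx_shift b'" using s(1) by simp
        moreover have "hc (entry b' b) \<otimes>\<^bsub>AA\<^esub> v b \<in> HG (s + (j - cx_shift b))"
          using HG_mult[OF HG_I, of "entry b' b" s "v b" "j - cx_shift b"] s(2) vb True by simp
        ultimately show ?thesis using True s(1) by simp
      next
        case False
        then have "v b = \<zero>\<^bsub>AA\<^esub>" using vb by simp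
        then have "hc (entry b' b) \<otimes>\<^bsub>AA\<^esub> v b = \<zero>\<^bsub>AA\<^esub>" using s(2) by simp
        then show ?thesis by (simp add: HG_zero)
      qed
    qed
  qed
  then show ?thesis unfolding shifted_sum_deg_def DD_def restrict_PiE_iff by blast
qed

lemma DD_minimal:
  assumes k: "1 \<le> k" and v: "v \<in> FF k" and b': "b' \<in> II (k - 1)"
  shows "DD k v b' \<in> genideal AA (\<Union>i\<in>{1..}. HG i)"
proof -
  let ?S = "\<Union>i\<in>{1..}. HG i"
  have S: "?S \<subseteq> carrier AA" using HG_closed by blast
  interpret J: ideal "genideal AA ?S" AA by (rule A.genideal_ideal[OF S])
  have "(\<Oplus>\<^bsub>AA\<^esub>b\<in>II k. hc (entry b' b) \<otimes>\<^bsub>AA\<^esub> v b) \<in> genideal AA ?S"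
  proof (rule A.finsum_mem[OF finite_cx_index])
    show "genideal AA ?S \<subseteq> carrier AA" using J.Icarr by blast
    show "\<zero>\<^bsub>AA\<^esub> \<in> genideal AA ?S" by (rule J.zero_closed)
    show "x \<oplus>\<^bsub>AA\<^esub> y \<in> genideal AA ?S" if "x \<in> genideal AA ?S" "y \<in> genideal AA ?S" for x y
      using that by (rule J.a_closed)
    fix b assume b: "b \<in> II k"
    have "hc (entry b' b) \<in> genideal AA ?S" using entry_cases[OF k b b']
    proof
      assume "entry b' b = \<zero>\<^bsub>KK\<^esub>"
      then show ?thesis using J.zero_closed by (simp add: hclass_zero)
    next
      assume "\<exists>s\<in>{1, 2, 3}. cx_shift b = cx_shift b' + s \<and> hom_cycle s (entry b' b)"
      then obtain s where s: "s \<in> {1, 2, 3}" "hom_cycle s (entry b' b)" by blast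
      moreover have "s \<in> {1..}" using s(1) by auto
      ultimately have "hc (entry b' b) \<in> ?S" using HG_I by blast
      then show ?thesis using A.genideal_self[OF S] by blast
    qed
    then show "hc (entry b' b) \<otimes>\<^bsub>AA\<^esub> v b \<in> genideal AA ?S" using PiE_mem[OF v b] by (rule J.I_r_closed)
  qed
  then show ?thesis using b' by (simp add: DD_def)
qed

abbreviation top where "top \<equiv> ([], []) :: elt"

lemma top_base: "base rk top" "wt top = 0"
  by (simp_all add: base_def wt_def)

text \<open>The image of \<open>\<Delta>\<^sub>1\<close> is \<open>A\<^sub>+\<close>.\<close>

lemma augmentation_kernel: "DD 1 ` FF 1 = {v \<in> FF 0. aug (v top) = \<zero>\<^bsub>QQ\<^esub>}"
proof (intro equalityI subsetI)
  fix w assume "w \<in> DD 1 ` FF 1"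
  then obtain v where v: "v \<in> FF 1" "w = DD 1 v" by blast
  have w: "w \<in> FF 0" using DD_closed[of 1 v] v by simp
  have "v \<in> FF (Suc (wt top))" using v(1) by (simp add: top_base)
  from DD_base_Ap[OF this top_base(1)] have "w top \<in> T.Ap" unfolding v(2) by (simp add: top_base)
  moreover have "w top \<in> carrier AA" using PiE_mem[OF w, of top] by (simp add: cx_index_0)
  ultimately show "w \<in> {v \<in> FF 0. aug (v top) = \<zero>\<^bsub>QQ\<^esub>}" using w aug_zero_iff by blast
next
  fix v assume "v \<in> {v \<in> FF 0. aug (v top) = \<zero>\<^bsub>QQ\<^esub>}"
  then have v: "v \<in> FF 0" "aug (v top) = \<zero>\<^bsub>QQ\<^esub>" by blast+
  have "v top \<in> carrier AA" using PiE_mem[OF v(1), of top] by (simp add: cx_index_0)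
  then have Ap: "v top \<in> T.Ap" using v(2) aug_zero_iff by blast
  have "\<exists>u\<in>FF (Suc 0). DD (Suc 0) u = v"
  proof (rule lift[OF v(1)])
    fix B assume "base rk B" "wt B \<le> 0"
    then have B: "B = top" "0 - wt B = 0" using base_wt_0 by auto
    show "\<exists>X Y T. (\<forall>p. X p \<in> carrier AA) \<and> (\<forall>p. Y p \<in> carrier AA) \<and> (\<forall>p. T p \<in> carrier AA) \<and>
        (\<forall>l\<in>lab (degs (0 - wt B)). v (emb (0 - wt B) (idx (degs (0 - wt B)) l) B) =
          T.Row (pdegs (0 - wt B)) (degs (0 - wt B)) X Y T l)"
      unfolding B(2) emb_0 unfolding B(1) by (rule Ap_image[OF Ap])
  qed
  then show "v \<in> DD 1 ` FF 1" by auto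
qed

lemma res_diff_linear:
  assumes k: "1 \<le> k"
  shows "right_linear AA (FF k) (free_add AA (II k)) (free_act AA (II k))
    (FF (k - 1)) (free_add AA (II (k - 1))) (free_act AA (II (k - 1))) (res_diff R xs z k)"
  unfolding right_linear_def
proof (intro conjI ballI Pi_I)
  fix v assume v: "v \<in> FF k"
  show "res_diff R xs z k v \<in> FF (k - 1)" unfolding res_diff_eq[OF k v] by (rule DD_closed[OF k v])
  { fix w assume w: "w \<in> FF k"
    have "free_add AA (II k) v w \<in> FF k"
      unfolding free_add_def restrict_PiE_iff using PiE_mem[OF v] PiE_mem[OF w] by simp
    then show "res_diff R xs z k (free_add AA (II k) v w) = free_add AA (II (k - 1)) (res_diff R xs z k v) (res_diff R xs z k w)"
      using v w by (simp only: res_diff_eq[OF k] DD_add[OF k]) }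
  { fix r assume r: "r \<in> carrier AA"
    have "free_act AA (II k) v r \<in> FF k"
      unfolding free_act_def restrict_PiE_iff using PiE_mem[OF v] r by simp
    then show "res_diff R xs z k (free_act AA (II k) v r) = free_act AA (II (k - 1)) (res_diff R xs z k v) r"
      using v r by (simp only: res_diff_eq[OF k] DD_act[OF k]) }
qed

lemma aug_linear: "right_linear AA (FF 0) (free_add AA (II 0)) (free_act AA (II 0)) (carrier QQ) (add QQ)
    (residue_act R \<mm>) (\<lambda>v. aug (v top))"
proof -
  have t: "v top \<in> carrier AA" if "v \<in> FF 0" for v using PiE_mem[OF that, of top] by (simp add: cx_index_0)
  show ?thesis
    unfolding right_linear_def free_add_def free_act_def residue_act_def cx_index_0
    using t[unfolded cx_index_0] by (simp add: aug_closed aug_add aug_mult)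
qed

lemma resolution: "graded_minimal_resolution AA HG II cx_shift (res_diff R xs z) QQ (residue_act R \<mm>) (\<lambda>v. aug (v top))"
  unfolding graded_minimal_resolution_def Let_def
proof (intro conjI allI impI ballI)
  show "finite (II k)" for k by (rule finite_cx_index)
  show "right_linear AA (FF k) (free_add AA (II k)) (free_act AA (II k))
    (FF (k - 1)) (free_add AA (II (k - 1))) (free_act AA (II (k - 1))) (res_diff R xs z k)" if "1 \<le> k" for k
    by (rule res_diff_linear[OF that])
  show "res_diff R xs z k ` FFdeg k j \<subseteq> FFdeg (k - 1) j" if k: "1 \<le> k" for k j
  proof
    fix w assume "w \<in> res_diff R xs z k ` FFdeg k j"
    then obtain v where v: "v \<in> FFdeg k j" "w = res_diff R xs z k v" by blast
    show "w \<in> FFdeg (k - 1) j"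
      unfolding v(2) res_diff_eq[OF k subsetD[OF FFdeg_sub v(1)]] by (rule DD_deg[OF k v(1)])
  qed
  show "right_linear AA (FF 0) (free_add AA (II 0)) (free_act AA (II 0)) (carrier QQ) (add QQ)
    (residue_act R \<mm>) (\<lambda>v. aug (v top))" by (rule aug_linear)
  show "(\<lambda>v. aug (v top)) ` FFdeg 0 j \<subseteq> {\<zero>\<^bsub>QQ\<^esub>}" if j: "1 \<le> j" for j
  proof
    fix w assume "w \<in> (\<lambda>v. aug (v top)) ` FFdeg 0 j"
    then obtain v where v: "v \<in> FFdeg 0 j" "w = aug (v top)" by blast
    have "v top \<in> HG j"
      using PiE_mem[OF v(1)[unfolded shifted_sum_deg_def], of top] by (simp add: cx_index_0 cx_shift_def)
    then show "w \<in> {\<zero>\<^bsub>QQ\<^esub>}" using aug_HG[OF _ j] v(2) by simp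
  qed
  show "(\<lambda>v. aug (v top)) ` FF 0 = carrier QQ"
  proof -
    have "(\<lambda>v. v top) ` FF 0 = carrier AA"
      using image_projection_PiE[of top "II 0" "\<lambda>_. carrier AA"] A.zero_closed
      by (auto simp: cx_index_0 PiE_eq_empty_iff)
    then show ?thesis using aug_surj by (metis image_image)
  qed
  show "res_diff R xs z 1 ` FF 1 = {v \<in> FF 0. aug (v top) = \<zero>\<^bsub>QQ\<^esub>}"
    unfolding augmentation_kernel[symmetric] by (rule image_cong[OF refl]) (rule res_diff_eq, simp_all)
  show "res_diff R xs z (Suc k) ` FF (Suc k) = {v \<in> FF k. res_diff R xs z k v = (\<lambda>b\<in>II (k - 1). \<zero>\<^bsub>AA\<^esub>)}"
    if k: "1 \<le> k" for k
  proof -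
    have k': "1 \<le> Suc k" by simp
    have "res_diff R xs z (Suc k) ` FF (Suc k) = DD (Suc k) ` FF (Suc k)"
      by (rule image_cong[OF refl]) (rule res_diff_eq[OF k'])
    also have "\<dots> = {v \<in> FF k. res_diff R xs z k v = (\<lambda>b\<in>II (k - 1). \<zero>\<^bsub>AA\<^esub>)}"
    proof (intro equalityI subsetI)
      fix v assume "v \<in> DD (Suc k) ` FF (Suc k)"
      then obtain u where u: "u \<in> FF (Suc k)" "v = DD (Suc k) u" by blast
      have v: "v \<in> FF k" using DD_closed[OF k' u(1)] u(2) by simp
      have "DD k v = (\<lambda>b\<in>II (k - 1). \<zero>\<^bsub>AA\<^esub>)"
      proof (rule PiE_ext[OF DD_closed[OF k v]])
        show "(\<lambda>b\<in>II (k - 1). \<zero>\<^bsub>AA\<^esub>) \<in> FF (k - 1)" by simp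
        show "DD k v b = (\<lambda>b\<in>II (k - 1). \<zero>\<^bsub>AA\<^esub>) b" if "b \<in> II (k - 1)" for b
          unfolding u(2) using DD_DD[OF k u(1) that] that by simp
      qed
      then show "v \<in> {v \<in> FF k. res_diff R xs z k v = (\<lambda>b\<in>II (k - 1). \<zero>\<^bsub>AA\<^esub>)}"
        unfolding mem_Collect_eq res_diff_eq[OF k v] by (intro conjI v)
    next
      fix v assume "v \<in> {v \<in> FF k. res_diff R xs z k v = (\<lambda>b\<in>II (k - 1). \<zero>\<^bsub>AA\<^esub>)}"
      then have v0: "v \<in> FF k" "res_diff R xs z k v = (\<lambda>b\<in>II (k - 1). \<zero>\<^bsub>AA\<^esub>)" by blast+
      note v = v0(1) v0(2)[unfolded res_diff_eq[OF k v0(1)]]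
      have "\<exists>u\<in>FF (Suc k). DD (Suc k) u = v"
        by (rule kernel_image[OF k v(1)]) (simp add: v(2))
      then show "v \<in> DD (Suc k) ` FF (Suc k)" by blast
    qed
    finally show ?thesis .
  qed
  show "res_diff R xs z k v b \<in> genideal AA (\<Union>i\<in>{1..}. HG i)"
    if "1 \<le> k" "v \<in> FF k" "b \<in> II (k - 1)" for k v b
    unfolding res_diff_eq[OF that(1,2)] by (rule DD_minimal[OF that])
qed

end

theorem theorem4p13:
  fixes R :: "('a, 'b) ring_scheme" and \<mm> :: "'a set" and xs :: "'a list"
    and z :: "nat \<Rightarrow> nat \<Rightarrow> nat set \<Rightarrow> 'a"
  assumes "noetherian_local_ring R \<mm>"
    and "codepth R \<mm> = 3"
    and "minimal_generators R \<mm> xs"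
    and "class_T_cycles R xs z"
  shows
    "(\<forall>k\<ge>1. is_chain_map R xs k (k - 1) (phi R xs z k)) \<and>
     (\<forall>k. homology_coords R xs k \<in>
        iso (cx_homology R xs k)
            (product_group (cx_index R xs k) (\<lambda>_. add_monoid (koszul_homology R xs)))) \<and>
     graded_minimal_resolution (koszul_homology R xs) (homology_deg R xs)
       (cx_index R xs) cx_shift (res_diff R xs z)
       (R Quot \<mm>) (residue_act R \<mm>) (\<lambda>v. koszul_aug R \<mm> (v ([], []))) \<and>
     cx_index R xs 0 = {([], [])} \<and>
     (\<forall>k s. card {b \<in> cx_index R xs k. cx_shift b = s} = unum (homology_rank R xs) k s) \<and>
     (\<forall>k. \<forall>b\<in>cx_index R xs k. k \<le> cx_shift b \<and> cx_shift b \<le> 3 * k)"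
proof -
  interpret class_T_koszul R \<mm> xs z
    using assms(1,3,4) by (intro class_T_koszul.intro class_T_koszul_axioms.intro)
  show ?thesis
    by (intro conjI allI impI ballI chain_map homology_iso resolution cx_index_0 card_cx_index_shift)
      (use cx_index_bounds in blast)+
qed

end
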